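(* Let $n\ge1$ be an integer and $\alpha\in(\tfrac12,1)$. Let $u_0\in\mathcal B$ be $\mathbb R^n$-valued with $\nabla\cdot u_0=0$ and $\|u_0\|_{\mathcal B}\le\varepsilon$, and let $u\in GX$ be the unique small global mild solution of the generalized Navier–Stokes equations with initial data $u_0$ (with $\varepsilon$ and $u$ as described in the context). Then $u(\cdot,t_0)\in\mathcal B$ for each fixed $t_0>0$.
   Context: The generalized Navier–Stokes equations on $\mathbb R^n$ are $u_t+(u\cdot\nabla)u+(-\Delta)^\alpha u+\nabla p=0$, $\nabla\cdot u=0$, $u(0)=u_0$. $S(t)=e^{-t(-\Delta)^\alpha}$, $t>0$, is the Fourier multiplier with symbol $e^{-t|\xi|^{2\alpha}}$, i.e. convolution with $\Phi(t,\cdot)=\mathcal F^{-1}(e^{-t|\xi|^{2\alpha}})$; it acts componentwise on vector fields. $\Pi$ is the Leray projection, the matrix Fourier multiplier with symbol $m_{ij}(\xi)=\delta_{ij}-\xi_i\xi_j/|\xi|^2$. For a matrix-valued function $f=(f_{jk})$ on $\mathbb R^n\times(0,\infty)$, $$(V\nabla\Pi f)_i(x,t)=\int_0^t\sum_{j,k}\big(\Pi_{ij}\partial_kS(t-s)f_{jk}(\cdot,s)\big)(x)\,ds,$$ where $\Pi_{ij}\partial_kS(\tau)$ is convolution with $\mathcal F^{-1}(m_{ij}(\xi)\,i\xi_k\,e^{-\tau|\xi|^{2\alpha}})\in L^1(\mathbb R^n)$. $GX$ is the space of functions on $\mathbb R^n\times(0,\infty)$ with finite norm $\|u\|_{GX}=\sup_{t>0}t^{1-\frac1{2\alpha}}\|u(\cdot,t)\|_{L^\infty(\mathbb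 R^n)}$. $\mathcal B=\dot B^{1-2\alpha,\infty}_\infty(\mathbb R^n)$, the homogeneous Besov space of $f\in\mathcal S'(\mathbb R^n)$ with $\|\theta(\lambda D)f\|_{L^\infty}\to0$ as $\lambda\to\infty$ for all $\theta\in C_c^\infty(\mathbb R^n)$ and $\sup_{j\in\mathbb Z}2^{j(1-2\alpha)}\|P_jf\|_{L^\infty}<\infty$ ($P_j$ the Littlewood–Paley projections to $|\xi|\sim2^j$). Up to equivalence, $\|f\|_{\mathcal B}=\sup_{t>0}t^{1-\frac1{2\alpha}}\|S(t)f\|_{L^\infty}$, and $f\in\mathcal B$ if and only if this quantity is finite. Solution: there exist $\varepsilon,\delta>0$ such that for every divergence-free $u_0\in\mathcal B$ with $\|u_0\|_{\mathcal B}\le\varepsilon$ there is exactly one $u\in GX$ with $\|u\|_{GX}\le\delta$ and $u=S(t)u_0-V\nabla\Pi(u\otimes u)$; this $u$ (obtained by a contraction argument in a small ball of $GX$) is the unique small global mild solution with data $u_0$. *)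

theory Defs
  imports "HOL-Analysis.Analysis" "HOL-Probability.Essential_Supremum"
begin

section \<open>Schwartz functions and tempered distributions\<close>

definition partial :: "'n::finite \<Rightarrow> (real^'n \<Rightarrow> 'b::real_normed_vector) \<Rightarrow> real^'n \<Rightarrow> 'b"
  where "partial k f = (\<lambda>x. frechet_derivative f (at x) (axis k 1))"

definition iter_partial :: "'n::finite list \<Rightarrow> (real^'n \<Rightarrow> 'b::real_normed_vector) \<Rightarrow> real^'n \<Rightarrow> 'b"
  where "iter_partial ks f = foldr partial ks f"

definition smooth :: "(real^'n::finite \<Rightarrow> 'b::real_normed_vector) \<Rightarrow> bool"
  where "smooth f \<longleftrightarrow> (\<forall>ks. iter_partial ks f differentiable_on UNIV)"

definition schwartz :: "(real^'n::finite \<Rightarrow> complex) set"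
  where "schwartz =
    {\<psi>. smooth \<psi> \<and> (\<forall>N ks. bounded (range (\<lambda>x. (1 + norm x) ^ N *\<^sub>R iter_partial ks \<psi> x)))}"

definition schwartz_seminorm :: "nat \<Rightarrow> (real^'n::finite \<Rightarrow> complex) \<Rightarrow> real"
  where "schwartz_seminorm N \<psi> =
    (SUP (ks, x) \<in> {ks. length ks \<le> N} \<times> UNIV. (1 + norm x) ^ N * norm (iter_partial ks \<psi> x))"

text \<open>A tempered distribution is represented by a functional on all functions, of which only
  the values on \<^const>\<open>schwartz\<close> matter.\<close>

type_synonym 'n dist = "(real^'n \<Rightarrow> complex) \<Rightarrow> complex"

definition tempered :: "'n::finite dist \<Rightarrow> bool"
  where "tempered T \<longleftrightarrow>
    (\<forall>\<psi>\<in>schwartz. \<forall>\<eta>\<in>schwartz. T (\<lambda>x. \<psi> x + \<eta> x) = T \<psi> + T \<eta>) \<and>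
    (\<forall>c. \<forall>\<psi>\<in>schwartz. T (\<lambda>x. c * \<psi> x) = c * T \<psi>) \<and>
    (\<exists>C N. \<forall>\<psi>\<in>schwartz. norm (T \<psi>) \<le> C * schwartz_seminorm N \<psi>)"

definition dist_of :: "(real^'n::finite \<Rightarrow> complex) \<Rightarrow> 'n dist"
  where "dist_of g = (\<lambda>\<psi>. LBINT x. g x * \<psi> x)"

definition real_dist :: "'n::finite dist \<Rightarrow> bool"
  where "real_dist T \<longleftrightarrow> (\<forall>\<psi>\<in>schwartz. range \<psi> \<subseteq> \<real> \<longrightarrow> T \<psi> \<in> \<real>)"

text \<open>Tested against \<open>\<psi>\<close>, the divergence is \<open>-\<Sum>\<^sub>k T\<^sub>k (\<partial>\<^sub>k \<psi>)\<close>.\<close>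

definition div_free :: "('n::finite dist)^'n \<Rightarrow> bool"
  where "div_free T \<longleftrightarrow> (\<forall>\<psi>\<in>schwartz. (\<Sum>k\<in>UNIV. (T $ k) (partial k \<psi>)) = 0)"


section \<open>Fourier multipliers\<close>

definition inv_fourier :: "(real^'n::finite \<Rightarrow> complex) \<Rightarrow> real^'n \<Rightarrow> complex"
  where "inv_fourier m x =
    complex_of_real (1 / (2 * pi) ^ CARD('n)) * (LBINT \<xi>. cis (x \<bullet> \<xi>) * m \<xi>)"

text \<open>For a test function \<open>m\<close>, the kernel \<open>\<F>\<^sup>-\<^sup>1 m\<close> is Schwartz and \<open>m(D) T\<close> is the smooth function
  \<open>\<F>\<^sup>-\<^sup>1 m * T\<close>.\<close>

definition test_function :: "(real^'n::finite \<Rightarrow> 'b::real_normed_vector) \<Rightarrow> bool"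
  where "test_function m \<longleftrightarrow> smooth m \<and> compact (closure {\<xi>. m \<xi> \<noteq> 0})"

definition multiplier :: "(real^'n::finite \<Rightarrow> complex) \<Rightarrow> 'n dist \<Rightarrow> real^'n \<Rightarrow> complex"
  where "multiplier m T x = T (\<lambda>y. inv_fourier m (x - y))"

definition Linf_norm :: "(real^'n::finite \<Rightarrow> 'b::real_normed_vector) \<Rightarrow> ennreal"
  where "Linf_norm g = esssup lborel (\<lambda>x. ennreal (norm (g x)))"


section \<open>The Besov space\<close>

definition littlewood_paley :: "(real^'n::finite \<Rightarrow> real) \<Rightarrow> bool"
  where "littlewood_paley \<phi> \<longleftrightarrow>
    smooth \<phi> \<and>
    (\<exists>a b. 0 < a \<and> (\<forall>\<xi>. \<phi> \<xi> \<noteq> 0 \<longrightarrow> a \<le> norm \<xi> \<and> norm \<xi> \<le> b)) \<and>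
    (\<forall>\<xi>. \<xi> \<noteq> 0 \<longrightarrow> ((\<lambda>j::int. \<phi> ((2 powi (-j)) *\<^sub>R \<xi>)) has_sum 1) UNIV)"

definition dyadic :: "(real^'n::finite \<Rightarrow> real) \<Rightarrow> int \<Rightarrow> real^'n \<Rightarrow> complex"
  where "dyadic \<phi> j \<xi> = complex_of_real (\<phi> ((2 powi (-j)) *\<^sub>R \<xi>))"

definition LP_proj :: "(real^'n::finite \<Rightarrow> real) \<Rightarrow> int \<Rightarrow> 'n dist \<Rightarrow> real^'n \<Rightarrow> complex"
  where "LP_proj \<phi> j T = multiplier (dyadic \<phi> j) T"

definition besov_norm :: "(real^'n::finite \<Rightarrow> real) \<Rightarrow> real \<Rightarrow> 'n dist \<Rightarrow> ennreal"
  where "besov_norm \<phi> \<alpha> T =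
    (SUP j::int. ennreal (2 powr (real_of_int j * (1 - 2 * \<alpha>))) * Linf_norm (LP_proj \<phi> j T))"

definition vanishes_at_low_freq :: "'n::finite dist \<Rightarrow> bool"
  where "vanishes_at_low_freq T \<longleftrightarrow>
    (\<forall>\<theta> :: real^'n \<Rightarrow> complex. test_function \<theta> \<longrightarrow>
      ((\<lambda>r. Linf_norm (multiplier (\<lambda>\<xi>. \<theta> (r *\<^sub>R \<xi>)) T)) \<longlongrightarrow> 0) at_top)"

definition besov :: "(real^'n::finite \<Rightarrow> real) \<Rightarrow> real \<Rightarrow> 'n dist set"
  where "besov \<phi> \<alpha> = {T. tempered T \<and> vanishes_at_low_freq T \<and> besov_norm \<phi> \<alpha> T < \<infinity>}"

text \<open>Vector fields: membership is componentwise, the norm is the largest component norm.\<close>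

definition besov_vec :: "(real^'n::finite \<Rightarrow> real) \<Rightarrow> real \<Rightarrow> (('n dist)^'n) set"
  where "besov_vec \<phi> \<alpha> = {T. \<forall>i. T $ i \<in> besov \<phi> \<alpha>}"

definition besov_vec_norm :: "(real^'n::finite \<Rightarrow> real) \<Rightarrow> real \<Rightarrow> ('n dist)^'n \<Rightarrow> ennreal"
  where "besov_vec_norm \<phi> \<alpha> T = (SUP i. besov_norm \<phi> \<alpha> (T $ i))"

definition vec_dist_of :: "(real^'n::finite \<Rightarrow> real^'n) \<Rightarrow> ('n dist)^'n"
  where "vec_dist_of g = (\<chi> i. dist_of (\<lambda>x. complex_of_real (g x $ i)))"


section \<open>The linear evolution and the bilinear term\<close>

definition heat_symbol :: "real \<Rightarrow> real \<Rightarrow> real^'n::finite \<Rightarrow> complex"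
  where "heat_symbol \<alpha> t \<xi> = complex_of_real (exp (- t * norm \<xi> powr (2 * \<alpha>)))"

text \<open>The symbol of \<open>S(t)\<close> is not smooth at the origin, so \<open>S(t)\<close> does not act on all tempered
  distributions. On \<^const>\<open>besov\<close> it acts through \<open>T = \<Sum>\<^sub>j P\<^sub>j T\<close>; for \<open>1/2 < \<alpha>\<close> the series below
  converges absolutely, uniformly in \<open>x\<close>.\<close>

definition heat :: "(real^'n::finite \<Rightarrow> real) \<Rightarrow> real \<Rightarrow> real \<Rightarrow> 'n dist \<Rightarrow> real^'n \<Rightarrow> complex"
  where "heat \<phi> \<alpha> t T x =
    (\<Sum>\<^sub>\<infinity>j\<in>UNIV. multiplier (\<lambda>\<xi>. heat_symbol \<alpha> t \<xi> * dyadic \<phi> j \<xi>) T x)"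

definition leray_symbol :: "'n::finite \<Rightarrow> 'n \<Rightarrow> real^'n \<Rightarrow> real"
  where "leray_symbol i j \<xi> = (if i = j then 1 else 0) - \<xi> $ i * \<xi> $ j / (norm \<xi>)\<^sup>2"

text \<open>The convolution kernel of \<open>\<Pi>\<^sub>i\<^sub>j \<partial>\<^sub>k S(\<tau>)\<close>.\<close>

definition leray_kernel :: "real \<Rightarrow> 'n::finite \<Rightarrow> 'n \<Rightarrow> 'n \<Rightarrow> real \<Rightarrow> real^'n \<Rightarrow> complex"
  where "leray_kernel \<alpha> i j k \<tau> = inv_fourier (\<lambda>\<xi>.
    complex_of_real (leray_symbol i j \<xi>) * (\<i> * complex_of_real (\<xi> $ k)) * heat_symbol \<alpha> \<tau> \<xi>)"

definition V_nabla_leray ::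
    "real \<Rightarrow> (real^'n::finite \<Rightarrow> real \<Rightarrow> real^'n^'n) \<Rightarrow> real^'n \<Rightarrow> real \<Rightarrow> complex^'n"
  where "V_nabla_leray \<alpha> f x t = (\<chi> i. LBINT s:{0<..<t}. (\<Sum>j\<in>UNIV. \<Sum>k\<in>UNIV.
    (LBINT y. leray_kernel \<alpha> i j k (t - s) (x - y) * complex_of_real (f y s $ j $ k))))"

definition tensor ::
    "(real^'n::finite \<Rightarrow> real \<Rightarrow> real^'n) \<Rightarrow> (real^'n \<Rightarrow> real \<Rightarrow> real^'n) \<Rightarrow> real^'n \<Rightarrow> real \<Rightarrow> real^'n^'n"
  where "tensor u v x t = (\<chi> j k. u x t $ j * v x t $ k)"


section \<open>Small global mild solutions\<close>

definition GX_norm :: "real \<Rightarrow> (real^'n::finite \<Rightarrow> real \<Rightarrow> real^'n) \<Rightarrow> ennreal"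
  where "GX_norm \<alpha> u =
    (SUP t\<in>{0<..}. ennreal (t powr (1 - 1 / (2 * \<alpha>))) * Linf_norm (\<lambda>x. u x t))"

definition GX :: "real \<Rightarrow> (real^'n::finite \<Rightarrow> real \<Rightarrow> real^'n) set"
  where "GX \<alpha> = {u. (\<lambda>(x, t). u x t) \<in> borel_measurable (restrict_space borel (UNIV \<times> {0<..}))
    \<and> GX_norm \<alpha> u < \<infinity>}"

definition mild_solution ::
    "(real^'n::finite \<Rightarrow> real) \<Rightarrow> real \<Rightarrow> ('n dist)^'n \<Rightarrow> (real^'n \<Rightarrow> real \<Rightarrow> real^'n) \<Rightarrow> bool"
  where "mild_solution \<phi> \<alpha> u0 u \<longleftrightarrow>
    (\<forall>t>0. AE x in lborel. \<forall>i. complex_of_real (u x t $ i) =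
      heat \<phi> \<alpha> t (u0 $ i) x - V_nabla_leray \<alpha> (tensor u u) x t $ i)"

definition small_data :: "(real^'n::finite \<Rightarrow> real) \<Rightarrow> real \<Rightarrow> real \<Rightarrow> ('n dist)^'n \<Rightarrow> bool"
  where "small_data \<phi> \<alpha> \<epsilon> u0 \<longleftrightarrow>
    u0 \<in> besov_vec \<phi> \<alpha> \<and> (\<forall>i. real_dist (u0 $ i)) \<and> div_free u0 \<and>
    besov_vec_norm \<phi> \<alpha> u0 \<le> ennreal \<epsilon>"

definition small_mild_solution ::
    "(real^'n::finite \<Rightarrow> real) \<Rightarrow> real \<Rightarrow> real \<Rightarrow> ('n dist)^'n \<Rightarrow> (real^'n \<Rightarrow> real \<Rightarrow> real^'n) \<Rightarrow> bool"
  where "small_mild_solution \<phi> \<alpha> \<delta> u0 u \<longleftrightarrow>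
    u \<in> GX \<alpha> \<and> GX_norm \<alpha> u \<le> ennreal \<delta> \<and> mild_solution \<phi> \<alpha> u0 u"

text \<open>The constants \<open>\<epsilon>\<close> and \<open>\<delta>\<close> of the small-data theorem: data of size at most \<open>\<epsilon>\<close> have exactly
  one mild solution in the \<open>\<delta>\<close>-ball, where functions are identified if they agree almost
  everywhere in \<open>x\<close> at each time.\<close>

definition small_data_constants :: "(real^'n::finite \<Rightarrow> real) \<Rightarrow> real \<Rightarrow> real \<Rightarrow> real \<Rightarrow> bool"
  where "small_data_constants \<phi> \<alpha> \<epsilon> \<delta> \<longleftrightarrow> 0 < \<epsilon> \<and> 0 < \<delta> \<and>
    (\<forall>u0. small_data \<phi> \<alpha> \<epsilon> u0 \<longrightarrow>
      (\<exists>u. small_mild_solution \<phi> \<alpha> \<delta> u0 u \<and>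
        (\<forall>v. small_mild_solution \<phi> \<alpha> \<delta> u0 v \<longrightarrow> (\<forall>t>0. AE x in lborel. v x t = u x t))))"

end

theory Submission
  imports Defs "HOL-Probability.Probability" "HOL-Real_Asymp.Real_Asymp"
begin

text \<open>Only the equation \<open>u = S(t) u\<^sub>0 - V\<nabla>\<Pi>(u \<otimes> u)\<close> at the time \<open>t\<^sub>0\<close> matters. Both terms are bounded
  functions, which settles the high frequencies because \<open>1 - 2\<alpha> < 0\<close>. For the low frequencies apply a
  cutoff \<open>\<theta>(r D)\<close> with \<open>r\<close> large. On \<open>S(t\<^sub>0) u\<^sub>0\<close> only the blocks \<open>P\<^sub>l u\<^sub>0\<close> with \<open>2\<^sup>l \<le> C/r\<close> survive, and they
  add up to \<open>O(r powr (1 - 2\<alpha>))\<close>. In the bilinear term the derivative gives \<open>\<parallel>\<theta>(r D) \<Pi> \<partial>\<^sub>k S(\<tau>)\<parallel> = O(1/r)\<close>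
  uniformly in \<open>\<tau>\<close>, while \<open>\<parallel>(u \<otimes> u)(s)\<parallel> \<le> C s powr (1/\<alpha> - 2)\<close> is integrable near \<open>0\<close> as \<open>\<alpha> < 1\<close>; and
  \<open>1/r\<close> is at most \<open>r powr (1 - 2\<alpha>)\<close>.

  The kernel estimates are reduced to Gaussians: \<open>exp (-t |\<xi>| powr (2\<alpha>))\<close> is a limit of averages of
  \<open>exp (-R |\<xi>|\<^sup>2)\<close> over \<open>R\<close>, and Fatou's lemma carries bounds in \<open>L\<^sup>1\<close> over to the limit.\<close>

section \<open>Smooth functions\<close>

text \<open>The obstacle is the origin in frequency: neither the heat symbol nor the Leray symbol is
  smooth there, so their kernels are not Schwartz functions and integration by parts does not show
  that they lie in L^1. Positivity replaces smoothness. The function l -> exp(-l^\<alpha>) is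
  completely monotone, so L^1 bounds for the explicit Gaussian kernels pass to it through
  superposition with positive weights. Discrete weights read off from the binomial series stand in
  for the stable law; only their mass and their inverse first moment have to be bounded uniformly.
  The same singularity prevents S(t) from acting on a tempered distribution directly. It acts on
  each Littlewood-Paley block, and the Besov norm becomes usable only through the identity (m1
  m2)(D) T = m1(D) (m2(D) T), in which T is exchanged with an integral. That T is known only as a
  functional with a seminorm bound is what makes this exchange the longest single argument.\<close>

lemma iter_partial_simps [simp]:
  "iter_partial [] f = f"
  "iter_partial (k # ks) f = partial k (iter_partial ks f)"
  by (simp_all add: iter_partial_def)

lemma iter_partial_append: "iter_partial (ks @ ls) f = iter_partial ks (iter_partial ls f)"
  by (simp add: iter_partial_def)

lemma partial_eqI: "(f has_derivative D) (at x) \<Longrightarrow> partial k f x = D (axis k 1)"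
  by (simp add: partial_def frechet_derivative_at[symmetric])

lemma vec_sum_axis: "(\<Sum>k\<in>UNIV. (h $ k) *\<^sub>R axis k (1::real)) = h"
  by (simp add: vec_eq_iff axis_def if_distrib cong: if_cong)

lemma frechet_derivative_sum_partial:
  assumes "f differentiable (at x)"
  shows "frechet_derivative f (at x) h = (\<Sum>k\<in>UNIV. (h $ k) *\<^sub>R partial k f x)"
proof -
  have l: "linear (frechet_derivative f (at x))"
    using assms linear_frechet_derivative by blast
  have "frechet_derivative f (at x) h = frechet_derivative f (at x) (\<Sum>k\<in>UNIV. (h $ k) *\<^sub>R axis k 1)"
    by (simp add: vec_sum_axis)
  also have "\<dots> = (\<Sum>k\<in>UNIV. (h $ k) *\<^sub>R partial k f x)"
    by (simp add: linear_sum[OF l] linear_cmul[OF l] partial_def)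
  finally show ?thesis .
qed

lemma partial_cong_open:
  assumes "open U" "x \<in> U" "\<And>y. y \<in> U \<Longrightarrow> f y = g y"
  shows "partial k f x = partial k g x"
proof -
  have "(f has_derivative D) (at x) \<longleftrightarrow> (g has_derivative D) (at x)" for D
    using has_derivative_transform_within_open[OF _ assms(1,2)] assms(3) by metis
  then show ?thesis
    by (simp add: partial_def frechet_derivative_def)
qed

text \<open>Differentiability at points of \<open>U\<close> is taken in the whole space, not within
  \<open>U\<close>, so local smoothness glues over unions of arbitrary sets.\<close>

definition smooth_on :: "(real^'n::finite) set \<Rightarrow> (real^'n \<Rightarrow> 'b::real_normed_vector) \<Rightarrow> bool"
  where "smooth_on U f \<longleftrightarrow> (\<forall>ks. \<forall>x\<in>U. iter_partial ks f differentiable (at x))"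

lemma smooth_iff_smooth_on: "smooth f \<longleftrightarrow> smooth_on UNIV f"
  by (auto simp: smooth_def smooth_on_def differentiable_on_def)

lemma smooth_on_Un: "smooth_on (U \<union> V) f \<longleftrightarrow> smooth_on U f \<and> smooth_on V f"
  by (auto simp: smooth_on_def)

lemma smooth_on_subset: "smooth_on U f \<Longrightarrow> V \<subseteq> U \<Longrightarrow> smooth_on V f"
  by (auto simp: smooth_on_def)

lemma smooth_on_iter_partial: "smooth_on U f \<Longrightarrow> smooth_on U (iter_partial ks f)"
  by (auto simp: smooth_on_def iter_partial_append[symmetric])

lemma smooth_on_partial: "smooth_on U f \<Longrightarrow> smooth_on U (partial k f)"
  using smooth_on_iter_partial[of U f "[k]"] by simp

lemma smooth_partial: "smooth f \<Longrightarrow> smooth (partial k f)"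
  by (simp add: smooth_iff_smooth_on smooth_on_partial)

lemma smooth_on_differentiable: "smooth_on U f \<Longrightarrow> x \<in> U \<Longrightarrow> f differentiable (at x)"
  by (metis iter_partial_simps(1) smooth_on_def)

lemma differentiable_cong_open:
  assumes "open U" "x \<in> U" "\<And>y. y \<in> U \<Longrightarrow> f y = g y" "g differentiable (at x)"
  shows "f differentiable (at x)"
  using has_derivative_transform_within_open[OF _ assms(1,2)] assms(3,4)
  unfolding differentiable_def by metis

text \<open>Smoothness as a greatest fixed point: any property closed under partial derivatives will
  do. Since \<open>U\<close> is open, a derivative has to agree with a function having the property
  only on \<open>U\<close>, whatever happens at a singular point outside.\<close>

lemma smooth_on_coinduct [consumes 2, case_names step]:
  assumes U: "open U" and f: "P f"
    and step: "\<And>f. P f \<Longrightarrow> (\<forall>x\<in>U. f differentiable (at x)) \<and> (\<forall>k. \<exists>g. P g \<and> (\<forall>x\<in>U. partial k f x = g x))"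
  shows "smooth_on U f"
proof -
  have ex: "\<exists>g. P g \<and> (\<forall>x\<in>U. iter_partial ks f x = g x)" for ks
  proof (induction ks)
    case Nil
    then show ?case using f by auto
  next
    case (Cons k ks)
    then obtain g where g: "P g" "\<forall>x\<in>U. iter_partial ks f x = g x" by blast
    obtain g' where g': "P g'" "\<forall>x\<in>U. partial k g x = g' x" using step[OF g(1)] by blast
    have "\<forall>x\<in>U. iter_partial (k # ks) f x = g' x"
      using partial_cong_open[OF U, of _ "iter_partial ks f" g] g(2) g'(2) by simp
    with g'(1) show ?case by blast
  qed
  show ?thesis unfolding smooth_on_def
  proof (intro allI ballI)
    fix ks x assume "x \<in> U"
    obtain g where g: "P g" "\<forall>x\<in>U. iter_partial ks f x = g x" using ex by blast
    then show "iter_partial ks f differentiable (at x)"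
      using differentiable_cong_open[OF U \<open>x \<in> U\<close>] step[OF g(1)] \<open>x \<in> U\<close> by blast
  qed
qed

lemma smooth_on_cong:
  assumes "open U" "smooth_on U g" "\<And>x. x \<in> U \<Longrightarrow> f x = g x"
  shows "smooth_on U f"
proof (rule smooth_on_coinduct[where P="\<lambda>f. \<exists>g. smooth_on U g \<and> (\<forall>x\<in>U. f x = g x)", OF assms(1)])
  show "\<exists>g. smooth_on U g \<and> (\<forall>x\<in>U. f x = g x)" using assms by auto
next
  fix f :: "real^'a \<Rightarrow> 'b" assume "\<exists>g. smooth_on U g \<and> (\<forall>x\<in>U. f x = g x)"
  then obtain g where g: "smooth_on U g" "\<forall>x\<in>U. f x = g x" by blast
  show "(\<forall>x\<in>U. f differentiable (at x)) \<and>
      (\<forall>k. \<exists>g. (\<exists>ga. smooth_on U ga \<and> (\<forall>x\<in>U. g x = ga x)) \<and> (\<forall>x\<in>U. partial k f x = g x))"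
    using g smooth_on_differentiable[OF g(1)] differentiable_cong_open[OF assms(1), of _ f g]
      smooth_on_partial[OF g(1)] partial_cong_open[OF assms(1), of _ f g]
    by blast
qed

text \<open>Smoothness of products and compositions is obtained by exhibiting a set of functions whose
  generated algebra is closed under differentiation.\<close>

inductive alg :: "('a \<Rightarrow> complex) set \<Rightarrow> ('a \<Rightarrow> complex) \<Rightarrow> bool" for A where
  alg_base: "f \<in> A \<Longrightarrow> alg A f"
| alg_const: "alg A (\<lambda>_. c)"
| alg_add: "alg A f \<Longrightarrow> alg A g \<Longrightarrow> alg A (\<lambda>x. f x + g x)"
| alg_mult: "alg A f \<Longrightarrow> alg A g \<Longrightarrow> alg A (\<lambda>x. f x * g x)"

text \<open>The sum and product rules express derivatives inside the algebra, so closure has to be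
  checked for the generators alone.\<close>

lemma smooth_on_alg:
  assumes U: "open U" and f: "alg A f"
    and step: "\<And>f. f \<in> A \<Longrightarrow> (\<forall>x\<in>U. f differentiable (at x)) \<and> (\<forall>k. \<exists>g. alg A g \<and> (\<forall>x\<in>U. partial k f x = g x))"
  shows "smooth_on U f"
  using U f
proof (rule smooth_on_coinduct)
  fix f assume "alg A f"
  then show "(\<forall>x\<in>U. f differentiable (at x)) \<and> (\<forall>k. \<exists>g. alg A g \<and> (\<forall>x\<in>U. partial k f x = g x))"
  proof induction
    case (alg_base f)
    then show ?case using step by blast
  next
    case (alg_const c)
    show ?case
      by (intro conjI ballI allI exI[of _ "\<lambda>_. 0"] alg.alg_const)
         (auto intro!: partial_eqI[THEN trans] has_derivative_const)
  next
    case (alg_add f g)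
    show ?case
    proof (intro conjI ballI allI)
      fix x assume "x \<in> U" then show "(\<lambda>x. f x + g x) differentiable at x"
        using alg_add.IH by (intro derivative_intros) auto
    next
      fix k
      obtain f' g' where fg: "alg A f'" "\<forall>x\<in>U. partial k f x = f' x" "alg A g'" "\<forall>x\<in>U. partial k g x = g' x"
        using alg_add.IH by meson
      have "partial k (\<lambda>x. f x + g x) x = f' x + g' x" if "x \<in> U" for x
      proof -
        have "(f has_derivative frechet_derivative f (at x)) (at x)" "(g has_derivative frechet_derivative g (at x)) (at x)"
          using alg_add.IH that by (auto simp: frechet_derivative_works)
        from partial_eqI[OF has_derivative_add[OF this]] show ?thesis
          using fg(2,4) that by (simp add: partial_def)
      qed
      then show "\<exists>h. alg A h \<and> (\<forall>x\<in>U. partial k (\<lambda>x. f x + g x) x = h x)"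
        using fg by (intro exI[of _ "\<lambda>x. f' x + g' x"]) (auto intro: alg.intros)
    qed
  next
    case (alg_mult f g)
    show ?case
    proof (intro conjI ballI allI)
      fix x assume "x \<in> U" then show "(\<lambda>x. f x * g x) differentiable at x"
        using alg_mult.IH by (intro derivative_intros) auto
    next
      fix k
      obtain f' g' where fg: "alg A f'" "\<forall>x\<in>U. partial k f x = f' x" "alg A g'" "\<forall>x\<in>U. partial k g x = g' x"
        using alg_mult.IH by meson
      have "partial k (\<lambda>x. f x * g x) x = f x * g' x + f' x * g x" if "x \<in> U" for x
      proof -
        have "(f has_derivative frechet_derivative f (at x)) (at x)" "(g has_derivative frechet_derivative g (at x)) (at x)"
          using alg_mult.IH that by (auto simp: frechet_derivative_works)
        from partial_eqI[OF has_derivative_mult[OF this]] show ?thesis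
          using fg(2,4) that by (simp add: partial_def)
      qed
      then show "\<exists>h. alg A h \<and> (\<forall>x\<in>U. partial k (\<lambda>x. f x * g x) x = h x)"
        using fg alg_mult.hyps
        by (intro exI[of _ "\<lambda>x. f x * g' x + f' x * g x"]) (auto intro: alg.intros)
    qed
  qed
qed

section \<open>Coordinates, radial powers, radial exponentials and Gaussians\<close>

definition coordf :: "'n \<Rightarrow> real^'n::finite \<Rightarrow> complex"
  where "coordf k \<xi> = complex_of_real (\<xi> $ k)"

lemma has_derivative_coordf: "(coordf k has_derivative (\<lambda>h. complex_of_real (h $ k))) (at x)"
  unfolding coordf_def by (auto intro!: derivative_eq_intros bounded_linear.has_derivative[OF bounded_linear_vec_nth])

lemma partial_coordf: "partial j (coordf k) x = (if j = k then 1 else 0)"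
  by (simp add: partial_eqI[OF has_derivative_coordf] axis_def)

lemma has_derivative_norm_powr:
  fixes x :: "real^'n::finite"
  assumes "x \<noteq> 0"
  shows "((\<lambda>x. norm x powr p) has_derivative (\<lambda>h. p * norm x powr (p - 2) * (x \<bullet> h))) (at x)"
proof -
  have n: "norm x > 0" using assms by simp
  have e: "norm x powr (p - 2) = norm x powr p / (norm x * norm x)"
    using n by (simp add: powr_diff power2_eq_square powr_numeral)
  have "((\<lambda>x. norm x powr p) has_derivative
     (\<lambda>h. norm x powr p * (0 * ln (norm x) + (h \<bullet> sgn x) * p / norm x))) (at x)"
    using n assms by (intro has_derivative_powr has_derivative_norm has_derivative_const) auto
  then show ?thesis
    by (simp add: e sgn_div_norm inner_commute divide_inverse mult_ac)
qed

text \<open>The exponent is a free real parameter because each differentiation lowers it by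
  two.\<close>

definition npowr :: "real \<Rightarrow> real^'n::finite \<Rightarrow> complex"
  where "npowr p \<xi> = complex_of_real (norm \<xi> powr p)"

definition nexp :: "real \<Rightarrow> real \<Rightarrow> real^'n::finite \<Rightarrow> complex"
  where "nexp c q \<xi> = complex_of_real (exp (c * norm \<xi> powr q))"

lemma has_derivative_npowr:
  "x \<noteq> 0 \<Longrightarrow> (npowr p has_derivative (\<lambda>h. complex_of_real (p * norm x powr (p - 2) * (x \<bullet> h)))) (at x)"
  unfolding npowr_def by (intro has_derivative_of_real has_derivative_norm_powr)

lemma has_derivative_nexp:
  "x \<noteq> 0 \<Longrightarrow> (nexp c q has_derivative (\<lambda>h. complex_of_real (exp (c * norm x powr q) * (c * (q * norm x powr (q - 2) * (x \<bullet> h)))))) (at x)"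
  unfolding nexp_def
  using has_derivative_exp[OF has_derivative_mult_right[OF has_derivative_norm_powr], of x c q]
  by (intro has_derivative_of_real) (simp add: mult_ac)

definition gauss_exp :: "real \<Rightarrow> real^'n::finite \<Rightarrow> complex"
  where "gauss_exp c \<xi> = complex_of_real (exp (c * (norm \<xi>)\<^sup>2))"

lemma has_derivative_gauss_exp:
  "(gauss_exp c has_derivative (\<lambda>h. complex_of_real (exp (c * (norm x)\<^sup>2) * (c * (2 * (x \<bullet> h)))))) (at x)"
  unfolding gauss_exp_def power2_norm_eq_inner
  by (auto intro!: derivative_eq_intros simp: inner_commute)

text \<open>Away from the origin the family is closed: a radial power differentiates to a multiple
  of a lower power times a coordinate, and an exponential to itself times such a term. Powers of the
  norm and the heat symbol are thus covered together.\<close>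

lemma smooth_on_alg_away:
  fixes f :: "real^'n::finite \<Rightarrow> complex"
  assumes \<phi>: "smooth_on (-{0}) \<phi>"
    and f: "alg (range (\<lambda>ks. iter_partial ks \<phi>) \<union> range coordf \<union> range npowr \<union> range (\<lambda>(c, q). nexp c q)) f"
      (is "alg ?A f")
  shows "smooth_on (-{0}) f"
proof (rule smooth_on_alg[OF _ f])
  show "open (- {0 :: real^'n})" by auto
next
  fix f assume "f \<in> ?A"
  then consider ks where "f = iter_partial ks \<phi>" | k where "f = coordf k" | p where "f = npowr p"
    | c q where "f = nexp c q" by auto
  then show "(\<forall>x\<in>-{0}. f differentiable (at x)) \<and> (\<forall>k. \<exists>g. alg ?A g \<and> (\<forall>x\<in>-{0}. partial k f x = g x))"
  proof cases
    case 1
    show ?thesis unfolding 1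
    proof (intro conjI ballI allI)
      fix x :: "real^'n" assume "x \<in> -{0}" then show "iter_partial ks \<phi> differentiable at x"
        using \<phi> by (auto simp: smooth_on_def)
    next
      fix k
      show "\<exists>g. alg ?A g \<and> (\<forall>x\<in>- {0}. partial k (iter_partial ks \<phi>) x = g x)"
        by (intro exI[of _ "iter_partial (k # ks) \<phi>"] conjI alg_base) (auto simp del: iter_partial_simps(2), simp)
    qed
  next
    case 2
    show ?thesis unfolding 2
    proof (intro conjI ballI allI)
      fix x :: "real^'n" show "coordf k differentiable at x"
        using has_derivative_coordf differentiable_def by blast
    next
      fix j
      show "\<exists>g. alg ?A g \<and> (\<forall>x\<in>-{0}. partial j (coordf k) x = g x)"
        by (intro exI[of _ "\<lambda>_. if j = k then 1 else 0"] conjI alg_const) (simp add: partial_coordf)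
    qed
  next
    case 3
    show ?thesis unfolding 3
    proof (intro conjI ballI allI)
      fix x :: "real^'n" assume "x \<in> -{0}" then show "npowr p differentiable at x"
        using has_derivative_npowr[of x p] by (auto simp: differentiable_def)
    next
      fix k
      show "\<exists>g. alg ?A g \<and> (\<forall>x\<in>- {0}. partial k (npowr p) x = g x)"
        by (rule exI[of _ "\<lambda>x. (of_real p * npowr (p - 2) x) * coordf k x"], rule conjI, (intro alg_mult alg_const alg_base; auto))
           (auto simp: partial_eqI[OF has_derivative_npowr] npowr_def coordf_def inner_axis)
    qed
  next
    case 4
    show ?thesis unfolding 4
    proof (intro conjI ballI allI)
      fix x :: "real^'n" assume "x \<in> -{0}" then show "nexp c q differentiable at x"
        using has_derivative_nexp[of x c q] by (auto simp: differentiable_def)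
    next
      fix k
      show "\<exists>g. alg ?A g \<and> (\<forall>x\<in>- {0}. partial k (nexp c q) x = g x)"
        by (rule exI[of _ "\<lambda>x. nexp c q x * ((of_real (c * q) * npowr (q - 2) x) * coordf k x)"], rule conjI, (intro alg_mult alg_const alg_base; auto))
           (auto simp: partial_eqI[OF has_derivative_nexp] npowr_def coordf_def nexp_def inner_axis)
    qed
  qed
qed

lemma smooth_alg_everywhere:
  fixes f :: "real^'n::finite \<Rightarrow> complex"
  assumes \<phi>: "smooth \<phi>" and \<psi>: "smooth \<psi>"
    and f: "alg (range (\<lambda>ks. iter_partial ks \<phi>) \<union> range (\<lambda>ks. iter_partial ks \<psi>) \<union> range coordf \<union> range gauss_exp) f"
      (is "alg ?A f")
  shows "smooth f"
  unfolding smooth_iff_smooth_on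
proof (rule smooth_on_alg[OF _ f])
  show "open (UNIV :: (real^'n) set)" by auto
next
  fix f assume "f \<in> ?A"
  then consider ks where "f = iter_partial ks \<phi>" | ks where "f = iter_partial ks \<psi>" | k where "f = coordf k" | p where "f = gauss_exp p" by auto
  then show "(\<forall>x\<in>UNIV. f differentiable (at x)) \<and> (\<forall>k. \<exists>g. alg ?A g \<and> (\<forall>x\<in>UNIV. partial k f x = g x))"
  proof cases
    case 1
    show ?thesis unfolding 1
    proof (intro conjI ballI allI)
      fix x :: "real^'n" show "iter_partial ks \<phi> differentiable at x"
        using \<phi> by (auto simp: smooth_iff_smooth_on smooth_on_def)
    next
      fix k
      show "\<exists>g. alg ?A g \<and> (\<forall>x\<in>UNIV. partial k (iter_partial ks \<phi>) x = g x)"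
        by (intro exI[of _ "iter_partial (k # ks) \<phi>"] conjI alg_base) (auto simp del: iter_partial_simps(2), simp)
    qed
  next
    case 2
    show ?thesis unfolding 2
    proof (intro conjI ballI allI)
      fix x :: "real^'n" show "iter_partial ks \<psi> differentiable at x"
        using \<psi> by (auto simp: smooth_iff_smooth_on smooth_on_def)
    next
      fix k
      show "\<exists>g. alg ?A g \<and> (\<forall>x\<in>UNIV. partial k (iter_partial ks \<psi>) x = g x)"
        by (intro exI[of _ "iter_partial (k # ks) \<psi>"] conjI alg_base) (auto simp del: iter_partial_simps(2), simp)
    qed
  next
    case 3
    show ?thesis unfolding 3
    proof (intro conjI ballI allI)
      fix x :: "real^'n" show "coordf k differentiable at x"
        using has_derivative_coordf differentiable_def by blast
    next
      fix j
      show "\<exists>g. alg ?A g \<and> (\<forall>x\<in>UNIV. partial j (coordf k) x = g x)"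
        by (intro exI[of _ "\<lambda>_. if j = k then 1 else 0"] conjI alg_const) (simp add: partial_coordf)
    qed
  next
    case 4
    show ?thesis unfolding 4
    proof (intro conjI ballI allI)
      fix x :: "real^'n" show "gauss_exp p differentiable at x"
        using has_derivative_gauss_exp[of p x] by (auto simp: differentiable_def)
    next
      fix k
      show "\<exists>g. alg ?A g \<and> (\<forall>x\<in>UNIV. partial k (gauss_exp p) x = g x)"
        by (rule exI[of _ "\<lambda>x. (of_real (2 * p) * gauss_exp p x) * coordf k x"], rule conjI, (intro alg_mult alg_const alg_base; auto))
           (auto simp: partial_eqI[OF has_derivative_gauss_exp] gauss_exp_def coordf_def inner_axis)
    qed
  qed
qed

lemma smooth_mult:
  fixes f g :: "real^'n::finite \<Rightarrow> complex"
  assumes "smooth f" "smooth g" shows "smooth (\<lambda>x. f x * g x)"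
  by (rule smooth_alg_everywhere[OF assms], intro alg_mult alg_base)
     (auto intro: range_eqI[of _ _ "[]"])

lemma smooth_coordf_mult:
  assumes "smooth f" shows "smooth (\<lambda>x. coordf k x * f x)"
  by (rule smooth_alg_everywhere[OF assms assms], intro alg_mult alg_base)
     (auto intro: range_eqI[of _ _ "[]"])

lemma smooth_gauss_exp_mult:
  assumes "smooth f" shows "smooth (\<lambda>x. f x * gauss_exp c x)"
  by (rule smooth_alg_everywhere[OF assms assms], intro alg_mult alg_base)
     (auto intro: range_eqI[of _ _ "[]"])

lemma smooth_cmult:
  fixes f :: "real^'n::finite \<Rightarrow> complex"
  assumes "smooth f" shows "smooth (\<lambda>x. c * f x)"
  by (rule smooth_alg_everywhere[OF assms assms], intro alg_mult alg_const alg_base)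
     (auto intro: range_eqI[of _ _ "[]"])

lemma smooth_add:
  fixes f g :: "real^'n::finite \<Rightarrow> complex"
  assumes "smooth f" "smooth g" shows "smooth (\<lambda>x. f x + g x)"
  by (rule smooth_alg_everywhere[OF assms], intro alg_add alg_base)
     (auto intro: range_eqI[of _ _ "[]"])

text \<open>Near the origin the function is locally zero; the ball and the punctured space cover
  everything. Applied to annular cutoffs times singular radial factors.\<close>

lemma smooth_if_away:
  fixes f :: "real^'n::finite \<Rightarrow> 'b::real_normed_vector"
  assumes "smooth_on (-{0}) f" "a > 0" "\<And>x. norm x < a \<Longrightarrow> f x = 0"
  shows "smooth f"
proof -
  have z: "smooth_on (ball 0 a) (\<lambda>_::real^'n. 0 :: 'b)"
  proof (rule smooth_on_coinduct[where P="\<lambda>f. f = (\<lambda>_. 0)"])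
    fix f :: "real^'n \<Rightarrow> 'b" assume "f = (\<lambda>_. 0)"
    then show "(\<forall>x\<in>ball 0 a. f differentiable at x) \<and> (\<forall>k. \<exists>g. g = (\<lambda>_. 0) \<and> (\<forall>x\<in>ball 0 a. partial k f x = g x))"
      by (auto intro!: partial_eqI[THEN trans] has_derivative_const)
  qed auto
  have "smooth_on (ball 0 a) f"
    by (rule smooth_on_cong[OF _ z]) (auto simp: assms(3))
  with assms(1) have "smooth_on (-{0} \<union> ball 0 a) f" by (simp add: smooth_on_Un)
  moreover have "-{0} \<union> ball (0::real^'n) a = UNIV" using assms(2) by auto
  ultimately show ?thesis by (simp add: smooth_iff_smooth_on)
qed

lemma smooth_npowr_mult:
  fixes f :: "real^'n::finite \<Rightarrow> complex"
  assumes "smooth f" "a > 0" "\<And>x. norm x < a \<Longrightarrow> f x = 0"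
  shows "smooth (\<lambda>x. f x * npowr p x)"
proof (rule smooth_if_away[OF _ assms(2)])
  show "smooth_on (-{0}) (\<lambda>x. f x * npowr p x)"
    by (rule smooth_on_alg_away[where \<phi>=f], rule smooth_on_subset[where U=UNIV],
       use assms(1) in \<open>simp add: smooth_iff_smooth_on\<close>, simp, intro alg_mult alg_base)
     (auto intro: range_eqI[of _ _ "[]"])
qed (simp add: assms(3))

lemma smooth_nexp_mult:
  fixes f :: "real^'n::finite \<Rightarrow> complex"
  assumes "smooth f" "a > 0" "\<And>x. norm x < a \<Longrightarrow> f x = 0"
  shows "smooth (\<lambda>x. nexp c q x * f x)"
proof (rule smooth_if_away[OF _ assms(2)])
  show "smooth_on (-{0}) (\<lambda>x. nexp c q x * f x)"
    by (rule smooth_on_alg_away[where \<phi>=f], rule smooth_on_subset[where U=UNIV],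
       use assms(1) in \<open>simp add: smooth_iff_smooth_on\<close>, simp, intro alg_mult alg_base)
     (auto intro: range_eqI[of _ _ "[]"])
qed (simp add: assms(3))

lemma smooth_of_real:
  fixes f :: "real^'n::finite \<Rightarrow> real"
  assumes "smooth f" shows "smooth (\<lambda>x. complex_of_real (f x))"
  unfolding smooth_iff_smooth_on
proof (rule smooth_on_coinduct[where P="\<lambda>g. \<exists>f::real^'n \<Rightarrow> real. smooth f \<and> g = (\<lambda>x. complex_of_real (f x))"])
  fix g assume "\<exists>f::real^'n \<Rightarrow> real. smooth f \<and> g = (\<lambda>x. complex_of_real (f x))"
  then obtain f :: "real^'n \<Rightarrow> real" where f: "smooth f" "g = (\<lambda>x. complex_of_real (f x))" by blast
  have d: "(f has_derivative frechet_derivative f (at x)) (at x)" for x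
    using smooth_on_differentiable[of UNIV f x] f(1) by (simp add: smooth_iff_smooth_on frechet_derivative_works)
  have d': "(g has_derivative (\<lambda>h. complex_of_real (frechet_derivative f (at x) h))) (at x)" for x
    unfolding f(2) by (rule has_derivative_of_real[OF d])
  have "partial k g x = complex_of_real (partial k f x)" for k x
    unfolding partial_def using partial_eqI[OF d', of k] by (simp add: partial_def)
  then show "(\<forall>x\<in>UNIV. g differentiable at x) \<and>
     (\<forall>k. \<exists>h. (\<exists>f::real^'n \<Rightarrow> real. smooth f \<and> h = (\<lambda>x. complex_of_real (f x))) \<and> (\<forall>x\<in>UNIV. partial k g x = h x))"
    using d' smooth_partial[OF f(1)] by (fastforce simp: differentiable_def)
qed (use assms in auto)

lemma smooth_scale:
  fixes f :: "real^'n::finite \<Rightarrow> 'b::real_normed_vector"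
  assumes "smooth f" shows "smooth (\<lambda>x. f (r *\<^sub>R x))"
  unfolding smooth_iff_smooth_on
\<comment> \<open>The chain rule multiplies by \<open>r\<close> at every differentiation, hence the
  arbitrary scalar \<open>c\<close> in the invariant.\<close>
proof (rule smooth_on_coinduct[where P="\<lambda>g. \<exists>(f::real^'n \<Rightarrow> 'b) c. smooth f \<and> g = (\<lambda>x. c *\<^sub>R f (r *\<^sub>R x))"])
  show "\<exists>fa c. smooth fa \<and> (\<lambda>x. f (r *\<^sub>R x)) = (\<lambda>x. c *\<^sub>R fa (r *\<^sub>R x))"
    using assms by (intro exI[of _ f] exI[of _ 1]) auto
next
  fix g assume "\<exists>(f::real^'n \<Rightarrow> 'b) c. smooth f \<and> g = (\<lambda>x. c *\<^sub>R f (r *\<^sub>R x))"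
  then obtain f :: "real^'n \<Rightarrow> 'b" and c where f: "smooth f" "g = (\<lambda>x. c *\<^sub>R f (r *\<^sub>R x))" by blast
  have d: "(f has_derivative frechet_derivative f (at x)) (at x)" for x
    using smooth_on_differentiable[of UNIV f x] f(1) by (simp add: smooth_iff_smooth_on frechet_derivative_works)
  have s: "((*\<^sub>R) r has_derivative (*\<^sub>R) r) (at x)" for x :: "real^'n"
    by (auto intro!: derivative_eq_intros)
  have d': "(g has_derivative (\<lambda>h. c *\<^sub>R frechet_derivative f (at (r *\<^sub>R x)) (r *\<^sub>R h))) (at x)" for x
    unfolding f(2) by (intro has_derivative_scaleR_right diff_chain_at[OF s d, unfolded o_def])
  have "partial k g x = (c * r) *\<^sub>R partial k f (r *\<^sub>R x)" for k x
    using linear_cmul[OF has_derivative_linear[OF d]]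
    unfolding partial_def using partial_eqI[OF d', of k] by (simp add: partial_def)
  then have "\<exists>h. (\<exists>(f::real^'n \<Rightarrow> 'b) c. smooth f \<and> h = (\<lambda>x. c *\<^sub>R f (r *\<^sub>R x))) \<and> (\<forall>x\<in>UNIV. partial k g x = h x)" for k
    using smooth_partial[OF f(1)]
    by (intro exI[of _ "\<lambda>x. (c * r) *\<^sub>R partial k f (r *\<^sub>R x)"]) blast
  with d' show "(\<forall>x\<in>UNIV. g differentiable at x) \<and>
     (\<forall>k. \<exists>h. (\<exists>(f::real^'n \<Rightarrow> 'b) c. smooth f \<and> h = (\<lambda>x. c *\<^sub>R f (r *\<^sub>R x))) \<and> (\<forall>x\<in>UNIV. partial k g x = h x))"
    by (auto simp: differentiable_def)
qed auto

section \<open>Integrability on Euclidean space and test functions\<close>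

lemma nn_integral_lborel_affine:
  fixes t :: "'a::euclidean_space"
  assumes [measurable]: "f \<in> borel_measurable borel" and c: "c \<noteq> 0"
  shows "(\<integral>\<^sup>+x. f x \<partial>lborel) = ennreal (\<bar>c\<bar> ^ DIM('a)) * (\<integral>\<^sup>+x. f (t + c *\<^sub>R x) \<partial>lborel)"
  by (subst lborel_affine[OF c, of t])
     (simp add: nn_integral_density nn_integral_distr nn_integral_cmult ennreal_power)

lemma integrable_lborel_affine:
  fixes f :: "'a::euclidean_space \<Rightarrow> 'b :: {banach, second_countable_topology}"
  assumes f: "integrable lborel f" and c: "c \<noteq> 0"
  shows "integrable lborel (\<lambda>x. f (t + c *\<^sub>R x))"
  using f f[THEN borel_measurable_integrable] c unfolding integrable_iff_bounded
  by (subst (asm) nn_integral_lborel_affine[where c=c and t=t]) (auto simp: ennreal_mult_less_top)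

lemma integral_lborel_affine:
  fixes f :: "'a::euclidean_space \<Rightarrow> 'b :: {banach, second_countable_topology}"
  assumes [measurable]: "f \<in> borel_measurable borel" and c: "c \<noteq> 0"
  shows "(\<integral>x. f x \<partial>lborel) = \<bar>c\<bar> ^ DIM('a) *\<^sub>R (\<integral>x. f (t + c *\<^sub>R x) \<partial>lborel)"
  by (subst lborel_affine[OF c, of t]) (simp add: integral_density integral_distr)

lemma nn_integral_lborel_reflect:
  fixes f :: "'a::euclidean_space \<Rightarrow> ennreal"
  assumes "f \<in> borel_measurable borel"
  shows "(\<integral>\<^sup>+x. f (t - x) \<partial>lborel) = (\<integral>\<^sup>+x. f x \<partial>lborel)"
  using nn_integral_lborel_affine[OF assms, of "-1" t] by simp

lemma nn_integral_lborel_shift: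
  fixes f :: "'a::euclidean_space \<Rightarrow> ennreal"
  assumes "f \<in> borel_measurable borel"
  shows "(\<integral>\<^sup>+x. f (x - t) \<partial>lborel) = (\<integral>\<^sup>+x. f x \<partial>lborel)"
  using nn_integral_lborel_affine[OF assms, of 1 "-t"] by simp

lemma integrable_lborel_reflect:
  fixes f :: "'a::euclidean_space \<Rightarrow> 'b :: {banach, second_countable_topology}"
  assumes "integrable lborel f" shows "integrable lborel (\<lambda>x. f (t - x))"
  using integrable_lborel_affine[OF assms, of "-1" t] by simp

lemma nn_integral_inverse_1_plus_square_finite:
  "(\<integral>\<^sup>+x. ennreal (inverse (1 + x\<^sup>2)) \<partial>lborel) < \<infinity>"
proof -
  have "integrable lborel (\<lambda>x::real. inverse (1 + x\<^sup>2))"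
    using integrable_inverse_1_plus_square by (simp add: set_integrable_def einterval_eq)
  from integrableD(2)[OF this] show ?thesis
    by (simp add: less_top abs_of_pos add_pos_nonneg)
qed

text \<open>Comparison with a product of one-dimensional functions 1/(1 + s^2): every coordinate
  satisfies 1 + (x.b)^2 <= (1 + |x|)^2, and multiplying over the basis produces the exponent
  \<open>2 * DIM('a)\<close>. Tonelli's theorem then factors the integral.\<close>

lemma integrable_inverse_one_plus_norm_power:
  "integrable lborel (\<lambda>x::'a::euclidean_space. inverse ((1 + norm x) ^ (2 * DIM('a))))"
proof (rule integrableI_bounded)
  have le: "inverse ((1 + norm x) ^ (2 * DIM('a))) \<le> (\<Prod>b\<in>Basis. inverse (1 + (x \<bullet> b)\<^sup>2))" for x :: 'a
  proof -
    have "(\<Prod>b\<in>Basis. 1 + (x \<bullet> b)\<^sup>2) \<le> (\<Prod>b\<in>(Basis::'a set). (1 + norm x)\<^sup>2)"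
    proof (rule prod_mono, intro conjI)
      fix b :: 'a assume b: "b \<in> Basis"
      have "(x \<bullet> b)\<^sup>2 \<le> (norm x)\<^sup>2"
        using Basis_le_norm[OF b, of x] by (metis abs_le_square_iff abs_norm_cancel)
      then show "1 + (x \<bullet> b)\<^sup>2 \<le> (1 + norm x)\<^sup>2"
        using norm_ge_zero[of x] unfolding power2_eq_square distrib_left distrib_right by linarith
    qed auto
    also have "\<dots> = (1 + norm x) ^ (2 * DIM('a))"
      by (simp add: power_mult)
    finally have *: "(\<Prod>b\<in>Basis. 1 + (x \<bullet> b)\<^sup>2) \<le> (1 + norm x) ^ (2 * DIM('a))" .
    have "0 < (\<Prod>b\<in>Basis. 1 + (x \<bullet> b)\<^sup>2)"
      by (intro prod_pos) (auto simp: add_pos_nonneg)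
    from le_imp_inverse_le[OF * this] show ?thesis
      by (simp add: prod_inversef[symmetric])
  qed
  have "(\<integral>\<^sup>+x. ennreal (norm (inverse ((1 + norm (x::'a)) ^ (2 * DIM('a))))) \<partial>lborel)
      \<le> (\<integral>\<^sup>+x. (\<Prod>b\<in>Basis. ennreal (inverse (1 + ((x::'a) \<bullet> b)\<^sup>2))) \<partial>lborel)"
    by (intro nn_integral_mono) (auto simp: prod_ennreal add_nonneg_nonneg intro!: ennreal_leI le)
  also have "\<dots> = (\<Prod>b\<in>(Basis::'a set). (\<integral>\<^sup>+x. ennreal (inverse (1 + x\<^sup>2)) \<partial>lborel))"
    by (rule nn_integral_lborel_prod) auto
  also have "\<dots> < \<infinity>"
    using nn_integral_inverse_1_plus_square_finite by (simp add: power_less_top_ennreal)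
  finally show "(\<integral>\<^sup>+x. ennreal (norm (inverse ((1 + norm (x::'a)) ^ (2 * DIM('a))))) \<partial>lborel) < \<infinity>" .
qed simp

lemma integrable_polynomial_decay:
  fixes f :: "'a::euclidean_space \<Rightarrow> 'b::{banach, second_countable_topology}"
  assumes [measurable]: "f \<in> borel_measurable borel"
    and b: "\<And>x. (1 + norm x) ^ (2 * DIM('a)) * norm (f x) \<le> C"
  shows "integrable lborel f"
proof (rule Bochner_Integration.integrable_bound[OF integrable_mult_right[OF integrable_inverse_one_plus_norm_power, of C]])
  show "AE x in lborel. norm (f x) \<le> norm (C * inverse ((1 + norm x) ^ (2 * DIM('a))))"
  proof (rule AE_I2)
    fix x
    have "norm (f x) \<le> C * inverse ((1 + norm x) ^ (2 * DIM('a)))"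
      using b[of x] by (simp add: field_simps add_pos_nonneg)
    then show "norm (f x) \<le> norm (C * inverse ((1 + norm x) ^ (2 * DIM('a))))" by simp
  qed
qed simp

text \<open>The exponential dominates each single term y^m/m! of its series; with y = c r^q and m q
  >= p this term outweighs r^p. For r <= 1 everything is bounded.\<close>

lemma exp_powr_decay:
  fixes c q :: real
  assumes c: "c > 0" and q: "q > 0"
  shows "\<exists>C. \<forall>r\<ge>0. (1 + r) ^ p * exp (- c * r powr q) \<le> C"
proof -
  obtain m :: nat where m: "real m * q \<ge> real p"
    using q by (metis less_eq_real_def mult.commute reals_Archimedean3)
  have "(1 + r) ^ p * exp (- c * r powr q) \<le> 2 ^ p * (1 + fact m / c ^ m)" if r: "r \<ge> 0" for r
  proof (cases "r \<le> 1")
    case True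
    have "(1 + r) ^ p * exp (- c * r powr q) \<le> 2 ^ p * 1"
      using True r c by (intro mult_mono power_mono) auto
    also have "\<dots> \<le> 2 ^ p * (1 + fact m / c ^ m)" using c by (intro mult_left_mono) auto
    finally show ?thesis .
  next
    case False
    define y where "y = c * r powr q"
    have y: "y > 0" using False c by (simp add: y_def)
    have "y ^ m / fact m \<le> exp y"
    proof -
      have s: "(\<lambda>n. y ^ n /\<^sub>R fact n) sums exp y" by (rule exp_converges)
      have "(\<Sum>n\<in>{m}. y ^ n /\<^sub>R fact n) \<le> exp y"
        using sum_le_suminf[of "\<lambda>n. y ^ n /\<^sub>R fact n" "{m}"] s y
        by (auto simp: sums_iff)
      then show ?thesis by (simp add: divide_inverse mult.commute)
    qed
    then have e: "exp (- y) \<le> fact m / y ^ m"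
      using y by (simp add: exp_minus field_simps)
    have "r ^ p \<le> (r powr q) ^ m"
    proof -
      have "r ^ p = r powr real p" using False by (simp add: powr_realpow)
      also have "\<dots> \<le> r powr (real m * q)" using False m by (intro powr_mono) auto
      also have "\<dots> = (r powr q) ^ m" using False by (simp add: powr_powr[symmetric] powr_realpow mult.commute)
      finally show ?thesis .
    qed
    then have "(1 + r) ^ p \<le> 2 ^ p * (r powr q) ^ m"
    proof -
      have "(1 + r) ^ p \<le> (2 * r) ^ p" using False by (intro power_mono) auto
      also have "\<dots> = 2 ^ p * r ^ p" by (simp add: power_mult_distrib)
      also have "\<dots> \<le> 2 ^ p * (r powr q) ^ m" using \<open>r ^ p \<le> _\<close> by simp
      finally show ?thesis .
    qed
    then have "(1 + r) ^ p * exp (- y) \<le> (2 ^ p * (r powr q) ^ m) * (fact m / y ^ m)"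
      using e by (intro mult_mono) auto
    also have "\<dots> = 2 ^ p * (fact m / c ^ m)"
      using False c by (simp add: y_def power_mult_distrib field_simps)
    also have "\<dots> \<le> 2 ^ p * (1 + fact m / c ^ m)" by (intro mult_left_mono) auto
    finally show ?thesis by (simp add: y_def)
  qed
  then show ?thesis by blast
qed

lemma integrable_growth_exp:
  fixes m :: "'a::euclidean_space \<Rightarrow> 'b::{banach, second_countable_topology}"
  assumes c: "c > 0" and q: "q > 0" and [measurable]: "m \<in> borel_measurable borel"
    and m: "\<And>x. norm (m x) \<le> A * (1 + norm x) ^ p * exp (- c * norm x powr q)"
  shows "integrable lborel m"
proof -
  obtain C where C: "\<forall>r\<ge>0. (1 + r) ^ (p + 2 * DIM('a)) * exp (- c * r powr q) \<le> C"
    using exp_powr_decay[OF c q] by blast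
  show ?thesis
  proof (rule integrable_polynomial_decay[where C="\<bar>A\<bar> * C"])
    fix x :: 'a
    have "(1 + norm x) ^ (2 * DIM('a)) * norm (m x)
      \<le> (1 + norm x) ^ (2 * DIM('a)) * (\<bar>A\<bar> * (1 + norm x) ^ p * exp (- c * norm x powr q))"
      using m[of x] by (intro mult_left_mono order_trans[OF m] mult_right_mono) auto
    also have "\<dots> = \<bar>A\<bar> * ((1 + norm x) ^ (p + 2 * DIM('a)) * exp (- c * norm x powr q))"
      by (simp add: power_add mult_ac)
    also have "\<dots> \<le> \<bar>A\<bar> * C" using C by (intro mult_left_mono) auto
    finally show "(1 + norm x) ^ (2 * DIM('a)) * norm (m x) \<le> \<bar>A\<bar> * C" .
  qed simp
qed

lemma integrable_growth_gauss:
  fixes m :: "'a::euclidean_space \<Rightarrow> 'b::{banach, second_countable_topology}"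
  assumes c: "c > 0" and m': "m \<in> borel_measurable borel"
    and m: "\<And>x. norm (m x) \<le> A * (1 + norm x) ^ p * exp (- c * (norm x)\<^sup>2)"
  shows "integrable lborel m"
  using m by (intro integrable_growth_exp[where c=c and q=2 and A=A and p=p] c m') (auto simp: powr_numeral)

section \<open>Test functions\<close>

lemma test_functionD:
  assumes "test_function m"
  shows "smooth m" "\<exists>b>0. \<forall>\<xi>. norm \<xi> > b \<longrightarrow> m \<xi> = 0"
proof -
  show "smooth m" using assms by (simp add: test_function_def)
  have "bounded (closure {\<xi>. m \<xi> \<noteq> 0})" using assms by (simp add: test_function_def compact_imp_bounded)
  then have "bounded {\<xi>. m \<xi> \<noteq> 0}" using closure_subset bounded_subset by blast
  then obtain b where "b > 0" "\<forall>\<xi>\<in>{\<xi>. m \<xi> \<noteq> 0}. norm \<xi> \<le> b" by (auto simp: bounded_pos)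
  then show "\<exists>b>0. \<forall>\<xi>. norm \<xi> > b \<longrightarrow> m \<xi> = 0" by force
qed

lemma test_functionI:
  assumes "smooth m" "\<And>\<xi>. norm \<xi> > b \<Longrightarrow> m \<xi> = 0"
  shows "test_function m"
proof -
  have "bounded {\<xi>. m \<xi> \<noteq> 0}"
    unfolding bounded_iff using assms(2) by (intro exI[of _ b]) force
  then show ?thesis using assms(1) by (simp add: test_function_def)
qed

lemma smooth_continuous: "smooth f \<Longrightarrow> continuous_on UNIV f"
  using smooth_on_differentiable[of UNIV f]
  by (auto simp: smooth_iff_smooth_on intro!: differentiable_imp_continuous_on differentiable_at_imp_differentiable_on)

lemma test_function_continuous: "test_function m \<Longrightarrow> continuous_on UNIV m"
  using test_functionD(1) smooth_continuous by blast

lemma test_function_borel: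
  fixes m :: "real^'n::finite \<Rightarrow> 'b::real_normed_vector"
  shows "test_function m \<Longrightarrow> m \<in> borel_measurable borel"
  by (rule borel_measurable_continuous_onI[OF test_function_continuous])

lemma test_function_bounded:
  assumes "test_function m" shows "\<exists>B>0. \<forall>\<xi>. norm (m \<xi>) \<le> B"
proof -
  obtain b where b: "b > 0" "\<And>\<xi>. norm \<xi> > b \<Longrightarrow> m \<xi> = 0" using test_functionD(2)[OF assms] by blast
  have "compact (m ` cball 0 b)"
    using test_function_continuous[OF assms] by (intro compact_continuous_image) (auto intro: continuous_on_subset)
  then obtain B where B: "B > 0" "\<And>y. y \<in> m ` cball 0 b \<Longrightarrow> norm y \<le> B"
    using compact_imp_bounded bounded_pos by metis
  have "norm (m \<xi>) \<le> B" for \<xi>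
    using B b(2)[of \<xi>] by (cases "norm \<xi> \<le> b") auto
  with B(1) show ?thesis by blast
qed

lemma test_function_partial:
  assumes "test_function m" shows "test_function (partial k m)"
proof -
  obtain b where b: "b > 0" "\<And>\<xi>. norm \<xi> > b \<Longrightarrow> m \<xi> = 0" using test_functionD(2)[OF assms] by blast
  show ?thesis
  proof (rule test_functionI)
    show "smooth (partial k m)" using test_functionD(1)[OF assms] smooth_partial by blast
    fix \<xi> :: "real^'a" assume "b < norm \<xi>"
    have "partial k m \<xi> = partial k (\<lambda>_. 0) \<xi>"
      using \<open>b < norm \<xi>\<close> b(2)
      by (intro partial_cong_open[of "- cball 0 b"]) auto
    then show "partial k m \<xi> = 0" by (simp add: partial_eqI[OF has_derivative_const])
  qed
qed

lemma test_function_mult_smooth: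
  fixes f g :: "real^'n::finite \<Rightarrow> complex"
  assumes "test_function f" "smooth g" shows "test_function (\<lambda>x. f x * g x)"
proof -
  obtain b where b: "b > 0" "\<And>\<xi>. norm \<xi> > b \<Longrightarrow> f \<xi> = 0" using test_functionD(2)[OF assms(1)] by blast
  then show ?thesis
    using smooth_mult[OF test_functionD(1)[OF assms(1)] assms(2)] by (intro test_functionI[of _ b]) auto
qed

lemma test_function_mult:
  fixes f g :: "real^'n::finite \<Rightarrow> complex"
  assumes "test_function f" "test_function g" shows "test_function (\<lambda>x. f x * g x)"
  using assms test_function_mult_smooth test_functionD(1) by blast

lemma test_function_coordf:
  assumes "test_function f" shows "test_function (\<lambda>x. coordf k x * f x)"
proof -
  obtain b where b: "b > 0" "\<And>\<xi>. norm \<xi> > b \<Longrightarrow> f \<xi> = 0" using test_functionD(2)[OF assms(1)] by blast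
  then show ?thesis
    using smooth_coordf_mult[OF test_functionD(1)[OF assms(1)]] by (intro test_functionI[of _ b]) auto
qed

lemma test_function_cmult:
  assumes "test_function f" shows "test_function (\<lambda>x. c * f x :: complex)"
proof -
  obtain b where b: "b > 0" "\<And>\<xi>. norm \<xi> > b \<Longrightarrow> f \<xi> = 0" using test_functionD(2)[OF assms(1)] by blast
  then show ?thesis
    using smooth_cmult[OF test_functionD(1)[OF assms(1)]] by (intro test_functionI[of _ b]) auto
qed

lemma test_function_scale:
  assumes "test_function f" "r > 0" shows "test_function (\<lambda>x. f (r *\<^sub>R x))"
proof -
  obtain b where b: "b > 0" "\<And>\<xi>. norm \<xi> > b \<Longrightarrow> f \<xi> = 0" using test_functionD(2)[OF assms(1)] by blast
  then show ?thesis
    using smooth_scale[OF test_functionD(1)[OF assms(1)]] assms(2)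
    by (intro test_functionI[of _ "b / r"]) (auto simp: field_simps)
qed

lemma test_function_integrable:
  fixes f :: "real^'n::finite \<Rightarrow> complex"
  assumes "test_function f" shows "integrable lborel f"
proof -
  obtain b where b: "b > 0" "\<And>\<xi>. norm \<xi> > b \<Longrightarrow> f \<xi> = 0" using test_functionD(2)[OF assms(1)] by blast
  have "integrable lborel (\<lambda>x. indicator (cball 0 b) x *\<^sub>R f x)"
    using test_function_continuous[OF assms]
    by (intro borel_integrable_compact) (auto intro: continuous_on_subset)
  moreover have "(\<lambda>x. indicator (cball 0 b) x *\<^sub>R f x) = f"
    using b(2) by (auto simp: fun_eq_iff indicator_def not_le)
  ultimately show ?thesis by simp
qed

section \<open>The inverse Fourier transform\<close>

lemma borel_measurable_cis [measurable]: "cis \<in> borel_measurable borel"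
  by (intro borel_measurable_continuous_onI continuous_intros)

lemma borel_measurable_coordf [measurable]: "coordf k \<in> borel_measurable borel"
  unfolding coordf_def by measurable

lemma integrable_cis_mult:
  fixes m :: "real^'n::finite \<Rightarrow> complex"
  assumes "integrable lborel m"
  shows "integrable lborel (\<lambda>\<xi>. cis (x \<bullet> \<xi>) * m \<xi>)"
proof -
  have [measurable]: "m \<in> borel_measurable borel" using borel_measurable_integrable[OF assms] by simp
  show ?thesis
    by (rule Bochner_Integration.integrable_bound[OF assms]) (auto simp: norm_mult)
qed

lemma cmod_cis_minus_one: "cmod (cis a - 1 - \<i> * a) \<le> a\<^sup>2 / 2"
  using iexp_approx1[of a 1] by (simp add: cis_conv_exp power2_eq_square algebra_simps)

text \<open>The dimension is visible only in the type, hence the \<open>itself\<close>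
  argument.\<close>

definition fourier_const :: "'n::finite itself \<Rightarrow> real"
  where "fourier_const _ = 1 / (2 * pi) ^ CARD('n)"

lemma fourier_const_pos: "fourier_const TYPE('n::finite) > 0"
  by (simp add: fourier_const_def)

lemma inv_fourier_eq:
  fixes m :: "real^'n::finite \<Rightarrow> complex"
  shows "inv_fourier m x = of_real (fourier_const TYPE('n)) * (\<integral>\<xi>. cis (x \<bullet> \<xi>) * m \<xi> \<partial>lborel)"
  by (simp add: inv_fourier_def fourier_const_def)

lemma inv_fourier_borel [measurable]:
  fixes m :: "real^'n::finite \<Rightarrow> complex"
  assumes [measurable]: "m \<in> borel_measurable borel"
  shows "inv_fourier m \<in> borel_measurable borel"
  unfolding inv_fourier_eq by measurable

lemma inv_fourier_cmult: "inv_fourier (\<lambda>\<xi>. c * m \<xi>) x = c * inv_fourier m x"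
proof -
  have "(\<lambda>\<xi>. cis (x \<bullet> \<xi>) * (c * m \<xi>)) = (\<lambda>\<xi>. c * (cis (x \<bullet> \<xi>) * m \<xi>))" by (simp add: fun_eq_iff mult_ac)
  then show ?thesis by (simp add: inv_fourier_eq mult_ac)
qed

lemma inv_fourier_add:
  assumes "integrable lborel m" "integrable lborel m'"
  shows "inv_fourier (\<lambda>\<xi>. m \<xi> + m' \<xi>) x = inv_fourier m x + inv_fourier m' x"
  using integrable_cis_mult[OF assms(1), of x] integrable_cis_mult[OF assms(2), of x]
  by (simp add: inv_fourier_eq distrib_left)

text \<open>Proved directly from the Taylor remainder of \<open>cis\<close>, which is at most
  (h.\<xi>)^2/2: integrated against \<open>m\<close> it is O(|h|^2) as soon as the second moment of
  \<open>m\<close> is finite.\<close>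

lemma inv_fourier_has_derivative:
  fixes m :: "real^'n::finite \<Rightarrow> complex"
  assumes m: "integrable lborel m"
    and m2: "integrable lborel (\<lambda>\<xi>. complex_of_real ((norm \<xi>)\<^sup>2) * m \<xi>)"
  shows "(inv_fourier m has_derivative
    (\<lambda>h. \<Sum>k\<in>UNIV. (h $ k) *\<^sub>R inv_fourier (\<lambda>\<xi>. \<i> * coordf k \<xi> * m \<xi>) x)) (at x)"
    (is "(_ has_derivative ?D) _")
  unfolding has_derivative_at
proof
  show "bounded_linear ?D"
    by (intro bounded_linear_sum bounded_linear_compose[OF bounded_linear_scaleR_left bounded_linear_vec_nth])
next
  have [measurable]: "m \<in> borel_measurable borel" using borel_measurable_integrable[OF m] by simp
  \<comment> \<open>From |\<xi>_k| <= |\<xi>| <= 1 + |\<xi>|^2, so the first moments are controlled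
    by the zeroth and the second.\<close>
  have mk: "integrable lborel (\<lambda>\<xi>. \<i> * coordf k \<xi> * m \<xi>)" for k
  proof (rule Bochner_Integration.integrable_bound[OF Bochner_Integration.integrable_add[OF integrable_norm[OF m] integrable_norm[OF m2]]])
    have "\<bar>\<xi> $ k\<bar> \<le> 1 + (norm \<xi>)\<^sup>2" for \<xi> :: "real^'n"
    proof -
      have "\<bar>\<xi> $ k\<bar> \<le> norm \<xi>" by (rule component_le_norm_cart)
      also have "\<dots> \<le> 1 + (norm \<xi>)\<^sup>2"
        using zero_le_power2[of "norm \<xi> - 1"] norm_ge_zero[of \<xi>] unfolding power2_diff one_power2 mult_1_right by linarith
      finally show ?thesis .
    qed
    then have "\<bar>\<xi> $ k\<bar> * cmod (m \<xi>) \<le> (1 + (norm \<xi>)\<^sup>2) * cmod (m \<xi>)" for \<xi> :: "real^'n"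
      by (rule mult_right_mono) simp
    then show "AE \<xi> in lborel. norm (\<i> * coordf k \<xi> * m \<xi>)
        \<le> norm (cmod (m \<xi>) + cmod (complex_of_real ((norm \<xi>)\<^sup>2) * m \<xi>))"
      by (simp add: coordf_def norm_mult norm_power distrib_right abs_of_nonneg)
  qed simp
  define c where "c = fourier_const TYPE('n)"
  have c: "c > 0" by (simp add: c_def fourier_const_pos)
  define M where "M = c * (\<integral>\<xi>. (norm \<xi>)\<^sup>2 / 2 * cmod (m \<xi>) \<partial>lborel)"
  have m2': "integrable lborel (\<lambda>\<xi>. (norm \<xi>)\<^sup>2 * cmod (m \<xi>))"
    using integrable_norm[OF m2] by (simp add: norm_mult norm_power)
  have D: "?D h = c * (\<integral>\<xi>. cis (x \<bullet> \<xi>) * (\<i> * of_real (h \<bullet> \<xi>) * m \<xi>) \<partial>lborel)" for h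
  proof -
    have "?D h = c * (\<Sum>k\<in>UNIV. (\<integral>\<xi>. of_real (h $ k) * (cis (x \<bullet> \<xi>) * (\<i> * coordf k \<xi> * m \<xi>)) \<partial>lborel))"
      unfolding integral_mult_right_zero
      by (simp add: inv_fourier_eq c_def scaleR_conv_of_real sum_distrib_left mult_ac)
    also have "(\<Sum>k\<in>UNIV. (\<integral>\<xi>. of_real (h $ k) * (cis (x \<bullet> \<xi>) * (\<i> * coordf k \<xi> * m \<xi>)) \<partial>lborel))
      = (\<integral>\<xi>. (\<Sum>k\<in>UNIV. of_real (h $ k) * (cis (x \<bullet> \<xi>) * (\<i> * coordf k \<xi> * m \<xi>))) \<partial>lborel)"
      by (intro Bochner_Integration.integral_sum[symmetric] integrable_mult_right integrable_cis_mult mk)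
    also have "(\<lambda>\<xi>. \<Sum>k\<in>UNIV. of_real (h $ k) * (cis (x \<bullet> \<xi>) * (\<i> * coordf k \<xi> * m \<xi>)))
      = (\<lambda>\<xi>. cis (x \<bullet> \<xi>) * (\<i> * of_real (h \<bullet> \<xi>) * m \<xi>))"
      by (simp add: fun_eq_iff inner_vec_def coordf_def sum_distrib_left sum_distrib_right mult_ac)
    finally show ?thesis .
  qed
  have Dint: "integrable lborel (\<lambda>\<xi>. cis (x \<bullet> \<xi>) * (\<i> * of_real (h \<bullet> \<xi>) * m \<xi>))" for h
  proof -
    have "integrable lborel (\<lambda>\<xi>. \<Sum>k\<in>UNIV. of_real (h $ k) * (\<i> * coordf k \<xi> * m \<xi>))"
      by (intro Bochner_Integration.integrable_sum integrable_mult_right mk)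
    also have "(\<lambda>\<xi>. \<Sum>k\<in>UNIV. of_real (h $ k) * (\<i> * coordf k \<xi> * m \<xi>)) = (\<lambda>\<xi>. \<i> * of_real (h \<bullet> \<xi>) * m \<xi>)"
      by (simp add: fun_eq_iff inner_vec_def coordf_def sum_distrib_left sum_distrib_right mult_ac)
    finally show ?thesis by (rule integrable_cis_mult)
  qed
  have bound: "norm (inv_fourier m (x + h) - inv_fourier m x - ?D h) \<le> M * (norm h)\<^sup>2" for h
  proof -
    have eq: "inv_fourier m (x + h) - inv_fourier m x - ?D h =
      c * (\<integral>\<xi>. cis (x \<bullet> \<xi>) * (cis (h \<bullet> \<xi>) - 1 - \<i> * of_real (h \<bullet> \<xi>)) * m \<xi> \<partial>lborel)"
    proof -
      have "(\<integral>\<xi>. cis (x \<bullet> \<xi>) * (cis (h \<bullet> \<xi>) - 1 - \<i> * of_real (h \<bullet> \<xi>)) * m \<xi> \<partial>lborel)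
         = (\<integral>\<xi>. cis ((x + h) \<bullet> \<xi>) * m \<xi> - cis (x \<bullet> \<xi>) * m \<xi> - cis (x \<bullet> \<xi>) * (\<i> * of_real (h \<bullet> \<xi>) * m \<xi>) \<partial>lborel)"
        by (intro Bochner_Integration.integral_cong) (auto simp: inner_add_left cis_mult[symmetric] algebra_simps)
      also have "\<dots> = (\<integral>\<xi>. cis ((x + h) \<bullet> \<xi>) * m \<xi> \<partial>lborel) - (\<integral>\<xi>. cis (x \<bullet> \<xi>) * m \<xi> \<partial>lborel)
          - (\<integral>\<xi>. cis (x \<bullet> \<xi>) * (\<i> * of_real (h \<bullet> \<xi>) * m \<xi>) \<partial>lborel)"
        using integrable_cis_mult[OF m] Dint by (simp add: Bochner_Integration.integral_diff)
      finally show ?thesis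
        by (simp only: D) (simp only: inv_fourier_eq c_def[symmetric] right_diff_distrib)
    qed
    have "norm (\<integral>\<xi>. cis (x \<bullet> \<xi>) * (cis (h \<bullet> \<xi>) - 1 - \<i> * of_real (h \<bullet> \<xi>)) * m \<xi> \<partial>lborel)
      \<le> (\<integral>\<xi>. (norm h)\<^sup>2 * ((norm \<xi>)\<^sup>2 / 2 * cmod (m \<xi>)) \<partial>lborel)"
    proof (rule Bochner_Integration.integral_norm_bound_integral)
      show "integrable lborel (\<lambda>\<xi>. (norm h)\<^sup>2 * ((norm \<xi>)\<^sup>2 / 2 * cmod (m \<xi>)))"
        using integrable_mult_right[OF m2', of "(norm h)\<^sup>2 / 2"] by (simp add: mult_ac)
      show "integrable lborel (\<lambda>\<xi>. cis (x \<bullet> \<xi>) * (cis (h \<bullet> \<xi>) - 1 - \<i> * of_real (h \<bullet> \<xi>)) * m \<xi>)"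
      proof -
        have "integrable lborel (\<lambda>\<xi>. cis ((x + h) \<bullet> \<xi>) * m \<xi> - cis (x \<bullet> \<xi>) * m \<xi> - cis (x \<bullet> \<xi>) * (\<i> * of_real (h \<bullet> \<xi>) * m \<xi>))"
          by (intro Bochner_Integration.integrable_diff integrable_cis_mult m Dint)
        then show ?thesis
          by (rule Bochner_Integration.integrable_cong[THEN iffD1, rotated -1])
             (auto simp: inner_add_left cis_mult[symmetric] algebra_simps)
      qed
      fix \<xi> :: "real^'n"
      have "cmod (cis (h \<bullet> \<xi>) - 1 - \<i> * of_real (h \<bullet> \<xi>)) \<le> (h \<bullet> \<xi>)\<^sup>2 / 2" by (rule cmod_cis_minus_one)
      also have "\<dots> \<le> (norm h)\<^sup>2 * (norm \<xi>)\<^sup>2 / 2"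
        using Cauchy_Schwarz_ineq2[of h \<xi>]
        by (metis abs_ge_zero abs_norm_cancel abs_mult divide_right_mono abs_le_square_iff power_mult_distrib zero_le_numeral)
      finally have "cmod (cis (h \<bullet> \<xi>) - 1 - \<i> * of_real (h \<bullet> \<xi>)) \<le> (norm h)\<^sup>2 * (norm \<xi>)\<^sup>2 / 2" .
      from mult_right_mono[OF this, of "cmod (m \<xi>)"]
      show "norm (cis (x \<bullet> \<xi>) * (cis (h \<bullet> \<xi>) - 1 - \<i> * of_real (h \<bullet> \<xi>)) * m \<xi>) \<le> (norm h)\<^sup>2 * ((norm \<xi>)\<^sup>2 / 2 * cmod (m \<xi>))"
        by (simp add: norm_mult mult_ac)
    qed
    also have "\<dots> = (norm h)\<^sup>2 * (\<integral>\<xi>. (norm \<xi>)\<^sup>2 / 2 * cmod (m \<xi>) \<partial>lborel)" by (rule integral_mult_right_zero)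
    finally show ?thesis
      unfolding eq norm_mult using c by (simp add: M_def field_simps)
  qed
  show "(\<lambda>h. norm (inv_fourier m (x + h) - inv_fourier m x - ?D h) / norm h) \<midarrow>0\<rightarrow> 0"
  proof (rule Lim_null_comparison)
    have "norm (norm (inv_fourier m (x + h) - inv_fourier m x - ?D h) / norm h) \<le> M * norm h" if "h \<noteq> 0" for h
      using bound[of h] that by (simp add: field_simps power2_eq_square)
    then show "\<forall>\<^sub>F h in at 0. norm (norm (inv_fourier m (x + h) - inv_fourier m x - ?D h) / norm h) \<le> M * norm h"
      by (simp add: eventually_at_filter)
    show "(\<lambda>h::real^'n. M * norm h) \<midarrow>0\<rightarrow> 0"
      by (auto intro!: tendsto_eq_intros)
  qed
qed

text \<open>All moments lie in L^1 but no smoothness is asked: this is what makes the inverse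
  transform smooth, and, unlike being a test function, it survives multiplication by a bounded
  measurable factor.\<close>

definition rapid :: "(real^'n::finite \<Rightarrow> complex) \<Rightarrow> bool"
  where "rapid m \<longleftrightarrow> m \<in> borel_measurable borel \<and>
    (\<forall>N. integrable lborel (\<lambda>\<xi>. complex_of_real (norm \<xi> ^ N) * m \<xi>))"

lemma rapid_integrable: "rapid m \<Longrightarrow> integrable lborel m"
  unfolding rapid_def by (drule conjunct2, drule spec[of _ 0]) simp

lemma rapid_coordf:
  assumes "rapid m" shows "rapid (\<lambda>\<xi>. \<i> * coordf k \<xi> * m \<xi>)"
proof -
  have [measurable]: "m \<in> borel_measurable borel" using assms by (simp add: rapid_def)
  have "integrable lborel (\<lambda>\<xi>. complex_of_real (norm \<xi> ^ N) * (\<i> * coordf k \<xi> * m \<xi>))" for N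
  proof (rule Bochner_Integration.integrable_bound)
    show "integrable lborel (\<lambda>\<xi>. complex_of_real (norm \<xi> ^ Suc N) * m \<xi>)"
      using assms unfolding rapid_def by blast
    have "norm \<xi> ^ N * (\<bar>\<xi> $ k\<bar> * cmod (m \<xi>)) \<le> norm \<xi> ^ N * (norm \<xi> * cmod (m \<xi>))" for \<xi> :: "real^'a"
      by (intro mult_left_mono mult_right_mono component_le_norm_cart) auto
    then show "AE \<xi> in lborel. norm (complex_of_real (norm \<xi> ^ N) * (\<i> * coordf k \<xi> * m \<xi>))
        \<le> norm (complex_of_real (norm \<xi> ^ Suc N) * m \<xi>)"
      by (simp add: coordf_def norm_mult norm_power mult_ac)
  qed simp
  then show ?thesis by (simp add: rapid_def)
qed

lemma rapid_mult_bounded: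
  assumes m: "rapid m" and [measurable]: "w \<in> borel_measurable borel" and w: "\<And>\<xi>. cmod (w \<xi>) \<le> B"
  shows "rapid (\<lambda>\<xi>. m \<xi> * w \<xi>)"
proof -
  have [measurable]: "m \<in> borel_measurable borel" using assms by (simp add: rapid_def)
  have "integrable lborel (\<lambda>\<xi>. complex_of_real (norm \<xi> ^ N) * (m \<xi> * w \<xi>))" for N
  proof (rule Bochner_Integration.integrable_bound)
    show "integrable lborel (\<lambda>\<xi>. of_real B * (complex_of_real (norm \<xi> ^ N) * m \<xi>))"
      using m unfolding rapid_def by (intro integrable_mult_right) blast
    have B: "0 \<le> B" using w[of undefined] norm_ge_zero order_trans by blast
    have "norm \<xi> ^ N * (cmod (m \<xi>) * cmod (w \<xi>)) \<le> norm \<xi> ^ N * (cmod (m \<xi>) * B)" for \<xi> :: "real^'a"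
      by (intro mult_left_mono w) auto
    then show "AE \<xi> in lborel. norm (complex_of_real (norm \<xi> ^ N) * (m \<xi> * w \<xi>))
        \<le> norm (of_real B * (complex_of_real (norm \<xi> ^ N) * m \<xi>))"
      using B by (simp add: norm_mult norm_power mult_ac)
  qed simp
  then show ?thesis by (simp add: rapid_def)
qed

lemma rapid_test_function:
  assumes "test_function m" shows "rapid m"
proof -
  obtain b where b: "b > 0" "\<And>\<xi>. norm \<xi> > b \<Longrightarrow> m \<xi> = 0" using test_functionD(2)[OF assms] by blast
  have [measurable]: "m \<in> borel_measurable borel" using test_function_borel[OF assms] .
  have "integrable lborel (\<lambda>\<xi>. complex_of_real (norm \<xi> ^ N) * m \<xi>)" for N
  proof (rule Bochner_Integration.integrable_bound)
    show "integrable lborel (\<lambda>\<xi>. of_real (b ^ N) * m \<xi>)"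
      by (intro integrable_mult_right test_function_integrable assms)
    have "norm \<xi> ^ N * cmod (m \<xi>) \<le> b ^ N * cmod (m \<xi>)" for \<xi> :: "real^'a"
      using b by (cases "norm \<xi> \<le> b") (auto intro!: mult_right_mono power_mono)
    then show "AE \<xi> in lborel. norm (complex_of_real (norm \<xi> ^ N) * m \<xi>) \<le> norm (of_real (b ^ N) * m \<xi>)"
      using b by (simp add: norm_mult norm_power)
  qed simp
  then show ?thesis by (simp add: rapid_def)
qed

lemma rapid_has_derivative:
  assumes "rapid m"
  shows "(inv_fourier m has_derivative
    (\<lambda>h. \<Sum>k\<in>UNIV. (h $ k) *\<^sub>R inv_fourier (\<lambda>\<xi>. \<i> * coordf k \<xi> * m \<xi>) x)) (at x)"
  using assms rapid_integrable[OF assms] unfolding rapid_def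
  by (intro inv_fourier_has_derivative) blast+

lemma partial_inv_fourier:
  assumes "rapid m"
  shows "partial k (inv_fourier m) = inv_fourier (\<lambda>\<xi>. \<i> * coordf k \<xi> * m \<xi>)"
proof
  fix x
  have "(\<Sum>j\<in>UNIV. (axis k 1 $ j) *\<^sub>R inv_fourier (\<lambda>\<xi>. \<i> * coordf j \<xi> * m \<xi>) x) = inv_fourier (\<lambda>\<xi>. \<i> * coordf k \<xi> * m \<xi>) x"
    by (simp add: axis_def if_distrib[of "\<lambda>c. c *\<^sub>R _"] cong: if_cong)
  then show "partial k (inv_fourier m) x = inv_fourier (\<lambda>\<xi>. \<i> * coordf k \<xi> * m \<xi>) x"
    using partial_eqI[OF rapid_has_derivative[OF assms]] by simp
qed

text \<open>The Fourier symbol of \<open>iter_partial ks\<close>; each coordinate carries its own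
  factor i.\<close>

primrec monomial :: "'n list \<Rightarrow> real^'n::finite \<Rightarrow> complex" where
  "monomial [] \<xi> = 1"
| "monomial (k # ks) \<xi> = \<i> * coordf k \<xi> * monomial ks \<xi>"

lemma rapid_monomial: "rapid m \<Longrightarrow> rapid (\<lambda>\<xi>. monomial ks \<xi> * m \<xi>)"
proof (induction ks)
  case (Cons k ks)
  from rapid_coordf[OF Cons.IH[OF Cons.prems], of k] show ?case by (simp add: mult_ac)
qed simp

lemma iter_partial_inv_fourier:
  assumes "rapid m"
  shows "iter_partial ks (inv_fourier m) = inv_fourier (\<lambda>\<xi>. monomial ks \<xi> * m \<xi>)"
proof (induction ks)
  case (Cons k ks)
  then show ?case using partial_inv_fourier[OF rapid_monomial[OF assms, of ks]] by (simp add: mult_ac)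
qed simp

lemma smooth_inv_fourier:
  assumes "rapid m" shows "smooth (inv_fourier m)"
  unfolding smooth_iff_smooth_on smooth_on_def iter_partial_inv_fourier[OF assms]
  using rapid_has_derivative[OF rapid_monomial[OF assms]] by (auto simp: differentiable_def)

lemma norm_diff_le_partial:
  fixes f :: "real^'n::finite \<Rightarrow> 'b::real_normed_vector"
  assumes "convex S" and d: "\<And>x. x \<in> S \<Longrightarrow> f differentiable (at x)"
    and B: "\<And>x k. x \<in> S \<Longrightarrow> norm (partial k f x) \<le> B" and "x \<in> S" "y \<in> S"
  shows "norm (f x - f y) \<le> (real CARD('n) * B) * norm (x - y)"
proof (rule differentiable_bound[OF assms(1) _ _ assms(4,5)])
  fix z assume z: "z \<in> S"
  show "(f has_derivative frechet_derivative f (at z)) (at z within S)"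
    using d[OF z] frechet_derivative_works has_derivative_at_withinI by blast
  show "onorm (frechet_derivative f (at z)) \<le> real CARD('n) * B"
  proof (rule onorm_le)
    fix h
    have "norm (frechet_derivative f (at z) h) \<le> (\<Sum>k\<in>UNIV. norm ((h $ k) *\<^sub>R partial k f z))"
      unfolding frechet_derivative_sum_partial[OF d[OF z]] by (rule norm_sum)
    also have "\<dots> \<le> (\<Sum>k\<in>(UNIV::'n set). norm h * B)"
      using B[OF z] by (intro sum_mono) (auto intro!: mult_mono component_le_norm_cart)
    finally show "norm (frechet_derivative f (at z) h) \<le> real CARD('n) * B * norm h" by (simp add: mult_ac)
  qed
qed

text \<open>Integration by parts as a limit of difference quotients: translating \<open>m\<close>
  along the k-th axis multiplies its Fourier integral by a phase, so the quotient of
  \<open>m\<close> and the quotient of the phase yield the same number, and both converge as the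
  step tends to 0.\<close>

lemma coordf_inv_fourier:
  fixes m :: "real^'n::finite \<Rightarrow> complex"
  assumes m: "test_function m"
  shows "coordf k x * inv_fourier m x = \<i> * inv_fourier (partial k m) x"
proof -
  obtain b where b: "b > 0" "\<And>\<xi>. norm \<xi> > b \<Longrightarrow> m \<xi> = 0" using test_functionD(2)[OF m] by blast
  have dm: "m differentiable (at \<xi>)" for \<xi>
    using test_functionD(1)[OF m] smooth_on_differentiable[of UNIV m \<xi>] by (simp add: smooth_iff_smooth_on)
  have "\<exists>B. \<forall>j\<in>UNIV. \<forall>\<xi>. norm (partial j m \<xi>) \<le> B"
  proof -
    have "\<forall>j. \<exists>B. \<forall>\<xi>. norm (partial j m \<xi>) \<le> B"
      using test_function_bounded[OF test_function_partial[OF m]] by blast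
    then obtain B where B: "\<And>j \<xi>. norm (partial j m \<xi>) \<le> B j" by metis
    have "norm (partial j m \<xi>) \<le> Max (range B)" for j \<xi>
      by (rule order_trans[OF B Max_ge]) auto
    then show ?thesis by blast
  qed
  then obtain B where B: "\<And>j \<xi>. norm (partial j m \<xi>) \<le> B" by blast
  define L where "L = real CARD('n) * B"
  have lip: "norm (m \<xi> - m \<eta>) \<le> L * norm (\<xi> - \<eta>)" for \<xi> \<eta>
    unfolding L_def by (rule norm_diff_le_partial[OF convex_UNIV]) (auto simp: dm B)
  define h where "h i = 1 / real (Suc i)" for i
  have h: "h i > 0" "h i \<le> 1" for i by (auto simp: h_def)
  have h0: "h \<longlonglongrightarrow> 0" unfolding h_def by (rule LIMSEQ_Suc[OF lim_1_over_n])
  define e where "e = (axis k 1 :: real^'n)"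
  have ne: "norm e = 1" by (simp add: e_def)
  have xe: "x \<bullet> e = x $ k" by (simp add: e_def inner_axis)
  have [measurable]: "m \<in> borel_measurable borel" using test_function_borel[OF m] .
  have [measurable]: "partial k m \<in> borel_measurable borel" using test_function_borel[OF test_function_partial[OF m]] .
  define I where "I = (\<integral>\<xi>. cis (x \<bullet> \<xi>) * m \<xi> \<partial>lborel)"
  have mi: "integrable lborel m" by (rule test_function_integrable[OF m])
  \<comment> \<open>Dominated convergence: the quotients are bounded by the Lipschitz constant, and
    they vanish outside the ball of radius b + 1 because the steps are at most 1.\<close>
  have lim1: "(\<lambda>i. \<integral>\<xi>. cis (x \<bullet> \<xi>) * ((m (h i *\<^sub>R e + 1 *\<^sub>R \<xi>) - m \<xi>) / h i) \<partial>lborel)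
    \<longlonglongrightarrow> (\<integral>\<xi>. cis (x \<bullet> \<xi>) * partial k m \<xi> \<partial>lborel)"
  proof (rule integral_dominated_convergence[where w="\<lambda>\<xi>. L * indicator (cball 0 (b + 1)) \<xi>"])
    show "integrable lborel (\<lambda>\<xi>::real^'n. L * indicator (cball 0 (b + 1)) \<xi>)"
      using emeasure_lborel_cball_finite[of "0::real^'n" "b + 1"]
      by (intro integrable_mult_right integrable_real_indicator) (auto simp: less_top)
    show "AE \<xi> in lborel. (\<lambda>i. cis (x \<bullet> \<xi>) * ((m (h i *\<^sub>R e + 1 *\<^sub>R \<xi>) - m \<xi>) / h i)) \<longlonglongrightarrow> cis (x \<bullet> \<xi>) * partial k m \<xi>"
    proof (intro AE_I2 tendsto_mult tendsto_const)
      fix \<xi>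
      have D: "(m has_derivative frechet_derivative m (at \<xi>)) (at \<xi>)"
        using dm frechet_derivative_works by blast
      have "((\<lambda>s. m (\<xi> + s *\<^sub>R e)) has_derivative (\<lambda>s. frechet_derivative m (at \<xi>) (s *\<^sub>R e))) (at (0::real))"
        by (rule has_derivative_compose[where g=m and f="\<lambda>s::real. \<xi> + s *\<^sub>R e"])
           (use D in \<open>auto intro!: derivative_eq_intros\<close>)
      moreover have "(\<lambda>s::real. frechet_derivative m (at \<xi>) (s *\<^sub>R e)) = (\<lambda>s. s *\<^sub>R partial k m \<xi>)"
        using linear_cmul[OF has_derivative_linear[OF D]] by (simp add: fun_eq_iff partial_def e_def)
      ultimately have "((\<lambda>s. m (\<xi> + s *\<^sub>R e)) has_vector_derivative partial k m \<xi>) (at (0::real))"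
        by (simp add: has_vector_derivative_def)
      then have "(\<lambda>s. norm (m (\<xi> + s *\<^sub>R e) - m \<xi> - s *\<^sub>R partial k m \<xi>) / norm s) \<midarrow>0\<rightarrow> 0"
        by (simp add: has_vector_derivative_def has_derivative_at)
      then have "(\<lambda>i. norm (m (\<xi> + h i *\<^sub>R e) - m \<xi> - h i *\<^sub>R partial k m \<xi>) / norm (h i)) \<longlonglongrightarrow> 0"
        by (rule filterlim_compose) (use h h0 in \<open>auto simp: filterlim_at less_imp_neq[symmetric]\<close>)
      also have "(\<lambda>i. norm (m (\<xi> + h i *\<^sub>R e) - m \<xi> - h i *\<^sub>R partial k m \<xi>) / norm (h i))
          = (\<lambda>i. norm ((m (\<xi> + h i *\<^sub>R e) - m \<xi>) /\<^sub>R h i - partial k m \<xi>))"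
      proof
        fix i
        have "(m (\<xi> + h i *\<^sub>R e) - m \<xi>) /\<^sub>R h i - partial k m \<xi>
            = (m (\<xi> + h i *\<^sub>R e) - m \<xi> - h i *\<^sub>R partial k m \<xi>) /\<^sub>R h i"
          using h(1)[of i] by (simp add: algebra_simps)
        then show "norm (m (\<xi> + h i *\<^sub>R e) - m \<xi> - h i *\<^sub>R partial k m \<xi>) / norm (h i)
            = norm ((m (\<xi> + h i *\<^sub>R e) - m \<xi>) /\<^sub>R h i - partial k m \<xi>)"
          by (simp add: divide_inverse_commute)
      qed
      finally have "(\<lambda>i. (m (\<xi> + h i *\<^sub>R e) - m \<xi>) /\<^sub>R h i) \<longlonglongrightarrow> partial k m \<xi>"
        by (simp only: tendsto_norm_zero_iff LIM_zero_iff)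
      then show "(\<lambda>i. (m (h i *\<^sub>R e + 1 *\<^sub>R \<xi>) - m \<xi>) / complex_of_real (h i)) \<longlonglongrightarrow> partial k m \<xi>"
        by (simp add: scaleR_conv_of_real divide_inverse mult_ac add_ac)
    qed
    fix i
    show "AE \<xi> in lborel. norm (cis (x \<bullet> \<xi>) * ((m (h i *\<^sub>R e + 1 *\<^sub>R \<xi>) - m \<xi>) / h i)) \<le> L * indicator (cball 0 (b + 1)) \<xi>"
    proof (rule AE_I2)
      fix \<xi>
      have he: "norm (h i *\<^sub>R e) = h i" using h[of i] ne by simp
      show "norm (cis (x \<bullet> \<xi>) * ((m (h i *\<^sub>R e + 1 *\<^sub>R \<xi>) - m \<xi>) / h i)) \<le> L * indicator (cball 0 (b + 1)) \<xi>"
      proof (cases "norm \<xi> \<le> b + 1")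
        case True
        have "norm (m (h i *\<^sub>R e + 1 *\<^sub>R \<xi>) - m \<xi>) \<le> L * h i"
          using lip[of "h i *\<^sub>R e + 1 *\<^sub>R \<xi>" \<xi>] he by simp
        then have "norm (m (h i *\<^sub>R e + 1 *\<^sub>R \<xi>) - m \<xi>) / h i \<le> L"
          using h(1)[of i] by (simp add: pos_divide_le_eq)
        then show ?thesis using True h(1)[of i] by (simp add: norm_mult norm_divide)
      next
        case False
        have "norm \<xi> \<le> norm (h i *\<^sub>R e + 1 *\<^sub>R \<xi>) + norm (h i *\<^sub>R e)"
          using norm_triangle_ineq4[of "h i *\<^sub>R e + 1 *\<^sub>R \<xi>" "h i *\<^sub>R e"] by simp
        then have "norm (h i *\<^sub>R e + 1 *\<^sub>R \<xi>) > b" using False h[of i] he by simp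
        then show ?thesis using b(2)[of "h i *\<^sub>R e + 1 *\<^sub>R \<xi>"] b(2)[of \<xi>] False by simp
      qed
    qed
  qed simp_all
  \<comment> \<open>Translation invariance of Lebesgue measure turns the integral of the shifted
    function into a phase times \<open>I\<close>.\<close>
  have eq: "(\<integral>\<xi>. cis (x \<bullet> \<xi>) * ((m (h i *\<^sub>R e + 1 *\<^sub>R \<xi>) - m \<xi>) / h i) \<partial>lborel) = (cis (- h i * x $ k) - 1) / h i * I" for i
  proof -
    have "I = (\<integral>\<xi>. cis (x \<bullet> (h i *\<^sub>R e + 1 *\<^sub>R \<xi>)) * m (h i *\<^sub>R e + 1 *\<^sub>R \<xi>) \<partial>lborel)"
      unfolding I_def by (subst integral_lborel_affine[where c=1 and t="h i *\<^sub>R e"]) simp_all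
    also have "\<dots> = (\<integral>\<xi>. cis (h i * x $ k) * (cis (x \<bullet> \<xi>) * m (h i *\<^sub>R e + 1 *\<^sub>R \<xi>)) \<partial>lborel)"
      by (intro Bochner_Integration.integral_cong) (auto simp: inner_add_right xe cis_mult[symmetric])
    also have "\<dots> = cis (h i * x $ k) * (\<integral>\<xi>. cis (x \<bullet> \<xi>) * m (h i *\<^sub>R e + 1 *\<^sub>R \<xi>) \<partial>lborel)"
      by (rule integral_mult_right_zero)
    finally have "(\<integral>\<xi>. cis (x \<bullet> \<xi>) * m (h i *\<^sub>R e + 1 *\<^sub>R \<xi>) \<partial>lborel) = cis (- h i * x $ k) * I"
      using cis_mult[of "- h i * x $ k" "h i * x $ k"] by (simp add: mult.assoc[symmetric])
    moreover have "integrable lborel (\<lambda>\<xi>. cis (x \<bullet> \<xi>) * m (h i *\<^sub>R e + 1 *\<^sub>R \<xi>))"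
      by (intro integrable_cis_mult integrable_lborel_affine mi) simp
    moreover have "integrable lborel (\<lambda>\<xi>. cis (x \<bullet> \<xi>) * m \<xi>)" by (rule integrable_cis_mult[OF mi])
    ultimately have "(\<integral>\<xi>. cis (x \<bullet> \<xi>) * m (h i *\<^sub>R e + 1 *\<^sub>R \<xi>) - cis (x \<bullet> \<xi>) * m \<xi> \<partial>lborel) = (cis (- h i * x $ k) - 1) * I"
      by (simp add: I_def[symmetric] left_diff_distrib)
    then have "(\<integral>\<xi>. (cis (x \<bullet> \<xi>) * m (h i *\<^sub>R e + 1 *\<^sub>R \<xi>) - cis (x \<bullet> \<xi>) * m \<xi>) / h i \<partial>lborel) = (cis (- h i * x $ k) - 1) * I / h i"
      by simp
    then show ?thesis by (simp add: algebra_simps diff_divide_distrib)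
  qed
  have lim2: "(\<lambda>i. (cis (- h i * x $ k) - 1) / h i * I) \<longlonglongrightarrow> (- \<i> * (x $ k)) * I"
  proof (intro tendsto_mult tendsto_const)
    have "(\<lambda>i. (cis (- h i * x $ k) - 1) / h i - (- \<i> * (x $ k))) \<longlonglongrightarrow> 0"
    proof (rule Lim_null_comparison)
      have "norm ((cis (- h i * x $ k) - 1) / h i - (- \<i> * (x $ k))) \<le> h i * (x $ k)\<^sup>2 / 2" for i
      proof -
        have "(cis (- h i * x $ k) - 1) / h i - (- \<i> * (x $ k)) = (cis (- h i * x $ k) - 1 - \<i> * of_real (- h i * x $ k)) / h i"
          using h(1)[of i] by (simp add: field_simps)
        also have "norm \<dots> \<le> (- h i * x $ k)\<^sup>2 / 2 / h i"
          unfolding norm_divide using h(1)[of i] cmod_cis_minus_one[of "- h i * x $ k"]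
          by (intro frac_le) auto
        also have "\<dots> = h i * (x $ k)\<^sup>2 / 2" using h(1)[of i] by (simp add: power2_eq_square)
        finally show ?thesis .
      qed
      then show "\<forall>\<^sub>F i in sequentially. norm ((cis (- h i * x $ k) - 1) / h i - (- \<i> * (x $ k))) \<le> h i * (x $ k)\<^sup>2 / 2"
        by simp
      show "(\<lambda>i. h i * (x $ k)\<^sup>2 / 2) \<longlonglongrightarrow> 0" using h0 by (auto intro!: tendsto_eq_intros)
    qed
    then show "(\<lambda>i. (cis (- h i * x $ k) - 1) / h i) \<longlonglongrightarrow> - \<i> * (x $ k)"
      using LIM_zero_iff by blast
  qed
  have "(\<integral>\<xi>. cis (x \<bullet> \<xi>) * partial k m \<xi> \<partial>lborel) = (- \<i> * (x $ k)) * I"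
    using lim1 lim2 unfolding eq by (rule LIMSEQ_unique)
  then show ?thesis by (simp add: inv_fourier_eq coordf_def I_def mult_ac)
qed

section \<open>Decay of the inverse transform of a test function\<close>

lemma inv_fourier_bounded:
  "norm (inv_fourier m x) \<le> fourier_const TYPE('n::finite) * (\<integral>\<xi>. norm (m (\<xi>::real^'n)) \<partial>lborel)"
proof -
  have "norm (\<integral>\<xi>. cis (x \<bullet> \<xi>) * m \<xi> \<partial>lborel) \<le> (\<integral>\<xi>. norm (cis (x \<bullet> \<xi>) * m \<xi>) \<partial>lborel)" by (rule integral_norm_bound)
  also have "\<dots> = (\<integral>\<xi>. norm (m \<xi>) \<partial>lborel)" by (simp add: norm_mult)
  finally show ?thesis using fourier_const_pos[where 'n='n] by (simp add: inv_fourier_eq norm_mult)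
qed

lemma one_plus_norm_le: "1 + norm x \<le> 1 + (\<Sum>k\<in>UNIV. \<bar>x $ k\<bar>)" for x :: "real^'n::finite"
  using norm_le_l1_cart[of x] by simp

text \<open>A factor 1 + |x| is at most 1 plus the sum of the |x_k|, and each x_k is traded for a
  derivative of \<open>m\<close> by \<open>coordf_inv_fourier\<close>. The induction therefore has
  to range over all test functions.\<close>

lemma inv_fourier_decay:
  fixes m :: "real^'n::finite \<Rightarrow> complex"
  assumes "test_function m"
  shows "\<exists>C. \<forall>x. (1 + norm x) ^ N * norm (inv_fourier m x) \<le> C"
  using assms
proof (induction N arbitrary: m)
  case 0
  then show ?case using inv_fourier_bounded[of m] by auto
next
  case (Suc N)
  obtain C where C: "\<And>x. (1 + norm x) ^ N * norm (inv_fourier m x) \<le> C" using Suc by blast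
  have "\<forall>k. \<exists>C. \<forall>x. (1 + norm x) ^ N * norm (inv_fourier (partial k m) x) \<le> C"
    using Suc test_function_partial by blast
  then obtain D where D: "\<And>k x. (1 + norm x) ^ N * norm (inv_fourier (partial k m) x) \<le> D k" by metis
  have "(1 + norm x) ^ Suc N * norm (inv_fourier m x) \<le> C + (\<Sum>k\<in>UNIV. D k)" for x
  proof -
    have eq: "\<bar>x $ k\<bar> * norm (inv_fourier m x) = norm (inv_fourier (partial k m) x)" for k
    proof -
      have "norm (coordf k x * inv_fourier m x) = norm (\<i> * inv_fourier (partial k m) x)"
        using coordf_inv_fourier[OF Suc.prems] by simp
      then show ?thesis by (simp add: norm_mult coordf_def)
    qed
    have "(1 + norm x) ^ Suc N * norm (inv_fourier m x) = (1 + norm x) ^ N * ((1 + norm x) * norm (inv_fourier m x))" by simp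
    also have "\<dots> \<le> (1 + norm x) ^ N * ((1 + (\<Sum>k\<in>UNIV. \<bar>x $ k\<bar>)) * norm (inv_fourier m x))"
      by (intro mult_left_mono mult_right_mono one_plus_norm_le) auto
    also have "\<dots> = (1 + norm x) ^ N * norm (inv_fourier m x) + (\<Sum>k\<in>UNIV. (1 + norm x) ^ N * norm (inv_fourier (partial k m) x))"
      by (simp add: eq[symmetric] distrib_left distrib_right sum_distrib_left sum_distrib_right mult_ac)
    also have "\<dots> \<le> C + (\<Sum>k\<in>UNIV. D k)" by (intro add_mono C sum_mono D)
    finally show ?thesis .
  qed
  then show ?case by blast
qed

lemma test_function_monomial: "test_function m \<Longrightarrow> test_function (\<lambda>\<xi>. monomial ks \<xi> * m \<xi>)"
proof (induction ks)
  case (Cons k ks)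
  from test_function_cmult[OF test_function_coordf[OF Cons.IH[OF Cons.prems], of k], of \<i>] show ?case by (simp add: mult_ac)
qed simp

lemma schwartz_inv_fourier:
  assumes "test_function m" shows "inv_fourier m \<in> schwartz"
proof -
  have "bounded (range (\<lambda>x. (1 + norm x) ^ N *\<^sub>R iter_partial ks (inv_fourier m) x))" for N ks
    using inv_fourier_decay[OF test_function_monomial[OF assms, of ks], of N]
    unfolding iter_partial_inv_fourier[OF rapid_test_function[OF assms]]
    by (auto simp: bounded_iff)
  then show ?thesis
    using smooth_inv_fourier[OF rapid_test_function[OF assms]] by (simp add: schwartz_def)
qed

lemma schwartz_integrable:
  fixes f :: "real^'n::finite \<Rightarrow> complex"
  assumes "f \<in> schwartz" shows "integrable lborel f"
proof -
  have "smooth f" "bounded (range (\<lambda>x. (1 + norm x) ^ (2 * DIM(real^'n)) *\<^sub>R iter_partial [] f x))"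
    using assms unfolding schwartz_def by blast+
  then obtain C where "\<And>x. (1 + norm x) ^ (2 * DIM(real^'n)) * norm (f x) \<le> C"
    by (auto simp: bounded_iff)
  then show ?thesis
    by (rule integrable_polynomial_decay[rotated])
       (use smooth_continuous[OF \<open>smooth f\<close>] in \<open>rule borel_measurable_continuous_onI\<close>)
qed

lemma inv_fourier_integrable: "test_function m \<Longrightarrow> integrable lborel (inv_fourier m)"
  by (intro schwartz_integrable schwartz_inv_fourier)

section \<open>Convolution, Fourier inversion and the Wiener algebra\<close>

lemma lborel_fubini_swap:
  fixes F :: "'a::euclidean_space \<Rightarrow> 'b::euclidean_space \<Rightarrow> 'c::{banach, second_countable_topology}"
  assumes [measurable]: "(\<lambda>(x, y). F x y) \<in> borel_measurable (borel \<Otimes>\<^sub>M borel)"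
    and fin: "(\<integral>\<^sup>+x. \<integral>\<^sup>+y. ennreal (norm (F x y)) \<partial>lborel \<partial>lborel) < \<infinity>"
  shows "(\<integral>x. \<integral>y. F x y \<partial>lborel \<partial>lborel) = (\<integral>y. \<integral>x. F x y \<partial>lborel \<partial>lborel)"
proof -
  have "integrable (lborel \<Otimes>\<^sub>M lborel) (\<lambda>(x, y). F x y)"
  proof (rule integrableI_bounded)
    have "(\<integral>\<^sup>+z. ennreal (norm (case z of (x, y) \<Rightarrow> F x y)) \<partial>(lborel \<Otimes>\<^sub>M lborel))
        = (\<integral>\<^sup>+x. \<integral>\<^sup>+y. ennreal (norm (F x y)) \<partial>lborel \<partial>lborel)"
      by (subst lborel.nn_integral_fst[symmetric]) (auto simp: split_beta)
    then show "(\<integral>\<^sup>+z. ennreal (norm (case z of (x, y) \<Rightarrow> F x y)) \<partial>(lborel \<Otimes>\<^sub>M lborel)) < \<infinity>"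
      using fin by simp
  qed measurable
  from lborel_pair.Fubini_integral[OF this] show ?thesis by simp
qed

text \<open>Valued in \<open>ennreal\<close>, so that Young's inequality and Fatou's lemma apply
  before integrability is known; integrability is then read off from a finite bound.\<close>

definition L1norm :: "('a::euclidean_space \<Rightarrow> complex) \<Rightarrow> ennreal"
  where "L1norm f = (\<integral>\<^sup>+x. ennreal (norm (f x)) \<partial>lborel)"

lemma integrable_iff_L1norm:
  "f \<in> borel_measurable borel \<Longrightarrow> integrable lborel f \<longleftrightarrow> L1norm f < \<infinity>"
  by (simp add: integrable_iff_bounded L1norm_def)

lemma L1norm_cmult: "f \<in> borel_measurable borel \<Longrightarrow> L1norm (\<lambda>x. c * f x) = ennreal (norm c) * L1norm f"
  by (simp add: L1norm_def norm_mult ennreal_mult nn_integral_cmult)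

lemma L1norm_add:
  assumes [measurable]: "f \<in> borel_measurable borel" "g \<in> borel_measurable borel"
  shows "L1norm (\<lambda>x. f x + g x) \<le> L1norm f + L1norm g"
  unfolding L1norm_def
  by (subst nn_integral_add[symmetric])
     (auto intro!: nn_integral_mono simp: ennreal_plus[symmetric] norm_triangle_ineq simp del: ennreal_plus)

lemma L1norm_sum:
  assumes "\<And>k. k \<in> S \<Longrightarrow> f k \<in> borel_measurable borel"
  shows "L1norm (\<lambda>x. \<Sum>k\<in>S. f k x) \<le> (\<Sum>k\<in>S. L1norm (f k))"
proof -
  have "L1norm (\<lambda>x. \<Sum>k\<in>S. f k x) \<le> (\<integral>\<^sup>+x. (\<Sum>k\<in>S. ennreal (norm (f k x))) \<partial>lborel)"
    unfolding L1norm_def by (intro nn_integral_mono) (auto simp: sum_ennreal norm_sum intro!: ennreal_leI)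
  also have "\<dots> = (\<Sum>k\<in>S. L1norm (f k))"
    unfolding L1norm_def using assms by (intro nn_integral_sum) auto
  finally show ?thesis .
qed

section \<open>Convolution\<close>

definition conv :: "('a::euclidean_space \<Rightarrow> complex) \<Rightarrow> ('a \<Rightarrow> complex) \<Rightarrow> 'a \<Rightarrow> complex"
  where "conv f g x = (\<integral>y. f (x - y) * g y \<partial>lborel)"

lemma conv_borel [measurable]:
  assumes [measurable]: "f \<in> borel_measurable borel" "g \<in> borel_measurable borel"
  shows "conv f g \<in> borel_measurable borel"
  unfolding conv_def by measurable

lemma L1norm_conv:
  assumes [measurable]: "f \<in> borel_measurable borel" "g \<in> borel_measurable borel"
  shows "L1norm (conv f g) \<le> L1norm f * L1norm g"
proof -
  have "L1norm (conv f g) \<le> (\<integral>\<^sup>+x. \<integral>\<^sup>+y. ennreal (norm (f (x - y))) * ennreal (norm (g y)) \<partial>lborel \<partial>lborel)"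
    unfolding L1norm_def conv_def
  proof (rule nn_integral_mono)
    fix x
    show "ennreal (norm (\<integral>y. f (x - y) * g y \<partial>lborel)) \<le> (\<integral>\<^sup>+y. ennreal (norm (f (x - y))) * ennreal (norm (g y)) \<partial>lborel)"
    \<comment> \<open>At a point where the integrand is not integrable the Bochner integral is zero,
      so the estimate holds there too.\<close>
    proof (cases "integrable lborel (\<lambda>y. f (x - y) * g y)")
      case True
      then show ?thesis using integral_norm_bound_ennreal[OF True] by (simp add: norm_mult ennreal_mult)
    qed (simp add: not_integrable_integral_eq)
  qed
  also have "\<dots> = (\<integral>\<^sup>+y. \<integral>\<^sup>+x. ennreal (norm (f (x - y))) * ennreal (norm (g y)) \<partial>lborel \<partial>lborel)"
    by (rule lborel_pair.Fubini'[symmetric]) measurable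
  also have "\<dots> = (\<integral>\<^sup>+y. L1norm f * ennreal (norm (g y)) \<partial>lborel)"
    using nn_integral_lborel_shift[of "\<lambda>x. ennreal (norm (f x))"]
    by (simp add: nn_integral_multc L1norm_def)
  also have "\<dots> = L1norm f * L1norm g" by (simp add: nn_integral_cmult L1norm_def)
  finally show ?thesis .
qed

lemma conv_reflect:
  assumes [measurable]: "f \<in> borel_measurable borel" "g \<in> borel_measurable borel"
  shows "conv f g x = conv g f x"
  using integral_lborel_affine[of "\<lambda>y. f (x - y) * g y" "-1" x]
  by (simp add: conv_def mult.commute)

lemma L1norm_translate:
  assumes [measurable]: "f \<in> borel_measurable borel"
  shows "(\<integral>\<^sup>+y. ennreal (norm (f (x - y))) \<partial>lborel) = L1norm f"
  unfolding L1norm_def by (rule nn_integral_lborel_reflect) measurable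

lemma conv_bounded_integrable:
  assumes [measurable]: "f \<in> borel_measurable borel" "g \<in> borel_measurable borel"
    and g: "AE y in lborel. norm (g y) \<le> B" and f: "L1norm f < \<infinity>"
  shows "integrable lborel (\<lambda>y. f (x - y) * g y)"
proof -
  have "integrable lborel f" using f by (simp add: integrable_iff_L1norm)
  then have "integrable lborel (\<lambda>y. of_real B * f (x - y))"
    by (intro integrable_mult_right integrable_lborel_reflect)
  then show ?thesis
  proof (rule Bochner_Integration.integrable_bound)
    show "AE y in lborel. norm (f (x - y) * g y) \<le> norm (of_real B * f (x - y))"
      using g
    proof eventually_elim
      fix y assume "norm (g y) \<le> B"
      then have "norm (f (x - y)) * norm (g y) \<le> norm (f (x - y)) * \<bar>B\<bar>" by (intro mult_left_mono) auto
      then show "norm (f (x - y) * g y) \<le> norm (of_real B * f (x - y))" by (simp add: norm_mult mult_ac)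
    qed
  qed measurable
qed

text \<open>The conclusion holds at every \<open>x\<close> although \<open>g\<close> is bounded only
  almost everywhere, since the integral ignores null sets. Later bounds can therefore be stated
  pointwise instead of through essential suprema.\<close>

lemma norm_conv_le:
  assumes [measurable]: "f \<in> borel_measurable borel" "g \<in> borel_measurable borel"
    and g: "AE y in lborel. norm (g y) \<le> B" and B: "0 \<le> B"
  shows "ennreal (norm (conv f g x)) \<le> L1norm f * ennreal B"
proof (cases "integrable lborel (\<lambda>y. f (x - y) * g y)")
  case True
  have "ennreal (norm (conv f g x)) \<le> (\<integral>\<^sup>+y. ennreal (norm (f (x - y) * g y)) \<partial>lborel)"
    unfolding conv_def by (rule integral_norm_bound_ennreal[OF True])
  also have "\<dots> \<le> (\<integral>\<^sup>+y. ennreal (norm (f (x - y))) * ennreal B \<partial>lborel)"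
  proof (rule nn_integral_mono_AE)
    show "AE y in lborel. ennreal (norm (f (x - y) * g y)) \<le> ennreal (norm (f (x - y))) * ennreal B"
      using g
    proof eventually_elim
      fix y assume "norm (g y) \<le> B"
      then show "ennreal (norm (f (x - y) * g y)) \<le> ennreal (norm (f (x - y))) * ennreal B"
        using B by (auto simp: norm_mult ennreal_mult[symmetric] intro!: ennreal_leI mult_left_mono)
    qed
  qed
  also have "\<dots> = L1norm f * ennreal B" by (simp add: nn_integral_multc L1norm_translate)
  finally show ?thesis .
qed (simp add: conv_def not_integrable_integral_eq)

text \<open>The bounded factor stays on the right; this is how a frequency cutoff is moved from a
  bounded function onto a kernel.\<close>

lemma conv_assoc:
  assumes [measurable]: "f \<in> borel_measurable borel" "g \<in> borel_measurable borel" "h \<in> borel_measurable borel"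
    and f: "L1norm f < \<infinity>" and g: "L1norm g < \<infinity>"
    and h: "AE y in lborel. norm (h y) \<le> B"
  shows "conv f (conv g h) x = conv (conv f g) h x"
proof -
  have "conv f (conv g h) x = (\<integral>y. \<integral>z. f (x - y) * (g (y - z) * h z) \<partial>lborel \<partial>lborel)"
    by (simp add: conv_def)
  also have "\<dots> = (\<integral>z. \<integral>y. f (x - y) * (g (y - z) * h z) \<partial>lborel \<partial>lborel)"
  proof (rule lborel_fubini_swap)
    have "(\<integral>\<^sup>+y. \<integral>\<^sup>+z. ennreal (norm (f (x - y) * (g (y - z) * h z))) \<partial>lborel \<partial>lborel)
      \<le> (\<integral>\<^sup>+y. \<integral>\<^sup>+z. ennreal (norm (f (x - y))) * (ennreal (norm (g (y - z))) * ennreal \<bar>B\<bar>) \<partial>lborel \<partial>lborel)"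
    proof (rule nn_integral_mono, rule nn_integral_mono_AE)
      fix y :: 'a
      show "AE z in lborel. ennreal (norm (f (x - y) * (g (y - z) * h z))) \<le> ennreal (norm (f (x - y))) * (ennreal (norm (g (y - z))) * ennreal \<bar>B\<bar>)"
        using h
      proof eventually_elim
        fix z assume "norm (h z) \<le> B"
        then show "ennreal (norm (f (x - y) * (g (y - z) * h z))) \<le> ennreal (norm (f (x - y))) * (ennreal (norm (g (y - z))) * ennreal \<bar>B\<bar>)"
          by (auto simp: norm_mult ennreal_mult[symmetric] intro!: ennreal_leI mult_left_mono)
      qed
    qed
    also have "\<dots> = L1norm f * (L1norm g * ennreal \<bar>B\<bar>)"
      by (simp add: nn_integral_cmult nn_integral_multc L1norm_translate)
    also have "\<dots> < \<infinity>" using f g by (simp add: ennreal_mult_less_top)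
    finally show "(\<integral>\<^sup>+y. \<integral>\<^sup>+z. ennreal (norm (f (x - y) * (g (y - z) * h z))) \<partial>lborel \<partial>lborel) < \<infinity>" .
  qed measurable
  also have "\<dots> = (\<integral>z. (\<integral>y. f (x - y) * g (y - z) \<partial>lborel) * h z \<partial>lborel)"
    by (simp add: mult.assoc[symmetric])
  moreover have "(\<integral>y. f (x - y) * g (y - z) \<partial>lborel) = conv f g (x - z)" for z
    unfolding conv_def using integral_lborel_affine[of "\<lambda>y. f (x - y) * g (y - z)" 1 z]
    by (simp add: algebra_simps)
  ultimately show ?thesis by (simp add: conv_def[of "conv f g"])
qed

section \<open>The Fourier transform of a Gaussian\<close>

lemma cis_sum: "finite S \<Longrightarrow> cis (\<Sum>b\<in>S. f b) = (\<Prod>b\<in>S. cis (f b))"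
  by (induction S rule: finite_induct) (auto simp: cis_mult[symmetric])

lemma integral_lborel_prod_complex:
  fixes f :: "'a::euclidean_space \<Rightarrow> real \<Rightarrow> complex"
  assumes "\<And>b. b \<in> Basis \<Longrightarrow> integrable lborel (f b)"
  shows "(\<integral>x. (\<Prod>b\<in>Basis. f b (x \<bullet> b)) \<partial>lborel) = (\<Prod>b\<in>Basis. (\<integral>x. f b x \<partial>lborel))"
proof -
  interpret finite_product_sigma_finite "\<lambda>_::'a. lborel :: real measure" Basis
    by standard auto
  have [measurable]: "f b \<in> borel_measurable borel" if "b \<in> Basis" for b
    using assms[OF that] borel_measurable_integrable by force
  have "(\<integral>x. (\<Prod>b\<in>Basis. f b (x \<bullet> b)) \<partial>lborel)
      = (\<integral>y. (\<Prod>b\<in>Basis. f b ((\<Sum>b\<in>Basis. y b *\<^sub>R b) \<bullet> b)) \<partial>(\<Pi>\<^sub>M b\<in>(Basis::'a set). lborel))"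
    by (subst lborel_eq) (simp add: integral_distr)
  also have "\<dots> = (\<integral>y. (\<Prod>b\<in>Basis. f b (y b)) \<partial>(\<Pi>\<^sub>M b\<in>(Basis::'a set). lborel))"
    by simp
  also have "\<dots> = (\<Prod>b\<in>Basis. (\<integral>x. f b x \<partial>lborel))"
    by (rule product_integral_prod) (use assms in auto)
  finally show ?thesis .
qed

text \<open>The characteristic function of the standard normal distribution without its normalising
  factor.\<close>

lemma integral_cis_gauss_real:
  "integrable lborel (\<lambda>t. cis (a * t) * complex_of_real (exp (- (t\<^sup>2 / 2))))"
  "(\<integral>t. cis (a * t) * complex_of_real (exp (- (t\<^sup>2 / 2))) \<partial>lborel) = complex_of_real (sqrt (2 * pi) * exp (- (a\<^sup>2 / 2)))"
proof -
  have e: "exp (- (t\<^sup>2 / 2)) = sqrt (2 * pi) * std_normal_density t" for t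
    by (simp add: std_normal_density_def)
  have i: "integrable lborel (\<lambda>t::real. exp (- (t\<^sup>2 / 2)))"
    unfolding e using integrable_std_normal_moment[of 0] by (intro integrable_mult_right) simp
  show "integrable lborel (\<lambda>t. cis (a * t) * complex_of_real (exp (- (t\<^sup>2 / 2))))"
    by (rule Bochner_Integration.integrable_bound[OF i]) (auto simp: norm_mult)
  have "complex_of_real (exp (- (a\<^sup>2 / 2))) = char std_normal_distribution a"
    by (simp add: char_std_normal_distribution)
  also have "\<dots> = (\<integral>t. std_normal_density t *\<^sub>R cis (a * t) \<partial>lborel)"
    unfolding char_def by (subst integral_density) (auto simp: cis_conv_exp)
  finally have eq: "complex_of_real (exp (- (a\<^sup>2 / 2))) = (\<integral>t. std_normal_density t *\<^sub>R cis (a * t) \<partial>lborel)" .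
  have "(\<integral>t. cis (a * t) * complex_of_real (exp (- (t\<^sup>2 / 2))) \<partial>lborel)
    = (\<integral>t. complex_of_real (sqrt (2 * pi)) * (std_normal_density t *\<^sub>R cis (a * t)) \<partial>lborel)"
    unfolding e by (simp add: scaleR_conv_of_real[where 'a=complex] mult_ac)
  also have "\<dots> = complex_of_real (sqrt (2 * pi)) * complex_of_real (exp (- (a\<^sup>2 / 2)))"
    unfolding eq by (rule integral_mult_right_zero)
  finally show "(\<integral>t. cis (a * t) * complex_of_real (exp (- (t\<^sup>2 / 2))) \<partial>lborel) = complex_of_real (sqrt (2 * pi) * exp (- (a\<^sup>2 / 2)))"
    by simp
qed

lemma gauss_exp_borel [measurable]: "gauss_exp c \<in> borel_measurable borel"
  unfolding gauss_exp_def by measurable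

lemma gauss_exp_prod:
  fixes \<xi> :: "real^'n::finite"
  shows "cis (x \<bullet> \<xi>) * gauss_exp (-1/2) \<xi> = (\<Prod>b\<in>Basis. cis ((x \<bullet> b) * (\<xi> \<bullet> b)) * complex_of_real (exp (- ((\<xi> \<bullet> b)\<^sup>2 / 2))))"
proof -
  have "(norm \<xi>)\<^sup>2 = (\<Sum>b\<in>Basis. (\<xi> \<bullet> b)\<^sup>2)"
    unfolding power2_norm_eq_inner euclidean_inner[of \<xi> \<xi>] by (simp add: power2_eq_square)
  then have "exp (-1/2 * (norm \<xi>)\<^sup>2) = (\<Prod>b\<in>Basis. exp (- ((\<xi> \<bullet> b)\<^sup>2 / 2)))"
    by (simp add: exp_sum[symmetric] sum_negf sum_divide_distrib)
  moreover have "cis (x \<bullet> \<xi>) = (\<Prod>b\<in>Basis. cis ((x \<bullet> b) * (\<xi> \<bullet> b)))"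
    unfolding euclidean_inner[of x \<xi>] by (rule cis_sum) simp
  ultimately show ?thesis by (simp add: gauss_exp_def prod.distrib)
qed

lemma integral_cis_gauss:
  fixes x :: "real^'n::finite"
  shows "(\<integral>\<xi>. cis (x \<bullet> \<xi>) * gauss_exp (-1/2) \<xi> \<partial>lborel) = complex_of_real (sqrt (2 * pi) ^ CARD('n)) * gauss_exp (-1/2) x"
proof -
  have "(\<integral>\<xi>. cis (x \<bullet> \<xi>) * gauss_exp (-1/2) \<xi> \<partial>lborel)
    = (\<Prod>b\<in>(Basis :: (real^'n) set). complex_of_real (sqrt (2 * pi) * exp (- ((x \<bullet> b)\<^sup>2 / 2))))"
    unfolding gauss_exp_prod
    by (subst integral_lborel_prod_complex) (auto simp: integral_cis_gauss_real)
  \<comment> \<open>The phases at frequency 0 equal 1; they are inserted so that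
    \<open>gauss_exp_prod\<close> reassembles the product.\<close>
  also have "\<dots> = complex_of_real (sqrt (2 * pi) ^ CARD('n)) * (\<Prod>b\<in>(Basis :: (real^'n) set). cis ((0 \<bullet> b) * (x \<bullet> b)) * complex_of_real (exp (- ((x \<bullet> b)\<^sup>2 / 2))))"
    by (simp add: prod.distrib)
  finally show ?thesis unfolding gauss_exp_prod[symmetric] by simp
qed

lemma gauss_exp_integrable: "c < 0 \<Longrightarrow> integrable lborel (gauss_exp c)"
  by (rule integrable_growth_gauss[where A=1 and p=0 and c="-c"]) (auto simp: gauss_exp_def)

lemma gauss_exp_scale: "gauss_exp c (r *\<^sub>R \<xi>) = gauss_exp (c * r\<^sup>2) \<xi>"
  by (simp add: gauss_exp_def power_mult_distrib mult_ac)

text \<open>Inversion is obtained by inserting a wide Gaussian and letting its width tend to infinity.\<close>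

lemma fourier_inversion:
  fixes m :: "real^'n::finite \<Rightarrow> complex"
  assumes mi: "integrable lborel m" and ki: "integrable lborel (inv_fourier m)"
    and mb: "\<And>\<eta>. norm (m \<eta>) \<le> B" and mc: "isCont m \<xi>"
  shows "(\<integral>x. inv_fourier m x * cis (- (x \<bullet> \<xi>)) \<partial>lborel) = m \<xi>"
proof -
  have [measurable]: "m \<in> borel_measurable borel" using borel_measurable_integrable[OF mi] by simp
  define G where "G = (gauss_exp (-1/2) :: real^'n \<Rightarrow> complex)"
  have [measurable]: "G \<in> borel_measurable borel" by (simp add: G_def)
  have Gi: "integrable lborel G" unfolding G_def by (rule gauss_exp_integrable) simp
  have G1: "norm (G x) \<le> 1" for x by (simp add: G_def gauss_exp_def)
  define \<epsilon> where "\<epsilon> i = 1 / real (Suc i)" for i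
  have e: "\<epsilon> i > 0" for i by (simp add: \<epsilon>_def)
  have e0: "\<epsilon> \<longlonglongrightarrow> 0" unfolding \<epsilon>_def by (rule LIMSEQ_Suc[OF lim_1_over_n])
  define s where "s = sqrt (2 * pi) ^ CARD('n)"
  \<comment> \<open>Two Gaussian integrals will occur, one from the transform in x and one from the
    total mass in y; each contributes \<open>s\<close>, and together they cancel the
    normalisation.\<close>
  have cs: "fourier_const TYPE('n) * s * s = 1"
  proof -
    have "s * s = (sqrt (2 * pi) * sqrt (2 * pi)) ^ CARD('n)"
      unfolding s_def by (rule power_mult_distrib[symmetric])
    also have "sqrt (2 * pi) * sqrt (2 * pi) = 2 * pi" by simp
    finally show ?thesis by (simp add: fourier_const_def mult.assoc)
  qed
  define A where "A i = (\<integral>x. inv_fourier m x * cis (- (x \<bullet> \<xi>)) * G (\<epsilon> i *\<^sub>R x) \<partial>lborel)" for i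
  have lim1: "A \<longlonglongrightarrow> (\<integral>x. inv_fourier m x * cis (- (x \<bullet> \<xi>)) * 1 \<partial>lborel)"
    unfolding A_def
  proof (rule integral_dominated_convergence[where w="\<lambda>x. norm (inv_fourier m x)"])
    show "AE x in lborel. (\<lambda>i. inv_fourier m x * cis (- (x \<bullet> \<xi>)) * G (\<epsilon> i *\<^sub>R x)) \<longlonglongrightarrow> inv_fourier m x * cis (- (x \<bullet> \<xi>)) * 1"
    proof (intro AE_I2 tendsto_mult tendsto_const)
      fix x :: "real^'n"
      have "(\<lambda>i. complex_of_real (exp (- (1/2) * (norm (\<epsilon> i *\<^sub>R x))\<^sup>2))) \<longlonglongrightarrow> complex_of_real (exp (- (1/2) * (norm (0 *\<^sub>R x))\<^sup>2))"
        by (intro tendsto_intros e0)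
      then show "(\<lambda>i. G (\<epsilon> i *\<^sub>R x)) \<longlonglongrightarrow> 1" by (simp add: G_def gauss_exp_def)
    qed
    show "AE x in lborel. norm (inv_fourier m x * cis (- (x \<bullet> \<xi>)) * G (\<epsilon> i *\<^sub>R x)) \<le> norm (inv_fourier m x)" for i
      by (auto simp: norm_mult mult_left_le G1)
  qed (auto intro: ki)
  \<comment> \<open>Fubini puts the Gaussian on the frequency side, where it becomes a bump of width
    \<open>\<epsilon> i\<close> around \<xi>. Substituting \<eta> = \<xi> +
    \<open>\<epsilon> i\<close> y cancels the power of \<open>\<epsilon> i\<close> in front.\<close>
  have Aeq: "A i = (fourier_const TYPE('n) * s) * (\<integral>y. m (\<xi> + \<epsilon> i *\<^sub>R y) * G y \<partial>lborel)" for i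
  proof -
    define c where "c = fourier_const TYPE('n)"
    have "A i = c * (\<integral>x. \<integral>\<eta>. cis (x \<bullet> \<eta>) * m \<eta> * (cis (- (x \<bullet> \<xi>)) * G (\<epsilon> i *\<^sub>R x)) \<partial>lborel \<partial>lborel)"
    proof -
      have "inv_fourier m x * cis (- (x \<bullet> \<xi>)) * G (\<epsilon> i *\<^sub>R x)
          = c * (\<integral>\<eta>. cis (x \<bullet> \<eta>) * m \<eta> * (cis (- (x \<bullet> \<xi>)) * G (\<epsilon> i *\<^sub>R x)) \<partial>lborel)" for x
        by (subst integral_mult_left_zero) (simp add: inv_fourier_eq c_def mult.assoc)
      then show ?thesis by (simp only: A_def integral_mult_right_zero)
    qed
    also have "(\<integral>x. \<integral>\<eta>. cis (x \<bullet> \<eta>) * m \<eta> * (cis (- (x \<bullet> \<xi>)) * G (\<epsilon> i *\<^sub>R x)) \<partial>lborel \<partial>lborel)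
      = (\<integral>\<eta>. \<integral>x. cis (x \<bullet> \<eta>) * m \<eta> * (cis (- (x \<bullet> \<xi>)) * G (\<epsilon> i *\<^sub>R x)) \<partial>lborel \<partial>lborel)"
    proof (rule lborel_fubini_swap)
      have "(\<integral>\<^sup>+x. \<integral>\<^sup>+\<eta>. ennreal (norm (cis (x \<bullet> \<eta>) * m \<eta> * (cis (- (x \<bullet> \<xi>)) * G (\<epsilon> i *\<^sub>R x)))) \<partial>lborel \<partial>lborel)
        = (\<integral>\<^sup>+x. \<integral>\<^sup>+\<eta>. ennreal (norm (m \<eta>)) * ennreal (norm (G (0 + \<epsilon> i *\<^sub>R x))) \<partial>lborel \<partial>lborel)"
        by (simp add: norm_mult ennreal_mult)
      also have "\<dots> = L1norm m * L1norm (\<lambda>x. G (0 + \<epsilon> i *\<^sub>R x))"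
        by (simp add: nn_integral_multc nn_integral_cmult L1norm_def)
      also have "\<dots> < \<infinity>"
        using mi integrable_lborel_affine[OF Gi, of "\<epsilon> i" 0] e[of i]
        by (simp add: integrable_iff_L1norm ennreal_mult_less_top)
      finally show "(\<integral>\<^sup>+x. \<integral>\<^sup>+\<eta>. ennreal (norm (cis (x \<bullet> \<eta>) * m \<eta> * (cis (- (x \<bullet> \<xi>)) * G (\<epsilon> i *\<^sub>R x)))) \<partial>lborel \<partial>lborel) < \<infinity>" .
    qed measurable
    also have "\<dots> = (\<integral>\<eta>. m \<eta> * (s / \<epsilon> i ^ CARD('n) * G ((1 / \<epsilon> i) *\<^sub>R (\<eta> - \<xi>))) \<partial>lborel)"
    proof (rule Bochner_Integration.integral_cong[OF refl])
      fix \<eta>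
      have "(\<integral>x. cis (x \<bullet> \<eta>) * m \<eta> * (cis (- (x \<bullet> \<xi>)) * G (\<epsilon> i *\<^sub>R x)) \<partial>lborel)
          = (\<integral>x. m \<eta> * (cis (x \<bullet> (\<eta> - \<xi>)) * G (\<epsilon> i *\<^sub>R x)) \<partial>lborel)"
      proof (rule Bochner_Integration.integral_cong[OF refl])
        fix x
        have "cis (x \<bullet> (\<eta> - \<xi>)) = cis (x \<bullet> \<eta>) * cis (- (x \<bullet> \<xi>))"
          by (simp add: inner_diff_right cis_mult)
        then show "cis (x \<bullet> \<eta>) * m \<eta> * (cis (- (x \<bullet> \<xi>)) * G (\<epsilon> i *\<^sub>R x)) = m \<eta> * (cis (x \<bullet> (\<eta> - \<xi>)) * G (\<epsilon> i *\<^sub>R x))"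
          by simp
      qed
      also have "\<dots> = m \<eta> * (\<integral>x. cis (x \<bullet> (\<eta> - \<xi>)) * G (\<epsilon> i *\<^sub>R x) \<partial>lborel)" by simp
      also have "(\<integral>x. cis (x \<bullet> (\<eta> - \<xi>)) * G (\<epsilon> i *\<^sub>R x) \<partial>lborel)
        = (1 / \<epsilon> i) ^ CARD('n) *\<^sub>R (\<integral>y. cis (((1 / \<epsilon> i) *\<^sub>R (\<eta> - \<xi>)) \<bullet> y) * G y \<partial>lborel)"
        using integral_lborel_affine[of "\<lambda>x. cis (x \<bullet> (\<eta> - \<xi>)) * G (\<epsilon> i *\<^sub>R x)" "1 / \<epsilon> i" 0] e[of i]
        by (simp add: inner_commute)
      also have "\<dots> = s / \<epsilon> i ^ CARD('n) * G ((1 / \<epsilon> i) *\<^sub>R (\<eta> - \<xi>))"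
        unfolding G_def integral_cis_gauss by (simp add: s_def scaleR_conv_of_real[where 'a=complex] power_divide)
      finally show "(\<integral>x. cis (x \<bullet> \<eta>) * m \<eta> * (cis (- (x \<bullet> \<xi>)) * G (\<epsilon> i *\<^sub>R x)) \<partial>lborel)
        = m \<eta> * (s / \<epsilon> i ^ CARD('n) * G ((1 / \<epsilon> i) *\<^sub>R (\<eta> - \<xi>)))" .
    qed
    also have "\<dots> = \<epsilon> i ^ CARD('n) *\<^sub>R (\<integral>y. (s / \<epsilon> i ^ CARD('n)) * (m (\<xi> + \<epsilon> i *\<^sub>R y) * G y) \<partial>lborel)"
      using e[of i] by (subst integral_lborel_affine[where c="\<epsilon> i" and t=\<xi>]) (auto simp: mult_ac)
    also have "\<dots> = s * (\<integral>y. m (\<xi> + \<epsilon> i *\<^sub>R y) * G y \<partial>lborel)"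
      unfolding integral_mult_right_zero using e[of i] by (simp add: scaleR_conv_of_real[where 'a=complex])
    finally show ?thesis by (simp add: c_def)
  qed
  have lim2: "(\<lambda>i. \<integral>y. m (\<xi> + \<epsilon> i *\<^sub>R y) * G y \<partial>lborel) \<longlonglongrightarrow> (\<integral>y. m \<xi> * G y \<partial>lborel)"
  proof (rule integral_dominated_convergence[where w="\<lambda>y. B * norm (G y)"])
    show "AE y in lborel. (\<lambda>i. m (\<xi> + \<epsilon> i *\<^sub>R y) * G y) \<longlonglongrightarrow> m \<xi> * G y"
    proof (intro AE_I2 tendsto_mult tendsto_const)
      fix y
      have "(\<lambda>i. \<xi> + \<epsilon> i *\<^sub>R y) \<longlonglongrightarrow> \<xi> + 0 *\<^sub>R y" by (intro tendsto_intros e0)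
      then show "(\<lambda>i. m (\<xi> + \<epsilon> i *\<^sub>R y)) \<longlonglongrightarrow> m \<xi>" using isCont_tendsto_compose[OF mc] by simp
    qed
    show "AE y in lborel. norm (m (\<xi> + \<epsilon> i *\<^sub>R y) * G y) \<le> B * norm (G y)" for i
      by (auto simp: norm_mult intro!: mult_right_mono mb)
    show "integrable lborel (\<lambda>y. B * norm (G y))" using Gi by simp
  qed measurable
  have "(\<integral>y. G y \<partial>lborel) = s"
    using integral_cis_gauss[of "0::real^'n"] by (simp add: G_def s_def gauss_exp_def)
  then have "(\<lambda>i. A i) \<longlonglongrightarrow> (fourier_const TYPE('n) * s) * (m \<xi> * s)"
    unfolding Aeq using tendsto_mult[OF tendsto_const lim2] by simp
  from LIMSEQ_unique[OF lim1 this] show ?thesis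
    using cs by (simp add: mult_ac flip: of_real_mult)
qed

text \<open>The hypotheses of \<open>fourier_inversion\<close> at every point: such a symbol is
  recovered from its kernel.\<close>

definition wiener :: "(real^'n::finite \<Rightarrow> complex) \<Rightarrow> bool"
  where "wiener m \<longleftrightarrow> continuous_on UNIV m \<and> (\<exists>B. \<forall>\<xi>. norm (m \<xi>) \<le> B) \<and>
    integrable lborel m \<and> integrable lborel (inv_fourier m)"

lemma wiener_test_function: "test_function m \<Longrightarrow> wiener m"
  using test_function_continuous test_function_bounded test_function_integrable inv_fourier_integrable
  unfolding wiener_def by blast

text \<open>With the kernel of \<open>m2\<close> written as an integral and the order swapped, the
  inner integral is the forward transform of the kernel of \<open>m1\<close>, which inversion
  identifies with \<open>m1\<close>. The roles are asymmetric so that \<open>m2\<close> may be a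
  symbol singular at the origin.\<close>

lemma inv_fourier_mult:
  fixes m1 m2 :: "real^'n::finite \<Rightarrow> complex"
  assumes m1: "wiener m1" and m2: "integrable lborel m2"
  shows "inv_fourier (\<lambda>\<xi>. m1 \<xi> * m2 \<xi>) x = conv (inv_fourier m1) (inv_fourier m2) x"
proof -
  have k1: "integrable lborel (inv_fourier m1)" and i1: "integrable lborel m1" and c1: "continuous_on UNIV m1"
    using m1 by (auto simp: wiener_def)
  obtain B where B: "\<And>\<xi>. norm (m1 \<xi>) \<le> B" using m1 by (auto simp: wiener_def)
  have [measurable]: "m1 \<in> borel_measurable borel" "m2 \<in> borel_measurable borel"
    using borel_measurable_integrable[OF i1] borel_measurable_integrable[OF m2] by simp_all
  define c where "c = fourier_const TYPE('n)"
  have "conv (inv_fourier m1) (inv_fourier m2) x = conv (inv_fourier m2) (inv_fourier m1) x"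
    by (rule conv_reflect) measurable
  also have "\<dots> = (\<integral>y. \<integral>\<xi>. c * cis ((x - y) \<bullet> \<xi>) * m2 \<xi> * inv_fourier m1 y \<partial>lborel \<partial>lborel)"
    unfolding conv_def
  proof (rule Bochner_Integration.integral_cong[OF refl])
    fix y
    show "inv_fourier m2 (x - y) * inv_fourier m1 y = (\<integral>\<xi>. c * cis ((x - y) \<bullet> \<xi>) * m2 \<xi> * inv_fourier m1 y \<partial>lborel)"
      by (subst integral_mult_left_zero) (simp add: inv_fourier_eq[of m2] c_def mult.assoc)
  qed
  also have "\<dots> = (\<integral>\<xi>. \<integral>y. c * cis ((x - y) \<bullet> \<xi>) * m2 \<xi> * inv_fourier m1 y \<partial>lborel \<partial>lborel)"
  proof (rule lborel_fubini_swap)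
    have "(\<integral>\<^sup>+y. \<integral>\<^sup>+\<xi>. ennreal (norm (c * cis ((x - y) \<bullet> \<xi>) * m2 \<xi> * inv_fourier m1 y)) \<partial>lborel \<partial>lborel)
      = (\<integral>\<^sup>+y. \<integral>\<^sup>+\<xi>. ennreal \<bar>c\<bar> * ennreal (norm (m2 \<xi>)) * ennreal (norm (inv_fourier m1 y)) \<partial>lborel \<partial>lborel)"
      by (simp add: norm_mult ennreal_mult)
    also have "\<dots> = ennreal \<bar>c\<bar> * L1norm m2 * L1norm (inv_fourier m1)"
      by (simp add: nn_integral_multc nn_integral_cmult L1norm_def)
    also have "\<dots> < \<infinity>"
      using m2 k1 by (simp add: integrable_iff_L1norm ennreal_mult_less_top)
    finally show "(\<integral>\<^sup>+y. \<integral>\<^sup>+\<xi>. ennreal (norm (c * cis ((x - y) \<bullet> \<xi>) * m2 \<xi> * inv_fourier m1 y)) \<partial>lborel \<partial>lborel) < \<infinity>" .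
  qed measurable
  also have "\<dots> = (\<integral>\<xi>. c * (cis (x \<bullet> \<xi>) * (m1 \<xi> * m2 \<xi>)) \<partial>lborel)"
  proof (rule Bochner_Integration.integral_cong[OF refl])
    fix \<xi>
    have "(\<integral>y. c * cis ((x - y) \<bullet> \<xi>) * m2 \<xi> * inv_fourier m1 y \<partial>lborel)
      = (\<integral>y. (c * cis (x \<bullet> \<xi>) * m2 \<xi>) * (inv_fourier m1 y * cis (- (y \<bullet> \<xi>))) \<partial>lborel)"
    proof (rule Bochner_Integration.integral_cong[OF refl])
      fix y
      have "cis ((x - y) \<bullet> \<xi>) = cis (x \<bullet> \<xi>) * cis (- (y \<bullet> \<xi>))"
        by (simp add: inner_diff_left cis_mult)
      then show "c * cis ((x - y) \<bullet> \<xi>) * m2 \<xi> * inv_fourier m1 y = (c * cis (x \<bullet> \<xi>) * m2 \<xi>) * (inv_fourier m1 y * cis (- (y \<bullet> \<xi>)))"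
        by simp
    qed
    also have "\<dots> = (c * cis (x \<bullet> \<xi>) * m2 \<xi>) * (\<integral>y. inv_fourier m1 y * cis (- (y \<bullet> \<xi>)) \<partial>lborel)"
      by (rule integral_mult_right_zero)
    also have "(\<integral>y. inv_fourier m1 y * cis (- (y \<bullet> \<xi>)) \<partial>lborel) = m1 \<xi>"
      by (rule fourier_inversion[OF i1 k1 B]) (use c1 in \<open>simp add: continuous_on_eq_continuous_at\<close>)
    finally show "(\<integral>y. c * cis ((x - y) \<bullet> \<xi>) * m2 \<xi> * inv_fourier m1 y \<partial>lborel) = c * (cis (x \<bullet> \<xi>) * (m1 \<xi> * m2 \<xi>))"
      by (simp add: mult_ac)
  qed
  also have "\<dots> = inv_fourier (\<lambda>\<xi>. m1 \<xi> * m2 \<xi>) x"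
    by (simp add: inv_fourier_eq c_def)
  finally show ?thesis by simp
qed

text \<open>The L^1 norm of the kernel, hence a bound for the multiplier on bounded functions. It is
  submultiplicative and invariant under dilations of the symbol; the scaling arguments below rest on
  these two facts.\<close>

definition FL1 :: "(real^'n::finite \<Rightarrow> complex) \<Rightarrow> ennreal"
  where "FL1 m = L1norm (inv_fourier m)"

lemma FL1_mult:
  assumes "wiener m1" "integrable lborel m2"
  shows "FL1 (\<lambda>\<xi>. m1 \<xi> * m2 \<xi>) \<le> FL1 m1 * FL1 m2"
proof -
  have [measurable]: "m1 \<in> borel_measurable borel" "m2 \<in> borel_measurable borel"
    using assms borel_measurable_integrable by (force simp: wiener_def)+
  show ?thesis
    unfolding FL1_def inv_fourier_mult[OF assms, abs_def] by (rule L1norm_conv) measurable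
qed

lemma wienerI:
  assumes "continuous_on UNIV m" "\<And>\<xi>. norm (m \<xi>) \<le> B" "integrable lborel m" "FL1 m < \<infinity>"
  shows "wiener m"
proof -
  have [measurable]: "m \<in> borel_measurable borel" using assms(3) borel_measurable_integrable by force
  show ?thesis using assms by (auto simp: wiener_def FL1_def integrable_iff_L1norm)
qed

lemma wiener_FL1: "wiener m \<Longrightarrow> FL1 m < \<infinity>"
proof -
  assume w: "wiener m"
  then have [measurable]: "m \<in> borel_measurable borel" using borel_measurable_integrable by (force simp: wiener_def)
  show "FL1 m < \<infinity>" using w by (simp add: wiener_def FL1_def integrable_iff_L1norm)
qed

lemma wiener_integrable: "wiener m \<Longrightarrow> integrable lborel m" by (simp add: wiener_def)

lemma wiener_mult:
  assumes "wiener m1" "wiener m2"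
  shows "wiener (\<lambda>\<xi>. m1 \<xi> * m2 \<xi>)"
proof -
  obtain B1 B2 where B: "\<And>\<xi>. norm (m1 \<xi>) \<le> B1" "\<And>\<xi>. norm (m2 \<xi>) \<le> B2" using assms by (auto simp: wiener_def)
  have [measurable]: "m1 \<in> borel_measurable borel" "m2 \<in> borel_measurable borel"
    using assms borel_measurable_integrable by (force simp: wiener_def)+
  show ?thesis
  proof (rule wienerI)
    show "continuous_on UNIV (\<lambda>\<xi>. m1 \<xi> * m2 \<xi>)" using assms by (auto simp: wiener_def intro!: continuous_intros)
    show "norm (m1 \<xi> * m2 \<xi>) \<le> B1 * B2" for \<xi>
      unfolding norm_mult by (intro mult_mono B order_trans[OF norm_ge_zero B(1)]) simp
    show "integrable lborel (\<lambda>\<xi>. m1 \<xi> * m2 \<xi>)"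
    proof (rule Bochner_Integration.integrable_bound)
      show "integrable lborel (\<lambda>\<xi>. of_real B1 * m2 \<xi>)" using assms(2) by (simp add: wiener_def)
      show "AE \<xi> in lborel. norm (m1 \<xi> * m2 \<xi>) \<le> norm (of_real B1 * m2 \<xi>)"
        using B(1) by (auto simp: norm_mult intro!: mult_right_mono order_trans[OF B(1)])
    qed measurable
    show "FL1 (\<lambda>\<xi>. m1 \<xi> * m2 \<xi>) < \<infinity>"
      using FL1_mult[OF assms(1) wiener_integrable[OF assms(2)]] wiener_FL1[OF assms(1)] wiener_FL1[OF assms(2)]
      by (auto simp: ennreal_mult_less_top intro: le_less_trans)
  qed
qed

lemma inv_fourier_scale:
  fixes m :: "real^'n::finite \<Rightarrow> complex"
  assumes [measurable]: "m \<in> borel_measurable borel" and r: "r > 0"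
  shows "inv_fourier (\<lambda>\<xi>. m (r *\<^sub>R \<xi>)) x = of_real ((1 / r) ^ CARD('n)) * inv_fourier m ((1 / r) *\<^sub>R x)"
  using integral_lborel_affine[of "\<lambda>\<xi>. cis (x \<bullet> \<xi>) * m (r *\<^sub>R \<xi>)" "1 / r" 0] r
  by (simp add: inv_fourier_eq scaleR_conv_of_real[where 'a=complex])

lemma FL1_scale:
  fixes m :: "real^'n::finite \<Rightarrow> complex"
  assumes [measurable]: "m \<in> borel_measurable borel" and r: "r > 0"
  shows "FL1 (\<lambda>\<xi>. m (r *\<^sub>R \<xi>)) = FL1 m"
proof -
  have "FL1 m = ennreal ((1 / r) ^ CARD('n)) * (\<integral>\<^sup>+x. ennreal (norm (inv_fourier m (0 + (1 / r) *\<^sub>R x))) \<partial>lborel)"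
    unfolding FL1_def L1norm_def using r
    by (subst nn_integral_lborel_affine[where c="1 / r" and t=0]) auto
  also have "\<dots> = (\<integral>\<^sup>+x. ennreal (norm (of_real ((1 / r) ^ CARD('n)) * inv_fourier m ((1 / r) *\<^sub>R x))) \<partial>lborel)"
    using r by (subst nn_integral_cmult[symmetric]) (auto simp: norm_mult ennreal_mult norm_power norm_divide)
  also have "\<dots> = FL1 (\<lambda>\<xi>. m (r *\<^sub>R \<xi>))"
    unfolding FL1_def L1norm_def inv_fourier_scale[OF assms] ..
  finally show ?thesis by simp
qed

section \<open>Subordination\<close>

text \<open>In the binomial series of (1 - z)^\<alpha> the coefficient of z is -\<alpha>, and every
  further one arises from its predecessor by a positive factor (k - \<alpha>)/(k + 1). So all but
  the constant term are nonpositive, and 1 minus the series is a generating function with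
  nonnegative coefficients, that of Sibuya's distribution.\<close>

lemma sibuya_coefficients:
  fixes \<alpha> :: real
  assumes "0 < \<alpha>" "\<alpha> < 1"
  shows "\<exists>c. (\<forall>k. 0 \<le> c k) \<and> c 0 = 0 \<and> (\<forall>z. 0 \<le> z \<longrightarrow> z < 1 \<longrightarrow> (\<lambda>k. c k * z ^ k) sums (1 - (1 - z) powr \<alpha>))"
proof -
  define d where "d k = (-1) ^ k * (\<alpha> gchoose k)" for k :: nat
  have rec: "d (Suc k) = d k * (real k - \<alpha>) / real (Suc k)" for k
  proof -
    have "real (Suc k) * (\<alpha> gchoose Suc k) = (\<alpha> - real k) * (\<alpha> gchoose k)"
      using gbinomial_mult_1[of \<alpha> k] by (simp add: algebra_simps)
    then have "(\<alpha> gchoose Suc k) = (\<alpha> - real k) * (\<alpha> gchoose k) / real (Suc k)"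
      by (simp add: field_simps)
    then have "d (Suc k) = (-1) ^ Suc k * ((\<alpha> - real k) * (\<alpha> gchoose k) / real (Suc k))"
      unfolding d_def by simp
    also have "\<dots> = d k * (real k - \<alpha>) / real (Suc k)" by (simp add: d_def field_simps)
    finally show ?thesis .
  qed
  have neg: "d (Suc k) \<le> 0" for k
  proof (induction k)
    case 0
    show ?case using assms rec[of 0] by (simp add: d_def)
  next
    case (Suc k)
    have "d (Suc k) * (real (Suc k) - \<alpha>) \<le> 0"
      using Suc assms by (intro mult_nonpos_nonneg) auto
    then show ?case unfolding rec[of "Suc k"] by (rule divide_nonpos_nonneg) simp
  qed
  define c where "c k = (if k = 0 then 0 else - d k)" for k
  have "0 \<le> c k" for k
    using neg[of "k - 1"] by (cases k) (auto simp: c_def)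
  moreover have "(\<lambda>k. c k * z ^ k) sums (1 - (1 - z) powr \<alpha>)" if z: "0 \<le> z" "z < 1" for z :: real
  proof -
    have "(\<lambda>k. (\<alpha> gchoose k) * (- z) ^ k) sums (1 + - z) powr \<alpha>"
      by (rule gen_binomial_real) (use z in auto)
    moreover have "(\<alpha> gchoose k) * (- z) ^ k = d k * z ^ k" for k
      unfolding d_def by (subst power_minus) simp
    ultimately have "(\<lambda>k. d k * z ^ k) sums (1 - z) powr \<alpha>" by simp
    from sums_diff[OF sums_single[of 0 "\<lambda>_. 1"] this]
    have "(\<lambda>k. (if k = 0 then 1 else 0) - d k * z ^ k) sums (1 - (1 - z) powr \<alpha>)" by simp
    moreover have "(if k = 0 then 1 else 0) - d k * z ^ k = c k * z ^ k" for k
      by (auto simp: c_def d_def)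
    ultimately show ?thesis by simp
  qed
  ultimately show ?thesis by (intro exI[of _ c]) (auto simp: c_def)
qed

text \<open>Cauchy products correspond to sums of independent copies. No mass sits at 0 once N > 0,
  which keeps inverse moments meaningful.\<close>

lemma sibuya_power_coefficients:
  fixes \<alpha> :: real
  assumes "0 < \<alpha>" "\<alpha> < 1"
  shows "\<exists>c. (\<forall>k. 0 \<le> c k) \<and> (0 < N \<longrightarrow> c 0 = 0) \<and>
    (\<forall>z. 0 \<le> z \<longrightarrow> z < 1 \<longrightarrow> (\<lambda>k. c k * z ^ k) sums (1 - (1 - z) powr \<alpha>) ^ N)"
proof (induction N)
  case 0
  have "(\<lambda>k::nat. (if k = 0 then 1 else 0) * z ^ k) sums 1" for z :: real
    using sums_single[of 0 "\<lambda>_. 1::real"] by (simp add: if_distrib[of "\<lambda>x. x * _"] cong: if_cong)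
  then show ?case by (intro exI[of _ "\<lambda>k. if k = 0 then 1 else 0"]) auto
next
  case (Suc N)
  obtain c where c: "\<And>k. 0 \<le> c k" "\<And>z. 0 \<le> z \<Longrightarrow> z < 1 \<Longrightarrow> (\<lambda>k. c k * z ^ k) sums (1 - (1 - z) powr \<alpha>) ^ N"
    using Suc by blast
  obtain b where b: "\<And>k. 0 \<le> b k" "b 0 = 0" "\<And>z. 0 \<le> z \<Longrightarrow> z < 1 \<Longrightarrow> (\<lambda>k. b k * z ^ k) sums (1 - (1 - z) powr \<alpha>)"
    using sibuya_coefficients[OF assms] by metis
  define a where "a k = (\<Sum>i\<le>k. b i * c (k - i))" for k
  have "(\<lambda>k. a k * z ^ k) sums (1 - (1 - z) powr \<alpha>) ^ Suc N" if z: "0 \<le> z" "z < 1" for z :: real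
  proof -
    have "(\<lambda>k. \<Sum>i\<le>k. (b i * z ^ i) * (c (k - i) * z ^ (k - i))) sums ((\<Sum>k. b k * z ^ k) * (\<Sum>k. c k * z ^ k))"
    proof (rule Cauchy_product_sums)
      show "summable (\<lambda>k. norm (b k * z ^ k))"
        using b(3)[OF z] b(1) z by (simp add: sums_iff)
      show "summable (\<lambda>k. norm (c k * z ^ k))"
        using c(2)[OF z] c(1) z by (simp add: sums_iff)
    qed
    moreover have "(\<Sum>i\<le>k. (b i * z ^ i) * (c (k - i) * z ^ (k - i))) = a k * z ^ k" for k
      unfolding a_def sum_distrib_right
      by (intro sum.cong) (auto simp: power_add[symmetric] mult_ac)
    ultimately show ?thesis using b(3)[OF z] c(2)[OF z] by (simp add: sums_iff)
  qed
  then show ?case using b c by (intro exI[of _ a]) (auto simp: a_def intro!: sum_nonneg)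
qed

text \<open>The majorant, uniform in \<open>i\<close>, behind both dominated convergence and the
  inverse moment. Put N = i + 1, h = l / N^(1/\<alpha>) and y = 1 - exp(-h). If h <= 1, then y >=
  h/2 and 1 - y^\<alpha> <= exp(-y^\<alpha>). If h > 1, then y^\<alpha> >= y gives 1 - y^\<alpha> <=
  exp(-h), and h >= h^\<alpha>. Raising to the power N uses N h^\<alpha> = l^\<alpha>; the factor
  1/2 comes from (h/2)^\<alpha> >= h^\<alpha>/2.\<close>

lemma sibuya_exp_bound:
  fixes \<alpha> l :: real
  assumes a: "0 < \<alpha>" "\<alpha> < 1" and l: "0 < l"
  shows "(1 - (1 - exp (- (l / real (Suc i) powr (1 / \<alpha>)))) powr \<alpha>) ^ Suc i \<le> exp (- (l powr \<alpha> / 2))"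
    and "0 \<le> (1 - (1 - exp (- (l / real (Suc i) powr (1 / \<alpha>)))) powr \<alpha>)"
proof -
  define N where "N = real (Suc i)"
  have N: "N \<ge> 1" by (simp add: N_def)
  define h where "h = l / N powr (1 / \<alpha>)"
  have h: "h > 0" using l N by (simp add: h_def)
  have ha: "h powr \<alpha> = l powr \<alpha> / N"
    using l N a by (simp add: h_def powr_divide powr_powr)
  define y where "y = 1 - exp (- h)"
  have y: "0 < y" "y < 1" using h by (auto simp: y_def)
  have ya: "y \<le> y powr \<alpha>" "y powr \<alpha> \<le> 1"
    using powr_mono'[of \<alpha> 1 y] powr_mono2[of \<alpha> y 1] a y by auto
  show "0 \<le> (1 - (1 - exp (- (l / real (Suc i) powr (1 / \<alpha>)))) powr \<alpha>)"
    using ya by (simp add: y_def h_def N_def)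
  have "(1 - y powr \<alpha>) ^ Suc i \<le> exp (- (l powr \<alpha> / 2))"
  proof (cases "h \<le> 1")
    case True
    have "h / 2 \<le> y"
    proof -
      have "1 + h \<le> exp h" by (rule exp_ge_add_one_self)
      then have "exp (- h) \<le> 1 / (1 + h)" using h by (simp add: exp_minus field_simps)
      also have "\<dots> \<le> 1 - h / 2"
      proof -
        have "1 \<le> (1 - h / 2) * (1 + h)" using h True by (simp add: algebra_simps mult_left_le)
        then show ?thesis using h by (simp add: pos_divide_le_eq)
      qed
      finally show ?thesis by (simp add: y_def)
    qed
    then have "(h / 2) powr \<alpha> \<le> y powr \<alpha>" using h a by (intro powr_mono2) auto
    moreover have "h powr \<alpha> / 2 \<le> (h / 2) powr \<alpha>"
    proof -
      have "(2::real) powr \<alpha> \<le> 2 powr 1" using a by (intro powr_mono) auto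
      from mult_left_mono[OF this, of "h powr \<alpha>"] show ?thesis using h by (simp add: powr_divide field_simps)
    qed
    ultimately have "h powr \<alpha> / 2 \<le> y powr \<alpha>" by linarith
    then have "N * (h powr \<alpha> / 2) \<le> N * y powr \<alpha>" using N by (intro mult_left_mono) auto
    then have "l powr \<alpha> / 2 \<le> N * y powr \<alpha>" using ha N by simp
    have "(1 - y powr \<alpha>) ^ Suc i \<le> exp (- (y powr \<alpha>)) ^ Suc i"
      using ya exp_ge_add_one_self[of "- (y powr \<alpha>)"] by (intro power_mono) auto
    also have "\<dots> = exp (- (N * y powr \<alpha>))"
      by (subst exp_of_nat_mult[symmetric]) (simp add: N_def del: of_nat_Suc)
    also have "\<dots> \<le> exp (- (l powr \<alpha> / 2))" using \<open>l powr \<alpha> / 2 \<le> N * y powr \<alpha>\<close> by simp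
    finally show ?thesis .
  next
    case False
    have "(1 - y powr \<alpha>) ^ Suc i \<le> exp (- h) ^ Suc i"
      using ya by (intro power_mono) (auto simp: y_def)
    also have "\<dots> = exp (- (N * h))"
      by (subst exp_of_nat_mult[symmetric]) (simp add: N_def del: of_nat_Suc)
    also have "\<dots> \<le> exp (- (l powr \<alpha> / 2))"
    proof -
      have "h powr \<alpha> \<le> h powr 1" using False a by (intro powr_mono) auto
      then have "N * h powr \<alpha> \<le> N * h" using h N by (intro mult_left_mono) auto
      moreover have "N * h powr \<alpha> = l powr \<alpha>" using ha N by simp
      ultimately have "l powr \<alpha> / 2 \<le> N * h" using powr_ge_zero[of l \<alpha>] by linarith
      then show ?thesis by simp
    qed
    finally show ?thesis .
  qed
  then show "(1 - (1 - exp (- (l / real (Suc i) powr (1 / \<alpha>)))) powr \<alpha>) ^ Suc i \<le> exp (- (l powr \<alpha> / 2))"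
    by (simp add: y_def h_def N_def)
qed

lemma sibuya_exp_tendsto:
  fixes \<alpha> l :: real
  assumes "0 < \<alpha>" "\<alpha> < 1" "0 < l"
  shows "(\<lambda>i. (1 - (1 - exp (- (l / real (Suc i) powr (1 / \<alpha>)))) powr \<alpha>) ^ Suc i) \<longlonglongrightarrow> exp (- (l powr \<alpha>))"
proof -
  \<comment> \<open>With x = (i + 1)^(-1/\<alpha>) the number of factors i + 1 is x^(-\<alpha>),
    which leaves a limit in one real variable at 0 from the right.\<close>
  have lim: "((\<lambda>x::real. (1 - (1 - exp (- (l * x))) powr \<alpha>) powr (x powr (-\<alpha>))) \<longlongrightarrow> exp (- (l powr \<alpha>))) (at_right 0)"
    using assms by real_asymp
  have f: "filterlim (\<lambda>i. 1 / real (Suc i) powr (1 / \<alpha>)) (at_right 0) sequentially"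
    using assms by real_asymp
  have eq: "(1 - (1 - exp (- (l * (1 / real (Suc i) powr (1 / \<alpha>))))) powr \<alpha>) powr ((1 / real (Suc i) powr (1 / \<alpha>)) powr (-\<alpha>))
    = (1 - (1 - exp (- (l / real (Suc i) powr (1 / \<alpha>)))) powr \<alpha>) ^ Suc i" for i
  proof -
    have e: "(1 / real (Suc i) powr (1 / \<alpha>)) powr (-\<alpha>) = real (Suc i)"
      using assms by (simp add: powr_divide powr_powr powr_minus divide_simps)
    have "0 < 1 - (1 - exp (- (l / real (Suc i) powr (1 / \<alpha>)))) powr \<alpha>"
    proof -
      have "(1 - exp (- (l / real (Suc i) powr (1 / \<alpha>)))) powr \<alpha> < 1 powr \<alpha>"
        using assms by (intro powr_less_mono2) auto
      then show ?thesis by simp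
    qed
    then show ?thesis unfolding e by (simp add: powr_realpow del: of_nat_Suc power_Suc)
  qed
  show ?thesis using filterlim_compose[OF lim f] unfolding eq .
qed

text \<open>Discrete approximations of the \<open>\<alpha>\<close>-stable subordinator: the generating function of a sum of
  \<open>i + 1\<close> Sibuya variables, rescaled by \<open>(i + 1) powr (1/\<alpha>)\<close>, gives probability weights whose Laplace
  transforms converge to \<open>exp (- \<lambda> powr \<alpha>)\<close>.\<close>

lemma subordinator_approximation:
  fixes \<alpha> :: real
  assumes a: "1/2 < \<alpha>" "\<alpha> < 1"
  obtains p s :: "nat \<Rightarrow> nat \<Rightarrow> real" and F :: "nat \<Rightarrow> real \<Rightarrow> real" and C :: real
  where "\<And>i k. 0 \<le> p i k" "\<And>i k. 0 < s i k" "\<And>i k. s i 0 \<le> s i k"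
    "\<And>i l. 0 < l \<Longrightarrow> (\<lambda>k. p i k * exp (- (l * s i k))) sums F i l"
    "\<And>i l. 0 < l \<Longrightarrow> 0 \<le> F i l" "\<And>i l. 0 < l \<Longrightarrow> F i l \<le> exp (- (l powr \<alpha> / 2))"
    "\<And>l. 0 < l \<Longrightarrow> (\<lambda>i. F i l) \<longlonglongrightarrow> exp (- (l powr \<alpha>))"
    "0 \<le> C" "\<And>i. (\<Sum>k. ennreal (p i k * (1 + 1 / s i k))) \<le> ennreal C"
    "\<And>i. F i \<in> borel_measurable borel"
proof -
  have a0: "0 < \<alpha>" using a by simp
  have "\<forall>N. \<exists>c. (\<forall>k. 0 \<le> c k) \<and> (0 < N \<longrightarrow> c 0 = 0) \<and>
    (\<forall>z. 0 \<le> z \<longrightarrow> z < 1 \<longrightarrow> (\<lambda>k. c k * z ^ k) sums (1 - (1 - z) powr \<alpha>) ^ N)"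
    using sibuya_power_coefficients[OF a0 a(2)] by blast
  then obtain c :: "nat \<Rightarrow> nat \<Rightarrow> real" where c: "\<And>N k. 0 \<le> c N k" "\<And>N. 0 < N \<Longrightarrow> c N 0 = 0"
    "\<And>N z. 0 \<le> z \<Longrightarrow> z < 1 \<Longrightarrow> (\<lambda>k. c N k * z ^ k) sums (1 - (1 - z) powr \<alpha>) ^ N"
    by metis
  \<comment> \<open>The index is shifted by one because the coefficient of z^0 vanishes;
    \<open>s i k\<close> is the rescaled value of k + 1 and is therefore positive.\<close>
  define p where "p i k = c (Suc i) (Suc k)" for i k
  define s where "s i k = real (Suc k) / real (Suc i) powr (1 / \<alpha>)" for i k
  define F where "F i l = (1 - (1 - exp (- (l / real (Suc i) powr (1 / \<alpha>)))) powr \<alpha>) ^ Suc i" for i l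
  have p: "0 \<le> p i k" for i k using c(1) by (simp add: p_def)
  have s: "0 < s i k" for i k by (simp add: s_def)
  have zsum: "(\<lambda>k. p i k * z ^ Suc k) sums (1 - (1 - z) powr \<alpha>) ^ Suc i" if "0 \<le> z" "z < 1" for i z
    using c(3)[OF that, of "Suc i"] c(2)[of "Suc i"]
      sums_Suc_iff[of "\<lambda>k. c (Suc i) k * z ^ k"] by (simp add: p_def del: power_Suc)
  have F: "(\<lambda>k. p i k * exp (- (l * s i k))) sums F i l" if l: "0 < l" for i l
  proof -
    have "exp (- (l / real (Suc i) powr (1 / \<alpha>))) ^ Suc k = exp (- (l * s i k))" for k
      by (subst exp_of_nat_mult[symmetric]) (simp add: s_def mult.commute del: of_nat_Suc)
    then show ?thesis
      using zsum[of "exp (- (l / real (Suc i) powr (1 / \<alpha>)))" i] l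
      by (simp add: F_def del: power_Suc of_nat_Suc)
  qed
  have Fb: "F i l \<le> exp (- (l powr \<alpha> / 2))" and F0: "0 \<le> F i l" if "0 < l" for i l
    using sibuya_exp_bound[OF a0 a(2) that, of i] by (auto simp: F_def simp del: power_Suc of_nat_Suc)
  have Fm: "F i \<in> borel_measurable borel" for i unfolding F_def by measurable
  \<comment> \<open>Abel's argument: finite sums at z < 1 are at most 1, and z tends to 1 from the
    left.\<close>
  have mass: "(\<Sum>k. ennreal (p i k)) \<le> 1" for i
  proof (rule suminf_le_const)
    fix n
    have "(\<Sum>k<n. p i k) \<le> 1"
    proof (rule tendsto_upperbound)
      show "((\<lambda>z. \<Sum>k<n. p i k * z ^ Suc k) \<longlongrightarrow> (\<Sum>k<n. p i k)) (at_left 1)"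
        by (auto intro!: tendsto_eq_intros)
      have "(\<Sum>k<n. p i k * z ^ Suc k) \<le> 1" if z: "0 < z" "z < 1" for z :: real
      proof -
        have "(\<Sum>k<n. p i k * z ^ Suc k) \<le> (1 - (1 - z) powr \<alpha>) ^ Suc i"
          using sum_le_suminf[of "\<lambda>k. p i k * z ^ Suc k" "{..<n}"] zsum[of z i] z p by (auto simp: sums_iff)
        also have "\<dots> \<le> 1 ^ Suc i"
          using z a0 powr_mono2[of \<alpha> "1 - z" 1] by (intro power_mono) auto
        finally show ?thesis by simp
      qed
      then show "\<forall>\<^sub>F z in at_left 1. (\<Sum>k<n. p i k * z ^ Suc k) \<le> 1"
        using eventually_at_left[of "0::real" 1] by (auto intro!: exI[of _ 0])
    qed simp
    then show "(\<Sum>k<n. ennreal (p i k)) \<le> 1"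
      using p by (simp add: sum_ennreal)
  qed simp
  define I where "I = (\<integral>\<^sup>+l. ennreal (exp (- (l powr \<alpha> / 2))) * indicator {0<..} l \<partial>lborel)"
  have Ifin: "I < \<infinity>"
  proof -
    have "integrable lborel (\<lambda>l::real. exp (- (norm l powr \<alpha> / 2)))"
      by (rule integrable_growth_exp[where c="1/2" and q=\<alpha> and A=1 and p=0]) (use a0 in auto)
    then have "(\<integral>\<^sup>+l. ennreal (norm (exp (- (norm (l::real) powr \<alpha> / 2)))) \<partial>lborel) < \<infinity>"
      by (simp add: integrable_iff_bounded)
    moreover have "I \<le> (\<integral>\<^sup>+l. ennreal (norm (exp (- (norm (l::real) powr \<alpha> / 2)))) \<partial>lborel)"
      unfolding I_def by (intro nn_integral_mono) (auto simp: indicator_def)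
    ultimately show ?thesis by (rule le_less_trans[rotated])
  qed
  \<comment> \<open>Since 1/s is the integral of exp(-l s) over l > 0, the inverse moment is the
    integral of the Laplace transform \<open>F i\<close>, whose majorant is integrable and
    independent of \<open>i\<close>.\<close>
  have moment: "(\<Sum>k. ennreal (p i k / s i k)) \<le> I" for i
  proof -
    have e: "ennreal (p i k / s i k) = (\<integral>\<^sup>+l. ennreal (p i k * exp (- (l * s i k))) * indicator {0<..} l \<partial>lborel)" for k
    proof -
      have "(\<integral>\<^sup>+l. ennreal (p i k * exp (- (l * s i k))) * indicator {0<..} l \<partial>lborel)
        = (\<integral>\<^sup>+l. ennreal (p i k * exp (- (l * s i k))) * indicator {0..} l \<partial>lborel)"
        by (intro nn_integral_cong_AE eventually_mono[OF AE_lborel_singleton[of 0]]) (auto simp: indicator_def)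
      also have "\<dots> = ennreal (0 - (- p i k / s i k * exp (- (0 * s i k))))"
      proof (rule nn_integral_FTC_atLeast)
        show "((\<lambda>l. - p i k / s i k * exp (- (l * s i k))) has_real_derivative p i k * exp (- (l * s i k))) (at l)" for l
          using s[of i k] by (auto intro!: derivative_eq_intros)
        have "((\<lambda>l. exp (- (l * s i k))) \<longlongrightarrow> 0) at_top"
          using s[of i k] by real_asymp
        from tendsto_mult[OF tendsto_const this, of "- p i k / s i k"] show "((\<lambda>l. - p i k / s i k * exp (- (l * s i k))) \<longlongrightarrow> 0) at_top"
          by simp
      qed (use p in auto)
      finally show ?thesis by simp
    qed
    have "(\<Sum>k. ennreal (p i k / s i k)) = (\<integral>\<^sup>+l. (\<Sum>k. ennreal (p i k * exp (- (l * s i k))) * indicator {0<..} l) \<partial>lborel)"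
      unfolding e by (rule nn_integral_suminf[symmetric]) measurable
    also have "\<dots> \<le> I"
      unfolding I_def
    proof (rule nn_integral_mono)
      fix l
      show "(\<Sum>k. ennreal (p i k * exp (- (l * s i k))) * indicator {0<..} l) \<le> ennreal (exp (- (l powr \<alpha> / 2))) * indicator {0<..} l"
      proof (cases "0 < l")
        case True
        have "(\<Sum>k. ennreal (p i k * exp (- (l * s i k)))) = ennreal (F i l)"
          using F[OF True, of i] p by (intro suminf_ennreal_eq) auto
        then show ?thesis using True Fb[OF True, of i] by (simp add: ennreal_leI)
      qed simp
    qed
    finally show ?thesis .
  qed
  have "(\<Sum>k. ennreal (p i k * (1 + 1 / s i k))) \<le> ennreal (1 + enn2real I)" for i
  proof -
    have "(\<Sum>k. ennreal (p i k * (1 + 1 / s i k))) = (\<Sum>k. ennreal (p i k) + ennreal (p i k / s i k))"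
      using p s by (intro suminf_cong) (simp add: distrib_left less_imp_le ennreal_plus[symmetric] del: ennreal_plus)
    also have "\<dots> = (\<Sum>k. ennreal (p i k)) + (\<Sum>k. ennreal (p i k / s i k))"
      by (rule suminf_add[symmetric]) auto
    also have "\<dots> \<le> 1 + I" by (intro add_mono mass moment)
    also have "\<dots> = ennreal (1 + enn2real I)" using Ifin by (simp add: less_top)
    finally show ?thesis .
  qed
  moreover have "s i 0 \<le> s i k" for i k by (simp add: s_def divide_right_mono)
  moreover have "(\<lambda>i. F i l) \<longlonglongrightarrow> exp (- (l powr \<alpha>))" if "0 < l" for l
    unfolding F_def by (rule sibuya_exp_tendsto[OF a0 a(2) that])
  ultimately show ?thesis
    using that[of p s F "1 + enn2real I"] p s F F0 Fb Fm by simp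
qed

section \<open>From Gaussian symbols to the fractional heat symbol\<close>

lemma heat_symbol_borel [measurable]: "heat_symbol \<alpha> t \<in> borel_measurable borel"
  unfolding heat_symbol_def by measurable

lemma L1norm_le_liminf:
  assumes [measurable]: "\<And>i. g i \<in> borel_measurable borel" "h \<in> borel_measurable borel"
    and lim: "\<And>x. (\<lambda>i::nat. g i x) \<longlonglongrightarrow> h x" and b: "\<And>i. L1norm (g i) \<le> D"
  shows "L1norm h \<le> D"
proof -
  have "L1norm h = (\<integral>\<^sup>+x. liminf (\<lambda>i. ennreal (norm (g i x))) \<partial>lborel)"
    unfolding L1norm_def
  proof (rule nn_integral_cong)
    fix x
    have "(\<lambda>i. ennreal (norm (g i x))) \<longlonglongrightarrow> ennreal (norm (h x))" by (intro tendsto_intros lim)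
    then show "ennreal (norm (h x)) = liminf (\<lambda>i. ennreal (norm (g i x)))"
      using lim_imp_Liminf[OF sequentially_bot] by metis
  qed
  also have "\<dots> \<le> liminf (\<lambda>i. L1norm (g i))"
    unfolding L1norm_def by (rule nn_integral_liminf) measurable
  also have "\<dots> \<le> limsup (\<lambda>i. L1norm (g i))" by (rule Liminf_le_Limsup) simp
  also have "\<dots> \<le> D" by (rule Limsup_bounded) (simp add: b)
  finally show ?thesis .
qed

text \<open>Convergence is demanded only off the origin, a null set, because the Laplace transforms
  of the weights are controlled only at positive arguments.\<close>

lemma inv_fourier_tendsto:
  assumes [measurable]: "\<And>i. M i \<in> borel_measurable borel" "M' \<in> borel_measurable borel"
    and w: "integrable lborel w" and b: "\<And>i \<xi>. norm (M i \<xi>) \<le> w \<xi>"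
    and lim: "\<And>\<xi>. \<xi> \<noteq> 0 \<Longrightarrow> (\<lambda>i::nat. M i \<xi>) \<longlonglongrightarrow> M' \<xi>"
  shows "(\<lambda>i. inv_fourier (M i) x) \<longlonglongrightarrow> inv_fourier M' x"
  unfolding inv_fourier_eq
proof (intro tendsto_mult tendsto_const integral_dominated_convergence[OF _ _ w])
  show "AE \<xi> in lborel. (\<lambda>i. cis (x \<bullet> \<xi>) * M i \<xi>) \<longlonglongrightarrow> cis (x \<bullet> \<xi>) * M' \<xi>"
    by (rule eventually_mono[OF AE_lborel_singleton[of 0]]) (auto intro!: tendsto_intros lim)
qed (auto simp: norm_mult b)

text \<open>A rate R^(-\<beta>) for Gaussians becomes t^(-\<beta>/\<alpha>), as R stands for
  t^(1/\<alpha>) times a random factor. The growth parameters \<open>A\<close> and \<open>p\<close>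
  ensure integrability and do not enter the bound. The range \<beta> <= 1 matches the control of the
  weights through 1 + 1/s.\<close>

definition subordination_const :: "'n::finite itself \<Rightarrow> real \<Rightarrow> real \<Rightarrow> bool"
  where "subordination_const _ \<alpha> C \<longleftrightarrow> 0 \<le> C \<and>
    (\<forall>(m :: real^'n \<Rightarrow> complex) A p B \<beta> t. m \<in> borel_measurable borel \<longrightarrow>
    (\<forall>\<xi>. norm (m \<xi>) \<le> A * (1 + norm \<xi>) ^ p) \<longrightarrow>
    (\<forall>R>0. FL1 (\<lambda>\<xi>. m \<xi> * gauss_exp (-R) \<xi>) \<le> ennreal (B * R powr (-\<beta>))) \<longrightarrow>
    0 \<le> B \<longrightarrow> 0 \<le> \<beta> \<longrightarrow> \<beta> \<le> 1 \<longrightarrow> 0 < t \<longrightarrow>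
    FL1 (\<lambda>\<xi>. m \<xi> * heat_symbol \<alpha> t \<xi>) \<le> ennreal (C * B * t powr (-\<beta>/\<alpha>)))"

lemma subordination_constD:
  assumes "subordination_const TYPE('n) \<alpha> C"
    and "m \<in> borel_measurable borel" "\<And>\<xi>::real^'n::finite. norm (m \<xi>) \<le> A * (1 + norm \<xi>) ^ p"
    and "\<And>R. R > 0 \<Longrightarrow> FL1 (\<lambda>\<xi>. m \<xi> * gauss_exp (-R) \<xi>) \<le> ennreal (B * R powr (-\<beta>))"
    and "0 \<le> B" "0 \<le> \<beta>" "\<beta> \<le> 1" "0 < t"
  shows "FL1 (\<lambda>\<xi>. m \<xi> * heat_symbol \<alpha> t \<xi>) \<le> ennreal (C * B * t powr (-\<beta>/\<alpha>))"
  by (rule assms(1)[unfolded subordination_const_def, THEN conjunct2, rule_format, where A=A and p=p])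
     (use assms in auto)

lemma subordination_const_exists:
  fixes \<alpha> :: real
  assumes a: "1/2 < \<alpha>" "\<alpha> < 1"
  shows "\<exists>C. subordination_const TYPE('n::finite) \<alpha> C"
proof -
  obtain p s :: "nat \<Rightarrow> nat \<Rightarrow> real" and F :: "nat \<Rightarrow> real \<Rightarrow> real" and C :: real
    where p: "\<And>i k. 0 \<le> p i k" and s: "\<And>i k. 0 < s i k" and s0: "\<And>i k. s i 0 \<le> s i k"
      and F: "\<And>i l. 0 < l \<Longrightarrow> (\<lambda>k. p i k * exp (- (l * s i k))) sums F i l"
      and F0: "\<And>i l. 0 < l \<Longrightarrow> 0 \<le> F i l" and Fb: "\<And>i l. 0 < l \<Longrightarrow> F i l \<le> exp (- (l powr \<alpha> / 2))"
      and Fl: "\<And>l. 0 < l \<Longrightarrow> (\<lambda>i. F i l) \<longlonglongrightarrow> exp (- (l powr \<alpha>))"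
      and C: "0 \<le> C" "\<And>i. (\<Sum>k. ennreal (p i k * (1 + 1 / s i k))) \<le> ennreal C"
      and Fm [measurable]: "\<And>i. F i \<in> borel_measurable borel"
    using subordinator_approximation[OF a] by blast
  show ?thesis
    unfolding subordination_const_def
  proof (intro exI[of _ C] conjI C(1) allI impI)
    fix m :: "real^'n \<Rightarrow> complex" and A :: real and q :: nat and B \<beta> t :: real
    assume [measurable]: "m \<in> borel_measurable borel"
      and m: "\<forall>\<xi>. norm (m \<xi>) \<le> A * (1 + norm \<xi>) ^ q"
      and mF: "\<forall>R>0. FL1 (\<lambda>\<xi>. m \<xi> * gauss_exp (-R) \<xi>) \<le> ennreal (B * R powr (-\<beta>))"
      and B: "0 \<le> B" and \<beta>: "0 \<le> \<beta>" "\<beta> \<le> 1" and t: "0 < t"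
    \<comment> \<open>Chosen so that (T |\<xi>|^2)^\<alpha> = t |\<xi>|^(2\<alpha>).\<close>
    define T where "T = t powr (1 / \<alpha>)"
    have T: "T > 0" using t by (simp add: T_def)
    have pw: "(T * (norm \<xi>)\<^sup>2) powr \<alpha> = t * norm \<xi> powr (2 * \<alpha>)" for \<xi> :: "real^'n"
    proof -
      have "(T * (norm \<xi>)\<^sup>2) powr \<alpha> = T powr \<alpha> * ((norm \<xi>)\<^sup>2) powr \<alpha>" by (rule powr_mult)
      also have "T powr \<alpha> = t" using t a by (simp add: T_def powr_powr)
      also have "((norm \<xi>)\<^sup>2) powr \<alpha> = norm \<xi> powr (2 * \<alpha>)" by (simp add: powr_powr flip: powr_numeral)
      finally show ?thesis .
    qed
    have pos: "0 < T * (norm \<xi>)\<^sup>2" if "\<xi> \<noteq> 0" for \<xi> :: "real^'n" using T that by simp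
    \<comment> \<open>Set to 0 at the origin, because the available bounds on \<open>F i\<close>
      concern positive arguments.\<close>
    define M where "M i \<xi> = (if \<xi> = 0 then 0 else m \<xi> * of_real (F i (T * (norm \<xi>)\<^sup>2)))" for i and \<xi> :: "real^'n"
    have [measurable]: "M i \<in> borel_measurable borel" for i
      unfolding M_def by measurable
    define w where "w \<xi> = A * (1 + norm \<xi>) ^ q * exp (- (t/2) * norm \<xi> powr (2 * \<alpha>))" for \<xi> :: "real^'n"
    have [measurable]: "w \<in> borel_measurable borel" unfolding w_def by measurable
    have w: "integrable lborel w"
    proof (rule integrable_growth_exp[where c="t/2" and q="2*\<alpha>" and A="\<bar>A\<bar>" and p=q])
      show "norm (w \<xi>) \<le> \<bar>A\<bar> * (1 + norm \<xi>) ^ q * exp (- (t/2) * norm \<xi> powr (2 * \<alpha>))" for \<xi>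
        by (simp add: w_def abs_mult)
    qed (use t a in auto)
    have Mw: "norm (M i \<xi>) \<le> w \<xi>" for i \<xi>
    proof (cases "\<xi> = 0")
      case True
      have "0 \<le> norm (m 0)" by simp
      also have "\<dots> \<le> A" using m[rule_format, of 0] by simp
      finally show ?thesis using True by (simp add: M_def w_def)
    next
      case False
      have "norm (M i \<xi>) = norm (m \<xi>) * F i (T * (norm \<xi>)\<^sup>2)"
        using F0[OF pos[OF False], of i] False by (simp add: M_def norm_mult)
      also have "\<dots> \<le> (A * (1 + norm \<xi>) ^ q) * exp (- ((T * (norm \<xi>)\<^sup>2) powr \<alpha> / 2))"
        using F0[OF pos[OF False], of i] by (intro mult_mono m[rule_format] Fb[OF pos[OF False]] order_trans[OF norm_ge_zero m[rule_format]]) auto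
      finally show ?thesis unfolding w_def pw by simp
    qed
    have Mi: "integrable lborel (M i)" for i
      by (rule Bochner_Integration.integrable_bound[OF w]) (auto intro!: order_trans[OF Mw])
    define g where "g i k \<xi> = m \<xi> * gauss_exp (- (T * s i k)) \<xi>" for i k and \<xi> :: "real^'n"
    have [measurable]: "g i k \<in> borel_measurable borel" for i k unfolding g_def by measurable
    have Ts: "0 < T * s i k" for i k using T s by simp
    have gi: "integrable lborel (g i k)" for i k
      by (rule integrable_growth_gauss[OF Ts[of i k], where A=A and p=q])
         (use m in \<open>auto simp: g_def norm_mult gauss_exp_def intro!: mult_right_mono\<close>)
    \<comment> \<open>Inversion term by term. The L^1 norms of the terms are summable because
      \<open>s i 0\<close> is the least of the \<open>s i k\<close>: every Gaussian is dominated by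
      the one with k = 0, and the weights have finite mass.\<close>
    have sums: "(\<lambda>k. of_real (p i k) * inv_fourier (g i k) x) sums inv_fourier (M i) x" for i x
    proof -
      have summ_p: "summable (p i)"
      proof -
        have "(\<Sum>k. ennreal (p i k)) \<le> (\<Sum>k. ennreal (p i k * (1 + 1 / s i k)))"
          using p s by (intro suminf_le ennreal_leI) (auto simp: distrib_left less_imp_le)
        also have "\<dots> < top" using C(2)[of i] by (rule le_less_trans) simp
        finally show ?thesis using p by (intro summable_suminf_not_top) auto
      qed
      have "(\<lambda>k. \<integral>\<xi>. cis (x \<bullet> \<xi>) * (of_real (p i k) * g i k \<xi>) \<partial>lborel) sums (\<integral>\<xi>. (\<Sum>k. cis (x \<bullet> \<xi>) * (of_real (p i k) * g i k \<xi>)) \<partial>lborel)"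
      proof (rule sums_integral)
        show "integrable lborel (\<lambda>\<xi>. cis (x \<bullet> \<xi>) * (of_real (p i k) * g i k \<xi>))" for k
          by (intro integrable_cis_mult integrable_mult_right gi)
        show "AE \<xi> in lborel. summable (\<lambda>k. norm (cis (x \<bullet> \<xi>) * (of_real (p i k) * g i k \<xi>)))"
        proof (rule eventually_mono[OF AE_lborel_singleton[of 0]])
          fix \<xi> :: "real^'n" assume "\<xi> \<noteq> 0"
          have "summable (\<lambda>k. norm (m \<xi>) * (p i k * exp (- (T * (norm \<xi>)\<^sup>2 * s i k))))"
            using F[OF pos[OF \<open>\<xi> \<noteq> 0\<close>], of i] by (intro summable_mult sums_summable)
          then show "summable (\<lambda>k. norm (cis (x \<bullet> \<xi>) * (of_real (p i k) * g i k \<xi>)))"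
            using p by (simp add: g_def gauss_exp_def norm_mult mult_ac)
        qed
        show "summable (\<lambda>k. \<integral>\<xi>. norm (cis (x \<bullet> \<xi>) * (of_real (p i k) * g i k \<xi>)) \<partial>lborel)"
        proof (rule summable_comparison_test)
          show "summable (\<lambda>k. p i k * (\<integral>\<xi>. norm (g i 0 \<xi>) \<partial>lborel))" using summ_p by (rule summable_mult2)
          have "(\<integral>\<xi>. norm (cis (x \<bullet> \<xi>) * (of_real (p i k) * g i k \<xi>)) \<partial>lborel) \<le> p i k * (\<integral>\<xi>. norm (g i 0 \<xi>) \<partial>lborel)" for k
          proof -
            have "(\<integral>\<xi>. norm (cis (x \<bullet> \<xi>) * (of_real (p i k) * g i k \<xi>)) \<partial>lborel) = p i k * (\<integral>\<xi>. norm (g i k \<xi>) \<partial>lborel)"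
              using p by (simp add: norm_mult)
            also have "\<dots> \<le> p i k * (\<integral>\<xi>. norm (g i 0 \<xi>) \<partial>lborel)"
            proof (intro mult_left_mono integral_mono integrable_norm gi p)
              fix \<xi> :: "real^'n"
              have "T * s i 0 * (norm \<xi>)\<^sup>2 \<le> T * s i k * (norm \<xi>)\<^sup>2"
                using T s0 by (intro mult_right_mono mult_left_mono) auto
              then show "norm (g i k \<xi>) \<le> norm (g i 0 \<xi>)"
                by (auto simp: g_def norm_mult gauss_exp_def intro!: mult_left_mono)
            qed
            finally show ?thesis .
          qed
          then show "\<exists>N. \<forall>k\<ge>N. norm (\<integral>\<xi>. norm (cis (x \<bullet> \<xi>) * (of_real (p i k) * g i k \<xi>)) \<partial>lborel) \<le> p i k * (\<integral>\<xi>. norm (g i 0 \<xi>) \<partial>lborel)"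
            by (simp add: integral_nonneg_AE)
        qed
      qed
      also have "(\<integral>\<xi>. (\<Sum>k. cis (x \<bullet> \<xi>) * (of_real (p i k) * g i k \<xi>)) \<partial>lborel) = (\<integral>\<xi>. cis (x \<bullet> \<xi>) * M i \<xi> \<partial>lborel)"
      proof (rule integral_cong_AE)
        show "AE \<xi> in lborel. (\<Sum>k. cis (x \<bullet> \<xi>) * (of_real (p i k) * g i k \<xi>)) = cis (x \<bullet> \<xi>) * M i \<xi>"
        proof (rule eventually_mono[OF AE_lborel_singleton[of 0]])
          fix \<xi> :: "real^'n" assume "\<xi> \<noteq> 0"
          have "(\<lambda>k. complex_of_real (p i k * exp (- (T * (norm \<xi>)\<^sup>2 * s i k)))) sums of_real (F i (T * (norm \<xi>)\<^sup>2))"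
            using F[OF pos[OF \<open>\<xi> \<noteq> 0\<close>], of i] by (rule sums_of_real)
          from sums_mult[OF this, of "cis (x \<bullet> \<xi>) * m \<xi>"]
          have "(\<lambda>k. cis (x \<bullet> \<xi>) * (of_real (p i k) * g i k \<xi>)) sums (cis (x \<bullet> \<xi>) * M i \<xi>)"
            using \<open>\<xi> \<noteq> 0\<close> by (simp add: g_def M_def gauss_exp_def mult_ac)
          then show "(\<Sum>k. cis (x \<bullet> \<xi>) * (of_real (p i k) * g i k \<xi>)) = cis (x \<bullet> \<xi>) * M i \<xi>" by (rule sums_unique[symmetric])
        qed
      qed measurable
      finally have "(\<lambda>k. of_real (fourier_const TYPE('n)) * (\<integral>\<xi>. cis (x \<bullet> \<xi>) * (of_real (p i k) * g i k \<xi>) \<partial>lborel)) sums inv_fourier (M i) x"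
        unfolding inv_fourier_eq[of "M i"] by (rule sums_mult)
      then show ?thesis by (simp add: inv_fourier_cmult[symmetric]) (simp add: inv_fourier_eq)
    qed
    have bound: "L1norm (inv_fourier (M i)) \<le> ennreal (C * B * t powr (-\<beta>/\<alpha>))" for i
    proof -
      have "L1norm (inv_fourier (M i)) \<le> (\<integral>\<^sup>+x. (\<Sum>k. ennreal (p i k) * ennreal (norm (inv_fourier (g i k) x))) \<partial>lborel)"
        unfolding L1norm_def
      proof (rule nn_integral_mono)
        fix x
        show "ennreal (norm (inv_fourier (M i) x)) \<le> (\<Sum>k. ennreal (p i k) * ennreal (norm (inv_fourier (g i k) x)))"
        proof (rule tendsto_upperbound)
          show "(\<lambda>n. ennreal (norm (\<Sum>k<n. of_real (p i k) * inv_fourier (g i k) x))) \<longlonglongrightarrow> ennreal (norm (inv_fourier (M i) x))"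
            using sums[of i x] unfolding sums_def by (intro tendsto_intros)
          show "\<forall>\<^sub>F n in sequentially. ennreal (norm (\<Sum>k<n. of_real (p i k) * inv_fourier (g i k) x))
              \<le> (\<Sum>k. ennreal (p i k) * ennreal (norm (inv_fourier (g i k) x)))"
          proof (intro always_eventually allI)
            fix n
            have "norm (\<Sum>k<n. of_real (p i k) * inv_fourier (g i k) x) \<le> (\<Sum>k<n. p i k * norm (inv_fourier (g i k) x))"
              by (rule order_trans[OF norm_sum]) (use p in \<open>simp add: norm_mult\<close>)
            then have "ennreal (norm (\<Sum>k<n. of_real (p i k) * inv_fourier (g i k) x)) \<le> (\<Sum>k<n. ennreal (p i k) * ennreal (norm (inv_fourier (g i k) x)))"
              using p by (simp add: sum_ennreal ennreal_mult[symmetric] ennreal_leI)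
            also have "\<dots> \<le> (\<Sum>k. ennreal (p i k) * ennreal (norm (inv_fourier (g i k) x)))" by (rule sum_le_suminf) auto
            finally show "ennreal (norm (\<Sum>k<n. of_real (p i k) * inv_fourier (g i k) x))
              \<le> (\<Sum>k. ennreal (p i k) * ennreal (norm (inv_fourier (g i k) x)))" .
          qed
        qed simp
      qed
      also have "\<dots> = (\<Sum>k. ennreal (p i k) * FL1 (g i k))"
        unfolding FL1_def L1norm_def by (subst nn_integral_suminf) (auto simp: nn_integral_cmult)
      also have "\<dots> \<le> (\<Sum>k. ennreal (B * T powr (-\<beta>)) * ennreal (p i k * (1 + 1 / s i k)))"
      proof (intro suminf_le)
        fix k
        \<comment> \<open>The power is at most 1 for s >= 1 and at most 1/s for s < 1, as 0 <=
          \<beta> <= 1.\<close>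
        have "s i k powr (-\<beta>) \<le> 1 + 1 / s i k"
        proof (cases "s i k \<ge> 1")
          case True
          have "s i k powr (-\<beta>) \<le> s i k powr 0" using True \<beta> by (intro powr_mono) auto
          then show ?thesis using True by (simp add: add_increasing2)
        next
          case False
          have "s i k powr (-\<beta>) \<le> s i k powr (-1)" using False s[of i k] \<beta> by (intro powr_mono') auto
          then show ?thesis using s[of i k] by (simp add: powr_minus_divide)
        qed
        then have "p i k * (T * s i k) powr (-\<beta>) \<le> T powr (-\<beta>) * (p i k * (1 + 1 / s i k))"
          using p[of i k] by (simp add: powr_mult mult_left_mono mult.left_commute)
        from mult_left_mono[OF this B] have le: "p i k * (B * (T * s i k) powr (-\<beta>)) \<le> B * T powr (-\<beta>) * (p i k * (1 + 1 / s i k))"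
          by (simp add: mult_ac)
        have "FL1 (g i k) \<le> ennreal (B * (T * s i k) powr (-\<beta>))"
          using mF Ts[of i k] unfolding g_def by blast
        then have "ennreal (p i k) * FL1 (g i k) \<le> ennreal (p i k) * ennreal (B * (T * s i k) powr (-\<beta>))"
          by (rule mult_left_mono) simp
        also have "\<dots> \<le> ennreal (B * T powr (-\<beta>)) * ennreal (p i k * (1 + 1 / s i k))"
          using p[of i k] B s[of i k] le by (subst (1 2) ennreal_mult[symmetric]) (auto intro!: ennreal_leI)
        finally show "ennreal (p i k) * FL1 (g i k) \<le> ennreal (B * T powr (-\<beta>)) * ennreal (p i k * (1 + 1 / s i k))" .
      qed auto
      also have "\<dots> = ennreal (B * T powr (-\<beta>)) * (\<Sum>k. ennreal (p i k * (1 + 1 / s i k)))"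
        by (rule ennreal_suminf_cmult)
      also have "\<dots> \<le> ennreal (B * T powr (-\<beta>)) * ennreal C" by (intro mult_left_mono C) simp
      also have "\<dots> = ennreal (C * B * t powr (-\<beta>/\<alpha>))"
        using B C(1) by (simp add: ennreal_mult[symmetric] T_def powr_powr mult_ac)
      finally show ?thesis .
    qed
    show "FL1 (\<lambda>\<xi>. m \<xi> * heat_symbol \<alpha> t \<xi>) \<le> ennreal (C * B * t powr (-\<beta>/\<alpha>))"
      unfolding FL1_def
    \<comment> \<open>The bound is uniform in the approximation index, so pointwise convergence of
      the kernels is enough for Fatou's lemma.\<close>
    proof (rule L1norm_le_liminf[OF _ _ _ bound])
      show "(\<lambda>i. inv_fourier (M i) x) \<longlonglongrightarrow> inv_fourier (\<lambda>\<xi>. m \<xi> * heat_symbol \<alpha> t \<xi>) x" for x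
      proof (rule inv_fourier_tendsto[OF _ _ w Mw])
        fix \<xi> :: "real^'n" assume "\<xi> \<noteq> 0"
        have "(\<lambda>i. m \<xi> * of_real (F i (T * (norm \<xi>)\<^sup>2))) \<longlonglongrightarrow> m \<xi> * of_real (exp (- ((T * (norm \<xi>)\<^sup>2) powr \<alpha>)))"
          by (intro tendsto_intros Fl pos \<open>\<xi> \<noteq> 0\<close>)
        then show "(\<lambda>i. M i \<xi>) \<longlonglongrightarrow> m \<xi> * heat_symbol \<alpha> t \<xi>"
          using \<open>\<xi> \<noteq> 0\<close> unfolding pw by (simp add: M_def heat_symbol_def)
      qed measurable
    qed measurable
  qed
qed

section \<open>Kernel estimates\<close>

lemma FL1_cmult:
  assumes [measurable]: "m \<in> borel_measurable borel"
  shows "FL1 (\<lambda>\<xi>. c * m \<xi>) = ennreal (norm c) * FL1 m"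
  unfolding FL1_def by (simp add: inv_fourier_cmult[abs_def] L1norm_cmult)

lemma FL1_add:
  assumes "integrable lborel m" "integrable lborel m'"
  shows "FL1 (\<lambda>\<xi>. m \<xi> + m' \<xi>) \<le> FL1 m + FL1 m'"
proof -
  have [measurable]: "m \<in> borel_measurable borel" "m' \<in> borel_measurable borel"
    using assms borel_measurable_integrable by force+
  show ?thesis unfolding FL1_def inv_fourier_add[OF assms, abs_def] by (rule L1norm_add) measurable
qed

lemma inv_fourier_sum:
  assumes "finite S" "\<And>k. k \<in> S \<Longrightarrow> integrable lborel (m k)"
  shows "inv_fourier (\<lambda>\<xi>. \<Sum>k\<in>S. m k \<xi>) x = (\<Sum>k\<in>S. inv_fourier (m k) x)"
  using assms
proof (induction S rule: finite_induct)
  case empty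
  then show ?case by (simp add: inv_fourier_eq)
next
  case (insert k S)
  then show ?case by (simp add: inv_fourier_add Bochner_Integration.integrable_sum)
qed

lemma FL1_sum:
  assumes "finite S" "\<And>k. k \<in> S \<Longrightarrow> integrable lborel (m k)"
  shows "FL1 (\<lambda>\<xi>. \<Sum>k\<in>S. m k \<xi>) \<le> (\<Sum>k\<in>S. FL1 (m k))"
proof -
  have m: "m k \<in> borel_measurable borel" if "k \<in> S" for k
    using assms(2)[OF that] borel_measurable_integrable by force
  have "inv_fourier (\<lambda>\<xi>. \<Sum>k\<in>S. m k \<xi>) = (\<lambda>x. \<Sum>k\<in>S. inv_fourier (m k) x)"
    using inv_fourier_sum[OF assms] by (simp add: fun_eq_iff)
  then show ?thesis unfolding FL1_def by (auto intro!: L1norm_sum inv_fourier_borel m)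
qed

section \<open>Gaussians with polynomial and Leray factors\<close>

lemma inv_fourier_std_gauss:
  "inv_fourier (gauss_exp (-1/2)) x =
    of_real (fourier_const TYPE('n) * sqrt (2 * pi) ^ CARD('n)) * gauss_exp (-1/2) (x :: real^'n::finite)"
  unfolding inv_fourier_eq integral_cis_gauss by simp

lemma wiener_std_gauss: "wiener (gauss_exp (-1/2) :: real^'n::finite \<Rightarrow> complex)"
proof -
  have "continuous_on UNIV (gauss_exp (-1/2) :: real^'n \<Rightarrow> complex)"
    unfolding gauss_exp_def by (intro continuous_intros)
  moreover have "norm (gauss_exp (-1/2) \<xi>) \<le> 1" for \<xi> :: "real^'n" by (simp add: gauss_exp_def)
  moreover have "integrable lborel (inv_fourier (gauss_exp (-1/2) :: real^'n \<Rightarrow> complex))"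
    unfolding inv_fourier_std_gauss[abs_def] by (intro integrable_mult_right gauss_exp_integrable) simp
  ultimately show ?thesis unfolding wiener_def by (auto intro!: gauss_exp_integrable)
qed

lemma rapid_std_gauss: "rapid (gauss_exp (-1/2) :: real^'n::finite \<Rightarrow> complex)"
  unfolding rapid_def
proof (intro conjI allI)
  fix N
  show "integrable lborel (\<lambda>\<xi>::real^'n. complex_of_real (norm \<xi> ^ N) * gauss_exp (-1/2) \<xi>)"
  proof (rule integrable_growth_gauss[where c="1/2" and A=1 and p=N])
    fix \<xi> :: "real^'n"
    have "norm \<xi> ^ N \<le> (1 + norm \<xi>) ^ N" by (intro power_mono) auto
    then show "norm (complex_of_real (norm \<xi> ^ N) * gauss_exp (-1/2) \<xi>) \<le> 1 * (1 + norm \<xi>) ^ N * exp (- (1/2) * (norm \<xi>)\<^sup>2)"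
      by (simp add: gauss_exp_def norm_mult norm_power)
  qed simp_all
qed simp

lemma norm_coordf_le: "norm (coordf k \<xi>) \<le> norm \<xi>"
  unfolding coordf_def norm_of_real by (rule component_le_norm_cart)

lemma norm_coordf_le': "norm (coordf k \<xi>) \<le> 1 + norm \<xi>"
  using norm_coordf_le[of k \<xi>] by linarith

lemma integrable_coordf_gauss:
  assumes "R > 0" shows "integrable lborel (\<lambda>\<xi>. coordf k \<xi> * gauss_exp (-R) \<xi>)"
  by (rule integrable_growth_gauss[OF assms, where A=1 and p=1])
     (auto simp: gauss_exp_def norm_mult intro!: mult_right_mono norm_coordf_le')

text \<open>The kernel is explicit: a factor i \<xi>_k in the symbol differentiates the kernel, and
  the kernel of the standard Gaussian is again a Gaussian.\<close>

lemma wiener_coordf_std_gauss: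
  "wiener (\<lambda>\<xi>. coordf k \<xi> * gauss_exp (-1/2) \<xi> :: complex)" (is "wiener ?m")
proof -
  have "\<exists>C. \<forall>r\<ge>0. (1 + r) ^ 1 * exp (- (1/2) * r powr 2) \<le> (C::real)"
    by (rule exp_powr_decay) auto
  then obtain C :: real where C: "\<And>r. r \<ge> 0 \<Longrightarrow> (1 + r) ^ 1 * exp (- (1/2) * r powr 2) \<le> C"
    by blast
  show ?thesis
  proof (rule wienerI[where B=C])
    show "continuous_on UNIV ?m"
      unfolding gauss_exp_def coordf_def by (intro continuous_intros)
    show "norm (?m \<xi>) \<le> C" for \<xi>
    proof -
      have "norm (?m \<xi>) \<le> (1 + norm \<xi>) * exp (- (1/2) * (norm \<xi>)\<^sup>2)"
        by (auto simp: gauss_exp_def norm_mult intro!: mult_right_mono norm_coordf_le')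
      then show ?thesis using C[of "norm \<xi>"] by (simp add: powr_numeral)
    qed
    show "integrable lborel ?m" using integrable_coordf_gauss[of "1/2" k] by simp
    define A where "A = fourier_const TYPE('a) * sqrt (2 * pi) ^ CARD('a)"
    have "inv_fourier (\<lambda>\<xi>. \<i> * coordf k \<xi> * gauss_exp (-1/2) \<xi>) x = of_real A * (- coordf k x * gauss_exp (-1/2) x)" for x
    proof -
      have "inv_fourier (\<lambda>\<xi>. \<i> * coordf k \<xi> * gauss_exp (-1/2) \<xi>) x = partial k (inv_fourier (gauss_exp (-1/2))) x"
        using partial_inv_fourier[OF rapid_std_gauss, of k] by simp
      also have "inv_fourier (gauss_exp (-1/2)) = (\<lambda>x. of_real A * gauss_exp (-1/2) (x :: real^'a))"
        unfolding inv_fourier_std_gauss[abs_def] A_def ..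
      also have "partial k (\<lambda>x. of_real A * gauss_exp (-1/2) x) x = of_real A * (- coordf k x * gauss_exp (-1/2) x)"
        by (rule partial_eqI[OF has_derivative_mult_right[OF has_derivative_gauss_exp], THEN trans])
           (simp add: inner_axis coordf_def gauss_exp_def)
      finally show ?thesis .
    qed
    then have e: "inv_fourier ?m x = \<i> * of_real A * (coordf k x * gauss_exp (-1/2) x)" for x
      using inv_fourier_cmult[of "-\<i>" "\<lambda>\<xi>. \<i> * coordf k \<xi> * gauss_exp (-1/2) \<xi>" x]
      by (simp add: mult.assoc[symmetric])
    have "integrable lborel (\<lambda>x. \<i> * of_real A * (coordf k x * gauss_exp (-1/2) x))"
      using integrable_coordf_gauss[of "1/2" k] by (intro integrable_mult_right) simp
    then show "FL1 ?m < \<infinity>"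
      unfolding FL1_def e[abs_def] by (subst integrable_iff_L1norm[symmetric]) auto
  qed
qed

lemma wiener_scale:
  assumes m: "wiener m" and r: "r > 0" shows "wiener (\<lambda>\<xi>. m (r *\<^sub>R \<xi>))"
proof -
  have [measurable]: "m \<in> borel_measurable borel" using borel_measurable_integrable[OF wiener_integrable[OF m]] by simp
  obtain B where B: "\<And>\<xi>. norm (m \<xi>) \<le> B" using m by (auto simp: wiener_def)
  show ?thesis
  proof (rule wienerI)
    have "continuous_on UNIV m" using m by (simp add: wiener_def)
    then show "continuous_on UNIV (\<lambda>\<xi>. m (r *\<^sub>R \<xi>))"
      by (intro continuous_on_compose2[of UNIV m UNIV "\<lambda>\<xi>. r *\<^sub>R \<xi>"] continuous_intros) auto
    show "integrable lborel (\<lambda>\<xi>. m (r *\<^sub>R \<xi>))"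
      using integrable_lborel_affine[OF wiener_integrable[OF m], of r 0] r by simp
    show "FL1 (\<lambda>\<xi>. m (r *\<^sub>R \<xi>)) < \<infinity>" using wiener_FL1[OF m] r by (simp add: FL1_scale)
  qed (rule B)
qed

lemma wiener_gauss: "R > 0 \<Longrightarrow> wiener (gauss_exp (-R))"
  using wiener_scale[OF wiener_std_gauss, of "sqrt (2 * R)"] by (simp add: gauss_exp_scale)

lemma FL1_gauss: "R > 0 \<Longrightarrow> FL1 (gauss_exp (-R) :: real^'n::finite \<Rightarrow> complex) = FL1 (gauss_exp (-1/2) :: real^'n \<Rightarrow> complex)"
  using FL1_scale[of "gauss_exp (-1/2) :: real^'n \<Rightarrow> complex" "sqrt (2 * R)", symmetric] by (simp add: gauss_exp_scale)

lemma wiener_cmult: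
  assumes "wiener m" shows "wiener (\<lambda>\<xi>. c * m \<xi>)"
proof -
  obtain B where B: "\<And>\<xi>. norm (m \<xi>) \<le> B" using assms by (auto simp: wiener_def)
  then have "norm (c * m \<xi>) \<le> norm c * B" for \<xi> unfolding norm_mult by (intro mult_left_mono) auto
  then show ?thesis using assms unfolding wiener_def inv_fourier_cmult[abs_def]
    by (auto intro!: continuous_intros)
qed

lemma wiener_coordf_gauss:
  assumes R: "R > 0" shows "wiener (\<lambda>\<xi>. coordf k \<xi> * gauss_exp (-R) \<xi>)"
proof -
  have "wiener (\<lambda>\<xi>. of_real (1 / sqrt (2 * R)) * (coordf k (sqrt (2 * R) *\<^sub>R \<xi>) * gauss_exp (-1/2) (sqrt (2 * R) *\<^sub>R \<xi>)))"
    using R by (intro wiener_cmult wiener_scale[OF wiener_coordf_std_gauss]) simp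
  also have "(\<lambda>\<xi>. of_real (1 / sqrt (2 * R)) * (coordf k (sqrt (2 * R) *\<^sub>R \<xi>) * gauss_exp (-1/2) (sqrt (2 * R) *\<^sub>R \<xi>)))
    = (\<lambda>\<xi>. coordf k \<xi> * gauss_exp (-R) \<xi>)"
    using R by (auto simp: fun_eq_iff gauss_exp_scale coordf_def)
  finally show ?thesis .
qed

text \<open>Dilation by sqrt (2R) carries exp(-|\<xi>|^2/2) to exp(-R|\<xi>|^2), and homogeneity of
  degree one leaves the factor R^(-1/2). Summing over the coordinates makes the constant uniform in
  \<open>k\<close>.\<close>

lemma FL1_coordf_gauss:
  "\<exists>D\<ge>0. \<forall>(k::'n::finite) R. R > 0 \<longrightarrow> FL1 (\<lambda>\<xi>. coordf k \<xi> * gauss_exp (-R) \<xi>) \<le> ennreal (D * R powr (-1/2))"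
proof -
  define E where "E k = FL1 (\<lambda>\<xi>. coordf k \<xi> * gauss_exp (-1/2) \<xi>)" for k :: 'n
  have E: "E k < \<infinity>" for k unfolding E_def by (rule wiener_FL1[OF wiener_coordf_std_gauss])
  define D where "D = (\<Sum>k\<in>UNIV. enn2real (E k))"
  have D: "E k \<le> ennreal D" for k
  proof -
    have "E k = ennreal (enn2real (E k))" using E[of k] by (simp add: less_top)
    also have "\<dots> \<le> ennreal D" unfolding D_def by (intro ennreal_leI member_le_sum) auto
    finally show ?thesis .
  qed
  have D0: "D \<ge> 0" unfolding D_def by (intro sum_nonneg) auto
  have "FL1 (\<lambda>\<xi>. coordf k \<xi> * gauss_exp (-R) \<xi>) \<le> ennreal (D * R powr (-1/2))" if R: "R > 0" for k :: 'n and R :: real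
  proof -
    have "E k = FL1 (\<lambda>\<xi>. coordf k (sqrt (2 * R) *\<^sub>R \<xi>) * gauss_exp (-1/2) (sqrt (2 * R) *\<^sub>R \<xi>))"
      unfolding E_def using R by (subst FL1_scale[symmetric, where r="sqrt (2 * R)"]) auto
    also have "(\<lambda>\<xi>. coordf k (sqrt (2 * R) *\<^sub>R \<xi>) * gauss_exp (-1/2) (sqrt (2 * R) *\<^sub>R \<xi>))
      = (\<lambda>\<xi>. of_real (sqrt (2 * R)) * (coordf k \<xi> * gauss_exp (-R) \<xi>))"
      using R by (auto simp: fun_eq_iff gauss_exp_scale coordf_def)
    also have "FL1 \<dots> = ennreal (sqrt (2 * R)) * FL1 (\<lambda>\<xi>. coordf k \<xi> * gauss_exp (-R) \<xi>)"
      using R by (subst FL1_cmult) auto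
    finally have e: "E k = ennreal (sqrt (2 * R)) * FL1 (\<lambda>\<xi>. coordf k \<xi> * gauss_exp (-R) \<xi>)" .
    have "FL1 (\<lambda>\<xi>. coordf k \<xi> * gauss_exp (-R) \<xi>) = ennreal (1 / sqrt (2 * R)) * E k"
      unfolding e mult.assoc[symmetric] using R by (simp add: ennreal_mult[symmetric])
    also have "\<dots> \<le> ennreal (1 / sqrt (2 * R)) * ennreal D" by (intro mult_left_mono D) simp
    also have "\<dots> = ennreal (1 / sqrt (2 * R) * D)" using R D0 by (subst ennreal_mult[symmetric]) auto
    also have "\<dots> \<le> ennreal (D * R powr (-1/2))"
    proof (rule ennreal_leI)
      have "1 / sqrt (2 * R) \<le> 1 / sqrt R" using R by (intro divide_left_mono) auto
      also have "\<dots> = R powr (-1/2)" using R powr_minus_divide[of R "1/2"] by (simp add: powr_half_sqrt)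
      finally have "1 / sqrt (2 * R) \<le> R powr (-1/2)" .
      from mult_right_mono[OF this D0] show "1 / sqrt (2 * R) * D \<le> D * R powr (-1/2)"
        by (simp add: mult.commute)
    qed
    finally show ?thesis .
  qed
  with D0 show ?thesis by blast
qed

lemma gauss_exp_add: "gauss_exp (a + b) \<xi> = gauss_exp a \<xi> * gauss_exp b \<xi>"
  by (simp add: gauss_exp_def distrib_right exp_add)

text \<open>Halving the Gaussian writes the symbol as a sum of squares of \<xi>_k
  exp(-R|\<xi>|^2/2), so submultiplicativity yields the factor R^(-1/2) twice.\<close>

lemma FL1_norm2_gauss:
  "\<exists>D\<ge>0. \<forall>R>0. FL1 (\<lambda>\<xi>::real^'n::finite. of_real ((norm \<xi>)\<^sup>2) * gauss_exp (-R) \<xi>) \<le> ennreal (D * R powr (-1))"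
proof -
  obtain D where D: "D \<ge> 0" "\<And>(k::'n) R. R > 0 \<Longrightarrow> FL1 (\<lambda>\<xi>. coordf k \<xi> * gauss_exp (-R) \<xi>) \<le> ennreal (D * R powr (-1/2))"
    using FL1_coordf_gauss by blast
  have "FL1 (\<lambda>\<xi>::real^'n. of_real ((norm \<xi>)\<^sup>2) * gauss_exp (-R) \<xi>) \<le> ennreal ((real CARD('n) * (2 * D\<^sup>2)) * R powr (-1))"
    if R: "R > 0" for R :: real
  proof -
    define g where "g k \<xi> = coordf k \<xi> * gauss_exp (-(R/2)) \<xi>" for k and \<xi> :: "real^'n"
    have g: "wiener (g k)" "FL1 (g k) \<le> ennreal (D * (R/2) powr (-1/2))" for k
      unfolding g_def using R by (intro wiener_coordf_gauss D; simp)+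
    have "(\<lambda>\<xi>::real^'n. of_real ((norm \<xi>)\<^sup>2) * gauss_exp (-R) \<xi>) = (\<lambda>\<xi>. \<Sum>k\<in>UNIV. g k \<xi> * g k \<xi>)"
    proof
      fix \<xi> :: "real^'n"
      have "(norm \<xi>)\<^sup>2 = (\<Sum>k\<in>UNIV. (\<xi> $ k)\<^sup>2)"
        unfolding power2_norm_eq_inner by (simp add: inner_vec_def power2_eq_square)
      moreover have "gauss_exp (-R) \<xi> = gauss_exp (-(R/2)) \<xi> * gauss_exp (-(R/2)) \<xi>"
        using gauss_exp_add[of "-(R/2)" "-(R/2)" \<xi>] by simp
      ultimately show "of_real ((norm \<xi>)\<^sup>2) * gauss_exp (-R) \<xi> = (\<Sum>k\<in>UNIV. g k \<xi> * g k \<xi>)"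
        by (simp add: g_def coordf_def sum_distrib_left sum_distrib_right power2_eq_square mult_ac)
    qed
    then have "FL1 (\<lambda>\<xi>::real^'n. of_real ((norm \<xi>)\<^sup>2) * gauss_exp (-R) \<xi>) \<le> (\<Sum>k\<in>UNIV. FL1 (\<lambda>\<xi>. g k \<xi> * g k \<xi>))"
      by (simp add: FL1_sum wiener_integrable[OF wiener_mult] g)
    also have "\<dots> \<le> (\<Sum>k\<in>(UNIV::'n set). ennreal (D * (R/2) powr (-1/2)) * ennreal (D * (R/2) powr (-1/2)))"
      by (intro sum_mono order_trans[OF FL1_mult] mult_mono g wiener_integrable) auto
    also have "\<dots> = ennreal (real CARD('n) * (D * (R/2) powr (-1/2) * (D * (R/2) powr (-1/2))))"
      using D(1) by (simp add: ennreal_mult[symmetric] ennreal_of_nat_eq_real_of_nat)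
    also have "D * (R/2) powr (-1/2) * (D * (R/2) powr (-1/2)) = 2 * D\<^sup>2 * R powr (-1)"
    proof -
      have "(R/2) powr (-1/2) * (R/2) powr (-1/2) = (R/2) powr (-1)" by (simp add: powr_add[symmetric])
      also have "\<dots> = 2 * R powr (-1)" using R by (simp add: powr_minus_divide)
      finally show ?thesis by (simp add: power2_eq_square mult_ac)
    qed
    finally show ?thesis by (simp add: mult_ac)
  qed
  then show ?thesis by (intro exI[of _ "real CARD('n) * (2 * D\<^sup>2)"]) auto
qed

definition cubic_gauss :: "'n::finite \<Rightarrow> 'n \<Rightarrow> 'n \<Rightarrow> real \<Rightarrow> real^'n \<Rightarrow> complex"
  where "cubic_gauss i j k r \<xi> = coordf i \<xi> * coordf j \<xi> * coordf k \<xi> * gauss_exp (-r) \<xi>"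

lemma cubic_gauss_measurable [measurable]: "case_prod (cubic_gauss i j k) \<in> borel_measurable (borel \<Otimes>\<^sub>M borel)"
  unfolding cubic_gauss_def gauss_exp_def by measurable

text \<open>One third of the Gaussian goes to each coordinate, and the three factors R^(-1/2)
  multiply.\<close>

lemma FL1_cubic_gauss:
  "\<exists>D\<ge>0. \<forall>(i::'n::finite) j k. \<forall>R>0. FL1 (cubic_gauss i j k R) \<le> ennreal (D * R powr (-3/2))"
proof -
  obtain D where D: "D \<ge> 0" "\<And>(k::'n) R. R > 0 \<Longrightarrow> FL1 (\<lambda>\<xi>. coordf k \<xi> * gauss_exp (-R) \<xi>) \<le> ennreal (D * R powr (-1/2))"
    using FL1_coordf_gauss by blast
  have "FL1 (cubic_gauss i j k R) \<le> ennreal ((D ^ 3 * 3 powr (3/2)) * R powr (-3/2))"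
    if R: "R > 0" for R :: real and i j k :: 'n
  proof -
    define g where "g k \<xi> = coordf k \<xi> * gauss_exp (-(R/3)) \<xi>" for k and \<xi> :: "real^'n"
    have g: "wiener (g k)" "FL1 (g k) \<le> ennreal (D * (R/3) powr (-1/2))" for k
      unfolding g_def using R by (intro wiener_coordf_gauss D; simp)+
    have "cubic_gauss i j k R = (\<lambda>\<xi>. g i \<xi> * (g j \<xi> * g k \<xi>))"
    proof
      fix \<xi> :: "real^'n"
      have "gauss_exp (-R) \<xi> = gauss_exp (-(R/3)) \<xi> * (gauss_exp (-(R/3)) \<xi> * gauss_exp (-(R/3)) \<xi>)"
        by (simp flip: gauss_exp_add)
      then show "cubic_gauss i j k R \<xi> = g i \<xi> * (g j \<xi> * g k \<xi>)" by (simp add: cubic_gauss_def g_def)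
    qed
    then have "FL1 (cubic_gauss i j k R) \<le> FL1 (g i) * (FL1 (g j) * FL1 (g k))"
      by (auto intro!: order_trans[OF FL1_mult] mult_left_mono FL1_mult g wiener_integrable wiener_mult)
    also have "\<dots> \<le> ennreal (D * (R/3) powr (-1/2)) * (ennreal (D * (R/3) powr (-1/2)) * ennreal (D * (R/3) powr (-1/2)))"
      by (intro mult_mono g) auto
    also have "\<dots> = ennreal (D ^ 3 * ((R/3) powr (-1/2) * ((R/3) powr (-1/2) * (R/3) powr (-1/2))))"
      using D(1) by (simp add: ennreal_mult[symmetric] power3_eq_cube mult_ac)
    also have "(R/3) powr (-1/2) * ((R/3) powr (-1/2) * (R/3) powr (-1/2)) = (R/3) powr (-3/2)"
      by (simp only: powr_add[symmetric]) simp
    also have "(R/3) powr (-3/2) = 3 powr (3/2) * R powr (-3/2)"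
      using R powr_minus_divide[of "R/3" "3/2"] powr_minus_divide[of R "3/2"] by (simp add: powr_divide)
    finally show ?thesis by (simp add: mult_ac)
  qed
  then show ?thesis using D(1) by (intro exI[of _ "D ^ 3 * 3 powr (3/2)"]) auto
qed

definition leray_mult :: "'n::finite \<Rightarrow> 'n \<Rightarrow> 'n \<Rightarrow> real^'n \<Rightarrow> complex"
  where "leray_mult i j k \<xi> = complex_of_real (leray_symbol i j \<xi>) * (\<i> * complex_of_real (\<xi> $ k))"

lemma leray_mult_borel [measurable]: "leray_mult i j k \<in> borel_measurable borel"
  unfolding leray_mult_def leray_symbol_def by measurable

lemma leray_kernel_eq: "leray_kernel \<alpha> i j k \<tau> = inv_fourier (\<lambda>\<xi>. leray_mult i j k \<xi> * heat_symbol \<alpha> \<tau> \<xi>)"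
  by (simp add: leray_kernel_def leray_mult_def)

lemma norm_leray_mult: "norm (leray_mult i j k \<xi>) \<le> 2 * norm \<xi>"
proof -
  have "\<bar>leray_symbol i j \<xi>\<bar> \<le> 1 + 1"
  proof -
    have "\<bar>\<xi> $ i * \<xi> $ j / (norm \<xi>)\<^sup>2\<bar> \<le> 1"
    proof (cases "\<xi> = 0")
      case False
      have "\<bar>\<xi> $ i\<bar> * \<bar>\<xi> $ j\<bar> \<le> norm \<xi> * norm \<xi>"
        by (intro mult_mono component_le_norm_cart) auto
      then show ?thesis using False by (simp add: abs_mult power2_eq_square)
    qed simp
    then show ?thesis unfolding leray_symbol_def
      by (intro order_trans[OF abs_triangle_ineq4] add_mono) auto
  qed
  then have "\<bar>leray_symbol i j \<xi>\<bar> * \<bar>\<xi> $ k\<bar> \<le> 2 * norm \<xi>"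
    by (intro mult_mono component_le_norm_cart) auto
  then show ?thesis by (simp add: leray_mult_def norm_mult)
qed

lemma norm_leray_mult': "norm (leray_mult i j k \<xi>) \<le> 2 * (1 + norm \<xi>) ^ 1"
  using norm_leray_mult[of i j k \<xi>] by simp

text \<open>Dividing by \<open>(norm \<xi>)\<^sup>2\<close> amounts to integrating the Gaussian over its parameter, so the
  singular symbol is a superposition of the Schwartz symbols \<^const>\<open>cubic_gauss\<close>.\<close>

lemma nn_integral_exp_tail:
  fixes c s :: real
  assumes "c > 0"
  shows "(\<integral>\<^sup>+r. ennreal (exp (- (r * c))) * indicator {s..} r \<partial>lborel) = ennreal (exp (- (s * c)) / c)"
proof -
  have "(\<integral>\<^sup>+r. ennreal (exp (- (r * c))) * indicator {s..} r \<partial>lborel) = ennreal (0 - (- exp (- (s * c)) / c))"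
  proof (rule nn_integral_FTC_atLeast)
    show "((\<lambda>r. - exp (- (r * c)) / c) has_real_derivative exp (- (r * c))) (at r)" for r
      using assms by (auto intro!: derivative_eq_intros)
    show "((\<lambda>r. - exp (- (r * c)) / c) \<longlongrightarrow> 0) at_top" using assms by real_asymp
  qed auto
  then show ?thesis by simp
qed

lemma integral_exp_tail:
  fixes c s :: real
  assumes "c > 0"
  shows "(\<integral>r. indicator {s..} r * exp (- (r * c)) \<partial>lborel) = exp (- (s * c)) / c"
  using nn_integral_exp_tail[OF assms, of s] assms
  by (intro integral_eq_nn_integral[THEN trans]) (auto simp: ennreal_mult mult.commute ennreal_indicator)

text \<open>The identity part of the projection is \<open>FL1_coordf_gauss\<close>. For the other
  part the cubic bound r^(-3/2) is integrated over r >= R and gives 2 R^(-1/2), the same rate as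
  without projection; hence the constant \<open>D1 + 2 * D3\<close>.\<close>

lemma FL1_leray_gauss:
  "\<exists>D\<ge>0. \<forall>(i::'n::finite) j k. \<forall>R>0. FL1 (\<lambda>\<xi>. leray_mult i j k \<xi> * gauss_exp (-R) \<xi>) \<le> ennreal (D * R powr (-1/2))"
proof -
  obtain D1 where D1: "D1 \<ge> 0" "\<And>(k::'n) R. R > 0 \<Longrightarrow> FL1 (\<lambda>\<xi>. coordf k \<xi> * gauss_exp (-R) \<xi>) \<le> ennreal (D1 * R powr (-1/2))"
    using FL1_coordf_gauss by blast
  obtain D3 where D3: "D3 \<ge> 0" "\<And>(i::'n) j k R. R > 0 \<Longrightarrow> FL1 (cubic_gauss i j k R) \<le> ennreal (D3 * R powr (-3/2))"
    using FL1_cubic_gauss by blast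
  have "FL1 (\<lambda>\<xi>. leray_mult i j k \<xi> * gauss_exp (-R) \<xi>) \<le> ennreal ((D1 + 2 * D3) * R powr (-1/2))"
    if R: "R > 0" for R :: real and i j k :: 'n
  proof -
    define Q where "Q \<xi> = coordf i \<xi> * coordf j \<xi> * coordf k \<xi> / of_real ((norm \<xi>)\<^sup>2) * gauss_exp (-R) \<xi>" for \<xi> :: "real^'n"
    have [measurable]: "Q \<in> borel_measurable borel" unfolding Q_def by measurable
    have cub: "norm (coordf i \<xi> * coordf j \<xi> * coordf k \<xi>) \<le> norm \<xi> * (norm \<xi>)\<^sup>2" for \<xi> :: "real^'n"
    proof -
      have "norm (coordf i \<xi> * coordf j \<xi> * coordf k \<xi>) \<le> norm \<xi> * norm \<xi> * norm \<xi>"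
        unfolding norm_mult by (intro mult_mono norm_coordf_le) auto
      then show ?thesis by (simp add: power2_eq_square)
    qed
    have Qb: "norm (Q \<xi>) \<le> 1 * (1 + norm \<xi>) ^ 1 * exp (- R * (norm \<xi>)\<^sup>2)" for \<xi>
    proof -
      have "norm (coordf i \<xi> * coordf j \<xi> * coordf k \<xi>) / (norm \<xi>)\<^sup>2 \<le> norm \<xi>"
        using cub[of \<xi>] by (cases "\<xi> = 0") (simp_all add: pos_divide_le_eq)
      then have "norm (coordf i \<xi> * coordf j \<xi> * coordf k \<xi>) / (norm \<xi>)\<^sup>2 * exp (- R * (norm \<xi>)\<^sup>2) \<le> (1 + norm \<xi>) * exp (- R * (norm \<xi>)\<^sup>2)"
        by (intro mult_right_mono) auto
      then show ?thesis by (simp add: Q_def norm_mult norm_divide gauss_exp_def norm_power)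
    qed
    have Qi: "integrable lborel Q"
      by (rule integrable_growth_gauss[OF R _ Qb]) simp
    \<comment> \<open>The swap of r and \<xi> is justified because integrating absolute values over
      r first gives |Q|, whose bound \<open>Qb\<close> is integrable. At the origin both sides
      vanish with the coordinates.\<close>
    have Qeq: "inv_fourier Q x = (\<integral>r. indicator {R..} r *\<^sub>R inv_fourier (cubic_gauss i j k r) x \<partial>lborel)" for x
    proof -
      define c where "c = fourier_const TYPE('n)"
      have "inv_fourier Q x = c * (\<integral>\<xi>. \<integral>r. indicator {R..} r *\<^sub>R (cis (x \<bullet> \<xi>) * cubic_gauss i j k r \<xi>) \<partial>lborel \<partial>lborel)"
        unfolding inv_fourier_eq c_def[symmetric]
      proof (intro arg_cong[where f="(*) (complex_of_real c)"] Bochner_Integration.integral_cong refl)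
        fix \<xi> :: "real^'n"
        show "cis (x \<bullet> \<xi>) * Q \<xi> = (\<integral>r. indicator {R..} r *\<^sub>R (cis (x \<bullet> \<xi>) * cubic_gauss i j k r \<xi>) \<partial>lborel)"
        proof (cases "\<xi> = 0")
          case True
          then show ?thesis by (simp add: Q_def cubic_gauss_def coordf_def)
        next
          case False
          define a where "a = cis (x \<bullet> \<xi>) * (coordf i \<xi> * coordf j \<xi> * coordf k \<xi>)"
          have "(\<integral>r. indicator {R..} r *\<^sub>R (cis (x \<bullet> \<xi>) * cubic_gauss i j k r \<xi>) \<partial>lborel)
            = (\<integral>r. a * complex_of_real (indicator {R..} r * exp (- (r * (norm \<xi>)\<^sup>2))) \<partial>lborel)"
            by (intro Bochner_Integration.integral_cong) (auto simp: a_def cubic_gauss_def gauss_exp_def indicator_def mult_ac)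
          also have "\<dots> = a * complex_of_real (exp (- (R * (norm \<xi>)\<^sup>2)) / (norm \<xi>)\<^sup>2)"
            using False by (simp only: integral_mult_right_zero integral_complex_of_real) (simp add: integral_exp_tail)
          also have "\<dots> = cis (x \<bullet> \<xi>) * Q \<xi>" by (simp add: a_def Q_def gauss_exp_def)
          finally show ?thesis by simp
        qed
      qed
      also have "(\<integral>\<xi>. \<integral>r. indicator {R..} r *\<^sub>R (cis (x \<bullet> \<xi>) * cubic_gauss i j k r \<xi>) \<partial>lborel \<partial>lborel)
        = (\<integral>r. \<integral>\<xi>. indicator {R..} r *\<^sub>R (cis (x \<bullet> \<xi>) * cubic_gauss i j k r \<xi>) \<partial>lborel \<partial>lborel)"
      proof (rule lborel_fubini_swap)
        have "(\<integral>\<^sup>+\<xi>. \<integral>\<^sup>+r. ennreal (norm (indicator {R..} r *\<^sub>R (cis (x \<bullet> \<xi>) * cubic_gauss i j k r \<xi>))) \<partial>lborel \<partial>lborel)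
          \<le> (\<integral>\<^sup>+\<xi>. ennreal (norm ((1 + norm (\<xi>::real^'n)) * exp (- R * (norm \<xi>)\<^sup>2))) \<partial>lborel)"
        proof (rule nn_integral_mono)
          fix \<xi> :: "real^'n"
          show "(\<integral>\<^sup>+r. ennreal (norm (indicator {R..} r *\<^sub>R (cis (x \<bullet> \<xi>) * cubic_gauss i j k r \<xi>))) \<partial>lborel)
            \<le> ennreal (norm ((1 + norm \<xi>) * exp (- R * (norm \<xi>)\<^sup>2)))"
          proof (cases "\<xi> = 0")
            case True
            then show ?thesis by (simp add: cubic_gauss_def coordf_def)
          next
            case False
            define b where "b = norm (coordf i \<xi> * coordf j \<xi> * coordf k \<xi>)"
            have "(\<integral>\<^sup>+r. ennreal (norm (indicator {R..} r *\<^sub>R (cis (x \<bullet> \<xi>) * cubic_gauss i j k r \<xi>))) \<partial>lborel)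
              = (\<integral>\<^sup>+r. ennreal b * (ennreal (exp (- (r * (norm \<xi>)\<^sup>2))) * indicator {R..} r) \<partial>lborel)"
              by (intro nn_integral_cong) (auto simp: b_def cubic_gauss_def gauss_exp_def norm_mult indicator_def ennreal_mult)
            also have "\<dots> = ennreal b * ennreal (exp (- (R * (norm \<xi>)\<^sup>2)) / (norm \<xi>)\<^sup>2)"
              using False by (simp add: nn_integral_cmult nn_integral_exp_tail)
            also have "\<dots> = ennreal (b * (exp (- (R * (norm \<xi>)\<^sup>2)) / (norm \<xi>)\<^sup>2))"
              by (rule ennreal_mult[symmetric]) (auto simp: b_def)
            also have "b * (exp (- (R * (norm \<xi>)\<^sup>2)) / (norm \<xi>)\<^sup>2) = norm (Q \<xi>)"
              by (simp add: Q_def b_def norm_mult norm_divide gauss_exp_def norm_power)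
            finally show ?thesis using Qb[of \<xi>] by (simp add: ennreal_leI abs_mult)
          qed
        qed
        also have "\<dots> < \<infinity>"
        proof -
          have "integrable lborel (\<lambda>\<xi>::real^'n. (1 + norm \<xi>) * exp (- R * (norm \<xi>)\<^sup>2))"
            by (rule integrable_growth_gauss[OF R, where A=1 and p=1]) (auto simp: abs_mult)
          then show ?thesis by (simp add: integrable_iff_bounded)
        qed
        finally show "(\<integral>\<^sup>+\<xi>. \<integral>\<^sup>+r. ennreal (norm (indicator {R..} r *\<^sub>R (cis (x \<bullet> \<xi>) * cubic_gauss i j k r \<xi>))) \<partial>lborel \<partial>lborel) < \<infinity>" .
      qed measurable
      also have "c * (\<integral>r. \<integral>\<xi>. indicator {R..} r *\<^sub>R (cis (x \<bullet> \<xi>) * cubic_gauss i j k r \<xi>) \<partial>lborel \<partial>lborel)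
        = (\<integral>r. indicator {R..} r *\<^sub>R inv_fourier (cubic_gauss i j k r) x \<partial>lborel)"
        unfolding inv_fourier_eq c_def[symmetric]
        by (simp only: integral_mult_right_zero[symmetric] integral_scaleR_right mult_scaleR_right)
      finally show ?thesis .
    qed
    have [measurable]: "(\<lambda>(r, x). inv_fourier (cubic_gauss i j k r) x) \<in> borel_measurable (borel \<Otimes>\<^sub>M borel)"
      unfolding inv_fourier_eq by measurable
    have "FL1 Q \<le> (\<integral>\<^sup>+x. \<integral>\<^sup>+r. indicator {R..} r * ennreal (norm (inv_fourier (cubic_gauss i j k r) x)) \<partial>lborel \<partial>lborel)"
      unfolding FL1_def L1norm_def
    proof (rule nn_integral_mono)
      fix x
      show "ennreal (norm (inv_fourier Q x)) \<le> (\<integral>\<^sup>+r. indicator {R..} r * ennreal (norm (inv_fourier (cubic_gauss i j k r) x)) \<partial>lborel)"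
      proof (cases "integrable lborel (\<lambda>r. indicator {R..} r *\<^sub>R inv_fourier (cubic_gauss i j k r) x)")
        case True
        show ?thesis unfolding Qeq
          by (rule order_trans[OF integral_norm_bound_ennreal[OF True]]) (auto intro!: nn_integral_mono simp: indicator_def)
      next
        case False
        then show ?thesis unfolding Qeq by (simp add: not_integrable_integral_eq)
      qed
    qed
    also have "\<dots> = (\<integral>\<^sup>+r. \<integral>\<^sup>+x. indicator {R..} r * ennreal (norm (inv_fourier (cubic_gauss i j k r) x)) \<partial>lborel \<partial>lborel)"
      by (rule lborel_pair.Fubini'[symmetric]) measurable
    also have "\<dots> = (\<integral>\<^sup>+r. indicator {R..} r * FL1 (cubic_gauss i j k r) \<partial>lborel)"
      unfolding FL1_def L1norm_def by (intro nn_integral_cong nn_integral_cmult) measurable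
    also have "\<dots> \<le> (\<integral>\<^sup>+r. ennreal (D3 * r powr (-3/2)) * indicator {R..} r \<partial>lborel)"
      using D3(2)[of _ i j k] R by (intro nn_integral_mono) (auto simp: indicator_def)
    also have "\<dots> = ennreal (0 - (- 2 * D3 * R powr (-1/2)))"
    proof (rule nn_integral_FTC_atLeast)
      fix r assume "R \<le> r"
      then show "((\<lambda>r. - 2 * D3 * r powr (-1/2)) has_real_derivative D3 * r powr (-3/2)) (at r)"
        using R by (auto intro!: derivative_eq_intros)
      show "0 \<le> D3 * r powr (-3/2)" using D3(1) by simp
    next
      have "((\<lambda>r::real. r powr (-1/2)) \<longlongrightarrow> 0) at_top" by real_asymp
      from tendsto_mult[OF tendsto_const this, of "-2 * D3"]
      show "((\<lambda>r. - 2 * D3 * r powr (-1/2)) \<longlongrightarrow> 0) at_top" by simp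
    qed auto
    finally have FQ: "FL1 Q \<le> ennreal (2 * D3 * R powr (-1/2))" by simp
    have eq: "leray_mult i j k \<xi> * gauss_exp (-R) \<xi>
      = (if i = j then \<i> else 0) * (coordf k \<xi> * gauss_exp (-R) \<xi>) + (-\<i>) * Q \<xi>" for \<xi>
      by (simp add: leray_mult_def leray_symbol_def Q_def coordf_def algebra_simps diff_divide_distrib)
    have "FL1 (\<lambda>\<xi>. leray_mult i j k \<xi> * gauss_exp (-R) \<xi>)
      \<le> FL1 (\<lambda>\<xi>. (if i = j then \<i> else 0) * (coordf k \<xi> * gauss_exp (-R) \<xi>)) + FL1 (\<lambda>\<xi>. (-\<i>) * Q \<xi>)"
      unfolding eq by (intro FL1_add integrable_mult_right integrable_coordf_gauss R Qi)
    also have "\<dots> \<le> FL1 (\<lambda>\<xi>. coordf k \<xi> * gauss_exp (-R) \<xi>) + FL1 Q"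
      by (subst (1 2) FL1_cmult) (auto intro!: add_mono)
    also have "\<dots> \<le> ennreal (D1 * R powr (-1/2)) + ennreal (2 * D3 * R powr (-1/2))"
      by (intro add_mono FQ D1(2) R)
    also have "\<dots> = ennreal ((D1 + 2 * D3) * R powr (-1/2))"
      using D1(1) D3(1) by (simp add: distrib_right flip: ennreal_plus)
    finally show ?thesis .
  qed
  then show ?thesis using D1(1) D3(1) by (intro exI[of _ "D1 + 2 * D3"]) auto
qed

section \<open>Kernels with the fractional heat factor\<close>

lemma integrable_heat_growth:
  assumes t: "t > 0" and \<alpha>: "\<alpha> > 0" and m: "m \<in> borel_measurable borel" "\<And>\<xi>. norm (m \<xi>) \<le> A * (1 + norm \<xi>) ^ p"
  shows "integrable lborel (\<lambda>\<xi>::real^'n::finite. m \<xi> * heat_symbol \<alpha> t \<xi>)"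
proof (rule integrable_growth_exp[OF t, where q="2*\<alpha>" and A=A and p=p])
  show "norm (m \<xi> * heat_symbol \<alpha> t \<xi>) \<le> A * (1 + norm \<xi>) ^ p * exp (- t * norm \<xi> powr (2 * \<alpha>))" for \<xi>
    by (auto simp: norm_mult heat_symbol_def intro!: mult_right_mono m)
qed (use \<alpha> m in auto)

text \<open>Subordination with \<beta> = 1/2. The exponent 1/(2\<alpha>) is below 1 since \<alpha> >
  1/2, which makes the singularity at t = 0 integrable in time.\<close>

lemma FL1_leray_heat:
  assumes a: "1/2 < \<alpha>" "\<alpha> < 1"
  shows "\<exists>C\<ge>0. \<forall>(i::'n::finite) j k. \<forall>t>0. L1norm (leray_kernel \<alpha> i j k t) \<le> ennreal (C * t powr (- (1 / (2 * \<alpha>))))"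
proof -
  obtain D where D: "D \<ge> 0" "\<And>(i::'n) j k R. R > 0 \<Longrightarrow> FL1 (\<lambda>\<xi>. leray_mult i j k \<xi> * gauss_exp (-R) \<xi>) \<le> ennreal (D * R powr (-1/2))"
    using FL1_leray_gauss by blast
  obtain C where Cc: "subordination_const TYPE('n) \<alpha> C" using subordination_const_exists[OF a] by blast
  then have C: "C \<ge> 0" by (simp add: subordination_const_def)
  note sub = subordination_constD[OF Cc]
  have "L1norm (leray_kernel \<alpha> i j k t) \<le> ennreal (C * D * t powr (- (1 / (2 * \<alpha>))))" if t: "t > 0" for i j k :: 'n and t
  proof -
    have "FL1 (\<lambda>\<xi>. leray_mult i j k \<xi> * heat_symbol \<alpha> t \<xi>) \<le> ennreal (C * D * t powr (-(1/2)/\<alpha>))"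
    proof (rule sub[OF _ norm_leray_mult'])
      fix R :: real assume "R > 0"
      then show "FL1 (\<lambda>\<xi>. leray_mult i j k \<xi> * gauss_exp (-R) \<xi>) \<le> ennreal (D * R powr (-(1/2)))"
        using D(2)[of R i j k] by simp
    qed (use D t in auto)
    then show ?thesis unfolding FL1_def leray_kernel_eq by (simp add: mult.commute)
  qed
  then show ?thesis using C D(1) by (intro exI[of _ "C * D"]) auto
qed

lemma leray_kernel_measurable [measurable]:
  "(\<lambda>(t, x). leray_kernel \<alpha> i j k t x) \<in> borel_measurable (borel \<Otimes>\<^sub>M borel)"
  unfolding leray_kernel_eq inv_fourier_eq heat_symbol_def by measurable

lemma leray_kernel_borel [measurable]: "leray_kernel \<alpha> i j k t \<in> borel_measurable borel"
  unfolding leray_kernel_eq by measurable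

text \<open>A low-frequency cutoff at scale \<open>1/r\<close> carries a factor \<open>gauss_exp (-r\<^sup>2)\<close> for free, and the
  Gaussian supplies the decay \<open>1/r\<close> that the derivative in the symbol provides.\<close>

lemma FL1_cutoff_leray_heat:
  fixes \<theta> :: "real^'n::finite \<Rightarrow> complex"
  assumes a: "1/2 < \<alpha>" "\<alpha> < 1" and \<theta>: "test_function \<theta>"
  shows "\<exists>C\<ge>0. \<forall>i j k. \<forall>r>0. \<forall>t>0. L1norm (conv (inv_fourier (\<lambda>\<xi>. \<theta> (r *\<^sub>R \<xi>))) (leray_kernel \<alpha> i j k t)) \<le> ennreal (C / r)"
proof -
  obtain D where D: "D \<ge> 0" "\<And>(i::'n) j k R. R > 0 \<Longrightarrow> FL1 (\<lambda>\<xi>. leray_mult i j k \<xi> * gauss_exp (-R) \<xi>) \<le> ennreal (D * R powr (-1/2))"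
    using FL1_leray_gauss by blast
  obtain C where Cc: "subordination_const TYPE('n) \<alpha> C" using subordination_const_exists[OF a] by blast
  then have C: "C \<ge> 0" by (simp add: subordination_const_def)
  note sub = subordination_constD[OF Cc]
  \<comment> \<open>The growing Gaussian is harmless on the compact support of \<theta>; it
    compensates the factor \<open>gauss_exp (-r\<^sup>2)\<close> that is split off below.\<close>
  define \<eta> where "\<eta> \<xi> = \<theta> \<xi> * gauss_exp 1 \<xi>" for \<xi>
  have \<eta>: "test_function \<eta>"
  proof -
    obtain b where b: "b > 0" "\<And>\<xi>. norm \<xi> > b \<Longrightarrow> \<theta> \<xi> = 0" using test_functionD(2)[OF \<theta>] by blast
    then show ?thesis unfolding \<eta>_def
      using smooth_gauss_exp_mult[OF test_functionD(1)[OF \<theta>]] by (intro test_functionI[of _ b]) auto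
  qed
  have [measurable]: "\<theta> \<in> borel_measurable borel" "\<eta> \<in> borel_measurable borel"
    using test_function_borel \<theta> \<eta> by blast+
  obtain Bt where Bt: "Bt > 0" "\<And>\<xi>. norm (\<theta> \<xi>) \<le> Bt" using test_function_bounded[OF \<theta>] by blast
  define E where "E = enn2real (FL1 \<eta>)"
  have E: "FL1 \<eta> = ennreal E" "E \<ge> 0"
    using wiener_FL1[OF wiener_test_function[OF \<eta>]] by (auto simp: E_def less_top)
  have "L1norm (conv (inv_fourier (\<lambda>\<xi>. \<theta> (r *\<^sub>R \<xi>))) (leray_kernel \<alpha> i j k t)) \<le> ennreal (C * (E * D) / r)"
    if r: "r > 0" and t: "t > 0" for i j k :: 'n and r t :: real
  proof -
    have w: "wiener (\<lambda>\<xi>. \<theta> (r *\<^sub>R \<xi>))" by (intro wiener_test_function test_function_scale \<theta> r)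
    have i: "integrable lborel (\<lambda>\<xi>. leray_mult i j k \<xi> * heat_symbol \<alpha> t \<xi>)"
      by (rule integrable_heat_growth[OF t _ _ norm_leray_mult']) (use a in auto)
    \<comment> \<open>Subordination with \<beta> = 0: its hypothesis is verified with a bound
      independent of R, so the conclusion is independent of t.\<close>
    have "FL1 (\<lambda>\<xi>. (\<theta> (r *\<^sub>R \<xi>) * leray_mult i j k \<xi>) * heat_symbol \<alpha> t \<xi>) \<le> ennreal (C * (E * D / r) * t powr (-0/\<alpha>))"
    proof (rule sub)
      show "norm (\<theta> (r *\<^sub>R \<xi>) * leray_mult i j k \<xi>) \<le> (Bt * 2) * (1 + norm \<xi>) ^ 1" for \<xi>
        unfolding norm_mult mult.assoc using Bt by (intro mult_mono norm_leray_mult') auto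
      fix R :: real assume R: "R > 0"
      have e: "(\<lambda>\<xi>. (\<theta> (r *\<^sub>R \<xi>) * leray_mult i j k \<xi>) * gauss_exp (-R) \<xi>)
        = (\<lambda>\<xi>. \<eta> (r *\<^sub>R \<xi>) * (leray_mult i j k \<xi> * gauss_exp (- (r\<^sup>2 + R)) \<xi>))"
      proof
        fix \<xi> :: "real^'n"
        have "gauss_exp (-R) \<xi> = gauss_exp 1 (r *\<^sub>R \<xi>) * gauss_exp (- (r\<^sup>2 + R)) \<xi>"
          by (simp add: gauss_exp_scale flip: gauss_exp_add)
        then show "(\<theta> (r *\<^sub>R \<xi>) * leray_mult i j k \<xi>) * gauss_exp (-R) \<xi>
          = \<eta> (r *\<^sub>R \<xi>) * (leray_mult i j k \<xi> * gauss_exp (- (r\<^sup>2 + R)) \<xi>)"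
          by (simp add: \<eta>_def mult_ac)
      qed
      have le1: "FL1 (\<lambda>\<xi>. \<eta> (r *\<^sub>R \<xi>) * (leray_mult i j k \<xi> * gauss_exp (- (r\<^sup>2 + R)) \<xi>))
        \<le> FL1 (\<lambda>\<xi>. \<eta> (r *\<^sub>R \<xi>)) * FL1 (\<lambda>\<xi>. leray_mult i j k \<xi> * gauss_exp (- (r\<^sup>2 + R)) \<xi>)"
      proof (rule FL1_mult)
        show "wiener (\<lambda>\<xi>. \<eta> (r *\<^sub>R \<xi>))" by (intro wiener_test_function test_function_scale \<eta> r)
        show "integrable lborel (\<lambda>\<xi>. leray_mult i j k \<xi> * gauss_exp (- (r\<^sup>2 + R)) \<xi>)"
          by (rule integrable_growth_gauss[of "r\<^sup>2 + R", where A=2 and p=1])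
             (use R r norm_leray_mult' in \<open>auto simp: norm_mult gauss_exp_def add_pos_pos intro!: mult_right_mono\<close>)
      qed
      have le2: "FL1 (\<lambda>\<xi>. \<eta> (r *\<^sub>R \<xi>)) * FL1 (\<lambda>\<xi>. leray_mult i j k \<xi> * gauss_exp (- (r\<^sup>2 + R)) \<xi>)
        \<le> ennreal E * ennreal (D * (r\<^sup>2 + R) powr (-1/2))"
        using r R E by (intro mult_mono D) (auto simp: FL1_scale add_pos_pos)
      have le3: "ennreal E * ennreal (D * (r\<^sup>2 + R) powr (-1/2)) \<le> ennreal (E * D / r * R powr - 0)"
      proof -
        have "(r\<^sup>2 + R) powr (-1/2) \<le> (r\<^sup>2) powr (-1/2)" using R r by (intro powr_mono2') auto
        also have "\<dots> = 1 / r" using r powr_minus_divide[of "r\<^sup>2" "1/2"] by (simp add: powr_half_sqrt)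
        finally have "E * (D * (r\<^sup>2 + R) powr (-1/2)) \<le> E * (D * (1 / r))"
          using E D by (intro mult_left_mono) auto
        then show ?thesis using E D R by (auto simp: ennreal_mult[symmetric] intro!: ennreal_leI)
      qed
      show "FL1 (\<lambda>\<xi>. (\<theta> (r *\<^sub>R \<xi>) * leray_mult i j k \<xi>) * gauss_exp (-R) \<xi>) \<le> ennreal (E * D / r * R powr - 0)"
        unfolding e by (rule order_trans[OF le1 order_trans[OF le2 le3]])
    qed (use E D r t in auto)
    then have "FL1 (\<lambda>\<xi>. \<theta> (r *\<^sub>R \<xi>) * (leray_mult i j k \<xi> * heat_symbol \<alpha> t \<xi>)) \<le> ennreal (C * (E * D) / r)"
      using t by (simp add: mult.assoc)
    then show ?thesis
      unfolding FL1_def leray_kernel_eq inv_fourier_mult[OF w i, abs_def] .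
  qed
  then show ?thesis using C E D(1) by (intro exI[of _ "C * (E * D)"]) auto
qed

text \<open>Subordination is used twice. For r >= 1 take \<beta> = 0. For r < 1, since f vanishes
  near 0, one can write f(r\<xi>) = r^2 |\<xi>|^2 g(r\<xi>) with a test function g; the factor
  |\<xi>|^2 costs 1/R against Gaussians, so \<beta> = 1 applies and r^2 is gained. For r = 2^(-l)
  this is the damping of high-frequency blocks by S(t).\<close>

lemma FL1_annulus_heat:
  fixes f :: "real^'n::finite \<Rightarrow> complex"
  assumes a: "1/2 < \<alpha>" "\<alpha> < 1" and f: "test_function f" and c: "c > 0" "\<And>\<xi>. norm \<xi> < c \<Longrightarrow> f \<xi> = 0" and t: "t > 0"
  shows "\<exists>C\<ge>0. \<forall>r>0. FL1 (\<lambda>\<xi>. f (r *\<^sub>R \<xi>) * heat_symbol \<alpha> t \<xi>) \<le> ennreal (C * min 1 (r\<^sup>2))"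
proof -
  obtain C where Cc: "subordination_const TYPE('n) \<alpha> C" using subordination_const_exists[OF a] by blast
  then have C: "C \<ge> 0" by (simp add: subordination_const_def)
  note sub = subordination_constD[OF Cc]
  obtain D where D: "D \<ge> 0" "\<And>R. R>0 \<Longrightarrow> FL1 (\<lambda>\<xi>::real^'n. of_real ((norm \<xi>)\<^sup>2) * gauss_exp (-R) \<xi>) \<le> ennreal (D * R powr (-1))"
    using FL1_norm2_gauss by blast
  define G where "G = enn2real (FL1 (gauss_exp (-1/2) :: real^'n \<Rightarrow> complex))"
  have G: "FL1 (gauss_exp (-1/2) :: real^'n \<Rightarrow> complex) = ennreal G" "G \<ge> 0"
    using wiener_FL1[OF wiener_std_gauss[where 'n='n]] by (auto simp: G_def less_top)
  obtain Bf where Bf: "\<And>\<xi>. norm (f \<xi>) \<le> Bf" using test_function_bounded[OF f] by blast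
  define E where "E = enn2real (FL1 f)"
  have E: "FL1 f = ennreal E" "E \<ge> 0"
    using wiener_FL1[OF wiener_test_function[OF f]] by (auto simp: E_def less_top)
  define g where "g \<xi> = f \<xi> * npowr (-2) \<xi>" for \<xi>
  have g: "test_function g"
  proof -
    obtain b where b: "b > 0" "\<And>\<xi>. norm \<xi> > b \<Longrightarrow> f \<xi> = 0" using test_functionD(2)[OF f] by blast
    then show ?thesis unfolding g_def
      using smooth_npowr_mult[OF test_functionD(1)[OF f] c] by (intro test_functionI[of _ b]) auto
  qed
  define E' where "E' = enn2real (FL1 g)"
  have E': "FL1 g = ennreal E'" "E' \<ge> 0"
    using wiener_FL1[OF wiener_test_function[OF g]] by (auto simp: E'_def less_top)
  have [measurable]: "f \<in> borel_measurable borel" "g \<in> borel_measurable borel"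
    using test_function_borel f g by blast+
  have gf: "f \<xi> = g \<xi> * of_real ((norm \<xi>)\<^sup>2)" for \<xi>
  proof (cases "\<xi> = 0")
    case True
    then show ?thesis using c by simp
  next
    case False
    then have "norm \<xi> powr (-2) * (norm \<xi>)\<^sup>2 = 1" by (simp add: powr_minus_divide powr_numeral)
    then show ?thesis by (simp add: g_def npowr_def mult.assoc flip: of_real_mult of_real_power)
  qed
  define K where "K = C * (E * G) + C * (E' * D) * t powr (-1/\<alpha>)"
  have K: "0 \<le> C * (E * G)" "0 \<le> C * (E' * D) * t powr (-1/\<alpha>)" using C E E' D G by auto
  have "FL1 (\<lambda>\<xi>. f (r *\<^sub>R \<xi>) * heat_symbol \<alpha> t \<xi>) \<le> ennreal (K * min 1 (r\<^sup>2))" if r: "r > 0" for r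
  proof (cases "1 \<le> r\<^sup>2")
    case True
    have "FL1 (\<lambda>\<xi>. f (r *\<^sub>R \<xi>) * heat_symbol \<alpha> t \<xi>) \<le> ennreal (C * (E * G) * t powr (-0/\<alpha>))"
    proof (rule sub)
      show "norm (f (r *\<^sub>R \<xi>)) \<le> Bf * (1 + norm \<xi>) ^ 0" for \<xi> using Bf by simp
      fix R :: real assume R: "R > 0"
      have "FL1 (\<lambda>\<xi>. f (r *\<^sub>R \<xi>) * gauss_exp (-R) \<xi>) \<le> FL1 (\<lambda>\<xi>. f (r *\<^sub>R \<xi>)) * FL1 (gauss_exp (-R) :: real^'n \<Rightarrow> complex)"
        using R r by (intro FL1_mult wiener_test_function test_function_scale f wiener_integrable[OF wiener_gauss]) auto
      also have "\<dots> = ennreal E * ennreal G"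
        using r trans[OF FL1_gauss[OF R] G(1)] by (simp add: FL1_scale E(1))
      also have "\<dots> = ennreal (E * G * R powr - 0)" using E G R by (simp add: ennreal_mult)
      finally show "FL1 (\<lambda>\<xi>. f (r *\<^sub>R \<xi>) * gauss_exp (-R) \<xi>) \<le> ennreal (E * G * R powr - 0)" .
    qed (use E G t in auto)
    also have "\<dots> \<le> ennreal (K * min 1 (r\<^sup>2))"
      using True t K by (intro ennreal_leI) (simp add: K_def)
    finally show ?thesis .
  next
    case False
    have "FL1 (\<lambda>\<xi>. f (r *\<^sub>R \<xi>) * heat_symbol \<alpha> t \<xi>) \<le> ennreal (C * (r\<^sup>2 * (E' * D)) * t powr (-1/\<alpha>))"
    proof (rule sub)
      show "norm (f (r *\<^sub>R \<xi>)) \<le> Bf * (1 + norm \<xi>) ^ 0" for \<xi> using Bf by simp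
      fix R :: real assume R: "R > 0"
      have "(\<lambda>\<xi>. f (r *\<^sub>R \<xi>) * gauss_exp (-R) \<xi>) = (\<lambda>\<xi>. of_real (r\<^sup>2) * (g (r *\<^sub>R \<xi>) * (of_real ((norm \<xi>)\<^sup>2) * gauss_exp (-R) \<xi>)))"
        by (simp add: fun_eq_iff gf power_mult_distrib mult_ac)
      then have "FL1 (\<lambda>\<xi>. f (r *\<^sub>R \<xi>) * gauss_exp (-R) \<xi>)
        = ennreal (r\<^sup>2) * FL1 (\<lambda>\<xi>. g (r *\<^sub>R \<xi>) * (of_real ((norm \<xi>)\<^sup>2) * gauss_exp (-R) \<xi>))"
        by (subst FL1_cmult[symmetric, of _ "of_real (r\<^sup>2)", simplified norm_of_real abs_power2]) auto
      also have "\<dots> \<le> ennreal (r\<^sup>2) * (FL1 (\<lambda>\<xi>. g (r *\<^sub>R \<xi>)) * FL1 (\<lambda>\<xi>::real^'n. of_real ((norm \<xi>)\<^sup>2) * gauss_exp (-R) \<xi>))"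
      proof (intro mult_left_mono FL1_mult wiener_test_function test_function_scale g r)
        show "integrable lborel (\<lambda>\<xi>::real^'n. complex_of_real ((norm \<xi>)\<^sup>2) * gauss_exp (-R) \<xi>)"
        proof (rule integrable_growth_gauss[OF R, where A=1 and p=2])
          fix \<xi> :: "real^'n"
          have "(norm \<xi>)\<^sup>2 \<le> (1 + norm \<xi>)\<^sup>2" by (intro power_mono) auto
          then show "norm (complex_of_real ((norm \<xi>)\<^sup>2) * gauss_exp (-R) \<xi>) \<le> 1 * (1 + norm \<xi>)\<^sup>2 * exp (- R * (norm \<xi>)\<^sup>2)"
            by (simp add: gauss_exp_def norm_mult norm_power)
        qed simp
      qed simp
      also have "\<dots> \<le> ennreal (r\<^sup>2) * (ennreal E' * ennreal (D * R powr (-1)))"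
        using r R E' by (intro mult_mono D) (auto simp: FL1_scale)
      also have "\<dots> = ennreal (r\<^sup>2 * (E' * D) * R powr - 1)" using E' D by (simp add: ennreal_mult[symmetric] mult_ac)
      finally show "FL1 (\<lambda>\<xi>. f (r *\<^sub>R \<xi>) * gauss_exp (-R) \<xi>) \<le> ennreal (r\<^sup>2 * (E' * D) * R powr - 1)" .
    qed (use E' D t in auto)
    also have "\<dots> \<le> ennreal (K * min 1 (r\<^sup>2))"
    proof (rule ennreal_leI)
      have "C * (r\<^sup>2 * (E' * D)) * t powr (-1/\<alpha>) = (C * (E' * D) * t powr (-1/\<alpha>)) * r\<^sup>2"
        by (simp add: mult_ac)
      also have "\<dots> \<le> K * r\<^sup>2" using K by (intro mult_right_mono) (auto simp: K_def)
      finally show "C * (r\<^sup>2 * (E' * D)) * t powr (-1/\<alpha>) \<le> K * min 1 (r\<^sup>2)" using False by (simp add: min_def)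
    qed
    finally show ?thesis .
  qed
  then show ?thesis using K by (intro exI[of _ K]) (auto simp: K_def)
qed

section \<open>The bilinear term\<close>

lemma set_integrable_powr_from_0:
  fixes a t :: real
  assumes "a > -1"
  shows "set_integrable lborel {0<..<t} (\<lambda>s. s powr a)"
proof (cases "t \<ge> 0")
  case True
  have "(\<lambda>s. s powr a) absolutely_integrable_on {0<..t}"
    using integrable_on_powr_from_0'[OF assms True] by (intro nonnegative_absolutely_integrable_1) auto
  then have "set_integrable lebesgue {0<..<t} (\<lambda>s. s powr a)"
    by (rule set_integrable_subset) auto
  then show ?thesis unfolding set_integrable_def by (subst (asm) integrable_completion) measurable
qed (simp add: set_integrable_def)

text \<open>The two endpoint singularities do not meet: on either half of the interval one factor is
  at most its value at t/2, because the exponents are nonpositive.\<close>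

lemma set_integrable_beta:
  fixes a b t :: real
  assumes "a > -1" "b > -1" "a \<le> 0" "b \<le> 0" "t > 0"
  shows "set_integrable lborel {0<..<t} (\<lambda>s. (t - s) powr a * s powr b)"
proof -
  have "set_integrable lborel {0<..<t} (\<lambda>s. (t - s) powr a)"
  proof -
    have "integrable lborel (\<lambda>s. indicator {0<..<t} (t - s) *\<^sub>R (t - s) powr a)"
      using integrable_lborel_reflect[OF set_integrable_powr_from_0[OF assms(1), of t, unfolded set_integrable_def], of t] .
    moreover have "indicator {0<..<t} (t - s) = (indicator {0<..<t} s :: real)" for s
      by (auto simp: indicator_def)
    ultimately show ?thesis by (simp add: set_integrable_def)
  qed
  then have "set_integrable lborel {0<..<t} (\<lambda>s. (t/2) powr b * (t - s) powr a + (t/2) powr a * s powr b)"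
    by (intro set_integral_add(1) set_integrable_mult_right set_integrable_powr_from_0 assms(2))
  then show ?thesis
  proof (rule set_integrable_bound)
    show "AE s in lborel. s \<in> {0<..<t} \<longrightarrow> norm ((t - s) powr a * s powr b) \<le> norm ((t/2) powr b * (t - s) powr a + (t/2) powr a * s powr b)"
    proof (intro AE_I2 impI)
      fix s assume s: "s \<in> {0<..<t}"
      have "(t - s) powr a * s powr b \<le> (t/2) powr b * (t - s) powr a + (t/2) powr a * s powr b"
      proof (cases "s \<le> t/2")
        case True
        have "(t - s) powr a \<le> (t/2) powr a" using True s assms by (intro powr_mono2') auto
        then have "(t - s) powr a * s powr b \<le> (t/2) powr a * s powr b" by (intro mult_right_mono) auto
        then show ?thesis by (simp add: add_increasing)
      next
        case False
        have "s powr b \<le> (t/2) powr b" using False s assms by (intro powr_mono2') auto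
        then have "(t - s) powr a * s powr b \<le> (t - s) powr a * (t/2) powr b" by (intro mult_left_mono) auto
        then show ?thesis by (simp add: add_increasing2 mult.commute)
      qed
      then show "norm ((t - s) powr a * s powr b) \<le> norm ((t/2) powr b * (t - s) powr a + (t/2) powr a * s powr b)"
        by simp
    qed
  qed (simp add: set_borel_measurable_def)
qed

text \<open>Should \<open>g\<close> fail to be integrable, its integral is 0, and \<open>b\<close>
  is nonnegative on \<open>A\<close> since it dominates a norm.\<close>

lemma norm_set_integral_le:
  fixes g :: "real \<Rightarrow> complex"
  assumes b: "set_integrable lborel A b" and gb: "\<And>s. s \<in> A \<Longrightarrow> norm (g s) \<le> b s"
  shows "norm (LBINT s:A. g s) \<le> (LBINT s:A. b s)"
proof (cases "set_integrable lborel A g")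
  case True
  show ?thesis unfolding set_lebesgue_integral_def
    by (rule Bochner_Integration.integral_norm_bound_integral)
       (use True b gb in \<open>auto simp: set_integrable_def indicator_def\<close>)
next
  case False
  have "0 \<le> b s" if "s \<in> A" for s using gb[OF that] norm_ge_zero order_trans by blast
  then have "0 \<le> (LBINT s:A. b s)" unfolding set_lebesgue_integral_def
    by (intro integral_nonneg_AE) (auto simp: indicator_def)
  then show ?thesis using False by (simp add: set_lebesgue_integral_def set_integrable_def not_integrable_integral_eq)
qed

lemma conv_time_integral:
  fixes W :: "'a::euclidean_space \<Rightarrow> real \<Rightarrow> complex"
  assumes [measurable]: "(\<lambda>(x, s). W x s) \<in> borel_measurable (borel \<Otimes>\<^sub>M borel)" "\<kappa> \<in> borel_measurable borel" "A \<in> sets borel"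
    and b: "set_integrable lborel A b" and Wb: "\<And>x s. s \<in> A \<Longrightarrow> norm (W x s) \<le> b s"
    and k: "L1norm \<kappa> < \<infinity>"
  shows "conv \<kappa> (\<lambda>x. LBINT s:A. W x s) x = (LBINT s:A. conv \<kappa> (\<lambda>x. W x s) x)"
proof -
  have [measurable]: "(\<lambda>s. indicator A s * b s) \<in> borel_measurable borel"
    using borel_measurable_integrable[OF b[unfolded set_integrable_def]] by simp
  have "conv \<kappa> (\<lambda>x. LBINT s:A. W x s) x = (\<integral>y. \<integral>s. \<kappa> (x - y) * (indicator A s *\<^sub>R W y s) \<partial>lborel \<partial>lborel)"
    by (simp only: conv_def set_lebesgue_integral_def integral_mult_right_zero)
  also have "\<dots> = (\<integral>s. \<integral>y. \<kappa> (x - y) * (indicator A s *\<^sub>R W y s) \<partial>lborel \<partial>lborel)"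
  proof (rule lborel_fubini_swap)
    have "(\<integral>\<^sup>+y. \<integral>\<^sup>+s. ennreal (norm (\<kappa> (x - y) * (indicator A s *\<^sub>R W y s))) \<partial>lborel \<partial>lborel)
      \<le> (\<integral>\<^sup>+y. \<integral>\<^sup>+s. ennreal (norm (\<kappa> (x - y))) * ennreal (norm (indicator A s * b s)) \<partial>lborel \<partial>lborel)"
    proof (intro nn_integral_mono)
      fix y s
      show "ennreal (norm (\<kappa> (x - y) * (indicator A s *\<^sub>R W y s))) \<le> ennreal (norm (\<kappa> (x - y))) * ennreal (norm (indicator A s * b s))"
      proof (cases "s \<in> A")
        case True
        then show ?thesis using Wb[OF True, of y]
          by (auto simp: norm_mult ennreal_mult[symmetric] intro!: ennreal_leI mult_left_mono)
      qed simp
    qed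
    also have "\<dots> = L1norm \<kappa> * (\<integral>\<^sup>+s. ennreal (norm (indicator A s * b s)) \<partial>lborel)"
      by (simp add: nn_integral_cmult nn_integral_multc L1norm_translate)
    also have "\<dots> < \<infinity>"
      using k b by (simp add: set_integrable_def integrable_iff_bounded ennreal_mult_less_top)
    finally show "(\<integral>\<^sup>+y. \<integral>\<^sup>+s. ennreal (norm (\<kappa> (x - y) * (indicator A s *\<^sub>R W y s))) \<partial>lborel \<partial>lborel) < \<infinity>" .
  qed measurable
  also have "\<dots> = (LBINT s:A. conv \<kappa> (\<lambda>x. W x s) x)"
    unfolding conv_def set_lebesgue_integral_def by simp
  finally show ?thesis .
qed

lemma norm_conv_le_real:
  assumes "f \<in> borel_measurable borel" "g \<in> borel_measurable borel"
    and "AE y in lborel. norm (g y) \<le> B" "0 \<le> B" "L1norm f \<le> ennreal K" "0 \<le> K"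
  shows "norm (conv f g x) \<le> K * B"
proof -
  have "ennreal (norm (conv f g x)) \<le> L1norm f * ennreal B" by (rule norm_conv_le[OF assms(1-4)])
  also have "\<dots> \<le> ennreal K * ennreal B" by (intro mult_right_mono assms) simp
  also have "\<dots> = ennreal (K * B)" using assms by (simp add: ennreal_mult)
  finally show ?thesis using assms by (simp add: ennreal_le_iff)
qed

lemma GX_bound:
  assumes u: "u \<in> GX \<alpha>"
  obtains G where "G \<ge> 0" "\<And>s. s > 0 \<Longrightarrow> AE x in lborel. norm (u x s) \<le> G * s powr (- (1 - 1 / (2 * \<alpha>)))"
proof -
  define G where "G = enn2real (GX_norm \<alpha> u)"
  have G: "GX_norm \<alpha> u = ennreal G" using u by (simp add: GX_def G_def less_top)
  have "AE x in lborel. norm (u x s) \<le> G * s powr (- (1 - 1 / (2 * \<alpha>)))" if s: "s > 0" for s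
  proof -
    define p where "p = s powr (1 - 1 / (2 * \<alpha>))"
    have p: "p > 0" using s by (simp add: p_def)
    have "ennreal p * Linf_norm (\<lambda>x. u x s) \<le> ennreal G"
      unfolding G[symmetric] GX_norm_def p_def using s by (intro SUP_upper2[of s]) auto
    then have "ennreal (1 / p) * (ennreal p * Linf_norm (\<lambda>x. u x s)) \<le> ennreal (1 / p) * ennreal G"
      by (rule mult_left_mono) simp
    also have "ennreal (1 / p) * (ennreal p * Linf_norm (\<lambda>x. u x s)) = Linf_norm (\<lambda>x. u x s)"
      using p by (simp add: mult.assoc[symmetric] ennreal_mult[symmetric])
    also have "ennreal (1 / p) * ennreal G = ennreal (G / p)"
      using p by (subst ennreal_mult[symmetric]) (auto simp: G_def)
    finally have le: "Linf_norm (\<lambda>x. u x s) \<le> ennreal (G / p)" .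
    have "AE x in lborel. ennreal (norm (u x s)) \<le> Linf_norm (\<lambda>x. u x s)"
      unfolding Linf_norm_def by (rule esssup_AE)
    then show ?thesis
    proof eventually_elim
      fix x assume "ennreal (norm (u x s)) \<le> Linf_norm (\<lambda>x. u x s)"
      then have "ennreal (norm (u x s)) \<le> ennreal (G / p)" using le order_trans by blast
      moreover have "0 \<le> G / p" using p by (simp add: G_def)
      ultimately have "norm (u x s) \<le> G / p" by (simp add: ennreal_le_iff)
      also have "G / p = G * s powr (- (1 - 1 / (2 * \<alpha>)))"
        by (simp only: p_def powr_minus divide_inverse)
      finally show "norm (u x s) \<le> G * s powr (- (1 - 1 / (2 * \<alpha>)))" .
    qed
  qed
  then show thesis by (intro that[of G]) (auto simp: G_def)
qed

text \<open>Extension by zero to times s <= 0 turns measurability on the half-space into joint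
  measurability on the product, as Fubini requires.\<close>

lemma GX_measurable:
  assumes u: "u \<in> GX \<alpha>"
  shows "(\<lambda>(x, s). indicator {0<..} s *\<^sub>R u x s) \<in> borel_measurable (borel \<Otimes>\<^sub>M borel)"
proof -
  have "(\<lambda>(x, t). u x t) \<in> borel_measurable (restrict_space borel (UNIV \<times> {0<..}))"
    using u by (simp add: GX_def)
  then have "(\<lambda>z. indicator (UNIV \<times> {0<..}) z *\<^sub>R (case z of (x, t) \<Rightarrow> u x t)) \<in> borel_measurable borel"
    by (subst (asm) borel_measurable_restrict_space_iff) (auto simp: borel_Times[of UNIV "{0<..}", simplified])
  also have "(\<lambda>z. indicator (UNIV \<times> {0<..}) z *\<^sub>R (case z of (x, t) \<Rightarrow> u x t)) = (\<lambda>(x, s). indicator {0<..} s *\<^sub>R u x s)"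
    by (auto simp: fun_eq_iff indicator_def)
  finally show ?thesis by (simp add: borel_prod)
qed

text \<open>The quadratic term contributes s^(1/\<alpha> - 2) and the kernel (t -
  s)^(-1/(2\<alpha>)). The first exponent exceeds -1 because \<alpha> < 1, the second because
  \<alpha> > 1/2. Under the cutoff the kernel bound C/r is independent of t - s, so that only the
  power of s is left to integrate.\<close>

lemma V_nabla_leray_bounds:
  fixes u :: "real^'n::finite \<Rightarrow> real \<Rightarrow> real^'n"
  assumes a: "1/2 < \<alpha>" "\<alpha> < 1" and u: "u \<in> GX \<alpha>" and t: "t > 0"
  defines "V \<equiv> \<lambda>i x. V_nabla_leray \<alpha> (tensor u u) x t $ i"
  shows "V i \<in> borel_measurable borel"
    and "\<exists>B\<ge>0. \<forall>x. norm (V i x) \<le> B"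
    and "test_function \<theta> \<Longrightarrow> \<exists>C\<ge>0. \<forall>r>0. \<forall>x. norm (conv (inv_fourier (\<lambda>\<xi>. \<theta> (r *\<^sub>R \<xi>))) (V i) x) \<le> C / r"
proof -
  obtain G where G: "G \<ge> 0" and uG: "\<And>s. s > 0 \<Longrightarrow> AE x in lborel. norm (u x s) \<le> G * s powr (- (1 - 1 / (2 * \<alpha>)))"
    using GX_bound[OF u] by blast
  obtain C where C: "C \<ge> 0" and K: "\<And>(i::'n) j k t. t > 0 \<Longrightarrow> L1norm (leray_kernel \<alpha> i j k t) \<le> ennreal (C * t powr (- (1 / (2 * \<alpha>))))"
    using FL1_leray_heat[OF a] by blast
  define U where "U y s = (indicator {0<..} s *\<^sub>R u y s :: real^'n)" for y s
  have [measurable]: "(\<lambda>(y, s). U y s) \<in> borel_measurable (borel \<Otimes>\<^sub>M borel)"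
    unfolding U_def by (rule GX_measurable[OF u])
  define Uc where "Uc j y s = U y s $ j" for j y s
  have [measurable]: "(\<lambda>(y, s). Uc j y s) \<in> borel_measurable (borel \<Otimes>\<^sub>M borel)" for j
  proof -
    have "(\<lambda>v::real^'n. v $ j) \<in> borel_measurable borel" by measurable
    then have "(\<lambda>z. (case z of (y, s) \<Rightarrow> U y s) $ j) \<in> borel_measurable (borel \<Otimes>\<^sub>M borel)"
      by (rule measurable_compose[rotated]) measurable
    then show ?thesis by (simp add: Uc_def split_beta)
  qed
  define f where "f j k s y = complex_of_real (Uc j y s * Uc k y s)" for j k s y
  have fm [measurable]: "(\<lambda>(s, y). f j k s y) \<in> borel_measurable (borel \<Otimes>\<^sub>M borel)" for j k
    unfolding f_def by measurable
  have fm1 [measurable]: "f j k s \<in> borel_measurable borel" for j k s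
    unfolding f_def by measurable
  define \<beta> where "\<beta> = -2 + 1 / \<alpha>"
  have \<beta>: "\<beta> > -1" "\<beta> \<le> 0"
    using a by (auto simp: \<beta>_def field_simps)
  have \<gamma>: "- (1 / (2 * \<alpha>)) > -1" "- (1 / (2 * \<alpha>)) \<le> 0" using a by (auto simp: field_simps)
  have fb: "AE y in lborel. norm (f j k s y) \<le> G\<^sup>2 * s powr \<beta>" if s: "s > 0" for j k s
    using uG[OF s]
  proof eventually_elim
    fix y assume le: "norm (u y s) \<le> G * s powr (- (1 - 1 / (2 * \<alpha>)))"
    have "norm (f j k s y) = \<bar>u y s $ j\<bar> * \<bar>u y s $ k\<bar>" using s by (simp add: f_def Uc_def U_def norm_mult)
    also have "\<dots> \<le> (G * s powr (- (1 - 1 / (2 * \<alpha>)))) * (G * s powr (- (1 - 1 / (2 * \<alpha>))))"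
      using G by (intro mult_mono order_trans[OF component_le_norm_cart le]) auto
    also have "\<dots> = G\<^sup>2 * (s powr (- (1 - 1 / (2 * \<alpha>))) * s powr (- (1 - 1 / (2 * \<alpha>))))"
      by (simp add: power2_eq_square mult_ac)
    also have "s powr (- (1 - 1 / (2 * \<alpha>))) * s powr (- (1 - 1 / (2 * \<alpha>))) = s powr \<beta>"
      unfolding powr_add[symmetric] \<beta>_def by (rule arg_cong[where f="\<lambda>e. s powr e"]) (use a in \<open>simp add: field_simps\<close>)
    finally show "norm (f j k s y) \<le> G\<^sup>2 * s powr \<beta>" .
  qed
  define W where "W j k x s = conv (leray_kernel \<alpha> i j k (t - s)) (f j k s) x" for j k x s
  have Wm [measurable]: "(\<lambda>(x, s). W j k x s) \<in> borel_measurable (borel \<Otimes>\<^sub>M borel)" for j k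
    unfolding W_def conv_def by measurable
  have Vi: "V i x = (LBINT s:{0<..<t}. (\<Sum>j\<in>UNIV. \<Sum>k\<in>UNIV. W j k x s))" for x
    unfolding V_def V_nabla_leray_def
    by (simp, intro set_lebesgue_integral_cong) (auto simp: W_def conv_def f_def Uc_def U_def tensor_def)
  \<comment> \<open>The factor \<open>(real CARD('n))\<^sup>2\<close> counts the pairs (j,
    k).\<close>
  define b where "b s = (real CARD('n))\<^sup>2 * (C * (G\<^sup>2 * ((t - s) powr (- (1 / (2 * \<alpha>))) * s powr \<beta>)))" for s
  have b: "set_integrable lborel {0<..<t} b"
    unfolding b_def using \<beta> \<gamma> t by (intro set_integrable_mult_right set_integrable_beta) auto
  have Wb: "norm (\<Sum>j\<in>UNIV. \<Sum>k\<in>UNIV. W j k x s) \<le> b s" if s: "s \<in> {0<..<t}" for x s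
  proof -
    have "norm (W j k x s) \<le> (C * (t - s) powr (- (1 / (2 * \<alpha>)))) * (G\<^sup>2 * s powr \<beta>)" for j k
      unfolding W_def using s C G fb[of s j k] K[of "t - s" i j k] by (intro norm_conv_le_real) auto
    then have "(\<Sum>j\<in>UNIV. \<Sum>k\<in>UNIV. norm (W j k x s)) \<le> (\<Sum>j\<in>(UNIV::'n set). \<Sum>k\<in>(UNIV::'n set). (C * (t - s) powr (- (1 / (2 * \<alpha>)))) * (G\<^sup>2 * s powr \<beta>))"
      by (intro sum_mono)
    also have "\<dots> = b s" by (simp add: b_def power2_eq_square mult_ac)
    finally show ?thesis
      by (intro order_trans[OF norm_sum] order_trans[OF sum_mono[OF norm_sum]]) auto
  qed
  show "V i \<in> borel_measurable borel"
    unfolding Vi[abs_def] set_lebesgue_integral_def by measurable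
  show "\<exists>B\<ge>0. \<forall>x. norm (V i x) \<le> B"
  proof (intro exI conjI allI)
    show "norm (V i x) \<le> (LBINT s:{0<..<t}. b s)" for x
      unfolding Vi by (rule norm_set_integral_le[OF b Wb])
    then show "0 \<le> (LBINT s:{0<..<t}. b s)" using norm_ge_zero order_trans by blast
  qed
  show "\<exists>C\<ge>0. \<forall>r>0. \<forall>x. norm (conv (inv_fourier (\<lambda>\<xi>. \<theta> (r *\<^sub>R \<xi>))) (V i) x) \<le> C / r" if \<theta>: "test_function \<theta>"
  proof -
    obtain C' where C': "C' \<ge> 0" and K': "\<And>i j k r t. r > 0 \<Longrightarrow> t > 0 \<Longrightarrow> L1norm (conv (inv_fourier (\<lambda>\<xi>. \<theta> (r *\<^sub>R \<xi>))) (leray_kernel \<alpha> i j k t)) \<le> ennreal (C' / r)"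
      using FL1_cutoff_leray_heat[OF a \<theta>] by blast
    have [measurable]: "\<theta> \<in> borel_measurable borel" using test_function_borel[OF \<theta>] .
    define c where "c s = (real CARD('n))\<^sup>2 * (C' * (G\<^sup>2 * s powr \<beta>))" for s
    have c: "set_integrable lborel {0<..<t} c"
      unfolding c_def using \<beta> t by (intro set_integrable_mult_right set_integrable_powr_from_0) auto
    have "norm (conv (inv_fourier (\<lambda>\<xi>. \<theta> (r *\<^sub>R \<xi>))) (V i) x) \<le> (LBINT s:{0<..<t}. c s) / r" if r: "r > 0" for r x
    proof -
      define \<kappa> where "\<kappa> = inv_fourier (\<lambda>\<xi>. \<theta> (r *\<^sub>R \<xi>))"
      have [measurable]: "\<kappa> \<in> borel_measurable borel" unfolding \<kappa>_def by measurable
      have \<kappa>: "L1norm \<kappa> < \<infinity>"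
        unfolding \<kappa>_def FL1_def[symmetric] by (intro wiener_FL1 wiener_test_function test_function_scale \<theta> r)
      have "conv \<kappa> (V i) x = (LBINT s:{0<..<t}. conv \<kappa> (\<lambda>x. \<Sum>j\<in>UNIV. \<Sum>k\<in>UNIV. W j k x s) x)"
        unfolding Vi[abs_def] by (rule conv_time_integral[OF _ _ _ b Wb \<kappa>]) measurable
      also have "norm \<dots> \<le> (LBINT s:{0<..<t}. c s / r)"
      proof (rule norm_set_integral_le)
        show "set_integrable lborel {0<..<t} (\<lambda>s. c s / r)" using c by (intro set_integrable_divide) auto
        fix s assume s: "s \<in> {0<..<t}"
        have Wi: "integrable lborel (\<lambda>y. \<kappa> (x - y) * W j k y s)" for j k
        proof (rule conv_bounded_integrable[OF _ _ _ \<kappa>])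
          show "AE y in lborel. norm (W j k y s) \<le> (C * (t - s) powr (- (1 / (2 * \<alpha>)))) * (G\<^sup>2 * s powr \<beta>)"
            unfolding W_def using s C G fb[of s j k] K[of "t - s" i j k]
            by (intro AE_I2, intro norm_conv_le_real) auto
        qed measurable
        have "conv \<kappa> (\<lambda>x. \<Sum>j\<in>UNIV. \<Sum>k\<in>UNIV. W j k x s) x = (\<Sum>j\<in>UNIV. \<Sum>k\<in>UNIV. conv \<kappa> (\<lambda>x. W j k x s) x)"
          unfolding conv_def sum_distrib_left
          by (simp add: Bochner_Integration.integral_sum Bochner_Integration.integrable_sum Wi)
        also have "norm \<dots> \<le> (\<Sum>j\<in>UNIV. \<Sum>k\<in>UNIV. norm (conv \<kappa> (\<lambda>x. W j k x s) x))"
          by (intro order_trans[OF norm_sum] order_trans[OF sum_mono[OF norm_sum]]) auto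
        also have "\<dots> \<le> (\<Sum>j\<in>(UNIV::'n set). \<Sum>k\<in>(UNIV::'n set). C' / r * (G\<^sup>2 * s powr \<beta>))"
        proof (intro sum_mono)
          fix j k
          \<comment> \<open>Associativity puts the cutoff onto the kernel, where it gains the factor
            1/r.\<close>
          have "conv \<kappa> (\<lambda>x. W j k x s) x = conv (conv \<kappa> (leray_kernel \<alpha> i j k (t - s))) (f j k s) x"
            unfolding W_def
          proof (rule conv_assoc[OF _ _ _ \<kappa> _ fb])
            show "L1norm (leray_kernel \<alpha> i j k (t - s)) < \<infinity>"
              using K[of "t - s" i j k] s by (auto intro: le_less_trans)
          qed (use s in auto)
          moreover have "norm (conv (conv \<kappa> (leray_kernel \<alpha> i j k (t - s))) (f j k s) x) \<le> C' / r * (G\<^sup>2 * s powr \<beta>)"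
            using s K'[OF r, of "t - s" i j k] C' r
            by (intro norm_conv_le_real fb) (auto simp: \<kappa>_def)
          ultimately show "norm (conv \<kappa> (\<lambda>x. W j k x s) x) \<le> C' / r * (G\<^sup>2 * s powr \<beta>)" by simp
        qed
        also have "\<dots> = c s / r" by (simp add: c_def power2_eq_square mult_ac)
        finally show "norm (conv \<kappa> (\<lambda>x. \<Sum>j\<in>UNIV. \<Sum>k\<in>UNIV. W j k x s) x) \<le> c s / r" .
      qed
      finally show ?thesis by (simp add: \<kappa>_def)
    qed
    moreover have "0 \<le> (LBINT s:{0<..<t}. c s)"
      unfolding set_lebesgue_integral_def using C' by (intro integral_nonneg_AE) (auto simp: c_def indicator_def)
    ultimately show ?thesis by blast
  qed
qed

section \<open>Multipliers of tempered distributions\<close>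

lemma schwartzD:
  assumes "\<psi> \<in> schwartz"
  shows "smooth \<psi>" "\<exists>B. \<forall>x. (1 + norm x) ^ N * norm (iter_partial ks \<psi> x) \<le> B"
proof -
  show "smooth \<psi>" using assms by (simp add: schwartz_def)
  have "bounded (range (\<lambda>x. (1 + norm x) ^ N *\<^sub>R iter_partial ks \<psi> x))"
    using assms unfolding schwartz_def by blast
  then show "\<exists>B. \<forall>x. (1 + norm x) ^ N * norm (iter_partial ks \<psi> x) \<le> B"
    by (auto simp: bounded_iff)
qed

lemma schwartzI:
  assumes "smooth \<psi>" "\<And>N ks. \<exists>B. \<forall>x. (1 + norm x) ^ N * norm (iter_partial ks \<psi> x) \<le> B"
  shows "\<psi> \<in> schwartz"
proof -
  have "bounded (range (\<lambda>x. (1 + norm x) ^ N *\<^sub>R iter_partial ks \<psi> x))" for N ks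
    using assms(2)[of N ks] by (auto simp: bounded_iff)
  then show ?thesis using assms(1) by (simp add: schwartz_def)
qed

lemma schwartz_iter_bound:
  assumes "\<psi> \<in> schwartz"
  shows "\<exists>B\<ge>0. \<forall>ks x. length ks \<le> L \<longrightarrow> (1 + norm x) ^ N * norm (iter_partial ks \<psi> x) \<le> B"
proof -
  have "\<forall>ks. \<exists>B. \<forall>x. (1 + norm x) ^ N * norm (iter_partial ks \<psi> x) \<le> B"
    using schwartzD(2)[OF assms] by blast
  then obtain B where B: "\<And>ks x. (1 + norm x) ^ N * norm (iter_partial ks \<psi> x) \<le> B ks" by metis
  have B0: "0 \<le> B ks" for ks using B[of 0 ks] by (meson norm_ge_zero order_trans mult_nonneg_nonneg zero_le_power add_nonneg_nonneg zero_le_one)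
  have fin: "finite {ks::'a list. length ks \<le> L}"
    using finite_lists_length_le[of "UNIV :: 'a set" L] by simp
  have "(1 + norm x) ^ N * norm (iter_partial ks \<psi> x) \<le> sum B {ks. length ks \<le> L}" if "length ks \<le> L" for ks x
    by (rule order_trans[OF B], rule member_le_sum) (use that B0 fin in auto)
  then show ?thesis using B0 by (intro exI[of _ "sum B {ks. length ks \<le> L}"]) (auto intro!: sum_nonneg)
qed

lemma iter_partial_differentiable: "smooth f \<Longrightarrow> iter_partial ks f differentiable (at x)"
  by (auto simp: smooth_iff_smooth_on smooth_on_def)

lemma iter_partial_add:
  fixes f g :: "real^'n::finite \<Rightarrow> complex"
  assumes "smooth f" "smooth g"
  shows "iter_partial ks (\<lambda>x. f x + g x) = (\<lambda>x. iter_partial ks f x + iter_partial ks g x)"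
proof (induction ks)
  case (Cons k ks)
  have "partial k (\<lambda>x. iter_partial ks f x + iter_partial ks g x) x
      = partial k (iter_partial ks f) x + partial k (iter_partial ks g) x" for x
    unfolding partial_def[of k "iter_partial ks f"] partial_def[of k "iter_partial ks g"]
    by (rule partial_eqI, rule has_derivative_add)
       (use iter_partial_differentiable assms frechet_derivative_works in blast)+
  then show ?case unfolding iter_partial_simps Cons.IH by (simp add: fun_eq_iff)
qed simp

lemma iter_partial_cmult:
  fixes f :: "real^'n::finite \<Rightarrow> complex"
  assumes "smooth f"
  shows "iter_partial ks (\<lambda>x. c * f x) = (\<lambda>x. c * iter_partial ks f x)"
proof (induction ks)
  case (Cons k ks)
  have "partial k (\<lambda>x. c * iter_partial ks f x) x = c * partial k (iter_partial ks f) x" for x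
    unfolding partial_def[of k "iter_partial ks f"]
    by (rule partial_eqI, rule has_derivative_mult_right)
       (use iter_partial_differentiable assms frechet_derivative_works in blast)+
  then show ?case unfolding iter_partial_simps Cons.IH by (simp add: fun_eq_iff)
qed simp

lemma schwartz_add:
  assumes "f \<in> schwartz" "g \<in> schwartz" shows "(\<lambda>x. f x + g x) \<in> schwartz"
proof (rule schwartzI)
  show "smooth (\<lambda>x. f x + g x)" using assms schwartzD(1) smooth_add by blast
  fix N ks
  obtain A where A: "\<And>x. (1 + norm x) ^ N * norm (iter_partial ks f x) \<le> A" using schwartzD(2)[OF assms(1)] by blast
  obtain B where B: "\<And>x. (1 + norm x) ^ N * norm (iter_partial ks g x) \<le> B" using schwartzD(2)[OF assms(2)] by blast
  have "(1 + norm x) ^ N * norm (iter_partial ks f x + iter_partial ks g x) \<le> A + B" for x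
    using mult_left_mono[OF norm_triangle_ineq[of "iter_partial ks f x" "iter_partial ks g x"], of "(1 + norm x) ^ N"] A[of x] B[of x]
    by (simp add: distrib_left)
  then show "\<exists>B. \<forall>x. (1 + norm x) ^ N * norm (iter_partial ks (\<lambda>x. f x + g x) x) \<le> B"
    unfolding iter_partial_add[OF schwartzD(1)[OF assms(1)] schwartzD(1)[OF assms(2)]] by blast
qed

lemma schwartz_cmult:
  assumes "f \<in> schwartz" shows "(\<lambda>x. c * f x) \<in> schwartz"
proof (rule schwartzI)
  show "smooth (\<lambda>x. c * f x)" using assms schwartzD(1) smooth_cmult by blast
  fix N ks
  obtain A where A: "\<And>x. (1 + norm x) ^ N * norm (iter_partial ks f x) \<le> A" using schwartzD(2)[OF assms(1)] by blast
  have "(1 + norm x) ^ N * norm (c * iter_partial ks f x) \<le> norm c * A" for x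
    using mult_left_mono[OF A[of x], of "norm c"] by (simp add: norm_mult mult_ac)
  then show "\<exists>B. \<forall>x. (1 + norm x) ^ N * norm (iter_partial ks (\<lambda>x. c * f x) x) \<le> B"
    unfolding iter_partial_cmult[OF schwartzD(1)[OF assms(1)]] by blast
qed

lemma iter_partial_reflect:
  assumes "smooth f"
  shows "iter_partial ks (\<lambda>y. f (x - y)) = (\<lambda>y. (-1) ^ length ks * iter_partial ks f (x - y) :: complex)"
proof (induction ks)
  case (Cons k ks)
  have "partial k (\<lambda>y. (-1) ^ length ks * iter_partial ks f (x - y)) y = (-1) ^ Suc (length ks) * partial k (iter_partial ks f) (x - y)" for y
  proof -
    have D: "(iter_partial ks f has_derivative frechet_derivative (iter_partial ks f) (at (x - y))) (at (x - y))"
      using iter_partial_differentiable[OF assms] frechet_derivative_works by blast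
    have "((\<lambda>y. iter_partial ks f (x - y)) has_derivative (\<lambda>h. frechet_derivative (iter_partial ks f) (at (x - y)) (- h))) (at y)"
      by (rule has_derivative_compose[where f="\<lambda>y. x - y", OF _ D]) (auto intro!: derivative_eq_intros)
    from has_derivative_mult_right[OF this, of "(-1) ^ length ks"] show ?thesis
      using linear_neg[OF has_derivative_linear[OF D]]
      by (subst partial_eqI) (auto simp: partial_def)
  qed
  then show ?case unfolding iter_partial_simps Cons.IH by (simp add: fun_eq_iff)
qed simp

lemma smooth_reflect:
  fixes f :: "real^'n::finite \<Rightarrow> complex"
  assumes "smooth f" shows "smooth (\<lambda>y. f (x - y))"
  unfolding smooth_iff_smooth_on smooth_on_def iter_partial_reflect[OF assms]
proof (intro allI ballI)
  fix ks y
  have "(\<lambda>y. iter_partial ks f (x - y)) differentiable (at y)"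
    by (rule differentiable_chain_at[where g="iter_partial ks f" and f="\<lambda>y. x - y", unfolded o_def])
       (auto intro!: iter_partial_differentiable[OF assms] derivative_intros)
  then show "(\<lambda>y. (-1) ^ length ks * iter_partial ks f (x - y)) differentiable (at y)"
    by (intro derivative_intros)
qed

text \<open>Peetre's inequality: it transfers a polynomial weight through a translation.\<close>

lemma one_plus_norm_triangle: "1 + norm z \<le> (1 + norm y) * (1 + norm (y - z :: 'a::real_normed_vector))"
proof -
  have "norm z \<le> norm y + norm (y - z)" using norm_triangle_ineq4[of y "y - z"] by simp
  moreover have "0 \<le> norm y * norm (y - z)" by simp
  moreover have "(1 + norm y) * (1 + norm (y - z)) = 1 + norm y + norm (y - z) + norm y * norm (y - z)"
    by (simp add: algebra_simps)
  ultimately show ?thesis by linarith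
qed

lemma schwartz_reflect:
  assumes "f \<in> schwartz" shows "(\<lambda>y. f (x - y)) \<in> schwartz"
proof (rule schwartzI)
  have s: "smooth f" using assms schwartzD(1) by blast
  then show "smooth (\<lambda>y. f (x - y))" by (rule smooth_reflect)
  fix N ks
  obtain A where A: "\<And>x. (1 + norm x) ^ N * norm (iter_partial ks f x) \<le> A" using schwartzD(2)[OF assms(1)] by blast
  have "(1 + norm y) ^ N * norm ((-1) ^ length ks * iter_partial ks f (x - y)) \<le> (1 + norm x) ^ N * A" for y
  proof -
    have "(1 + norm y) ^ N \<le> ((1 + norm x) * (1 + norm (x - y))) ^ N"
      by (intro power_mono one_plus_norm_triangle) auto
    then have "(1 + norm y) ^ N * norm (iter_partial ks f (x - y)) \<le> ((1 + norm x) * (1 + norm (x - y))) ^ N * norm (iter_partial ks f (x - y))"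
      by (intro mult_right_mono) auto
    also have "\<dots> = (1 + norm x) ^ N * ((1 + norm (x - y)) ^ N * norm (iter_partial ks f (x - y)))"
      by (simp add: power_mult_distrib)
    also have "\<dots> \<le> (1 + norm x) ^ N * A" by (intro mult_left_mono A) auto
    finally show ?thesis by (simp add: norm_mult norm_power)
  qed
  then show "\<exists>B. \<forall>y. (1 + norm y) ^ N * norm (iter_partial ks (\<lambda>y. f (x - y)) y) \<le> B"
    unfolding iter_partial_reflect[OF s] by blast
qed

text \<open>\<open>schwartz_seminorm\<close> is a real supremum, informative only for a set that is
  bounded. Here it is exchanged once and for all for any common bound \<open>B\<close> of the
  weighted derivatives; replacing the constant by its absolute value makes the estimate monotone in
  \<open>B\<close>.\<close>

lemma tempered_bound:
  assumes "tempered T"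
  obtains C N where "0 \<le> C" "\<And>\<psi> B. \<psi> \<in> schwartz \<Longrightarrow>
    (\<And>ks x. length ks \<le> N \<Longrightarrow> (1 + norm x) ^ N * norm (iter_partial ks \<psi> x) \<le> B) \<Longrightarrow> norm (T \<psi>) \<le> C * B"
proof -
  obtain C N where CN: "\<And>\<psi>. \<psi> \<in> schwartz \<Longrightarrow> norm (T \<psi>) \<le> C * schwartz_seminorm N \<psi>"
    using assms unfolding tempered_def by blast
  have "norm (T \<psi>) \<le> \<bar>C\<bar> * B" if \<psi>: "\<psi> \<in> schwartz"
    and B: "\<And>ks x. length ks \<le> N \<Longrightarrow> (1 + norm x) ^ N * norm (iter_partial ks \<psi> x) \<le> B" for \<psi> B
  proof -
    let ?F = "\<lambda>(ks, x). (1 + norm x) ^ N * norm (iter_partial ks \<psi> x)"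
    let ?A = "{ks::'a list. length ks \<le> N} \<times> (UNIV :: (real^'a) set)"
    have ne: "([], 0) \<in> ?A" by simp
    have bdd: "bdd_above (?F ` ?A)" using B by (intro bdd_aboveI2[of _ _ B]) auto
    have "0 \<le> ?F ([], 0)" by simp
    also have "\<dots> \<le> schwartz_seminorm N \<psi>" unfolding schwartz_seminorm_def by (rule cSUP_upper[OF ne bdd])
    finally have p: "0 \<le> schwartz_seminorm N \<psi>" .
    have "schwartz_seminorm N \<psi> \<le> B" unfolding schwartz_seminorm_def
    proof (rule cSUP_least)
      show "?A \<noteq> {}" using ne by blast
    qed (use B in auto)
    have "norm (T \<psi>) \<le> C * schwartz_seminorm N \<psi>" by (rule CN[OF \<psi>])
    also have "\<dots> \<le> \<bar>C\<bar> * schwartz_seminorm N \<psi>" using p by (intro mult_right_mono) auto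
    also have "\<dots> \<le> \<bar>C\<bar> * B" using \<open>schwartz_seminorm N \<psi> \<le> B\<close> by (intro mult_left_mono) auto
    finally show ?thesis .
  qed
  then show thesis by (intro that[of "\<bar>C\<bar>" N]) auto
qed

lemma tempered_add: "tempered T \<Longrightarrow> \<psi> \<in> schwartz \<Longrightarrow> \<eta> \<in> schwartz \<Longrightarrow> T (\<lambda>x. \<psi> x + \<eta> x) = T \<psi> + T \<eta>"
  by (simp add: tempered_def)

lemma tempered_cmult: "tempered T \<Longrightarrow> \<psi> \<in> schwartz \<Longrightarrow> T (\<lambda>x. c * \<psi> x) = c * T \<psi>"
  by (simp add: tempered_def)

lemma schwartz_zero: "(\<lambda>_::real^'n::finite. 0) \<in> schwartz"
proof -
  have "iter_partial ks (\<lambda>_::real^'n. 0 :: complex) = (\<lambda>_. 0)" for ks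
  proof (induction ks)
    case (Cons k ks)
    show ?case unfolding iter_partial_simps Cons.IH
      by (rule ext, rule partial_eqI[THEN trans], rule has_derivative_const) simp
  qed simp
  then show ?thesis by (intro schwartzI) (auto simp: smooth_def)
qed

lemma tempered_zero: "tempered T \<Longrightarrow> T (\<lambda>_. 0) = 0"
  using tempered_cmult[OF _ schwartz_zero, of T 0] by simp

text \<open>The superposition is the reflected inverse transform of m W, where W is a Fourier
  integral of \<open>w\<close> and hence bounded; \<open>rapid\<close> is preserved by such a
  factor. Smoothness and differentiation under the integral thus come from the frequency
  side.\<close>

lemma smooth_weighted_conv:
  fixes w m :: "real^'n::finite \<Rightarrow> complex"
  assumes w: "integrable lborel w" and m: "rapid m"
  defines "\<Phi> \<equiv> \<lambda>z. \<integral>y. w y * inv_fourier m (y - z) \<partial>lborel"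
  shows "smooth \<Phi>"
    and "iter_partial ks \<Phi> = (\<lambda>z. (-1) ^ length ks * (\<integral>y. w y * iter_partial ks (inv_fourier m) (y - z) \<partial>lborel))"
proof -
  have [measurable]: "w \<in> borel_measurable borel" using borel_measurable_integrable[OF w] by simp
  define W where "W \<xi> = (\<integral>y. w y * cis (y \<bullet> \<xi>) \<partial>lborel)" for \<xi>
  have [measurable]: "W \<in> borel_measurable borel" unfolding W_def by measurable
  have Wb: "norm (W \<xi>) \<le> (\<integral>y. norm (w y) \<partial>lborel)" for \<xi>
    unfolding W_def by (rule order_trans[OF integral_norm_bound]) (simp add: norm_mult)
  have eq: "(\<integral>y. w y * inv_fourier M (y - z) \<partial>lborel) = inv_fourier (\<lambda>\<xi>. M \<xi> * W \<xi>) (0 - z)"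
    if M: "integrable lborel M" for M z
  proof -
    have [measurable]: "M \<in> borel_measurable borel" using borel_measurable_integrable[OF M] by simp
    define c where "c = complex_of_real (fourier_const TYPE('n))"
    have "(\<integral>y. w y * inv_fourier M (y - z) \<partial>lborel) = (\<integral>y. \<integral>\<xi>. (w y * c) * (cis ((y - z) \<bullet> \<xi>) * M \<xi>) \<partial>lborel \<partial>lborel)"
      by (simp only: inv_fourier_eq c_def integral_mult_right_zero mult.assoc)
    also have "\<dots> = (\<integral>\<xi>. \<integral>y. (w y * c) * (cis ((y - z) \<bullet> \<xi>) * M \<xi>) \<partial>lborel \<partial>lborel)"
    proof (rule lborel_fubini_swap)
      have "(\<integral>\<^sup>+y. \<integral>\<^sup>+\<xi>. ennreal (norm ((w y * c) * (cis ((y - z) \<bullet> \<xi>) * M \<xi>))) \<partial>lborel \<partial>lborel)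
        = (\<integral>\<^sup>+y. \<integral>\<^sup>+\<xi>. ennreal (norm (w y)) * (ennreal (norm c) * ennreal (norm (M \<xi>))) \<partial>lborel \<partial>lborel)"
        by (simp add: norm_mult ennreal_mult mult_ac)
      also have "\<dots> = L1norm w * (ennreal (norm c) * L1norm M)"
        by (simp add: nn_integral_cmult nn_integral_multc L1norm_def)
      also have "\<dots> < \<infinity>" using w M by (simp add: integrable_iff_L1norm ennreal_mult_less_top)
      finally show "(\<integral>\<^sup>+y. \<integral>\<^sup>+\<xi>. ennreal (norm ((w y * c) * (cis ((y - z) \<bullet> \<xi>) * M \<xi>))) \<partial>lborel \<partial>lborel) < \<infinity>" .
    qed measurable
    also have "\<dots> = (\<integral>\<xi>. c * (cis ((0 - z) \<bullet> \<xi>) * (M \<xi> * W \<xi>)) \<partial>lborel)"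
    proof (rule Bochner_Integration.integral_cong[OF refl])
      fix \<xi>
      have "(\<integral>y. (w y * c) * (cis ((y - z) \<bullet> \<xi>) * M \<xi>) \<partial>lborel)
        = (\<integral>y. (c * cis ((0 - z) \<bullet> \<xi>) * M \<xi>) * (w y * cis (y \<bullet> \<xi>)) \<partial>lborel)"
      proof (rule Bochner_Integration.integral_cong[OF refl])
        fix y
        have "cis ((y - z) \<bullet> \<xi>) = cis ((0 - z) \<bullet> \<xi>) * cis (y \<bullet> \<xi>)"
          by (simp add: inner_diff_left cis_mult)
        then show "(w y * c) * (cis ((y - z) \<bullet> \<xi>) * M \<xi>) = (c * cis ((0 - z) \<bullet> \<xi>) * M \<xi>) * (w y * cis (y \<bullet> \<xi>))"
          by (simp add: mult_ac)
      qed
      also have "\<dots> = (c * cis ((0 - z) \<bullet> \<xi>) * M \<xi>) * W \<xi>"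
        unfolding W_def by (rule integral_mult_right_zero)
      finally show "(\<integral>y. (w y * c) * (cis ((y - z) \<bullet> \<xi>) * M \<xi>) \<partial>lborel) = c * (cis ((0 - z) \<bullet> \<xi>) * (M \<xi> * W \<xi>))"
        by (simp only: mult_ac)
    qed
    also have "\<dots> = inv_fourier (\<lambda>\<xi>. M \<xi> * W \<xi>) (0 - z)"
      by (simp only: inv_fourier_eq c_def integral_mult_right_zero)
    finally show ?thesis .
  qed
  have mW: "rapid (\<lambda>\<xi>. m \<xi> * W \<xi>)" by (rule rapid_mult_bounded[OF m _ Wb]) measurable
  have \<Phi>: "\<Phi> = (\<lambda>z. inv_fourier (\<lambda>\<xi>. m \<xi> * W \<xi>) (0 - z))"
    unfolding \<Phi>_def by (rule ext, rule eq[OF rapid_integrable[OF m]])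
  show "smooth \<Phi>" unfolding \<Phi> by (rule smooth_reflect[OF smooth_inv_fourier[OF mW]])
  show "iter_partial ks \<Phi> = (\<lambda>z. (-1) ^ length ks * (\<integral>y. w y * iter_partial ks (inv_fourier m) (y - z) \<partial>lborel))"
  proof
    fix z
    have "iter_partial ks \<Phi> z = (-1) ^ length ks * inv_fourier (\<lambda>\<xi>. monomial ks \<xi> * (m \<xi> * W \<xi>)) (0 - z)"
      unfolding \<Phi> iter_partial_reflect[OF smooth_inv_fourier[OF mW]] iter_partial_inv_fourier[OF mW] ..
    also have "inv_fourier (\<lambda>\<xi>. monomial ks \<xi> * (m \<xi> * W \<xi>)) (0 - z) = (\<integral>y. w y * iter_partial ks (inv_fourier m) (y - z) \<partial>lborel)"
      unfolding iter_partial_inv_fourier[OF m]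
      using eq[OF rapid_integrable[OF rapid_monomial[OF m, of ks]], of z] by (simp only: mult.assoc)
    finally show "iter_partial ks \<Phi> z = (-1) ^ length ks * (\<integral>y. w y * iter_partial ks (inv_fourier m) (y - z) \<partial>lborel)" .
  qed
qed

text \<open>For tempered \<open>T\<close> the identity \<open>T (\<integral> w y * k (y - \<cdot>) dy) = \<integral> w y * T (k (y - \<cdot>)) dy\<close> is proved by
  cutting \<open>w\<close> into pieces supported in small balls, where both sides are compared with the value
  obtained by freezing \<open>y\<close> at the centre.\<close>

lemma tempered_weighted_conv:
  fixes w m :: "real^'n::finite \<Rightarrow> complex"
  assumes T: "tempered T" and m: "test_function m"
    and w [measurable]: "w \<in> borel_measurable borel"
    and wN: "\<And>N. integrable lborel (\<lambda>y. (1 + norm y) ^ N * norm (w y))"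
  defines "k \<equiv> inv_fourier m"
  shows "T (\<lambda>z. \<integral>y. w y * k (y - z) \<partial>lborel) = (\<integral>y. w y * T (\<lambda>z. k (y - z)) \<partial>lborel)"
    and "continuous_on UNIV (\<lambda>y. T (\<lambda>z. k (y - z)))"
proof -
  obtain C N where C: "0 \<le> C" and Tb: "\<And>\<psi> B. \<psi> \<in> schwartz \<Longrightarrow>
    (\<And>ks x. length ks \<le> N \<Longrightarrow> (1 + norm x) ^ N * norm (iter_partial ks \<psi> x) \<le> B) \<Longrightarrow> norm (T \<psi>) \<le> C * B"
    using tempered_bound[OF T] by blast
  have rm: "rapid m" by (rule rapid_test_function[OF m])
  have kS: "k \<in> schwartz" unfolding k_def by (rule schwartz_inv_fourier[OF m])
  have ks: "smooth k" by (rule schwartzD(1)[OF kS])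
  have krS: "(\<lambda>z. k (y - z)) \<in> schwartz" for y by (rule schwartz_reflect[OF kS])
  obtain P where P: "0 \<le> P" and kP: "\<And>ks x. length ks \<le> Suc N \<Longrightarrow> (1 + norm x) ^ N * norm (iter_partial ks k x) \<le> P"
    using schwartz_iter_bound[OF kS, of "Suc N" N] by blast
  have kcont: "continuous_on UNIV (iter_partial ks k)" for ks
    using iter_partial_differentiable[OF ks] by (auto intro!: differentiable_imp_continuous_on differentiable_at_imp_differentiable_on)
  have [measurable]: "iter_partial ks k \<in> borel_measurable borel" for ks
    by (rule borel_measurable_continuous_onI[OF kcont])
  have kshift: "(1 + norm z) ^ M * norm (iter_partial ks k (y - z)) \<le> (1 + norm y) ^ M * B"
    if "\<And>x. (1 + norm x) ^ M * norm (iter_partial ks k x) \<le> B" for ks y z M B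
  proof -
    have "(1 + norm z) ^ M * norm (iter_partial ks k (y - z)) \<le> ((1 + norm y) * (1 + norm (y - z))) ^ M * norm (iter_partial ks k (y - z))"
      by (intro mult_right_mono power_mono one_plus_norm_triangle) auto
    also have "\<dots> = (1 + norm y) ^ M * ((1 + norm (y - z)) ^ M * norm (iter_partial ks k (y - z)))"
      by (simp add: power_mult_distrib)
    also have "\<dots> \<le> (1 + norm y) ^ M * B" by (intro mult_left_mono that) auto
    finally show ?thesis .
  qed
  \<comment> \<open>The constant in the modulus of continuity below: \<open>CARD('n)\<close> from
    the mean value inequality in terms of coordinate derivatives, 2^N from comparing the weight at y
    - z with the weight at points within distance 1 of it.\<close>
  define D where "D = real CARD('n) * (2 ^ N * P)"
  have D: "0 \<le> D" using P by (simp add: D_def)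
  have kmod: "(1 + norm z) ^ N * norm (iter_partial ks k (y - z) - iter_partial ks k (y0 - z)) \<le> norm (y - y0) * ((1 + norm y) ^ N * D)"
    if len: "length ks \<le> N" and d: "norm (y - y0) \<le> 1" for ks y y0 z
  proof -
    have "norm (iter_partial ks k (y - z) - iter_partial ks k (y0 - z))
      \<le> (real CARD('n) * ((2 * (1 + norm y)) ^ N * P / (1 + norm z) ^ N)) * norm ((y - z) - (y0 - z))"
    proof (rule norm_diff_le_partial[where S="cball (y - z) 1"])
      fix q j assume q: "q \<in> cball (y - z) 1"
      have "norm (y - z) \<le> norm q + 1"
        using q norm_triangle_ineq[of q "y - z - q"] by (simp add: dist_norm)
      then have "1 + norm (y - z) \<le> 2 * (1 + norm q)" by (rule order_trans[OF add_left_mono]) simp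
      then have "(1 + norm y) * (1 + norm (y - z)) \<le> (1 + norm y) * (2 * (1 + norm q))"
        by (intro mult_left_mono) auto
      then have "1 + norm z \<le> 2 * (1 + norm y) * (1 + norm q)"
        using order_trans[OF one_plus_norm_triangle[of z y]] by (simp only: mult_ac)
      then have "(1 + norm z) ^ N \<le> (2 * (1 + norm y) * (1 + norm q)) ^ N" by (intro power_mono) auto
      then have "(1 + norm z) ^ N * norm (partial j (iter_partial ks k) q)
          \<le> (2 * (1 + norm y)) ^ N * ((1 + norm q) ^ N * norm (partial j (iter_partial ks k) q))"
        by (subst mult.assoc[symmetric], subst power_mult_distrib[symmetric]) (intro mult_right_mono, auto)
      also have "\<dots> \<le> (2 * (1 + norm y)) ^ N * P"
        using kP[of "j # ks" q] len by (intro mult_left_mono) auto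
      finally show "norm (partial j (iter_partial ks k) q) \<le> (2 * (1 + norm y)) ^ N * P / (1 + norm z) ^ N"
        by (subst pos_le_divide_eq) (auto simp: mult.commute add_pos_nonneg)
    qed (use d in \<open>auto simp: dist_norm iter_partial_differentiable[OF ks]\<close>)
    then have "(1 + norm z) ^ N * norm (iter_partial ks k (y - z) - iter_partial ks k (y0 - z))
      \<le> (1 + norm z) ^ N * ((real CARD('n) * ((2 * (1 + norm y)) ^ N * P / (1 + norm z) ^ N)) * norm (y - y0))"
      by (intro mult_left_mono) auto
    also have "\<dots> = ((1 + norm z) ^ N / (1 + norm z) ^ N) * (norm (y - y0) * ((1 + norm y) ^ N * D))"
      by (simp only: D_def power_mult_distrib) (simp add: mult_ac)
    also have "\<dots> = norm (y - y0) * ((1 + norm y) ^ N * D)"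
    proof -
      have "1 + norm z \<noteq> 0" using norm_ge_zero[of z] by linarith
      then show ?thesis by simp
    qed
    finally show ?thesis .
  qed
  define g where "g y = T (\<lambda>z. k (y - z))" for y
  have gb: "norm (g y) \<le> C * ((1 + norm y) ^ N * P)" for y
    unfolding g_def
  proof (rule Tb[OF krS])
    fix js :: "'n list" and z assume "length js \<le> N"
    then show "(1 + norm z) ^ N * norm (iter_partial js (\<lambda>z. k (y - z)) z) \<le> (1 + norm y) ^ N * P"
      using kshift[of N js P z y] kP by (simp add: iter_partial_reflect[OF ks] norm_mult norm_power)
  qed
  have gmod: "norm (g y - g y0) \<le> C * (norm (y - y0) * ((1 + norm y) ^ N * D))" if d: "norm (y - y0) \<le> 1" for y y0
  proof -
    have S1: "(\<lambda>z. (-1) * k (y0 - z)) \<in> schwartz" by (rule schwartz_cmult[OF krS])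
    have "g y - g y0 = T (\<lambda>z. k (y - z) + (-1) * k (y0 - z))"
      unfolding g_def tempered_add[OF T krS S1] tempered_cmult[OF T krS] by simp
    also have "norm \<dots> \<le> C * (norm (y - y0) * ((1 + norm y) ^ N * D))"
    proof (rule Tb[OF schwartz_add[OF krS S1]])
      fix js :: "'n list" and z assume len: "length js \<le> N"
      have "iter_partial js (\<lambda>z. k (y - z) + (-1) * k (y0 - z)) z
          = (-1) ^ length js * (iter_partial js k (y - z) - iter_partial js k (y0 - z))"
        unfolding iter_partial_add[OF smooth_reflect[OF ks] smooth_cmult[OF smooth_reflect[OF ks]]]
          iter_partial_cmult[OF smooth_reflect[OF ks]] iter_partial_reflect[OF ks]
        by (simp add: algebra_simps)
      then show "(1 + norm z) ^ N * norm (iter_partial js (\<lambda>z. k (y - z) + (-1) * k (y0 - z)) z) \<le> norm (y - y0) * ((1 + norm y) ^ N * D)"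
        using kmod[OF len d] by (simp add: norm_mult norm_power)
    qed
    finally show ?thesis .
  qed
  have gcont: "continuous_on UNIV g"
    unfolding continuous_on_iff
  proof (intro ballI allI impI)
    fix y0 :: "real^'n" and e :: real assume e: "0 < e"
    define L where "L = C * ((2 + norm y0) ^ N * D)"
    have L: "0 \<le> L" using C D by (simp add: L_def)
    show "\<exists>d>0. \<forall>y\<in>UNIV. dist y y0 < d \<longrightarrow> dist (g y) (g y0) < e"
    proof (intro exI[of _ "min 1 (e / (L + 1))"] conjI ballI impI)
      show "0 < min 1 (e / (L + 1))" using e L by simp
      fix y assume "dist y y0 < min 1 (e / (L + 1))"
      then have d: "norm (y - y0) < 1" "norm (y - y0) < e / (L + 1)" by (auto simp: dist_norm)
      have "norm y \<le> 1 + norm y0" using d norm_triangle_ineq2[of y y0] by linarith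
      then have "(1 + norm y) ^ N \<le> (2 + norm y0) ^ N" by (intro power_mono) auto
      then have "norm (g y - g y0) \<le> C * (norm (y - y0) * ((2 + norm y0) ^ N * D))"
        using C D d(1) by (intro order_trans[OF gmod] mult_left_mono mult_right_mono) auto
      also have "\<dots> = norm (y - y0) * L" by (simp add: L_def)
      also have "\<dots> \<le> norm (y - y0) * (L + 1)" by (intro mult_left_mono) auto
      also have "\<dots> < e" using d(2) L by (simp add: pos_less_divide_eq)
      finally show "dist (g y) (g y0) < e" by (simp add: dist_norm)
    qed
  qed
  have [measurable]: "g \<in> borel_measurable borel" by (rule borel_measurable_continuous_onI[OF gcont])
  \<comment> \<open>Weights with all polynomial moments, a class stable under restriction to Borel
    sets, so that \<open>w\<close> may be cut into pieces.\<close>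
  define good where "good v \<longleftrightarrow> v \<in> borel_measurable borel \<and> (\<forall>N. integrable lborel (\<lambda>y. (1 + norm y) ^ N * norm (v y)))"
    for v :: "real^'n \<Rightarrow> complex"
  define \<Phi> where "\<Phi> v z = (\<integral>y. v y * k (y - z) \<partial>lborel)" for v z
  define I where "I v = (\<integral>y. (1 + norm y) ^ N * norm (v y) \<partial>lborel)" for v :: "real^'n \<Rightarrow> complex"
  have goodI: "integrable lborel v" if "good v" for v
  proof -
    have "integrable lborel (\<lambda>y. (1 + norm y) ^ 0 * norm (v y))" and [measurable]: "v \<in> borel_measurable borel"
      using that unfolding good_def by blast+
    then show ?thesis by (simp add: integrable_norm_iff)
  qed
  have goodN: "integrable lborel (\<lambda>y. (1 + norm y) ^ M * norm (v y))" if "good v" for v M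
    using that by (simp add: good_def)
  have goodm: "v \<in> borel_measurable borel" if "good v" for v
    using that by (simp add: good_def)
  have good_ind: "good (\<lambda>y. indicator S y * v y)" if v: "good v" and S [measurable]: "S \<in> sets borel" for v S
  proof -
    have [measurable]: "v \<in> borel_measurable borel" by (rule goodm[OF v])
    have "integrable lborel (\<lambda>y. (1 + norm y) ^ M * norm (indicator S y * v y))" for M
      by (rule Bochner_Integration.integrable_bound[OF goodN[OF v, of M]]) (auto simp: indicator_def)
    then show ?thesis by (simp add: good_def)
  qed
  have kb: "integrable lborel (\<lambda>y. v y * iter_partial js k (y - z))" if v: "good v" for v js z
  proof -
    have [measurable]: "v \<in> borel_measurable borel" by (rule goodm[OF v])
    obtain B where B: "\<And>x. (1 + norm x) ^ 0 * norm (iter_partial js k x) \<le> B" using schwartzD(2)[OF kS] by blast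
    have B0: "0 \<le> B" using order_trans[OF norm_ge_zero, of "iter_partial js k 0" B] B[of 0] by simp
    show ?thesis
    proof (rule Bochner_Integration.integrable_bound[OF integrable_mult_right[OF goodI[OF v], of "of_real B"]])
      have "norm (v y) * norm (iter_partial js k (y - z)) \<le> norm (v y) * B" for y
        using B[of "y - z"] by (intro mult_left_mono) auto
      then show "AE y in lborel. norm (v y * iter_partial js k (y - z)) \<le> norm (of_real B * v y)"
        using B0 by (simp add: norm_mult mult.commute)
    qed measurable
  qed
  have \<Phi>s: "smooth (\<Phi> v)" and \<Phi>i: "iter_partial js (\<Phi> v) = (\<lambda>z. (-1) ^ length js * (\<integral>y. v y * iter_partial js k (y - z) \<partial>lborel))"
    if v: "good v" for v js
    using smooth_weighted_conv[OF goodI[OF v] rm] unfolding \<Phi>_def[abs_def] k_def by blast+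
  have \<Phi>b: "(1 + norm z) ^ M * norm (iter_partial js (\<Phi> v) z) \<le> (\<integral>y. (1 + norm y) ^ M * norm (v y) \<partial>lborel) * B"
    if v: "good v" and B: "\<And>x. (1 + norm x) ^ M * norm (iter_partial js k x) \<le> B" for v js M B z
  proof -
    have "(1 + norm z) ^ M * norm (iter_partial js (\<Phi> v) z) = (1 + norm z) ^ M * norm (\<integral>y. v y * iter_partial js k (y - z) \<partial>lborel)"
      by (simp add: \<Phi>i[OF v] norm_mult norm_power)
    also have "\<dots> \<le> (1 + norm z) ^ M * (\<integral>y. norm (v y * iter_partial js k (y - z)) \<partial>lborel)"
      by (intro mult_left_mono integral_norm_bound) auto
    also have "\<dots> = (\<integral>y. (1 + norm z) ^ M * norm (v y * iter_partial js k (y - z)) \<partial>lborel)" by simp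
    also have "\<dots> \<le> (\<integral>y. (1 + norm y) ^ M * norm (v y) * B \<partial>lborel)"
    proof (rule integral_mono)
      show "integrable lborel (\<lambda>y. (1 + norm z) ^ M * norm (v y * iter_partial js k (y - z)))"
        by (intro integrable_mult_right integrable_norm kb v)
      show "integrable lborel (\<lambda>y. (1 + norm y) ^ M * norm (v y) * B)"
        by (intro integrable_mult_left goodN v)
      fix y
      have "norm (v y) * ((1 + norm z) ^ M * norm (iter_partial js k (y - z))) \<le> norm (v y) * ((1 + norm y) ^ M * B)"
        by (intro mult_left_mono kshift B) auto
      then show "(1 + norm z) ^ M * norm (v y * iter_partial js k (y - z)) \<le> (1 + norm y) ^ M * norm (v y) * B"
        by (simp add: norm_mult mult_ac)
    qed
    also have "\<dots> = (\<integral>y. (1 + norm y) ^ M * norm (v y) \<partial>lborel) * B" by simp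
    finally show ?thesis .
  qed
  have \<Phi>S: "\<Phi> v \<in> schwartz" if v: "good v" for v
  proof (rule schwartzI[OF \<Phi>s[OF v]])
    fix M js
    obtain B where "\<And>x. (1 + norm x) ^ M * norm (iter_partial js k x) \<le> B" using schwartzD(2)[OF kS] by blast
    from \<Phi>b[OF v this] show "\<exists>B. \<forall>x. (1 + norm x) ^ M * norm (iter_partial js (\<Phi> v) x) \<le> B" by blast
  qed
  have vg: "integrable lborel (\<lambda>y. v y * g y)" and vgb: "norm (\<integral>y. v y * g y \<partial>lborel) \<le> C * P * I v" if v: "good v" for v
  proof -
    have [measurable]: "v \<in> borel_measurable borel" by (rule goodm[OF v])
    have le: "norm (v y * g y) \<le> C * P * ((1 + norm y) ^ N * norm (v y))" for y
      using mult_left_mono[OF gb[of y], of "norm (v y)"] by (simp add: norm_mult mult_ac)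
    show i: "integrable lborel (\<lambda>y. v y * g y)"
      by (rule Bochner_Integration.integrable_bound[OF integrable_mult_right[OF goodN[OF v, of N], of "C * P"]])
         (auto intro!: order_trans[OF le])
    have "norm (\<integral>y. v y * g y \<partial>lborel) \<le> (\<integral>y. C * P * ((1 + norm y) ^ N * norm (v y)) \<partial>lborel)"
      by (rule Bochner_Integration.integral_norm_bound_integral[OF i _ le]) (intro integrable_mult_right goodN v)
    then show "norm (\<integral>y. v y * g y \<partial>lborel) \<le> C * P * I v" by (simp add: I_def)
  qed
  \<comment> \<open>The defect of the claimed identity. It is additive in the weight, and the goal
    is that it vanishes at \<open>w\<close>.\<close>
  define E where "E v = T (\<Phi> v) - (\<integral>y. v y * g y \<partial>lborel)" for v
  have Ecrude: "norm (E v) \<le> 2 * C * P * I v" if v: "good v" for v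
  proof -
    have "norm (T (\<Phi> v)) \<le> C * (I v * P)"
      unfolding I_def by (rule Tb[OF \<Phi>S[OF v]]) (intro \<Phi>b[OF v] kP; simp)
    with vgb[OF v] show ?thesis
      unfolding E_def using norm_triangle_ineq4[of "T (\<Phi> v)" "\<integral>y. v y * g y \<partial>lborel"]
      by (simp add: mult_ac)
  qed
  have Eadd: "E (\<lambda>y. v1 y + v2 y) = E v1 + E v2" if v: "good v1" "good v2" for v1 v2
  proof -
    have "\<Phi> (\<lambda>y. v1 y + v2 y) = (\<lambda>z. \<Phi> v1 z + \<Phi> v2 z)"
      using kb[OF v(1), of "[]"] kb[OF v(2), of "[]"] by (simp add: \<Phi>_def fun_eq_iff distrib_right)
    then show ?thesis
      using vg[OF v(1)] vg[OF v(2)] tempered_add[OF T \<Phi>S[OF v(1)] \<Phi>S[OF v(2)]]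
      by (simp add: E_def distrib_right)
  qed
  \<comment> \<open>On a ball of radius \<rho> both T of the superposition and the integral of
    \<open>g\<close> against the weight lie within O(\<rho>) of c times g(y0), where c is the
    integral of the weight; the two comparisons account for the factor 2.\<close>
  have Esmall: "norm (E v) \<le> \<rho> * (2 * C * D) * I v"
    if v: "good v" and \<rho>: "0 < \<rho>" "\<rho> \<le> 1" and supp: "\<And>y. y \<notin> cball y0 \<rho> \<Longrightarrow> v y = 0" for v \<rho> y0
  proof -
    have [measurable]: "v \<in> borel_measurable borel" by (rule goodm[OF v])
    define c where "c = (\<integral>y. v y \<partial>lborel)"
    have S1: "(\<lambda>z. (-c) * k (y0 - z)) \<in> schwartz" by (rule schwartz_cmult[OF krS])
    have "T (\<Phi> v) - c * g y0 = T (\<lambda>z. \<Phi> v z + (-c) * k (y0 - z))"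
      unfolding g_def tempered_add[OF T \<Phi>S[OF v] S1] tempered_cmult[OF T krS] by simp
    also have "norm \<dots> \<le> C * (\<rho> * D * I v)"
    proof (rule Tb[OF schwartz_add[OF \<Phi>S[OF v] S1]])
      fix js :: "'n list" and z assume len: "length js \<le> N"
      have "iter_partial js (\<lambda>z. \<Phi> v z + (-c) * k (y0 - z)) z
          = (-1) ^ length js * ((\<integral>y. v y * iter_partial js k (y - z) \<partial>lborel) - c * iter_partial js k (y0 - z))"
        unfolding iter_partial_add[OF \<Phi>s[OF v] smooth_cmult[OF smooth_reflect[OF ks]]]
          iter_partial_cmult[OF smooth_reflect[OF ks]] iter_partial_reflect[OF ks] \<Phi>i[OF v]
        by (simp add: algebra_simps)
      also have "(\<integral>y. v y * iter_partial js k (y - z) \<partial>lborel) - c * iter_partial js k (y0 - z)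
        = (\<integral>y. v y * (iter_partial js k (y - z) - iter_partial js k (y0 - z)) \<partial>lborel)"
        using kb[OF v] goodI[OF v] by (simp add: c_def right_diff_distrib)
      finally have "(1 + norm z) ^ N * norm (iter_partial js (\<lambda>z. \<Phi> v z + (-c) * k (y0 - z)) z)
        = (1 + norm z) ^ N * norm (\<integral>y. v y * (iter_partial js k (y - z) - iter_partial js k (y0 - z)) \<partial>lborel)"
        by (simp add: norm_mult norm_power)
      also have "\<dots> \<le> (1 + norm z) ^ N * (\<integral>y. norm (v y * (iter_partial js k (y - z) - iter_partial js k (y0 - z))) \<partial>lborel)"
        by (intro mult_left_mono integral_norm_bound) auto
      also have "\<dots> = (\<integral>y. (1 + norm z) ^ N * norm (v y * (iter_partial js k (y - z) - iter_partial js k (y0 - z))) \<partial>lborel)" by simp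
      also have "\<dots> \<le> (\<integral>y. \<rho> * D * ((1 + norm y) ^ N * norm (v y)) \<partial>lborel)"
      proof (rule integral_mono)
        show "integrable lborel (\<lambda>y. (1 + norm z) ^ N * norm (v y * (iter_partial js k (y - z) - iter_partial js k (y0 - z))))"
          unfolding right_diff_distrib
          by (intro integrable_mult_right integrable_norm Bochner_Integration.integrable_diff kb v integrable_mult_left goodI)
        show "integrable lborel (\<lambda>y. \<rho> * D * ((1 + norm y) ^ N * norm (v y)))"
          by (intro integrable_mult_right goodN v)
        fix y
        show "(1 + norm z) ^ N * norm (v y * (iter_partial js k (y - z) - iter_partial js k (y0 - z))) \<le> \<rho> * D * ((1 + norm y) ^ N * norm (v y))"
        proof (cases "y \<in> cball y0 \<rho>")
          case True
          then have d: "norm (y - y0) \<le> \<rho>" by (simp add: dist_norm norm_minus_commute)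
          have "(1 + norm z) ^ N * norm (iter_partial js k (y - z) - iter_partial js k (y0 - z)) \<le> norm (y - y0) * ((1 + norm y) ^ N * D)"
            using kmod[OF len, of y y0 z] d \<rho> by simp
          also have "\<dots> \<le> \<rho> * ((1 + norm y) ^ N * D)" using d D by (intro mult_right_mono) auto
          finally have "norm (v y) * ((1 + norm z) ^ N * norm (iter_partial js k (y - z) - iter_partial js k (y0 - z))) \<le> norm (v y) * (\<rho> * ((1 + norm y) ^ N * D))"
            by (intro mult_left_mono) auto
          then show ?thesis by (simp add: norm_mult mult_ac)
        qed (simp add: supp)
      qed
      also have "\<dots> = \<rho> * D * I v" by (simp add: I_def)
      finally show "(1 + norm z) ^ N * norm (iter_partial js (\<lambda>z. \<Phi> v z + (-c) * k (y0 - z)) z) \<le> \<rho> * D * I v" .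
    qed
    finally have 1: "norm (T (\<Phi> v) - c * g y0) \<le> C * (\<rho> * D * I v)" .
    have "c * g y0 - (\<integral>y. v y * g y \<partial>lborel) = (\<integral>y. v y * (g y0 - g y) \<partial>lborel)"
      using vg[OF v] goodI[OF v] by (simp add: c_def right_diff_distrib)
    also have "norm \<dots> \<le> (\<integral>y. C * \<rho> * D * ((1 + norm y) ^ N * norm (v y)) \<partial>lborel)"
    proof (rule Bochner_Integration.integral_norm_bound_integral)
      show "integrable lborel (\<lambda>y. v y * (g y0 - g y))"
        unfolding right_diff_distrib by (intro Bochner_Integration.integrable_diff vg v integrable_mult_left goodI)
      show "integrable lborel (\<lambda>y. C * \<rho> * D * ((1 + norm y) ^ N * norm (v y)))"
        by (intro integrable_mult_right goodN v)
      fix y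
      show "norm (v y * (g y0 - g y)) \<le> C * \<rho> * D * ((1 + norm y) ^ N * norm (v y))"
      proof (cases "y \<in> cball y0 \<rho>")
        case True
        then have d: "norm (y - y0) \<le> \<rho>" by (simp add: dist_norm norm_minus_commute)
        have "norm (g y0 - g y) \<le> C * (norm (y - y0) * ((1 + norm y) ^ N * D))"
          using gmod[of y y0] d \<rho> by (simp add: norm_minus_commute)
        also have "\<dots> \<le> C * (\<rho> * ((1 + norm y) ^ N * D))" using d D C by (intro mult_left_mono mult_right_mono) auto
        finally have "norm (v y) * norm (g y0 - g y) \<le> norm (v y) * (C * (\<rho> * ((1 + norm y) ^ N * D)))"
          by (intro mult_left_mono) auto
        then show ?thesis by (simp add: norm_mult mult_ac)
      qed (simp add: supp)
    qed
    also have "\<dots> = C * \<rho> * D * I v" by (simp add: I_def)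
    finally have 2: "norm (c * g y0 - (\<integral>y. v y * g y \<partial>lborel)) \<le> C * \<rho> * D * I v" .
    have "E v = (T (\<Phi> v) - c * g y0) + (c * g y0 - (\<integral>y. v y * g y \<partial>lborel))" by (simp add: E_def)
    then have "norm (E v) \<le> C * (\<rho> * D * I v) + C * \<rho> * D * I v"
      using norm_triangle_le[OF add_mono[OF 1 2]] by simp
    then show ?thesis by (simp add: mult_ac)
  qed
  have Iadd: "I (\<lambda>y. indicator A y * v y) + I (\<lambda>y. indicator B y * v y) = I (\<lambda>y. indicator (A \<union> B) y * v y)"
    if v: "good v" and AB: "A \<in> sets borel" "B \<in> sets borel" "A \<inter> B = {}" for v A B
  proof -
    have "I (\<lambda>y. indicator A y * v y) + I (\<lambda>y. indicator B y * v y)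
      = (\<integral>y. (1 + norm y) ^ N * norm (indicator A y * v y) + (1 + norm y) ^ N * norm (indicator B y * v y) \<partial>lborel)"
      unfolding I_def using goodN[OF good_ind[OF v AB(1)], of N] goodN[OF good_ind[OF v AB(2)], of N]
      by (rule Bochner_Integration.integral_add[symmetric])
    also have "\<dots> = I (\<lambda>y. indicator (A \<union> B) y * v y)"
      unfolding I_def using AB(3) by (intro Bochner_Integration.integral_cong) (auto simp: indicator_def)
    finally show ?thesis .
  qed
  \<comment> \<open>The pieces are made disjoint one ball at a time. Each estimate carries the mass
    \<open>I\<close> of its piece and these masses add up, so the number of balls, which grows as
    \<rho> shrinks, does not appear.\<close>
  have Ecover: "norm (E (\<lambda>y. indicator S y * v y)) \<le> \<rho> * (2 * C * D) * I (\<lambda>y. indicator S y * v y)"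
    if v: "good v" and \<rho>: "0 < \<rho>" "\<rho> \<le> 1" and F: "finite F" "S \<subseteq> (\<Union>c\<in>F. cball c \<rho>)" "S \<in> sets borel" for v \<rho> F S
    using F
  proof (induction F arbitrary: S rule: finite_induct)
    case empty
    have g0: "good (\<lambda>_. 0)" by (simp add: good_def)
    have "norm (E (\<lambda>_. 0)) \<le> 2 * C * P * I (\<lambda>_. 0)" by (rule Ecrude[OF g0])
    then show ?case using empty by (simp add: I_def)
  next
    case (insert c F)
    define A where "A = S \<inter> cball c \<rho>"
    define B where "B = S - cball c \<rho>"
    have AB: "A \<in> sets borel" "B \<in> sets borel" "A \<inter> B = {}" "A \<union> B = S"
      using insert.prems by (auto simp: A_def B_def)
    have gA: "good (\<lambda>y. indicator A y * v y)" and gB: "good (\<lambda>y. indicator B y * v y)"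
      using good_ind v AB by blast+
    have eq: "(\<lambda>y. indicator S y * v y) = (\<lambda>y. indicator A y * v y + indicator B y * v y)"
      using AB by (auto simp: fun_eq_iff indicator_def)
    have a: "norm (E (\<lambda>y. indicator A y * v y)) \<le> \<rho> * (2 * C * D) * I (\<lambda>y. indicator A y * v y)"
      by (rule Esmall[OF gA \<rho>, of c]) (auto simp: A_def)
    have b: "norm (E (\<lambda>y. indicator B y * v y)) \<le> \<rho> * (2 * C * D) * I (\<lambda>y. indicator B y * v y)"
      using insert.prems AB by (intro insert.IH) (auto simp: B_def)
    have "norm (E (\<lambda>y. indicator S y * v y)) \<le> norm (E (\<lambda>y. indicator A y * v y)) + norm (E (\<lambda>y. indicator B y * v y))"
      unfolding eq Eadd[OF gA gB] by (rule norm_triangle_ineq)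
    also have "\<dots> \<le> \<rho> * (2 * C * D) * (I (\<lambda>y. indicator A y * v y) + I (\<lambda>y. indicator B y * v y))"
      using add_mono[OF a b] by (simp add: distrib_left)
    also have "I (\<lambda>y. indicator A y * v y) + I (\<lambda>y. indicator B y * v y) = I (\<lambda>y. indicator S y * v y)"
      using Iadd[OF v AB(1-3)] AB(4) by simp
    finally show ?case .
  qed
  have gw: "good w" using w wN by (simp add: good_def)
  have tail: "(\<lambda>i. I (\<lambda>y. indicator (- cball 0 (real i)) y * w y)) \<longlonglongrightarrow> 0"
  proof -
    have "(\<lambda>i. \<integral>y. (1 + norm y) ^ N * norm (indicator (- cball 0 (real i)) y * w y) \<partial>lborel) \<longlonglongrightarrow> (\<integral>y. 0 \<partial>(lborel :: (real^'n) measure))"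
    proof (rule integral_dominated_convergence[OF _ _ wN[of N]])
      show "AE y in lborel. (\<lambda>i. (1 + norm y) ^ N * norm (indicator (- cball 0 (real i)) y * w y)) \<longlonglongrightarrow> 0"
      proof (rule AE_I2)
        fix y :: "real^'n"
        obtain i0 :: nat where i0: "norm y \<le> real i0" using real_arch_simple by blast
        have "\<forall>\<^sub>F i in sequentially. (1 + norm y) ^ N * norm (indicator (- cball 0 (real i)) y * w y) = 0"
          unfolding eventually_sequentially
        proof (intro exI[of _ i0] allI impI)
          fix i assume "i0 \<le> i"
          then have "norm y \<le> real i" using i0 by linarith
          then show "(1 + norm y) ^ N * norm (indicator (- cball 0 (real i)) y * w y) = 0" by simp
        qed
        then show "(\<lambda>i. (1 + norm y) ^ N * norm (indicator (- cball 0 (real i)) y * w y)) \<longlonglongrightarrow> 0"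
          by (rule tendsto_eventually)
      qed
    qed (auto simp: indicator_def)
    then show ?thesis by (simp add: I_def)
  qed
  have I0: "0 \<le> I v" for v unfolding I_def by (intro integral_nonneg_AE) auto
  have le: "norm (E w) \<le> \<rho> * (2 * C * D) * I w + 2 * C * P * I (\<lambda>y. indicator (- cball 0 (real i)) y * w y)"
    if \<rho>: "0 < \<rho>" "\<rho> \<le> 1" for \<rho> i
  proof -
    define S where "S = cball (0::real^'n) (real i)"
    have S: "S \<in> sets borel" "- S \<in> sets borel" by (auto simp: S_def)
    have "compact S" by (simp add: S_def)
    then obtain F where F: "finite F" "S \<subseteq> (\<Union>c\<in>F. ball c \<rho>)"
      unfolding compact_eq_totally_bounded using \<rho>(1) by blast
    have F': "S \<subseteq> (\<Union>c\<in>F. cball c \<rho>)" by (rule subset_trans[OF F(2)], intro UN_mono) auto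
    have gS: "good (\<lambda>y. indicator S y * w y)" "good (\<lambda>y. indicator (- S) y * w y)" using good_ind[OF gw] S by auto
    have eq: "w = (\<lambda>y. indicator S y * w y + indicator (- S) y * w y)" by (auto simp: fun_eq_iff indicator_def)
    have "norm (E w) \<le> norm (E (\<lambda>y. indicator S y * w y)) + norm (E (\<lambda>y. indicator (- S) y * w y))"
      by (subst eq, subst Eadd[OF gS]) (rule norm_triangle_ineq)
    also have "\<dots> \<le> \<rho> * (2 * C * D) * I (\<lambda>y. indicator S y * w y) + 2 * C * P * I (\<lambda>y. indicator (- S) y * w y)"
      by (intro add_mono Ecover[OF gw \<rho> F(1) F' S(1)] Ecrude[OF gS(2)])
    also have "\<dots> \<le> \<rho> * (2 * C * D) * I w + 2 * C * P * I (\<lambda>y. indicator (- S) y * w y)"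
    proof (intro add_right_mono mult_left_mono)
      show "I (\<lambda>y. indicator S y * w y) \<le> I w"
        unfolding I_def by (intro integral_mono goodN gS gw) (auto simp: indicator_def)
    qed (use \<rho> C D in auto)
    finally show ?thesis by (simp add: S_def)
  qed
  \<comment> \<open>First the radius of the compact part tends to infinity with \<rho> fixed;
    afterwards \<rho> tends to 0.\<close>
  have le0: "norm (E w) \<le> \<rho> * (2 * C * D) * I w + 0" if \<rho>: "0 < \<rho>" "\<rho> \<le> 1" for \<rho>
  proof (rule LIMSEQ_le_const)
    show "(\<lambda>i. \<rho> * (2 * C * D) * I w + 2 * C * P * I (\<lambda>y. indicator (- cball 0 (real i)) y * w y)) \<longlonglongrightarrow> \<rho> * (2 * C * D) * I w + 0"
      by (intro tendsto_add tendsto_const tendsto_mult_right_zero tail)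
    show "\<exists>n. \<forall>i\<ge>n. norm (E w) \<le> \<rho> * (2 * C * D) * I w + 2 * C * P * I (\<lambda>y. indicator (- cball 0 (real i)) y * w y)"
      using le[OF \<rho>] by blast
  qed
  have "norm (E w) \<le> 0"
  proof (rule LIMSEQ_le_const)
    have "(\<lambda>i. 1 / real (Suc i)) \<longlonglongrightarrow> 0" by (rule LIMSEQ_Suc[OF lim_1_over_n])
    then have "(\<lambda>i. 1 / real (Suc i) * (2 * C * D) * I w + 0) \<longlonglongrightarrow> 0 * (2 * C * D) * I w + 0"
      by (intro tendsto_intros)
    then show "(\<lambda>i. 1 / real (Suc i) * (2 * C * D) * I w + 0) \<longlonglongrightarrow> 0" by simp
    have "norm (E w) \<le> 1 / real (Suc i) * (2 * C * D) * I w + 0" for i by (rule le0) auto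
    then show "\<exists>n. \<forall>i\<ge>n. norm (E w) \<le> 1 / real (Suc i) * (2 * C * D) * I w + 0" by blast
  qed
  then have "T (\<Phi> w) = (\<integral>y. w y * g y \<partial>lborel)" by (simp add: E_def)
  then show "T (\<lambda>z. \<integral>y. w y * k (y - z) \<partial>lborel) = (\<integral>y. w y * T (\<lambda>z. k (y - z)) \<partial>lborel)"
    by (simp add: \<Phi>_def[abs_def] g_def)
  show "continuous_on UNIV (\<lambda>y. T (\<lambda>z. k (y - z)))" using gcont by (simp add: g_def[abs_def])
qed

lemma multiplier_borel:
  assumes T: "tempered T" and m: "test_function m"
  shows "multiplier m T \<in> borel_measurable borel"
  \<comment> \<open>The continuity statement does not involve the weight, so the zero weight
    serves.\<close>
  using tempered_weighted_conv(2)[OF T m, of "\<lambda>_. 0"]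
  by (intro borel_measurable_continuous_onI) (simp add: multiplier_def[abs_def])

text \<open>The kernel of m1 m2 is a superposition of translates of the kernel of \<open>m2\<close>
  weighted by the kernel of \<open>m1\<close>, and \<open>tempered_weighted_conv\<close> lets T pass
  under the integral. The first multiplier then acts by convolution on the function m2(D) T, for
  which bounds in L^inf are available.\<close>

lemma multiplier_mult:
  assumes T: "tempered T" and m1: "test_function m1" and m2: "test_function m2"
  shows "multiplier (\<lambda>\<xi>. m1 \<xi> * m2 \<xi>) T x = conv (inv_fourier m1) (multiplier m2 T) x"
proof -
  have [measurable]: "m1 \<in> borel_measurable borel" using test_function_borel[OF m1] .
  have wN: "integrable lborel (\<lambda>y. (1 + norm y) ^ N * norm (inv_fourier m1 (x - y)))" for N
  proof -
    have S: "(\<lambda>y. inv_fourier m1 (x - y)) \<in> schwartz" by (intro schwartz_reflect schwartz_inv_fourier m1)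
    obtain B where B: "\<And>y. (1 + norm y) ^ (2 * DIM(real^'a) + N) * norm (inv_fourier m1 (x - y)) \<le> B"
      using schwartzD(2)[OF S, of "2 * DIM(real^'a) + N" "[]"] by auto
    show ?thesis
      by (rule integrable_polynomial_decay[where C=B]) (use B in \<open>auto simp: power_add mult.assoc\<close>)
  qed
  have "(\<lambda>z. \<integral>y. inv_fourier m1 (x - y) * inv_fourier m2 (y - z) \<partial>lborel) = (\<lambda>z. inv_fourier (\<lambda>\<xi>. m1 \<xi> * m2 \<xi>) (x - z))"
  proof
    fix z
    have [measurable]: "m2 \<in> borel_measurable borel" using test_function_borel[OF m2] .
    have "inv_fourier (\<lambda>\<xi>. m1 \<xi> * m2 \<xi>) (x - z) = conv (inv_fourier m1) (inv_fourier m2) (x - z)"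
      by (rule inv_fourier_mult[OF wiener_test_function[OF m1] test_function_integrable[OF m2]])
    also have "\<dots> = (\<integral>y. inv_fourier m1 (x - y) * inv_fourier m2 (y - z) \<partial>lborel)"
      unfolding conv_def
      using integral_lborel_affine[of "\<lambda>y. inv_fourier m1 (x - z - y) * inv_fourier m2 y" 1 "-z"]
      by (simp add: algebra_simps)
    finally show "(\<integral>y. inv_fourier m1 (x - y) * inv_fourier m2 (y - z) \<partial>lborel) = inv_fourier (\<lambda>\<xi>. m1 \<xi> * m2 \<xi>) (x - z)" by simp
  qed
  then show ?thesis
    using tempered_weighted_conv(1)[OF T m2 _ wN] by (simp add: multiplier_def conv_def)
qed

lemma multiplier_sum:
  assumes T: "tempered T" and "finite S" and "\<And>i. i \<in> S \<Longrightarrow> test_function (m i)"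
  shows "multiplier (\<lambda>\<xi>. \<Sum>i\<in>S. m i \<xi>) T x = (\<Sum>i\<in>S. multiplier (m i) T x)"
proof -
  have e: "inv_fourier (\<lambda>\<xi>. \<Sum>i\<in>S. m i \<xi>) = (\<lambda>x. \<Sum>i\<in>S. inv_fourier (m i) x)"
    by (rule ext, rule inv_fourier_sum[OF assms(2)], rule test_function_integrable, rule assms(3))
  have "(\<lambda>y. \<Sum>i\<in>S. inv_fourier (m i) (x - y)) \<in> schwartz \<and>
      T (\<lambda>y. \<Sum>i\<in>S. inv_fourier (m i) (x - y)) = (\<Sum>i\<in>S. T (\<lambda>y. inv_fourier (m i) (x - y)))"
    using assms(2,3)
  proof (induction S rule: finite_induct)
    case empty
    then show ?case using tempered_zero[OF T] schwartz_zero by simp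
  next
    case (insert i S)
    have S1: "(\<lambda>y. inv_fourier (m i) (x - y)) \<in> schwartz"
      using insert.prems by (intro schwartz_reflect schwartz_inv_fourier) auto
    have S2: "(\<lambda>y. \<Sum>i\<in>S. inv_fourier (m i) (x - y)) \<in> schwartz"
      and eq: "T (\<lambda>y. \<Sum>i\<in>S. inv_fourier (m i) (x - y)) = (\<Sum>i\<in>S. T (\<lambda>y. inv_fourier (m i) (x - y)))"
      using insert by auto
    show ?case
      using tempered_add[OF T S1 S2] schwartz_add[OF S1 S2] insert.hyps eq by simp
  qed
  then show ?thesis by (simp add: multiplier_def e)
qed

lemma multiplier_zero: "tempered T \<Longrightarrow> multiplier (\<lambda>_. 0) T x = 0"
  using multiplier_sum[of T "{}"] by simp

section \<open>The linear evolution\<close>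

lemma dyadic_eq: "dyadic \<phi> j = (\<lambda>\<xi>. complex_of_real (\<phi> ((2 powr (- real_of_int j)) *\<^sub>R \<xi>)))"
  unfolding dyadic_def using powr_real_of_int'[of 2 "-j"] by (simp add: fun_eq_iff)

lemma littlewood_paley_test_function:
  assumes "littlewood_paley \<phi>" shows "test_function (\<lambda>\<xi>. complex_of_real (\<phi> \<xi>))"
proof -
  obtain a b where "\<And>\<xi>. \<phi> \<xi> \<noteq> 0 \<Longrightarrow> a \<le> norm \<xi> \<and> norm \<xi> \<le> b"
    using assms unfolding littlewood_paley_def by blast
  then have "\<phi> \<xi> = 0" if "norm \<xi> > b" for \<xi> using that by force
  then show ?thesis
    using assms unfolding littlewood_paley_def by (intro test_functionI[of _ b] smooth_of_real) auto
qed

lemma test_function_dyadic: "littlewood_paley \<phi> \<Longrightarrow> test_function (dyadic \<phi> j)"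
  unfolding dyadic_eq by (rule test_function_scale[OF littlewood_paley_test_function]) auto

lemma heat_symbol_nexp: "heat_symbol \<alpha> t = nexp (- t) (2 * \<alpha>)"
  by (simp add: fun_eq_iff heat_symbol_def nexp_def)

text \<open>The heat symbol is singular only at the origin, which \<open>f\<close> removes; the
  product may therefore be applied to any tempered distribution.\<close>

lemma test_function_heat_mult:
  assumes f: "test_function f" and c: "c > 0" "\<And>\<xi>. norm \<xi> < c \<Longrightarrow> f \<xi> = 0"
  shows "test_function (\<lambda>\<xi>. heat_symbol \<alpha> t \<xi> * f \<xi>)"
proof -
  obtain b where b: "b > 0" "\<And>\<xi>. norm \<xi> > b \<Longrightarrow> f \<xi> = 0" using test_functionD(2)[OF f] by blast
  then show ?thesis unfolding heat_symbol_nexp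
    using smooth_nexp_mult[OF test_functionD(1)[OF f] c] by (intro test_functionI[of _ b]) auto
qed

text \<open>Only the finitely many neighbours of \<open>\<phi>\<^sub>l\<close> contribute to \<open>\<phi>\<^sub>l = \<Sum>\<^sub>i \<phi>\<^sub>i \<phi>\<^sub>l\<close>, and their number does
  not depend on \<open>l\<close>.\<close>

lemma littlewood_paley_neighbours:
  assumes "littlewood_paley \<phi>"
  obtains M :: nat where "\<And>l \<xi>. dyadic \<phi> l \<xi> = (\<Sum>i\<in>{l - int M..l + int M}. dyadic \<phi> i \<xi> * dyadic \<phi> l \<xi>)"
proof -
  obtain a b where a: "0 < a" and ab: "\<And>\<xi>. \<phi> \<xi> \<noteq> 0 \<Longrightarrow> a \<le> norm \<xi> \<and> norm \<xi> \<le> b"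
    and hs: "\<And>\<xi>. \<xi> \<noteq> 0 \<Longrightarrow> ((\<lambda>j::int. \<phi> ((2 powi (-j)) *\<^sub>R \<xi>)) has_sum 1) UNIV"
    using assms unfolding littlewood_paley_def by blast
  \<comment> \<open>Blocks i and l overlap only if 2^|i - l| <= b/a, which forces |i - l| <=
    M.\<close>
  obtain M :: nat where M: "b / a < 2 ^ M" using real_arch_pow[of 2 "b / a"] by auto
  define p where "p j \<xi> = \<phi> ((2 powi (-j)) *\<^sub>R \<xi>)" for j :: int and \<xi>
  have supp: "2 powr j * a \<le> norm \<xi> \<and> norm \<xi> \<le> 2 powr j * b" if "p j \<xi> \<noteq> 0" for j \<xi>
  proof -
    have e: "norm ((2 powi (-j)) *\<^sub>R \<xi>) = norm \<xi> / 2 powr j"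
      using powr_real_of_int'[of 2 "-j"] by (simp add: powr_minus divide_inverse mult.commute flip: powr_real_of_int')
    have "a \<le> norm \<xi> / 2 powr j" "norm \<xi> / 2 powr j \<le> b" using ab[OF that[unfolded p_def]] unfolding e by auto
    then show ?thesis by (simp add: pos_le_divide_eq pos_divide_le_eq mult.commute)
  qed
  have near: "\<bar>i - l\<bar> \<le> int M" if "p i \<xi> \<noteq> 0" "p l \<xi> \<noteq> 0" for i l \<xi>
  proof -
    have aux: "j - k \<le> int M" if "p j \<xi> \<noteq> 0" "p k \<xi> \<noteq> 0" for j k
    proof (rule ccontr)
      assume "\<not> j - k \<le> int M"
      then have "real M \<le> real_of_int j - real_of_int k" by linarith
      have "2 powr j * a \<le> 2 powr k * b" using supp[OF that(1)] supp[OF that(2)] by linarith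
      then have "2 powr (real_of_int j - real_of_int k) \<le> b / a"
        using a by (simp add: powr_diff field_simps)
      moreover have "2 powr real M \<le> 2 powr (real_of_int j - real_of_int k)"
        using \<open>real M \<le> _\<close> by (intro powr_mono) auto
      ultimately show False using M by (simp add: powr_realpow)
    qed
    show ?thesis using aux[OF that] aux[OF that(2,1)] by linarith
  qed
  have "dyadic \<phi> l \<xi> = (\<Sum>i\<in>{l - int M..l + int M}. dyadic \<phi> i \<xi> * dyadic \<phi> l \<xi>)" for l \<xi>
  proof (cases "p l \<xi> = 0")
    case True
    then show ?thesis by (simp add: dyadic_def p_def)
  next
    case False
    have "\<xi> \<noteq> 0"
    proof
      assume "\<xi> = 0"
      then have "2 powr l * a \<le> 0" using supp[OF False] by simp
      moreover have "0 < 2 powr l * a" using a by simp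
      ultimately show False by linarith
    qed
    have "((\<lambda>j. p j \<xi>) has_sum 1) UNIV" using hs[OF \<open>\<xi> \<noteq> 0\<close>] by (simp add: p_def)
    moreover have "p j \<xi> = 0" if "j \<notin> {l - int M..l + int M}" for j
      using near[OF _ False, of j] that by force
    ultimately have "((\<lambda>j. p j \<xi>) has_sum 1) {l - int M..l + int M}"
      by (subst has_sum_cong_neutral[where T=UNIV and g="\<lambda>j. p j \<xi>"]) auto
    then have "(\<Sum>i\<in>{l - int M..l + int M}. p i \<xi>) = 1"
      by (simp add: has_sum_finite_iff)
    then have "of_real (\<Sum>i\<in>{l - int M..l + int M}. p i \<xi>) * complex_of_real (p l \<xi>) = of_real (p l \<xi>)" by simp
    then show ?thesis by (simp add: dyadic_def p_def sum_distrib_right)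
  qed
  then show thesis by (rule that)
qed

lemma besov_LP_bound:
  assumes \<phi>: "littlewood_paley \<phi>" and T: "T \<in> besov \<phi> \<alpha>"
  obtains A where "0 \<le> A" "\<And>j. LP_proj \<phi> j T \<in> borel_measurable borel"
    "\<And>j. AE x in lborel. norm (LP_proj \<phi> j T x) \<le> A * 2 powr (real_of_int j * (2 * \<alpha> - 1))"
proof -
  define A where "A = enn2real (besov_norm \<phi> \<alpha> T)"
  have A: "besov_norm \<phi> \<alpha> T = ennreal A" "0 \<le> A" using T by (auto simp: besov_def A_def less_top)
  have le: "Linf_norm (LP_proj \<phi> j T) \<le> ennreal (A * 2 powr (real_of_int j * (2 * \<alpha> - 1)))" for j
  proof -
    define p where "p = 2 powr (real_of_int j * (1 - 2 * \<alpha>))"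
    have p: "p > 0" by (simp add: p_def)
    have "ennreal p * Linf_norm (LP_proj \<phi> j T) \<le> ennreal A"
      unfolding A(1)[symmetric] besov_norm_def p_def by (rule SUP_upper2[of j]) auto
    then have "ennreal (1 / p) * (ennreal p * Linf_norm (LP_proj \<phi> j T)) \<le> ennreal (1 / p) * ennreal A"
      by (rule mult_left_mono) simp
    also have "ennreal (1 / p) * (ennreal p * Linf_norm (LP_proj \<phi> j T)) = Linf_norm (LP_proj \<phi> j T)"
      using p by (simp add: mult.assoc[symmetric] ennreal_mult[symmetric])
    also have "ennreal (1 / p) * ennreal A = ennreal (1 / p * A)" using p A by (subst ennreal_mult[symmetric]) auto
    also have "1 / p = 2 powr (real_of_int j * (2 * \<alpha> - 1))"
    proof -
      have "1 / p = 2 powr (- (real_of_int j * (1 - 2 * \<alpha>)))" by (simp only: p_def powr_minus_divide)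
      also have "- (real_of_int j * (1 - 2 * \<alpha>)) = real_of_int j * (2 * \<alpha> - 1)" by (simp add: algebra_simps)
      finally show ?thesis .
    qed
    finally show ?thesis by (simp add: mult.commute)
  qed
  have m: "LP_proj \<phi> j T \<in> borel_measurable borel" for j
    using T unfolding LP_proj_def by (intro multiplier_borel test_function_dyadic \<phi>) (simp add: besov_def)
  have "AE x in lborel. norm (LP_proj \<phi> j T x) \<le> A * 2 powr (real_of_int j * (2 * \<alpha> - 1))" for j
  proof -
    have "AE x in lborel. ennreal (norm (LP_proj \<phi> j T x)) \<le> Linf_norm (LP_proj \<phi> j T)"
      unfolding Linf_norm_def by (rule esssup_AE)
    then show ?thesis
    proof eventually_elim
      fix x assume "ennreal (norm (LP_proj \<phi> j T x)) \<le> Linf_norm (LP_proj \<phi> j T)"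
      from order_trans[OF this le[of j]] show "norm (LP_proj \<phi> j T x) \<le> A * 2 powr (real_of_int j * (2 * \<alpha> - 1))"
        using A by (simp add: ennreal_le_iff)
    qed
  qed
  with that A m show thesis by blast
qed

section \<open>Sums over dyadic scales\<close>

lemma summable_on_powr_abs_int:
  fixes q :: real
  assumes "0 \<le> q" "q < 1"
  shows "(\<lambda>l::int. q ^ nat \<bar>l\<bar>) summable_on UNIV"
proof -
  have g: "(\<lambda>n::nat. q ^ n) summable_on UNIV"
    using assms by (subst summable_on_UNIV_nonneg_real_iff) (auto intro: summable_geometric)
  have 1: "(\<lambda>l::int. q ^ nat \<bar>l\<bar>) summable_on range int"
    using g by (subst summable_on_reindex) (auto simp: o_def)
  have 2: "(\<lambda>l::int. q ^ nat \<bar>l\<bar>) summable_on range (\<lambda>n. - int n)"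
    using g by (subst summable_on_reindex) (auto simp: o_def inj_def)
  have 3: "(\<lambda>l::int. q ^ nat \<bar>l\<bar>) summable_on (range (\<lambda>n. - int n) - range int)"
    by (rule summable_on_subset_banach[OF 2]) auto
  have "range int \<union> (range (\<lambda>n. - int n) - range int) = UNIV"
  proof -
    have "l \<in> range int \<or> l \<in> range (\<lambda>n. - int n)" for l
      by (cases l rule: int_cases2) auto
    then show ?thesis by blast
  qed
  with summable_on_Un_disjoint[OF 1 3] show ?thesis by simp
qed

text \<open>A geometric series running downwards from the largest index L with 2^L <= X; its ratio
  2^(-\<rho>) gives the denominator.\<close>

lemma sum_dyadic_le:
  fixes \<rho> :: real
  assumes \<rho>: "0 < \<rho>" and F: "finite F" "\<And>l. l \<in> F \<Longrightarrow> 2 powr (real_of_int l) \<le> X" and X: "X > 0"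
  shows "(\<Sum>l\<in>F. 2 powr (real_of_int l * \<rho>)) \<le> X powr \<rho> / (1 - 2 powr (- \<rho>))"
proof -
  define L where "L = \<lfloor>log 2 X\<rfloor>"
  define q where "q = 2 powr (- \<rho>)"
  have q: "0 \<le> q" "q < 1" using \<rho> by (auto simp: q_def powr_less_one)
  have lL: "l \<le> L" if "l \<in> F" for l
  proof -
    have "real_of_int l \<le> log 2 X" using F(2)[OF that] X by (simp add: le_log_iff)
    then show ?thesis by (simp add: L_def le_floor_iff)
  qed
  have LX: "2 powr (real_of_int L * \<rho>) \<le> X powr \<rho>"
  proof -
    have "2 powr real_of_int L \<le> X" using X by (simp add: L_def le_log_iff[symmetric])
    then have "(2 powr real_of_int L) powr \<rho> \<le> X powr \<rho>" using \<rho> by (intro powr_mono2) auto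
    then show ?thesis by (simp add: powr_powr)
  qed
  have "(\<Sum>l\<in>F. 2 powr (real_of_int l * \<rho>)) = (\<Sum>l\<in>F. 2 powr (real_of_int L * \<rho>) * q ^ nat (L - l))"
  proof (rule sum.cong[OF refl])
    fix l assume "l \<in> F"
    have "q ^ nat (L - l) = 2 powr (- \<rho> * real (nat (L - l)))"
    proof -
      have "q ^ nat (L - l) = q powr real (nat (L - l))" by (rule powr_realpow[symmetric]) (simp add: q_def)
      then show ?thesis by (simp add: q_def powr_powr)
    qed
    also have "real (nat (L - l)) = real_of_int L - real_of_int l" using lL[OF \<open>l \<in> F\<close>] by simp
    finally show "2 powr (real_of_int l * \<rho>) = 2 powr (real_of_int L * \<rho>) * q ^ nat (L - l)"
      by (simp add: powr_add[symmetric] algebra_simps)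
  qed
  also have "\<dots> = 2 powr (real_of_int L * \<rho>) * (\<Sum>l\<in>F. q ^ nat (L - l))" by (rule sum_distrib_left[symmetric])
  also have "(\<Sum>l\<in>F. q ^ nat (L - l)) = (\<Sum>n\<in>(\<lambda>l. nat (L - l)) ` F. q ^ n)"
  proof (subst sum.reindex)
    show "inj_on (\<lambda>l. nat (L - l)) F"
    proof (rule inj_onI)
      fix x y assume "x \<in> F" "y \<in> F" "nat (L - x) = nat (L - y)"
      then show "x = y" using lL[of x] lL[of y] by linarith
    qed
  qed simp
  also have "2 powr (real_of_int L * \<rho>) * \<dots> \<le> X powr \<rho> * (1 / (1 - q))"
  proof (rule mult_mono[OF LX])
    have "(\<Sum>n\<in>(\<lambda>l. nat (L - l)) ` F. q ^ n) \<le> (\<Sum>n. q ^ n)"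
      using q F(1) by (intro sum_le_suminf summable_geometric) auto
    then show "(\<Sum>n\<in>(\<lambda>l. nat (L - l)) ` F. q ^ n) \<le> 1 / (1 - q)" using q by (simp add: suminf_geometric)
  qed (use q in \<open>auto intro!: sum_nonneg\<close>)
  finally show ?thesis by (simp add: q_def)
qed

text \<open>Symmetric intervals are cofinal among the finite sets of integers, so an unordered sum
  can be taken along a sequence. This yields measurability of the heat series and a uniform tail
  bound.\<close>

lemma filterlim_int_intervals: "filterlim (\<lambda>n. {- int n..int n}) (finite_subsets_at_top UNIV) sequentially"
  unfolding filterlim_finite_subsets_at_top
proof (intro allI impI)
  fix X :: "int set" assume X: "finite X \<and> X \<subseteq> UNIV"
  define m where "m = nat (Max (insert 0 (abs ` X)))"
  have le: "\<bar>x\<bar> \<le> int m" if "x \<in> X" for x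
  proof -
    have "\<bar>x\<bar> \<le> Max (insert 0 (abs ` X))" using X that by (intro Max_ge) auto
    then show ?thesis unfolding m_def by linarith
  qed
  show "\<forall>\<^sub>F n in sequentially. finite {- int n..int n} \<and> X \<subseteq> {- int n..int n} \<and> {- int n..int n} \<subseteq> UNIV"
    unfolding eventually_sequentially
  proof (intro exI[of _ m] allI impI conjI)
    fix n assume "m \<le> n"
    show "X \<subseteq> {- int n..int n}"
    proof
      fix x assume "x \<in> X"
      from le[OF this] \<open>m \<le> n\<close> show "x \<in> {- int n..int n}" by auto
    qed
  qed auto
qed

text \<open>Cutting off at frequency \<open>1/r\<close> leaves only the blocks with \<open>2\<^sup>l \<le> C/r\<close>, and these sum
  geometrically to \<open>r powr (1 - 2\<alpha>)\<close>.\<close>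

lemma heat_bounds:
  fixes \<phi> :: "real^'n::finite \<Rightarrow> real"
  assumes \<phi>: "littlewood_paley \<phi>" and a: "1/2 < \<alpha>" "\<alpha> < 1" and T: "T \<in> besov \<phi> \<alpha>" and t: "t > 0"
  shows "heat \<phi> \<alpha> t T \<in> borel_measurable borel"
    and "\<exists>B\<ge>0. \<forall>x. norm (heat \<phi> \<alpha> t T x) \<le> B"
    and "test_function \<theta> \<Longrightarrow> \<exists>C\<ge>0. \<forall>r>0. \<forall>x. norm (conv (inv_fourier (\<lambda>\<xi>. \<theta> (r *\<^sub>R \<xi>))) (heat \<phi> \<alpha> t T) x) \<le> C * r powr (1 - 2 * \<alpha>)"
proof -
  have Tt: "tempered T" using T by (simp add: besov_def)
  define \<rho> where "\<rho> = 2 * \<alpha> - 1"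
  have \<rho>: "0 < \<rho>" "\<rho> < 1" using a by (auto simp: \<rho>_def)
  obtain a0 b0 where a0: "0 < a0" and ab: "\<And>\<xi>. \<phi> \<xi> \<noteq> 0 \<Longrightarrow> a0 \<le> norm \<xi> \<and> norm \<xi> \<le> b0"
    using \<phi> unfolding littlewood_paley_def by blast
  obtain M :: nat where M: "\<And>l \<xi>. dyadic \<phi> l \<xi> = (\<Sum>i\<in>{l - int M..l + int M}. dyadic \<phi> i \<xi> * dyadic \<phi> l \<xi>)"
    using littlewood_paley_neighbours[OF \<phi>] by blast
  obtain A where A: "0 \<le> A" and pm [measurable]: "\<And>j. LP_proj \<phi> j T \<in> borel_measurable borel"
    and pA: "\<And>j. AE x in lborel. norm (LP_proj \<phi> j T x) \<le> A * 2 powr (real_of_int j * \<rho>)"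
    using besov_LP_bound[OF \<phi> T] unfolding \<rho>_def by blast
  have td: "test_function (dyadic \<phi> j)" for j by (rule test_function_dyadic[OF \<phi>])
  have [measurable]: "dyadic \<phi> j \<in> borel_measurable borel" for j by (rule test_function_borel[OF td])
  have dz: "dyadic \<phi> j \<xi> = 0" if "norm \<xi> < 2 powr j * a0" for j \<xi>
  proof (rule ccontr)
    assume "dyadic \<phi> j \<xi> \<noteq> 0"
    then have "\<phi> ((2 powr (- real_of_int j)) *\<^sub>R \<xi>) \<noteq> 0" by (simp add: dyadic_eq)
    from ab[OF this] have "a0 \<le> norm ((2 powr (- real_of_int j)) *\<^sub>R \<xi>)" by blast
    then have "a0 \<le> norm \<xi> / 2 powr j" by (simp add: powr_minus divide_inverse mult.commute)
    then show False using that by (simp add: pos_le_divide_eq mult.commute)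
  qed
  have th: "test_function (\<lambda>\<xi>. heat_symbol \<alpha> t \<xi> * dyadic \<phi> l \<xi>)" for l
    using dz a0 by (intro test_function_heat_mult[where c="2 powr l * a0"] td) auto
  define g where "g l = multiplier (\<lambda>\<xi>. heat_symbol \<alpha> t \<xi> * dyadic \<phi> l \<xi>) T" for l
  have gm [measurable]: "g l \<in> borel_measurable borel" for l
    unfolding g_def by (rule multiplier_borel[OF Tt th])
  have "\<exists>C\<ge>0. \<forall>r>0. FL1 (\<lambda>\<xi>. complex_of_real (\<phi> (r *\<^sub>R \<xi>)) * heat_symbol \<alpha> t \<xi>) \<le> ennreal (C * min 1 (r\<^sup>2))"
    by (rule FL1_annulus_heat[OF a littlewood_paley_test_function[OF \<phi>] a0 _ t]) (use ab in force)
  then obtain C where C: "0 \<le> C" and CF: "\<And>r. r > 0 \<Longrightarrow> FL1 (\<lambda>\<xi>. complex_of_real (\<phi> (r *\<^sub>R \<xi>)) * heat_symbol \<alpha> t \<xi>) \<le> ennreal (C * min 1 (r\<^sup>2))"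
    by blast
  \<comment> \<open>The value of min 1 r^2 at r = 2^(-l), as supplied by
    \<open>FL1_annulus_heat\<close>.\<close>
  define K where "K l = min 1 (2 powr (-2 * real_of_int l))" for l :: int
  have K0: "0 \<le> K l" "K l \<le> 1" for l by (auto simp: K_def)
  have Fi: "FL1 (\<lambda>\<xi>. heat_symbol \<alpha> t \<xi> * dyadic \<phi> i \<xi>) \<le> ennreal (C * K i)" for i
  proof -
    have "(2 powr (- real_of_int i))\<^sup>2 = 2 powr (-2 * real_of_int i)"
      by (simp add: powr_powr mult.commute flip: powr_numeral)
    then show ?thesis
      using CF[of "2 powr (- real_of_int i)"] unfolding dyadic_eq K_def by (simp add: mult.commute)
  qed
  \<comment> \<open>Indices at distance at most M change \<open>K\<close> by at most the factor
    2^(2M).\<close>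
  have Kn: "K i \<le> 2 powr (2 * real M) * K l" if "i \<in> {l - int M..l + int M}" for i l
  proof -
    have "real_of_int l - real M \<le> real_of_int i" using that by (simp add: of_int_le_iff[symmetric, where 'a=real] del: of_int_le_iff)
    then have "2 powr (-2 * real_of_int i) \<le> 2 powr (2 * real M + -2 * real_of_int l)" by (intro powr_mono) auto
    then have 1: "2 powr (-2 * real_of_int i) \<le> 2 powr (2 * real M) * 2 powr (-2 * real_of_int l)" by (simp only: powr_add)
    have 2: "1 \<le> 2 powr (2 * real M)" by (intro ge_one_powr_ge_zero) auto
    show ?thesis
    proof (cases "1 \<le> 2 powr (-2 * real_of_int l)")
      case True
      then show ?thesis using 2 K0(2)[of i] by (simp add: K_def)
    next
      case False
      then show ?thesis using 1 by (simp add: K_def min_def split: if_splits)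
    qed
  qed
  \<comment> \<open>The window of neighbours has 2M + 1 members, and each costs the factor 2^(2M) of
    \<open>Kn\<close>.\<close>
  define B0 where "B0 = (2 * real M + 1) * (C * 2 powr (2 * real M) * A)"
  have B0: "0 \<le> B0" using C A by (simp add: B0_def)
  define b where "b l = B0 * (K l * 2 powr (real_of_int l * \<rho>))" for l
  have b0: "0 \<le> b l" for l using B0 K0 by (simp add: b_def)
  \<comment> \<open>The Besov norm controls only P_l T itself. The heat factor is therefore placed
    on the neighbours i, and each heat-damped neighbour is convolved with P_l T.\<close>
  have gb: "norm (g l x) \<le> b l" for l x
  proof -
    have "(\<lambda>\<xi>. heat_symbol \<alpha> t \<xi> * dyadic \<phi> l \<xi>) = (\<lambda>\<xi>. \<Sum>i\<in>{l - int M..l + int M}. (heat_symbol \<alpha> t \<xi> * dyadic \<phi> i \<xi>) * dyadic \<phi> l \<xi>)"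
      by (subst M) (simp add: sum_distrib_left mult.assoc)
    then have "g l x = (\<Sum>i\<in>{l - int M..l + int M}. multiplier (\<lambda>\<xi>. (heat_symbol \<alpha> t \<xi> * dyadic \<phi> i \<xi>) * dyadic \<phi> l \<xi>) T x)"
      unfolding g_def by (simp add: multiplier_sum[OF Tt] test_function_mult[OF th td])
    also have "\<dots> = (\<Sum>i\<in>{l - int M..l + int M}. conv (inv_fourier (\<lambda>\<xi>. heat_symbol \<alpha> t \<xi> * dyadic \<phi> i \<xi>)) (LP_proj \<phi> l T) x)"
      unfolding LP_proj_def by (intro sum.cong refl multiplier_mult[OF Tt th td])
    also have "norm \<dots> \<le> (\<Sum>i\<in>{l - int M..l + int M}. C * 2 powr (2 * real M) * K l * (A * 2 powr (real_of_int l * \<rho>)))"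
    proof (rule sum_norm_le)
      fix i assume i: "i \<in> {l - int M..l + int M}"
      show "norm (conv (inv_fourier (\<lambda>\<xi>. heat_symbol \<alpha> t \<xi> * dyadic \<phi> i \<xi>)) (LP_proj \<phi> l T) x)
        \<le> C * 2 powr (2 * real M) * K l * (A * 2 powr (real_of_int l * \<rho>))"
      proof (rule norm_conv_le_real[OF _ pm pA])
        have "C * K i \<le> C * (2 powr (2 * real M) * K l)" by (intro mult_left_mono Kn i C)
        then show "L1norm (inv_fourier (\<lambda>\<xi>. heat_symbol \<alpha> t \<xi> * dyadic \<phi> i \<xi>)) \<le> ennreal (C * 2 powr (2 * real M) * K l)"
          using Fi[of i] unfolding FL1_def by (auto intro!: order_trans[OF Fi[of i, unfolded FL1_def]] ennreal_leI simp: mult.assoc)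
      qed (use A C K0 in \<open>auto intro!: inv_fourier_borel\<close>)
    qed
    also have "\<dots> = b l" by (simp add: b_def B0_def mult_ac)
    finally show ?thesis .
  qed
  define q where "q = 2 powr (- \<rho>)"
  have q: "0 \<le> q" "q < 1" using \<rho> by (auto simp: q_def powr_less_one)
  \<comment> \<open>For l < 0 the bound is 2^(l\<rho>) itself. For l >= 0 the damping gives
    2^(l(\<rho> - 2)), which is at most 2^(-l\<rho>) because \<rho> <= 1.\<close>
  have bq: "b l \<le> B0 * q ^ nat \<bar>l\<bar>" for l
  proof -
    have qe: "q ^ nat \<bar>l\<bar> = 2 powr (- \<rho> * real_of_int \<bar>l\<bar>)"
    proof -
      have "q ^ nat \<bar>l\<bar> = q powr real (nat \<bar>l\<bar>)" by (rule powr_realpow[symmetric]) (simp add: q_def)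
      then show ?thesis by (simp add: q_def powr_powr)
    qed
    have "K l * 2 powr (real_of_int l * \<rho>) \<le> q ^ nat \<bar>l\<bar>"
    proof (cases "l \<ge> 0")
      case True
      have "K l * 2 powr (real_of_int l * \<rho>) \<le> 2 powr (-2 * real_of_int l) * 2 powr (real_of_int l * \<rho>)"
        by (intro mult_right_mono) (auto simp: K_def)
      also have "\<dots> = 2 powr (real_of_int l * (\<rho> - 2))" by (simp add: powr_add[symmetric] algebra_simps)
      also have "\<dots> \<le> q ^ nat \<bar>l\<bar>"
      proof -
        have "real_of_int l * (\<rho> - 2) \<le> real_of_int l * (- \<rho>)" using True \<rho> by (intro mult_left_mono) auto
        then show ?thesis unfolding qe using True by (intro powr_mono) (auto simp: mult.commute)
      qed
      finally show ?thesis .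
    next
      case False
      have "K l * 2 powr (real_of_int l * \<rho>) \<le> 1 * 2 powr (real_of_int l * \<rho>)" by (intro mult_right_mono K0) auto
      also have "\<dots> = q ^ nat \<bar>l\<bar>" unfolding qe using False by (simp add: mult.commute)
      finally show ?thesis .
    qed
    then show ?thesis unfolding b_def using B0 by (intro mult_left_mono) auto
  qed
  have bs: "b summable_on UNIV"
  proof (rule summable_on_comparison_test)
    show "(\<lambda>l::int. B0 * q ^ nat \<bar>l\<bar>) summable_on UNIV" by (intro summable_on_cmult_right summable_on_powr_abs_int q)
  qed (use bq b0 in auto)
  have gs: "(\<lambda>l. norm (g l x)) summable_on UNIV" for x
    by (rule summable_on_comparison_test[OF bs]) (auto simp: gb)
  have gsum: "(\<lambda>l. g l x) summable_on UNIV" for x by (rule Infinite_Sum.abs_summable_summable[OF gs])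
  define v where "v = heat \<phi> \<alpha> t T"
  have v: "v x = (\<Sum>\<^sub>\<infinity>l\<in>UNIV. g l x)" for x by (simp add: v_def heat_def g_def)
  define I where "I n = {- int n..int n}" for n
  have hv: "((\<lambda>l. g l x) has_sum v x) UNIV" for x unfolding v by (rule has_sum_infsum[OF gsum])
  have lim: "(\<lambda>n. \<Sum>l\<in>I n. g l x) \<longlonglongrightarrow> v x" for x
    using filterlim_compose[OF hv[of x, unfolded has_sum_def] filterlim_int_intervals] by (simp add: I_def)
  have vm [measurable]: "v \<in> borel_measurable borel"
    by (rule borel_measurable_LIMSEQ_metric[of "\<lambda>n x. \<Sum>l\<in>I n. g l x"]) (auto intro!: lim)
  \<comment> \<open>A tail bound uniform in x; it allows convolution with the cutoff to be taken
    term by term up to an error H times \<open>\<tau> n\<close>.\<close>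
  define \<tau> where "\<tau> n = (\<Sum>\<^sub>\<infinity>l\<in>UNIV. b l) - (\<Sum>l\<in>I n. b l)" for n
  have \<tau>: "\<tau> \<longlonglongrightarrow> 0"
  proof -
    have "(b has_sum (\<Sum>\<^sub>\<infinity>l\<in>UNIV. b l)) UNIV" by (rule has_sum_infsum[OF bs])
    from filterlim_compose[OF this[unfolded has_sum_def] filterlim_int_intervals]
    have "(\<lambda>n. \<Sum>l\<in>I n. b l) \<longlonglongrightarrow> (\<Sum>\<^sub>\<infinity>l\<in>UNIV. b l)" by (simp add: I_def)
    from tendsto_diff[OF tendsto_const this, of "\<Sum>\<^sub>\<infinity>l\<in>UNIV. b l"] show ?thesis by (simp add: \<tau>_def[abs_def])
  qed
  \<comment> \<open>Compare with the partial sum over \<open>I m\<close> for m >= n, then let m tend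
    to infinity.\<close>
  have tail: "norm (v x - (\<Sum>l\<in>I n. g l x)) \<le> \<tau> n" for x n
  proof (rule Lim_bounded2[where N=n])
    show "(\<lambda>m. (\<Sum>\<^sub>\<infinity>l\<in>UNIV. b l) - (\<Sum>l\<in>I n. b l) + norm (v x - (\<Sum>l\<in>I m. g l x))) \<longlonglongrightarrow> \<tau> n"
      using tendsto_add[OF tendsto_const tendsto_norm[OF tendsto_diff[OF tendsto_const lim[of x]]],
        of "(\<Sum>\<^sub>\<infinity>l\<in>UNIV. b l) - (\<Sum>l\<in>I n. b l)" "v x"]
      by (simp add: \<tau>_def)
    show "\<forall>m\<ge>n. norm (v x - (\<Sum>l\<in>I n. g l x)) \<le> (\<Sum>\<^sub>\<infinity>l\<in>UNIV. b l) - (\<Sum>l\<in>I n. b l) + norm (v x - (\<Sum>l\<in>I m. g l x))"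
    proof (intro allI impI)
      fix m assume "n \<le> m"
      then have sub: "I n \<subseteq> I m" by (auto simp: I_def)
      have fin: "finite (I m)" by (simp add: I_def)
      have "norm ((\<Sum>l\<in>I m. g l x) - (\<Sum>l\<in>I n. g l x)) = norm (\<Sum>l\<in>I m - I n. g l x)"
        using sum_diff[OF fin sub, of "\<lambda>l. g l x"] by simp
      also have "\<dots> \<le> (\<Sum>l\<in>I m - I n. b l)" by (rule sum_norm_le) (rule gb)
      also have "\<dots> = (\<Sum>l\<in>I m. b l) - (\<Sum>l\<in>I n. b l)" by (rule sum_diff[OF fin sub])
      also have "\<dots> \<le> (\<Sum>\<^sub>\<infinity>l\<in>UNIV. b l) - (\<Sum>l\<in>I n. b l)"
        using finite_sum_le_infsum[OF bs fin] b0 by simp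
      finally show "norm (v x - (\<Sum>l\<in>I n. g l x)) \<le> (\<Sum>\<^sub>\<infinity>l\<in>UNIV. b l) - (\<Sum>l\<in>I n. b l) + norm (v x - (\<Sum>l\<in>I m. g l x))"
        using norm_triangle_ineq[of "(\<Sum>l\<in>I m. g l x) - (\<Sum>l\<in>I n. g l x)" "v x - (\<Sum>l\<in>I m. g l x)"] by simp
    qed
  qed
  have \<tau>0: "0 \<le> \<tau> n" for n using tail[of 0 n] norm_ge_zero order_trans by blast
  \<comment> \<open>\<open>I 0\<close> consists of the index 0 alone.\<close>
  have vb: "norm (v x) \<le> \<tau> 0 + b 0" for x
    using tail[of x 0] gb[of 0 x] norm_triangle_ineq[of "v x - g 0 x" "g 0 x"] by (simp add: I_def)
  show "heat \<phi> \<alpha> t T \<in> borel_measurable borel" using vm by (simp add: v_def)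
  show "\<exists>B\<ge>0. \<forall>x. norm (heat \<phi> \<alpha> t T x) \<le> B"
    using vb \<tau>0[of 0] b0[of 0] unfolding v_def by (intro exI[of _ "\<tau> 0 + b 0"]) auto
  show "\<exists>C\<ge>0. \<forall>r>0. \<forall>x. norm (conv (inv_fourier (\<lambda>\<xi>. \<theta> (r *\<^sub>R \<xi>))) (heat \<phi> \<alpha> t T) x) \<le> C * r powr (1 - 2 * \<alpha>)"
    if \<theta>: "test_function \<theta>"
  proof -
    obtain bt where bt: "bt > 0" "\<And>\<xi>. norm \<xi> > bt \<Longrightarrow> \<theta> \<xi> = 0" using test_functionD(2)[OF \<theta>] by blast
    have [measurable]: "\<theta> \<in> borel_measurable borel" using test_function_borel[OF \<theta>] .
    define H where "H = enn2real (FL1 \<theta>)"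
    have H: "FL1 \<theta> = ennreal H" "0 \<le> H"
      using wiener_FL1[OF wiener_test_function[OF \<theta>]] by (auto simp: H_def less_top)
    define c where "c = H * B0 * (bt / a0) powr \<rho> / (1 - 2 powr (- \<rho>))"
    have q1: "0 < 1 - 2 powr (- \<rho>)" using q by (simp add: q_def)
    have c: "0 \<le> c" unfolding c_def using H B0 q1 by (intro divide_nonneg_nonneg mult_nonneg_nonneg) auto
    have "norm (conv (inv_fourier (\<lambda>\<xi>. \<theta> (r *\<^sub>R \<xi>))) v x) \<le> c * r powr (1 - 2 * \<alpha>)" if r: "r > 0" for r x
    proof -
      define \<kappa> where "\<kappa> = inv_fourier (\<lambda>\<xi>. \<theta> (r *\<^sub>R \<xi>))"
      have [measurable]: "\<kappa> \<in> borel_measurable borel" unfolding \<kappa>_def by measurable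
      have tr: "test_function (\<lambda>\<xi>. \<theta> (r *\<^sub>R \<xi>))" by (rule test_function_scale[OF \<theta> r])
      have \<kappa>: "L1norm \<kappa> = ennreal H" using FL1_scale[of \<theta> r] r H unfolding FL1_def \<kappa>_def by simp
      have \<kappa>fin: "L1norm \<kappa> < \<infinity>" by (simp add: \<kappa>)
      \<comment> \<open>Block l lives where |\<xi>| >= 2^l a0 and the cutoff where |\<xi>| <= bt/r;
        they meet only if 2^l <= X.\<close>
      define X where "X = bt / (a0 * r)"
      have X: "X > 0" using bt a0 r by (simp add: X_def)
      have cg: "conv \<kappa> (g l) x = multiplier (\<lambda>\<xi>. \<theta> (r *\<^sub>R \<xi>) * (heat_symbol \<alpha> t \<xi> * dyadic \<phi> l \<xi>)) T x" for l
        unfolding \<kappa>_def g_def by (rule multiplier_mult[OF Tt tr th, symmetric])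
      have cz: "conv \<kappa> (g l) x = 0" if l: "\<not> 2 powr (real_of_int l) \<le> X" for l
      proof -
        have "\<theta> (r *\<^sub>R \<xi>) * (heat_symbol \<alpha> t \<xi> * dyadic \<phi> l \<xi>) = 0" for \<xi>
        proof (cases "norm \<xi> < 2 powr l * a0")
          case True
          then show ?thesis by (simp add: dz)
        next
          case False
          have "bt < 2 powr l * (a0 * r)" using l a0 r by (simp add: X_def pos_divide_less_eq not_le)
          also have "\<dots> = (2 powr l * a0) * r" by simp
          also have "\<dots> \<le> norm \<xi> * r" using False r by (intro mult_right_mono) auto
          finally have "norm (r *\<^sub>R \<xi>) > bt" using r by (simp add: mult.commute)
          then show ?thesis by (simp add: bt(2))
        qed
        then show ?thesis by (simp only: cg multiplier_zero[OF Tt])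
      qed
      \<comment> \<open>The damping is discarded through K <= 1: the factor 2^(l\<rho>) alone is
        summable towards low frequencies.\<close>
      have cb: "norm (conv \<kappa> (g l) x) \<le> H * (B0 * 2 powr (real_of_int l * \<rho>))" for l
      proof -
        have "norm (conv \<kappa> (g l) x) \<le> H * b l"
          by (rule norm_conv_le_real) (use gb b0 H \<kappa> in auto)
        also have "\<dots> \<le> H * (B0 * (1 * 2 powr (real_of_int l * \<rho>)))"
          unfolding b_def using H B0 K0 by (intro mult_left_mono mult_right_mono) auto
        finally show ?thesis by simp
      qed
      have gi: "integrable lborel (\<lambda>y. \<kappa> (x - y) * g l y)" for l
        by (rule conv_bounded_integrable[OF _ _ _ \<kappa>fin, where B="b l"]) (use gb in auto)
      have vi: "integrable lborel (\<lambda>y. \<kappa> (x - y) * v y)"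
        by (rule conv_bounded_integrable[OF _ _ _ \<kappa>fin, where B="\<tau> 0 + b 0"]) (use vb in auto)
      have "norm (conv \<kappa> v x) \<le> c * r powr (1 - 2 * \<alpha>) + H * \<tau> n" for n
      proof -
        have fin: "finite (I n)" by (simp add: I_def)
        have "conv \<kappa> v x = (\<Sum>l\<in>I n. conv \<kappa> (g l) x) + conv \<kappa> (\<lambda>y. v y - (\<Sum>l\<in>I n. g l y)) x"
        proof -
          have "conv \<kappa> (\<lambda>y. v y - (\<Sum>l\<in>I n. g l y)) x = (\<integral>y. \<kappa> (x - y) * v y - (\<Sum>l\<in>I n. \<kappa> (x - y) * g l y) \<partial>lborel)"
            by (simp add: conv_def right_diff_distrib sum_distrib_left)
          also have "\<dots> = conv \<kappa> v x - (\<Sum>l\<in>I n. conv \<kappa> (g l) x)"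
            using vi gi by (simp add: conv_def Bochner_Integration.integral_sum Bochner_Integration.integrable_sum)
          finally show ?thesis by simp
        qed
        also have "norm \<dots> \<le> norm (\<Sum>l\<in>I n. conv \<kappa> (g l) x) + H * \<tau> n"
        proof (rule order_trans[OF norm_triangle_ineq], rule add_left_mono)
          show "norm (conv \<kappa> (\<lambda>y. v y - (\<Sum>l\<in>I n. g l y)) x) \<le> H * \<tau> n"
            by (rule norm_conv_le_real) (use tail \<tau>0 H \<kappa> in auto)
        qed
        also have "norm (\<Sum>l\<in>I n. conv \<kappa> (g l) x) \<le> c * r powr (1 - 2 * \<alpha>)"
        proof -
          define F where "F = {l \<in> I n. 2 powr (real_of_int l) \<le> X}"
          have "(\<Sum>l\<in>I n. conv \<kappa> (g l) x) = (\<Sum>l\<in>F. conv \<kappa> (g l) x)"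
            unfolding F_def using fin cz by (intro sum.mono_neutral_right) auto
          also have "norm \<dots> \<le> (\<Sum>l\<in>F. H * (B0 * 2 powr (real_of_int l * \<rho>)))" by (rule sum_norm_le) (rule cb)
          also have "\<dots> = H * B0 * (\<Sum>l\<in>F. 2 powr (real_of_int l * \<rho>))" by (simp add: sum_distrib_left mult.assoc)
          also have "\<dots> \<le> H * B0 * (X powr \<rho> / (1 - 2 powr (- \<rho>)))"
            using H B0 X fin \<rho> by (intro mult_left_mono sum_dyadic_le) (auto simp: F_def)
          also have "X powr \<rho> = (bt / a0) powr \<rho> * r powr (1 - 2 * \<alpha>)"
          proof -
            have "X = (bt / a0) * (1 / r)" by (simp add: X_def)
            then have "X powr \<rho> = (bt / a0) powr \<rho> * (1 / r) powr \<rho>" by (simp only: powr_mult)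
            also have "(1 / r) powr \<rho> = r powr (- \<rho>)" using r by (simp add: powr_divide powr_minus_divide)
            also have "- \<rho> = 1 - 2 * \<alpha>" by (simp add: \<rho>_def)
            finally show ?thesis .
          qed
          also have "H * B0 * ((bt / a0) powr \<rho> * r powr (1 - 2 * \<alpha>) / (1 - 2 powr (- \<rho>))) = c * r powr (1 - 2 * \<alpha>)"
            by (simp add: c_def)
          finally show ?thesis .
        qed
        finally show ?thesis by simp
      qed
      moreover have "(\<lambda>n. c * r powr (1 - 2 * \<alpha>) + H * \<tau> n) \<longlonglongrightarrow> c * r powr (1 - 2 * \<alpha>) + H * 0"
        by (intro tendsto_intros \<tau>)
      ultimately have "norm (conv \<kappa> v x) \<le> c * r powr (1 - 2 * \<alpha>) + H * 0"
        by (intro LIMSEQ_le_const) auto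
      then show ?thesis by (simp add: \<kappa>_def)
    qed
    then show ?thesis using c unfolding v_def by blast
  qed
qed

section \<open>Bounded functions in the Besov space\<close>

lemma tempered_dist_of:
  fixes g :: "real^'n::finite \<Rightarrow> complex"
  assumes [measurable]: "g \<in> borel_measurable borel" and g: "AE x in lborel. norm (g x) \<le> B" and B: "0 \<le> B"
  shows "tempered (dist_of g)"
proof -
  have i: "integrable lborel (\<lambda>x. g x * \<psi> x)" if \<psi>: "\<psi> \<in> schwartz" for \<psi>
  proof -
    have pi: "integrable lborel \<psi>" by (rule schwartz_integrable[OF \<psi>])
    then have [measurable]: "\<psi> \<in> borel_measurable borel" using borel_measurable_integrable by force
    show ?thesis
    proof (rule Bochner_Integration.integrable_bound[OF integrable_mult_right[OF pi, of "of_real B"]])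
      show "AE x in lborel. norm (g x * \<psi> x) \<le> norm (of_real B * \<psi> x)"
        using g by eventually_elim (use B in \<open>auto simp: norm_mult intro!: mult_right_mono\<close>)
    qed measurable
  qed
  \<comment> \<open>With this power the weight is integrable, and the seminorm of the same order,
    used with no derivative, bounds \<psi> by it.\<close>
  define N where "N = 2 * DIM(real^'n)"
  define J where "J = (\<integral>x. inverse ((1 + norm (x::real^'n)) ^ N) \<partial>lborel)"
  have Ji: "integrable lborel (\<lambda>x::real^'n. inverse ((1 + norm x) ^ N))"
    unfolding N_def by (rule integrable_inverse_one_plus_norm_power)
  have bound: "norm (dist_of g \<psi>) \<le> B * J * schwartz_seminorm N \<psi>" if \<psi>: "\<psi> \<in> schwartz" for \<psi>
  proof -
    obtain K where K: "\<And>ks x. length ks \<le> N \<Longrightarrow> (1 + norm x) ^ N * norm (iter_partial ks \<psi> x) \<le> K"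
      using schwartz_iter_bound[OF \<psi>] by blast
    have \<psi>le: "norm (\<psi> x) \<le> schwartz_seminorm N \<psi> * inverse ((1 + norm x) ^ N)" for x
    proof -
      have "(\<lambda>(ks, x). (1 + norm x) ^ N * norm (iter_partial ks \<psi> x)) ([], x) \<le> schwartz_seminorm N \<psi>"
        unfolding schwartz_seminorm_def by (rule cSUP_upper) (use K in \<open>auto intro!: bdd_aboveI2[of _ _ K]\<close>)
      moreover have "0 < (1 + norm x) ^ N" by (intro zero_less_power add_pos_nonneg) auto
      ultimately show ?thesis by (simp add: field_simps)
    qed
    have "norm (dist_of g \<psi>) \<le> (\<integral>x. norm (g x * \<psi> x) \<partial>lborel)"
      unfolding dist_of_def by (rule integral_norm_bound)
    also have "\<dots> \<le> (\<integral>x. B * schwartz_seminorm N \<psi> * inverse ((1 + norm (x::real^'n)) ^ N) \<partial>lborel)"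
    proof (rule integral_mono_AE)
      show "AE x in lborel. norm (g x * \<psi> x) \<le> B * schwartz_seminorm N \<psi> * inverse ((1 + norm x) ^ N)"
        using g
      proof eventually_elim
        fix x assume "norm (g x) \<le> B"
        then have "norm (g x) * norm (\<psi> x) \<le> B * (schwartz_seminorm N \<psi> * inverse ((1 + norm x) ^ N))"
          by (intro mult_mono \<psi>le B) auto
        then show "norm (g x * \<psi> x) \<le> B * schwartz_seminorm N \<psi> * inverse ((1 + norm x) ^ N)"
          by (simp add: norm_mult mult.assoc)
      qed
    qed (use i[OF \<psi>] Ji in auto)
    also have "\<dots> = B * J * schwartz_seminorm N \<psi>" by (simp add: J_def mult_ac)
    finally show ?thesis .
  qed
  have "dist_of g (\<lambda>x. \<psi> x + \<eta> x) = dist_of g \<psi> + dist_of g \<eta>" if "\<psi> \<in> schwartz" "\<eta> \<in> schwartz" for \<psi> \<eta>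
    unfolding dist_of_def using i[OF that(1)] i[OF that(2)] by (simp add: distrib_left)
  moreover have "dist_of g (\<lambda>x. c * \<psi> x) = c * dist_of g \<psi>" for c \<psi>
    unfolding dist_of_def by (simp only: mult.left_commute[of "g _" c] integral_mult_right_zero)
  ultimately show ?thesis unfolding tempered_def using bound by blast
qed

lemma multiplier_dist_of: "multiplier m (dist_of g) x = conv (inv_fourier m) g x"
  by (simp add: multiplier_def dist_of_def conv_def mult.commute)

lemma Linf_norm_le:
  assumes "f \<in> borel_measurable borel" "\<And>x. norm (f x) \<le> B"
  shows "Linf_norm f \<le> ennreal B"
  unfolding Linf_norm_def using assms by (intro esssup_I) (auto intro!: AE_I2 ennreal_leI)

text \<open>With r = 2^(-j) the j-th block is the cutoff \<phi>(r \<xi>). For r >= 1 the weight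
  r^(2\<alpha> - 1) cancels the first term of \<open>low\<close> and leaves r^(2\<alpha> - 2) <= 1
  from the second, so 2 C suffices. For r < 1 the weight is at most 1 and the boundedness of
  \<open>g\<close> suffices. Letting r tend to infinity in \<open>low\<close> gives the vanishing at
  low frequencies.\<close>

lemma besov_dist_of:
  fixes \<phi> :: "real^'n::finite \<Rightarrow> real" and g :: "real^'n \<Rightarrow> complex"
  assumes \<phi>: "littlewood_paley \<phi>" and a: "1/2 < \<alpha>" "\<alpha> < 1"
    and gm [measurable]: "g \<in> borel_measurable borel" and g: "AE x in lborel. norm (g x) \<le> B" and B: "0 \<le> B"
    and low: "\<And>\<theta>. test_function \<theta> \<Longrightarrow> \<exists>C\<ge>0. \<forall>r>0. \<forall>x.
      norm (conv (inv_fourier (\<lambda>\<xi>. \<theta> (r *\<^sub>R \<xi>))) g x) \<le> C * (r powr (1 - 2 * \<alpha>) + 1 / r)"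
  shows "dist_of g \<in> besov \<phi> \<alpha>"
proof -
  have mm: "multiplier (\<lambda>\<xi>. \<theta> (r *\<^sub>R \<xi>)) (dist_of g) \<in> borel_measurable borel" if \<theta>: "test_function \<theta>" for \<theta> :: "real^'n \<Rightarrow> complex" and r
  proof -
    have [measurable]: "\<theta> \<in> borel_measurable borel" using test_function_borel[OF \<theta>] .
    show ?thesis unfolding multiplier_dist_of[abs_def] by measurable
  qed
  have bound: "\<exists>C\<ge>0. \<forall>r>0. Linf_norm (multiplier (\<lambda>\<xi>. \<theta> (r *\<^sub>R \<xi>)) (dist_of g)) \<le> ennreal (C * (r powr (1 - 2 * \<alpha>) + 1 / r))"
    if \<theta>: "test_function \<theta>" for \<theta> :: "real^'n \<Rightarrow> complex"
  proof -
    obtain C where "0 \<le> C" "\<And>r x. r > 0 \<Longrightarrow> norm (conv (inv_fourier (\<lambda>\<xi>. \<theta> (r *\<^sub>R \<xi>))) g x) \<le> C * (r powr (1 - 2 * \<alpha>) + 1 / r)"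
      using low[OF \<theta>] by blast
    then show ?thesis by (intro exI[of _ C]) (auto intro!: Linf_norm_le mm[OF \<theta>] simp: multiplier_dist_of)
  qed
  have "vanishes_at_low_freq (dist_of g)"
    unfolding vanishes_at_low_freq_def
  proof (intro allI impI)
    fix \<theta> :: "real^'n \<Rightarrow> complex" assume \<theta>: "test_function \<theta>"
    obtain C where C: "0 \<le> C" "\<And>r. r > 0 \<Longrightarrow> Linf_norm (multiplier (\<lambda>\<xi>. \<theta> (r *\<^sub>R \<xi>)) (dist_of g)) \<le> ennreal (C * (r powr (1 - 2 * \<alpha>) + 1 / r))"
      using bound[OF \<theta>] by blast
    have "((\<lambda>r::real. r powr (1 - 2 * \<alpha>) + 1 / r) \<longlongrightarrow> 0) at_top" using a by real_asymp
    from tendsto_mult[OF tendsto_const[of C] this]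
    have "((\<lambda>r. ennreal (C * (r powr (1 - 2 * \<alpha>) + 1 / r))) \<longlongrightarrow> ennreal 0) at_top"
      by (intro tendsto_ennrealI) simp
    then have lim: "((\<lambda>r. ennreal (C * (r powr (1 - 2 * \<alpha>) + 1 / r))) \<longlongrightarrow> 0) at_top" by simp
    show "((\<lambda>r. Linf_norm (multiplier (\<lambda>\<xi>. \<theta> (r *\<^sub>R \<xi>)) (dist_of g))) \<longlongrightarrow> 0) at_top"
    proof (rule tendsto_sandwich[OF _ _ tendsto_const lim])
      show "\<forall>\<^sub>F r in at_top. Linf_norm (multiplier (\<lambda>\<xi>. \<theta> (r *\<^sub>R \<xi>)) (dist_of g)) \<le> ennreal (C * (r powr (1 - 2 * \<alpha>) + 1 / r))"
        by (rule eventually_mono[OF eventually_gt_at_top[of 0]]) (rule C(2))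
    qed simp
  qed
  moreover have "besov_norm \<phi> \<alpha> (dist_of g) < \<infinity>"
  proof -
    define \<theta> where "\<theta> \<xi> = complex_of_real (\<phi> \<xi>)" for \<xi>
    have \<theta>: "test_function \<theta>" unfolding \<theta>_def by (rule littlewood_paley_test_function[OF \<phi>])
    have [measurable]: "\<theta> \<in> borel_measurable borel" using test_function_borel[OF \<theta>] .
    obtain C where C: "0 \<le> C" "\<And>r. r > 0 \<Longrightarrow> Linf_norm (multiplier (\<lambda>\<xi>. \<theta> (r *\<^sub>R \<xi>)) (dist_of g)) \<le> ennreal (C * (r powr (1 - 2 * \<alpha>) + 1 / r))"
      using bound[OF \<theta>] by blast
    define H where "H = enn2real (FL1 \<theta>)"
    have H: "FL1 \<theta> = ennreal H" "0 \<le> H"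
      using wiener_FL1[OF wiener_test_function[OF \<theta>]] by (auto simp: H_def less_top)
    have high: "Linf_norm (multiplier (\<lambda>\<xi>. \<theta> (r *\<^sub>R \<xi>)) (dist_of g)) \<le> ennreal (H * B)" if r: "r > 0" for r
    proof (rule Linf_norm_le[OF mm[OF \<theta>]])
      show "norm (multiplier (\<lambda>\<xi>. \<theta> (r *\<^sub>R \<xi>)) (dist_of g) x) \<le> H * B" for x
        unfolding multiplier_dist_of
        by (rule norm_conv_le_real[OF _ gm g B]) (use FL1_scale[of \<theta> r] r H in \<open>auto simp: FL1_def intro!: inv_fourier_borel\<close>)
    qed
    have "ennreal (2 powr (real_of_int j * (1 - 2 * \<alpha>))) * Linf_norm (LP_proj \<phi> j (dist_of g)) \<le> ennreal (2 * C + H * B)" for j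
    proof -
      define r where "r = 2 powr (- real_of_int j)"
      have r: "r > 0" by (simp add: r_def)
      have e: "2 powr (real_of_int j * (1 - 2 * \<alpha>)) = r powr (2 * \<alpha> - 1)"
        by (simp add: r_def powr_powr algebra_simps)
      have p: "LP_proj \<phi> j (dist_of g) = multiplier (\<lambda>\<xi>. \<theta> (r *\<^sub>R \<xi>)) (dist_of g)"
        by (simp add: LP_proj_def dyadic_eq r_def \<theta>_def)
      show ?thesis
      proof (cases "1 \<le> r")
        case True
        have "ennreal (r powr (2 * \<alpha> - 1)) * Linf_norm (LP_proj \<phi> j (dist_of g)) \<le> ennreal (r powr (2 * \<alpha> - 1)) * ennreal (C * (r powr (1 - 2 * \<alpha>) + 1 / r))"
          unfolding p by (intro mult_left_mono C(2) r) auto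
        also have "\<dots> = ennreal (C * (r powr (2 * \<alpha> - 1) * (r powr (1 - 2 * \<alpha>) + 1 / r)))"
          using C(1) r by (subst ennreal_mult[symmetric]) (auto simp: mult_ac intro!: mult_nonneg_nonneg add_nonneg_nonneg)
        also have "\<dots> \<le> ennreal (2 * C + H * B)"
        proof (rule ennreal_leI)
          have "r powr (2 * \<alpha> - 1) * r powr (1 - 2 * \<alpha>) = 1" using r by (simp add: powr_add[symmetric])
          moreover have "r powr (2 * \<alpha> - 1) * (1 / r) \<le> 1"
          proof -
            have "r powr (2 * \<alpha> - 1) \<le> r powr 1" using True a by (intro powr_mono) auto
            then show ?thesis using r by simp
          qed
          ultimately have "r powr (2 * \<alpha> - 1) * (r powr (1 - 2 * \<alpha>) + 1 / r) \<le> 2" by (simp add: distrib_left)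
          from mult_left_mono[OF this C(1)] show "C * (r powr (2 * \<alpha> - 1) * (r powr (1 - 2 * \<alpha>) + 1 / r)) \<le> 2 * C + H * B"
            using mult_nonneg_nonneg[OF H(2) B] by simp
        qed
        finally show ?thesis unfolding e .
      next
        case False
        have "r powr (2 * \<alpha> - 1) \<le> 1" using False r a powr_mono2[of "2 * \<alpha> - 1" r 1] by simp
        then have "ennreal (r powr (2 * \<alpha> - 1)) * Linf_norm (LP_proj \<phi> j (dist_of g)) \<le> 1 * ennreal (H * B)"
          unfolding p by (intro mult_mono high r) (auto simp: ennreal_le_1)
        also have "\<dots> \<le> ennreal (2 * C + H * B)" using C(1) by (auto intro!: ennreal_leI)
        finally show ?thesis unfolding e .
      qed
    qed
    then have "besov_norm \<phi> \<alpha> (dist_of g) \<le> ennreal (2 * C + H * B)"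
      unfolding besov_norm_def by (rule SUP_least)
    then show ?thesis by (rule le_less_trans) simp
  qed
  ultimately show ?thesis using tempered_dist_of[OF gm g B] by (simp add: besov_def)
qed

theorem corollary1p5:
  fixes \<phi> :: "real^'n::finite \<Rightarrow> real"
    and \<alpha> \<epsilon> \<delta> t0 :: real
    and u0 :: "('n dist)^'n"
    and u :: "real^'n \<Rightarrow> real \<Rightarrow> real^'n"
  assumes "littlewood_paley \<phi>"
    and "1/2 < \<alpha>" and "\<alpha> < 1"
    and "small_data_constants \<phi> \<alpha> \<epsilon> \<delta>"
    and "u0 \<in> besov_vec \<phi> \<alpha>"
    and "\<forall>i. real_dist (u0 $ i)"
    and "div_free u0"
    and "besov_vec_norm \<phi> \<alpha> u0 \<le> ennreal \<epsilon>"
    and "u \<in> GX \<alpha>"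
    and "GX_norm \<alpha> u \<le> ennreal \<delta>"
    and "mild_solution \<phi> \<alpha> u0 u"
    and "0 < t0"
  shows "vec_dist_of (\<lambda>x. u x t0) \<in> besov_vec \<phi> \<alpha>"
proof -
  note a = assms(2,3) and u = assms(9) and t0 = \<open>0 < t0\<close>
  have "dist_of (\<lambda>x. complex_of_real (u x t0 $ i)) \<in> besov \<phi> \<alpha>" for i
  proof -
    define g where "g x = complex_of_real (u x t0 $ i)" for x
    define S where "S = heat \<phi> \<alpha> t0 (u0 $ i)"
    define V where "V x = V_nabla_leray \<alpha> (tensor u u) x t0 $ i" for x
    have T: "u0 $ i \<in> besov \<phi> \<alpha>" using assms(5) by (simp add: besov_vec_def)
    have Sm [measurable]: "S \<in> borel_measurable borel" and Sb: "\<exists>B\<ge>0. \<forall>x. norm (S x) \<le> B"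
      unfolding S_def using heat_bounds(1,2)[OF assms(1) a T t0] by blast+
    have Vm [measurable]: "V \<in> borel_measurable borel" and Vb: "\<exists>B\<ge>0. \<forall>x. norm (V x) \<le> B"
      unfolding V_def using V_nabla_leray_bounds(1,2)[OF a u t0] by blast+
    obtain BS where BS: "0 \<le> BS" "\<And>x. norm (S x) \<le> BS" using Sb by blast
    obtain BV where BV: "0 \<le> BV" "\<And>x. norm (V x) \<le> BV" using Vb by blast
    have gSV: "AE x in lborel. g x = S x - V x"
      using assms(11) t0 unfolding mild_solution_def g_def S_def V_def by (auto elim!: eventually_mono)
    have gm [measurable]: "g \<in> borel_measurable borel"
    proof -
      have c: "(\<lambda>v::real^'n. complex_of_real (v $ i)) \<in> borel_measurable borel" by measurable
      have "(\<lambda>x. (x, t0)) \<in> borel \<rightarrow>\<^sub>M borel \<Otimes>\<^sub>M borel" by measurable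
      from measurable_compose[OF this GX_measurable[OF u]]
      have "(\<lambda>x. u x t0) \<in> borel_measurable borel" using t0 by simp
      from measurable_compose[OF this c] show ?thesis by (simp add: g_def[abs_def])
    qed
    have "dist_of g \<in> besov \<phi> \<alpha>"
    proof (rule besov_dist_of[OF assms(1) a gm, where B="BS + BV"])
      show "AE x in lborel. norm (g x) \<le> BS + BV"
        using gSV
      proof eventually_elim
        fix x assume "g x = S x - V x"
        then show "norm (g x) \<le> BS + BV"
          using norm_triangle_ineq4[of "S x" "V x"] BS(2)[of x] BV(2)[of x] by simp
      qed
      show "0 \<le> BS + BV" using BS BV by simp
      fix \<theta> :: "real^'n \<Rightarrow> complex" assume \<theta>: "test_function \<theta>"
      have [measurable]: "\<theta> \<in> borel_measurable borel" using test_function_borel[OF \<theta>] .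
      obtain C1 where C1: "0 \<le> C1" "\<And>r x. r > 0 \<Longrightarrow> norm (conv (inv_fourier (\<lambda>\<xi>. \<theta> (r *\<^sub>R \<xi>))) S x) \<le> C1 * r powr (1 - 2 * \<alpha>)"
        using heat_bounds(3)[OF assms(1) a T t0 \<theta>] unfolding S_def by blast
      obtain C2 where C2: "0 \<le> C2" "\<And>r x. r > 0 \<Longrightarrow> norm (conv (inv_fourier (\<lambda>\<xi>. \<theta> (r *\<^sub>R \<xi>))) V x) \<le> C2 / r"
        using V_nabla_leray_bounds(3)[OF a u t0 \<theta>, of i] unfolding V_def[abs_def] by blast
      have "norm (conv (inv_fourier (\<lambda>\<xi>. \<theta> (r *\<^sub>R \<xi>))) g x) \<le> (C1 + C2) * (r powr (1 - 2 * \<alpha>) + 1 / r)" if r: "r > 0" for r x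
      proof -
        define \<kappa> where "\<kappa> = inv_fourier (\<lambda>\<xi>. \<theta> (r *\<^sub>R \<xi>))"
        have \<kappa>m [measurable]: "\<kappa> \<in> borel_measurable borel" unfolding \<kappa>_def by measurable
        have \<kappa>: "L1norm \<kappa> < \<infinity>"
          unfolding \<kappa>_def FL1_def[symmetric] by (intro wiener_FL1 wiener_test_function test_function_scale \<theta> r)
        have Si: "integrable lborel (\<lambda>y. \<kappa> (x - y) * S y)"
          by (rule conv_bounded_integrable[OF \<kappa>m Sm _ \<kappa>, of BS]) (simp add: BS)
        have Vi: "integrable lborel (\<lambda>y. \<kappa> (x - y) * V y)"
          by (rule conv_bounded_integrable[OF \<kappa>m Vm _ \<kappa>, of BV]) (simp add: BV)
        \<comment> \<open>The mild equation holds only almost everywhere in x, which is enough under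
          the integral.\<close>
        have "conv \<kappa> g x = (\<integral>y. \<kappa> (x - y) * S y - \<kappa> (x - y) * V y \<partial>lborel)"
          unfolding conv_def
          by (rule integral_cong_AE) (use gSV in \<open>auto elim!: eventually_mono simp: right_diff_distrib\<close>)
        also have "\<dots> = conv \<kappa> S x - conv \<kappa> V x"
          unfolding conv_def by (rule Bochner_Integration.integral_diff[OF Si Vi])
        also have "norm \<dots> \<le> C1 * r powr (1 - 2 * \<alpha>) + C2 / r"
          using norm_triangle_ineq4[of "conv \<kappa> S x" "conv \<kappa> V x"] C1(2)[OF r, of x] C2(2)[OF r, of x]
          by (simp add: \<kappa>_def)
        also have "\<dots> \<le> (C1 + C2) * (r powr (1 - 2 * \<alpha>) + 1 / r)"
        proof -
          have "0 \<le> C2 * r powr (1 - 2 * \<alpha>)" "0 \<le> C1 * (1 / r)" using C1 C2 r by auto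
          then show ?thesis by (simp add: distrib_left distrib_right add_divide_distrib)
        qed
        finally show ?thesis by (simp add: \<kappa>_def)
      qed
      then show "\<exists>C\<ge>0. \<forall>r>0. \<forall>x. norm (conv (inv_fourier (\<lambda>\<xi>. \<theta> (r *\<^sub>R \<xi>))) g x) \<le> C * (r powr (1 - 2 * \<alpha>) + 1 / r)"
        using C1(1) C2(1) by (intro exI[of _ "C1 + C2"]) auto
    qed
    then show ?thesis by (simp add: g_def[abs_def])
  qed
  then show ?thesis by (simp add: besov_vec_def vec_dist_of_def)
qed

end
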